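(* Let $\mathbf{A}_N$ and $\mathbf{B}_N$ be $N\times N$ symmetric/Hermitian random matrices with $\mathbf{A}_N\overset{p}{\longmapsto}A\in\mathcal{M}_{\mathrm{alg}}$ and $\mathbf{B}_N\overset{p}{\longmapsto}B\in\mathcal{M}_{\mathrm{alg}}$. Let $\mathbf{Q}_N$ be a Haar distributed $N\times N$ unitary/orthogonal matrix independent of $\mathbf{A}_N$ and $\mathbf{B}_N$. Then $$\mathbf{C}_N=\mathbf{A}_N+\mathbf{Q}_N\mathbf{B}_N\mathbf{Q}_N'\overset{p}{\longmapsto}C\in\mathcal{M}_{\mathrm{alg}}.$$
   Context: For an $N\times N$ matrix $\mathbf{M}$ with real eigenvalues, let $F^{\mathbf{M}}(x)=\frac1N\#\{\text{eigenvalues of }\mathbf{M}\le x\}$ (counted with multiplicity). For a sequence of random matrices $\mathbf{A}_N$ of size $N\times N$ with real eigenvalues, $\mathbf{A}_N\overset{p}{\longmapsto}A$ means that there is a non-random probability distribution function $F^A$ on $\mathbb{R}$ such that $F^{\mathbf{A}_N}(x)\to F^A(x)$ in probability as $N\to\infty$ at every continuity point $x$ of $F^A$; here $A$ is only a symbol naming the limit. The Stieltjes transform of $F^A$ is $m_A(z)=\int\frac{1}{x-z}\,dF^A(x)$ for $z\in\mathbb{C}^+$ (the open upper half plane). The distribution $F^A$ is algebraic if there is a nonzero bivariate polynomial $L(m,z)$ with real coefficients such that $L(m_A(z),z)=0$ for all $z\in\mathbb{C}^+$. One writes $\mathbf{A}_N\overset{p}{\longmapsto}A\in\mathcal{M}_{\mathrm{alg}}$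 if $\mathbf{A}_N\overset{p}{\longmapsto}A$ and $F^A$ is algebraic. The conclusion $\mathbf{C}_N\overset{p}{\longmapsto}C\in\mathcal{M}_{\mathrm{alg}}$ asserts both that the limiting distribution $F^C$ exists and that it is algebraic. The prime $'$ denotes transpose (conjugate transpose in the complex case); "unitary/orthogonal" corresponds to the complex Hermitian/real symmetric cases, respectively. *)

theory Defs
  imports
    "HOL-Probability.Probability"
    "HOL-Computational_Algebra.Fundamental_Theorem_Algebra"
    "Jordan_Normal_Form.Char_Poly"
    "Jordan_Normal_Form.Schur_Decomposition"
begin

text \<open>
  The real symmetric/orthogonal and complex Hermitian/unitary cases are treated together: matrices
  have type \<^typ>\<open>complex mat\<close>, and a set \<open>K\<close> of admissible entries is either \<open>\<real>\<close> or \<open>UNIV\<close>.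
  For \<open>K = \<real>\<close> the adjoint is the transpose, Hermitian means real symmetric, and the group
  below is the orthogonal group.
\<close>

definition hermitian_matrices :: "complex set \<Rightarrow> nat \<Rightarrow> complex mat set" where
  "hermitian_matrices K N =
     {X \<in> carrier_mat N N. (\<forall>i<N. \<forall>j<N. X $$ (i, j) \<in> K) \<and> mat_adjoint X = X}"

definition unitary_group :: "complex set \<Rightarrow> nat \<Rightarrow> complex mat set" where
  "unitary_group K N =
     {U \<in> carrier_mat N N. (\<forall>i<N. \<forall>j<N. U $$ (i, j) \<in> K) \<and>
        U * mat_adjoint U = 1\<^sub>m N \<and> mat_adjoint U * U = 1\<^sub>m N}"

text \<open>The Borel sigma-algebra on \<open>N \<times> N\<close> matrices, generated by the entries.\<close>

definition mat_borel :: "nat \<Rightarrow> complex mat measure" where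
  "mat_borel N =
     vimage_algebra (carrier_mat N N) (\<lambda>X. \<lambda>ij\<in>{..<N} \<times> {..<N}. X $$ ij)
       (Pi\<^sub>M ({..<N} \<times> {..<N}) (\<lambda>_. borel))"

definition hermitian_borel :: "complex set \<Rightarrow> nat \<Rightarrow> complex mat measure" where
  "hermitian_borel K N = restrict_space (mat_borel N) (hermitian_matrices K N)"

definition unitary_borel :: "complex set \<Rightarrow> nat \<Rightarrow> complex mat measure" where
  "unitary_borel K N = restrict_space (mat_borel N) (unitary_group K N)"

definition is_haar_probability :: "complex set \<Rightarrow> nat \<Rightarrow> complex mat measure \<Rightarrow> bool" where
  "is_haar_probability K N H \<longleftrightarrow>
     prob_space H \<and> sets H = sets (unitary_borel K N) \<and>
     (\<forall>U \<in> unitary_group K N. distr H H (\<lambda>V. U * V) = H)"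

definition haar_distributed ::
  "complex set \<Rightarrow> nat \<Rightarrow> 'w measure \<Rightarrow> ('w \<Rightarrow> complex mat) \<Rightarrow> bool" where
  "haar_distributed K N P Q \<longleftrightarrow>
     Q \<in> P \<rightarrow>\<^sub>M unitary_borel K N \<and> is_haar_probability K N (distr P (unitary_borel K N) Q)"

text \<open>
  The library's \<open>indep_var\<close> requires both random variables to have values in the same type; this is the
  same notion for two value types: the generated sigma-algebras are independent.
\<close>

definition independent_rvs ::
  "'w measure \<Rightarrow> 'a measure \<Rightarrow> ('w \<Rightarrow> 'a) \<Rightarrow> 'b measure \<Rightarrow> ('w \<Rightarrow> 'b) \<Rightarrow> bool" where
  "independent_rvs P S X T Y \<longleftrightarrow>
     X \<in> P \<rightarrow>\<^sub>M S \<and> Y \<in> P \<rightarrow>\<^sub>M T \<and>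
     prob_space.indep_set P
       (sets (vimage_algebra (space P) X S)) (sets (vimage_algebra (space P) Y T))"

text \<open>
  Empirical eigenvalue distribution function; \<open>proots\<close> is the multiset of roots with
  multiplicity. It is meant for matrices with real eigenvalues, where \<open>Re e = e\<close>.
\<close>

definition esd :: "complex mat \<Rightarrow> real \<Rightarrow> real" where
  "esd X x = real (size {#e \<in># proots (char_poly X). Re e \<le> x#}) / real (dim_row X)"

text \<open>
  A probability distribution function \<open>F\<close> on the line is given by the Borel probability measure
  \<open>\<mu>\<close> with \<open>F = cdf \<mu>\<close>, and integration against \<open>dF\<close> is integration against \<open>\<mu>\<close>.
\<close>

definition esd_tendsto_in_prob ::
  "(nat \<Rightarrow> 'w measure) \<Rightarrow> (nat \<Rightarrow> 'w \<Rightarrow> complex mat) \<Rightarrow> real measure \<Rightarrow> bool" where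
  "esd_tendsto_in_prob M X \<mu> \<longleftrightarrow>
     (\<forall>x. isCont (cdf \<mu>) x \<longrightarrow>
       (\<forall>\<epsilon>>0. (\<lambda>N. measure (M N) {\<omega> \<in> space (M N). \<bar>esd (X N \<omega>) x - cdf \<mu> x\<bar> > \<epsilon>})
          \<longlonglongrightarrow> 0))"

definition stieltjes :: "real measure \<Rightarrow> complex \<Rightarrow> complex" where
  "stieltjes \<mu> z = (LINT x|\<mu>. 1 / (complex_of_real x - z))"

text \<open>
  A bivariate polynomial \<open>L(m, z)\<close> is represented as a polynomial in \<open>m\<close> whose coefficients are
  polynomials in \<open>z\<close>.
\<close>

definition eval_bivariate :: "real poly poly \<Rightarrow> complex \<Rightarrow> complex \<Rightarrow> complex" where
  "eval_bivariate L m z = poly (map_poly (\<lambda>p. poly (map_poly complex_of_real p) z) L) m"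

definition algebraic_distribution :: "real measure \<Rightarrow> bool" where
  "algebraic_distribution \<mu> \<longleftrightarrow>
     (\<exists>L :: real poly poly. L \<noteq> 0 \<and>
        (\<forall>z. Im z > 0 \<longrightarrow> eval_bivariate L (stieltjes \<mu> z) z = 0))"

text \<open>
  \<open>M N\<close> is the probability space carrying the \<open>N\<close>-th matrix of the sequence; a common
  probability space is the special case of constant \<open>M\<close>.
\<close>

definition tendsto_in_M_alg ::
  "(nat \<Rightarrow> 'w measure) \<Rightarrow> (nat \<Rightarrow> 'w \<Rightarrow> complex mat) \<Rightarrow> bool" where
  "tendsto_in_M_alg M X \<longleftrightarrow>
     (\<exists>\<mu>. real_distribution \<mu> \<and> esd_tendsto_in_prob M X \<mu> \<and> algebraic_distribution \<mu>)"

end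

theory Submission
  imports Defs "HOL-Complex_Analysis.Complex_Analysis" "HOL-Real_Asymp.Real_Asymp"
begin

text \<open>
  Diagonalising \<open>A\<close> and \<open>B\<close> and using the invariance of the Haar measure, one may take
  \<open>X = diag a + Q diag b Q\<^sup>*\<close> with fixed \<open>a\<close>, \<open>b\<close>; changing few eigenvalues hardly moves the normalised
  trace \<open>g\<close> of the resolvent \<open>G = (X - z)\<^sup>-\<^sup>1\<close>, so \<open>a\<close> and \<open>b\<close> may be truncated at a fixed height.
  Rotating \<open>Q\<close> in a coordinate plane and differentiating under the Haar integral (integration by parts on the
  group) shows that \<open>G j j\<close> is close, in mean square over \<open>j\<close> and \<open>Q\<close>, to \<open>1 / (a j - w\<^sub>1)\<close>, where
  \<open>w\<^sub>1 = (tr (diag a G) / N - 1) / g\<close>. The same holds with the roles of \<open>a\<close> and \<open>b\<close> exchanged, and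
  \<open>w\<^sub>1 + w\<^sub>2 = z - 1 / g\<close>. Hence \<open>g\<close> almost solves the subordination equations
  \<open>m\<^sub>A(w\<^sub>1) = m\<^sub>B(w\<^sub>2) = g\<close>, \<open>w\<^sub>1 + w\<^sub>2 = z - 1 / g\<close>. For \<open>z = \<i> y\<close> with \<open>y\<close> large these are stable by a contraction
  argument, so \<open>g\<close> concentrates at their unique solution. Convergence of the Stieltjes transform at such
  points, which accumulate in the upper half plane and are unbounded, gives weak convergence. Finally \<open>w\<^sub>1\<close> and \<open>w\<^sub>2\<close> are
  algebraic over \<open>\<real>(g)\<close>, hence so is \<open>z = w\<^sub>1 + w\<^sub>2 + 1 / g\<close>; the resulting polynomial relation holds on the whole
  half plane by the identity theorem.
\<close>

section \<open>Matrices\<close>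

text \<open>Neither moments nor bounded supports are assumed, so tails enter only through 1 + w
  m(w), which is small high up. This fixes a scale \<open>L\<close> and the restriction to heights y
  >= 160 \<open>L\<close>, where stability has explicit constants. The gain in N comes from one
  mechanism. The defect Y_j is an average over i of terms P_i; testing it against its own conjugate
  and integrating by parts leaves only terms that carry G_ij or derivatives of Y_j, and the sum over
  i of |G_ij|^2 stays below 1/(Im z)^2 for every N. Hence E |Y_j|^2 = O(1/N) without any separate
  concentration inequality. The subordination equations are never solved analytically: the matrices
  themselves supply approximate solutions, and stability makes these a Cauchy sequence. In the same
  way the limit law arises as a weak limit of spectral distributions of sampled matrices. The bound
  on the defect depends on the truncation height, so that height is chosen from the desired accuracy
  before N tends to infinity.\<close>

lemma mult_mat_entry:
  "A \<in> carrier_mat n m \<Longrightarrow> B \<in> carrier_mat m p \<Longrightarrow> i < n \<Longrightarrow> j < p \<Longrightarrow>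
    (A * B) $$ (i, j) = (\<Sum>k<m. A $$ (i, k) * B $$ (k, j))"
  by (simp add: scalar_prod_def atLeast0LessThan)

lemma mult_mat_vec_entry:
  "A \<in> carrier_mat n m \<Longrightarrow> v \<in> carrier_vec m \<Longrightarrow> i < n \<Longrightarrow>
    vec_index (A *\<^sub>v v) i = (\<Sum>k<m. A $$ (i, k) * vec_index v k)"
  by (simp add: scalar_prod_def atLeast0LessThan)

lemma dim_adjoint [simp]: "dim_row (mat_adjoint A) = dim_col A" "dim_col (mat_adjoint A) = dim_row A"
  by (simp_all add: mat_adjoint_def)

lemma index_adjoint [simp]:
  "i < dim_col A \<Longrightarrow> j < dim_row A \<Longrightarrow> mat_adjoint A $$ (i, j) = cnj (A $$ (j, i))"
  by (simp add: mat_adjoint_def mat_of_rows_def)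

lemma adjoint_carrier: "A \<in> carrier_mat n m \<Longrightarrow> mat_adjoint A \<in> carrier_mat m n"
  by (rule carrier_matI) simp_all

lemma adjoint_entry:
  assumes "A \<in> carrier_mat n m" "i < m" "j < n"
  shows "mat_adjoint A $$ (i, j) = cnj (A $$ (j, i))"
  using assms by simp

lemma adjoint_adjoint [simp]:
  fixes A :: "complex mat"
  shows "mat_adjoint (mat_adjoint A) = A"
  by (rule eq_matI) simp_all

lemma adjoint_mult:
  fixes A :: "complex mat"
  assumes A: "A \<in> carrier_mat n m" and B: "B \<in> carrier_mat m p"
  shows "mat_adjoint (A * B) = mat_adjoint B * mat_adjoint A"
proof (rule eq_matI)
  note cA = adjoint_carrier[OF A] and cB = adjoint_carrier[OF B] and cM = mult_carrier_mat[OF A B]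
  fix i j assume "i < dim_row (mat_adjoint B * mat_adjoint A)" "j < dim_col (mat_adjoint B * mat_adjoint A)"
  hence ij: "i < p" "j < n" using cA cB by auto
  have "mat_adjoint (A * B) $$ (i, j) = (\<Sum>k<m. cnj (A $$ (j, k) * B $$ (k, i)))"
    unfolding adjoint_entry[OF cM ij] mult_mat_entry[OF A B ij(2,1)] cnj_sum ..
  also have "\<dots> = (\<Sum>k<m. mat_adjoint B $$ (i, k) * mat_adjoint A $$ (k, j))"
  proof (rule sum.cong[OF refl])
    fix k assume "k \<in> {..<m}"
    hence k: "k < m" by simp
    show "cnj (A $$ (j, k) * B $$ (k, i)) = mat_adjoint B $$ (i, k) * mat_adjoint A $$ (k, j)"
      unfolding adjoint_entry[OF A k ij(2)] adjoint_entry[OF B ij(1) k] by simp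
  qed
  also have "\<dots> = (mat_adjoint B * mat_adjoint A) $$ (i, j)"
    unfolding mult_mat_entry[OF cB cA ij] ..
  finally show "mat_adjoint (A * B) $$ (i, j) = (mat_adjoint B * mat_adjoint A) $$ (i, j)" .
qed (use A B in simp_all)

lemma adjoint_add:
  fixes A :: "complex mat"
  assumes A: "A \<in> carrier_mat n m" and B: "B \<in> carrier_mat n m"
  shows "mat_adjoint (A + B) = mat_adjoint A + mat_adjoint B"
  by (rule eq_matI) (use assms in simp_all)

lemma square_carrier:
  fixes A B :: "complex mat"
  shows "A \<in> carrier_mat n n \<Longrightarrow> mat_adjoint A \<in> carrier_mat n n"
    "A \<in> carrier_mat n n \<Longrightarrow> B \<in> carrier_mat n n \<Longrightarrow> A * B \<in> carrier_mat n n"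
    "A \<in> carrier_mat n n \<Longrightarrow> B \<in> carrier_mat n n \<Longrightarrow> A + B \<in> carrier_mat n n"
    "A \<in> carrier_mat n n \<Longrightarrow> B \<in> carrier_mat n n \<Longrightarrow> A - B \<in> carrier_mat n n"
    "A \<in> carrier_mat n n \<Longrightarrow> c \<cdot>\<^sub>m A \<in> carrier_mat n n"
  by (auto simp: adjoint_carrier)

abbreviation hermitian :: "nat \<Rightarrow> complex mat \<Rightarrow> bool" where
  "hermitian N X \<equiv> X \<in> carrier_mat N N \<and> mat_adjoint X = X"

lemma hermitian_entry: "hermitian N X \<Longrightarrow> i < N \<Longrightarrow> j < N \<Longrightarrow> X $$ (i, j) = cnj (X $$ (j, i))"
  using adjoint_entry[of X N N i j] by argo

lemma hermitianI:
  assumes X: "X \<in> carrier_mat N N" and e: "\<And>i j. i < N \<Longrightarrow> j < N \<Longrightarrow> X $$ (i, j) = cnj (X $$ (j, i))"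
  shows "hermitian N X"
proof -
  have "mat_adjoint X = X"
  proof (rule eq_matI)
    fix i j assume "i < dim_row X" "j < dim_col X"
    hence "i < N" "j < N" using X by auto
    from e[OF this] this show "mat_adjoint X $$ (i, j) = X $$ (i, j)" using X by simp
  qed (use X in simp_all)
  with X show ?thesis by simp
qed

text \<open>The quadratic form \<open>q\<close> of a Hermitian matrix is its own conjugate, while at
  an eigenvector it is \<open>z\<close> times the positive number \<open>s\<close>.\<close>

lemma hermitian_eigenvalue_real:
  assumes X: "hermitian N X" and v: "v \<in> carrier_vec N" "v \<noteq> 0\<^sub>v N" and ev: "X *\<^sub>v v = z \<cdot>\<^sub>v v"
  shows "Im z = 0"
proof -
  define q where "q = (\<Sum>i<N. \<Sum>j<N. cnj (vec_index v i) * X $$ (i, j) * vec_index v j)"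
  define s where "s = (\<Sum>i<N. (cmod (vec_index v i))\<^sup>2)"
  have "cnj q = (\<Sum>i<N. \<Sum>j<N. cnj (vec_index v j) * X $$ (j, i) * vec_index v i)"
    unfolding q_def cnj_sum complex_cnj_mult
  proof (intro sum.cong refl)
    fix i j assume "i \<in> {..<N}" "j \<in> {..<N}"
    thus "cnj (cnj (vec_index v i)) * cnj (X $$ (i, j)) * cnj (vec_index v j) =
        cnj (vec_index v j) * X $$ (j, i) * vec_index v i"
      using hermitian_entry[OF X, of j i] by simp
  qed
  also have "\<dots> = q" unfolding q_def by (rule sum.swap)
  finally have "Im q = 0" by (simp add: complex_eq_iff)
  have "(\<Sum>j<N. X $$ (i, j) * vec_index v j) = z * vec_index v i" if "i < N" for i
    using arg_cong[OF ev, of "\<lambda>w. vec_index w i"] that v(1)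
    by (simp add: mult_mat_vec_entry[OF conjunct1[OF X] v(1) that] del: index_mult_mat_vec)
  hence "q = (\<Sum>i<N. z * of_real ((cmod (vec_index v i))\<^sup>2))"
    unfolding q_def complex_norm_square
    by (intro sum.cong refl) (simp add: mult.assoc sum_distrib_left[symmetric])
  also have "\<dots> = z * of_real s"
    by (simp add: s_def sum_distrib_left)
  finally have "Im z * s = 0" using \<open>Im q = 0\<close> by simp
  moreover have "s \<noteq> 0"
  proof
    assume "s = 0"
    hence "\<forall>i<N. vec_index v i = 0" unfolding s_def by (subst (asm) sum_nonneg_eq_0_iff) auto
    hence "v = 0\<^sub>v N" using v(1) by (intro eq_vecI) auto
    with v(2) show False by simp
  qed
  ultimately show ?thesis by simp
qed

section \<open>The spectral theorem over the reals and the complex numbers\<close>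

definition diag_real :: "nat \<Rightarrow> (nat \<Rightarrow> real) \<Rightarrow> complex mat" where
  "diag_real N a = mat N N (\<lambda>(i, j). if i = j then complex_of_real (a i) else 0)"

lemma diag_real_carrier [simp]: "diag_real N a \<in> carrier_mat N N"
  and diag_real_entry [simp]: "i < N \<Longrightarrow> j < N \<Longrightarrow>
    diag_real N a $$ (i, j) = (if i = j then complex_of_real (a i) else 0)"
  and dim_diag_real [simp]: "dim_row (diag_real N a) = N" "dim_col (diag_real N a) = N"
  by (simp_all add: diag_real_def)

lemma diag_real_hermitian [simp]: "hermitian N (diag_real N a)"
  by (rule hermitianI) auto

lemma unitaryI:
  assumes U: "U \<in> carrier_mat N N" and K: "\<And>i j. i < N \<Longrightarrow> j < N \<Longrightarrow> U $$ (i, j) \<in> K"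
    and "\<And>i j. i < N \<Longrightarrow> j < N \<Longrightarrow> (\<Sum>k<N. U $$ (i, k) * cnj (U $$ (j, k))) = (if i = j then 1 else 0)"
  shows "U \<in> unitary_group K N"
proof -
  note A = adjoint_carrier[OF U]
  have 1: "U * mat_adjoint U = 1\<^sub>m N"
    by (rule eq_matI)
      (use U A assms(3) in \<open>auto simp del: index_mult_mat(1) simp: mult_mat_entry[OF U A] adjoint_entry[OF U]\<close>)
  from mat_mult_left_right_inverse[OF U A this] 1 U K show ?thesis
    by (simp add: unitary_group_def)
qed

lemma unitaryD:
  assumes "U \<in> unitary_group K N"
  shows "U \<in> carrier_mat N N" "U * mat_adjoint U = 1\<^sub>m N" "mat_adjoint U * U = 1\<^sub>m N"
    "i < N \<Longrightarrow> j < N \<Longrightarrow> U $$ (i, j) \<in> K"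
  using assms unfolding unitary_group_def by blast+

lemma unitary_rows:
  assumes "U \<in> unitary_group K N" "i < N" "j < N"
  shows "(\<Sum>k<N. U $$ (i, k) * cnj (U $$ (j, k))) = (if i = j then 1 else 0)"
proof -
  have U: "U \<in> carrier_mat N N" and e: "U * mat_adjoint U = 1\<^sub>m N"
    using assms by (auto simp: unitary_group_def)
  show ?thesis using arg_cong[OF e, of "\<lambda>M. M $$ (i, j)"] assms(2,3)
    by (simp add: mult_mat_entry[OF U adjoint_carrier[OF U]] adjoint_entry[OF U] del: index_mult_mat(1))
qed

lemma unitary_adjoint:
  assumes K: "K = \<real> \<or> K = UNIV" and "U \<in> unitary_group K N"
  shows "mat_adjoint U \<in> unitary_group K N"
proof -
  have U: "U \<in> carrier_mat N N" using assms by (simp add: unitary_group_def)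
  show ?thesis using assms
    by (auto simp: unitary_group_def adjoint_entry[OF U] complex_is_Real_iff)
qed

lemma unitary_mult:
  assumes K: "K = \<real> \<or> K = UNIV" and U: "U \<in> unitary_group K N" and V: "V \<in> unitary_group K N"
  shows "U * V \<in> unitary_group K N"
proof -
  have c: "U \<in> carrier_mat N N" "V \<in> carrier_mat N N" using U V by (auto simp: unitary_group_def)
  have "(U * V) * mat_adjoint (U * V) = U * (V * mat_adjoint V) * mat_adjoint U"
    using c by (simp add: adjoint_mult[OF c] square_carrier assoc_mult_mat[of _ N N _ N _ N])
  moreover have "mat_adjoint (U * V) * (U * V) = mat_adjoint V * (mat_adjoint U * U) * V"
    using c by (simp add: adjoint_mult[OF c] square_carrier assoc_mult_mat[of _ N N _ N _ N])
  moreover have "(U * V) $$ (i, j) \<in> K" if "i < N" "j < N" for i j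
    using K U V that unfolding mult_mat_entry[OF c that] by (auto simp: unitary_group_def)
  ultimately show ?thesis using U V c by (simp add: unitary_group_def square_carrier)
qed

text \<open>The matrix is the reflection that exchanges the first basis vector with
  \<open>w\<close>, a multiple of \<open>v\<close> by a phase. The phase makes the first entry of
  \<open>w\<close> real, so that one Hermitian reflection suffices, and nonpositive, so that the
  denominator 1 - \<open>r\<close> is at least 1 even when \<open>v\<close> is itself the first
  basis vector.\<close>

lemma householder:
  assumes K: "K = \<real> \<or> K = UNIV" and vK: "\<And>i. i < N \<Longrightarrow> v i \<in> K" and N: "0 < N"
    and norm: "(\<Sum>i<N. v i * cnj (v i)) = 1"
  obtains U \<theta> where "U \<in> unitary_group K N" "\<And>i. i < N \<Longrightarrow> U $$ (i, 0) = \<theta> * v i" "hermitian N U"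
proof -
  define \<theta> where "\<theta> = (if v 0 = 0 then 1 else - cnj (v 0) / of_real (cmod (v 0)))"
  have \<theta>K: "\<theta> \<in> K" using K vK[OF N] by (auto simp: \<theta>_def complex_is_Real_iff)
  have \<theta>1: "\<theta> * cnj \<theta> = 1"
    by (auto simp: \<theta>_def complex_norm_square[symmetric] norm_divide)
  define w where "w i = \<theta> * v i" for i
  define r where "r = - cmod (v 0)"
  have w0: "w 0 = of_real r"
  proof (cases "v 0 = 0")
    case False
    hence "w 0 = - (v 0 * cnj (v 0)) / of_real (cmod (v 0))" by (simp add: w_def \<theta>_def)
    also have "v 0 * cnj (v 0) = of_real (cmod (v 0)) * of_real (cmod (v 0))"
      by (simp add: complex_norm_square[symmetric] power2_eq_square)
    finally show ?thesis using False by (simp add: r_def)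
  qed (simp add: w_def \<theta>_def r_def)
  have r: "r \<le> 0" by (simp add: r_def)
  hence r1: "1 - complex_of_real r \<noteq> 0" 
    using of_real_eq_iff[of 1 r, where 'a=complex] by (auto simp del: of_real_eq_iff)
  have wn: "(\<Sum>i<N. w i * cnj (w i)) = 1"
  proof -
    have "(\<Sum>i<N. w i * cnj (w i)) = (\<theta> * cnj \<theta>) * (\<Sum>i<N. v i * cnj (v i))"
      unfolding sum_distrib_left by (intro sum.cong) (auto simp: w_def)
    thus ?thesis by (simp add: \<theta>1 norm)
  qed
  define u where "u i = w i - (if i = 0 then 1 else 0)" for i
  have un: "(\<Sum>i<N. cnj (u i) * u i) = 2 * (1 - of_real r)"
  proof -
    have "cnj (u i) * u i = w i * cnj (w i) + (if i = 0 then 1 - 2 * of_real r else 0)" for i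
      using w0 by (auto simp: u_def algebra_simps)
    thus ?thesis using N by (simp add: sum.distrib wn algebra_simps)
  qed
  define U where "U = mat N N (\<lambda>(i, j). (if i = j then 1 else 0) - u i * cnj (u j) / (1 - of_real r))"
  have U: "U \<in> carrier_mat N N" by (simp add: U_def)
  have e: "U $$ (i, j) = (if i = j then 1 else 0) - u i * cnj (u j) / (1 - of_real r)" if "i < N" "j < N" for i j
    using that by (simp add: U_def)
  have "U $$ (i, j) \<in> K" if "i < N" "j < N" for i j
    using K \<theta>K vK that unfolding e[OF that] u_def w_def by auto
  moreover have "(\<Sum>k<N. U $$ (i, k) * cnj (U $$ (j, k))) = (if i = j then 1 else 0)" if ij: "i < N" "j < N" for i j
  proof -
    define d where "d = inverse (1 - complex_of_real r)"
    have d: "d * (1 - of_real r) = 1" "cnj d = d" using r1 by (auto simp: d_def)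
    have "(\<Sum>k<N. U $$ (i, k) * cnj (U $$ (j, k))) =
      (\<Sum>k<N. (if k = i then (if i = j then 1 else 0) - cnj (u j) * u i * d else 0)
         - (if k = j then u i * cnj (u j) * d else 0) + u i * cnj (u j) * d * d * (cnj (u k) * u k))"
    proof (intro sum.cong refl)
      fix k assume "k \<in> {..<N}"
      hence k: "k < N" by simp
      have 1: "U $$ (i, k) = (if i = k then 1 else 0) - u i * cnj (u k) * d"
        by (simp only: e[OF ij(1) k] d_def divide_inverse)
      have "U $$ (j, k) = (if j = k then 1 else 0) - u j * cnj (u k) * d"
        by (simp only: e[OF ij(2) k] d_def divide_inverse)
      hence 2: "cnj (U $$ (j, k)) = (if j = k then 1 else 0) - cnj (u j) * u k * d"
        by (simp add: d(2))
      show "U $$ (i, k) * cnj (U $$ (j, k)) = (if k = i then (if i = j then 1 else 0) - cnj (u j) * u i * d else 0)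
         - (if k = j then u i * cnj (u j) * d else 0) + u i * cnj (u j) * d * d * (cnj (u k) * u k)"
        unfolding 1 2 by (auto simp: algebra_simps)
    qed
    also have "\<dots> = (if i = j then 1 else 0) - cnj (u j) * u i * d - u i * cnj (u j) * d
        + u i * cnj (u j) * d * d * (\<Sum>k<N. cnj (u k) * u k)"
      using ij by (simp add: sum.distrib sum_subtractf sum_distrib_left)
    also have "\<dots> = (if i = j then 1 else 0) - 2 * (u i * cnj (u j) * d)
        + 2 * (u i * cnj (u j) * d * (d * (1 - of_real r)))"
      unfolding un by (simp add: algebra_simps)
    also have "\<dots> = (if i = j then 1 else 0)" unfolding d(1) by simp
    finally show ?thesis .
  qed
  ultimately have "U \<in> unitary_group K N" by (intro unitaryI U)
  moreover have "U $$ (i, 0) = \<theta> * v i" if "i < N" for i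
  proof -
    have "cnj (u 0) = - (1 - of_real r)" by (simp add: u_def w0)
    hence "u i * cnj (u 0) / (1 - of_real r) = - u i"
      using r1 by (metis mult_minus_right nonzero_mult_div_cancel_right minus_divide_left)
    hence "U $$ (i, 0) = (if i = 0 then 1 else 0) + u i" using e[OF that N] by simp
    thus ?thesis by (simp add: u_def w_def)
  qed
  moreover have "hermitian N U" by (rule hermitianI[OF U]) (auto simp: e)
  ultimately show ?thesis using that by blast
qed

lemma hermitian_conj:
  assumes "hermitian N X" "U \<in> carrier_mat N N"
  shows "hermitian N (U * X * mat_adjoint U)"
  using assms by (simp add: adjoint_mult[of _ N N _ N] square_carrier assoc_mult_mat[of _ N N _ N _ N])

text \<open>The fundamental theorem of algebra yields a complex eigenvector. In the real symmetric
  case its real and imaginary parts solve the same equation, because matrix and eigenvalue are real,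
  and one of the two does not vanish at \<open>k\<close>.\<close>

lemma hermitian_eigenvector:
  assumes K: "K = \<real> \<or> K = UNIV" and X: "X \<in> hermitian_matrices K N" and N: "0 < N"
  obtains v and r :: real where "\<And>i. i < N \<Longrightarrow> v i \<in> K" "(\<Sum>i<N. v i * cnj (v i)) = 1"
    "\<And>i. i < N \<Longrightarrow> (\<Sum>j<N. X $$ (i, j) * v j) = of_real r * v i"
proof -
  have h: "hermitian N X" and XK: "\<And>i j. i < N \<Longrightarrow> j < N \<Longrightarrow> X $$ (i, j) \<in> K"
    using X by (auto simp: hermitian_matrices_def)
  hence Xc: "X \<in> carrier_mat N N" by simp
  have "degree (char_poly X) = N"
    using degree_monic_char_poly[OF Xc] by (rule conjunct1)
  hence "\<not> constant (poly (char_poly X))"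
    using N by (simp only: constant_degree not_gr_zero)
  from Fundamental_Theorem_Algebra.fundamental_theorem_of_algebra[OF this]
  obtain z where "poly (char_poly X) z = 0" by (elim exE)
  hence "eigenvalue X z" unfolding eigenvalue_root_char_poly[OF Xc] .
  then obtain v where v: "v \<in> carrier_vec N" "v \<noteq> 0\<^sub>v N" "X *\<^sub>v v = z \<cdot>\<^sub>v v"
    using Xc unfolding eigenvalue_def eigenvector_def by auto
  define r where "r = Re z"
  have z: "z = of_real r"
    using hermitian_eigenvalue_real[OF h v] by (simp add: complex_eq_iff r_def)
  define f where "f = vec_index v"
  have ev: "(\<Sum>j<N. X $$ (i, j) * f j) = of_real r * f i" if "i < N" for i
    using arg_cong[OF v(3), of "\<lambda>w. vec_index w i"] that v(1)
    by (simp add: mult_mat_vec_entry[OF Xc v(1) that] z f_def del: index_mult_mat_vec)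
  obtain k where k: "k < N" "f k \<noteq> 0"
  proof -
    have "\<exists>k<N. f k \<noteq> 0"
    proof (rule ccontr)
      assume "\<not> ?thesis"
      hence "v = 0\<^sub>v N" using v(1) by (intro eq_vecI) (auto simp: f_def)
      with v(2) show False by simp
    qed
    thus ?thesis using that by blast
  qed
  have "\<exists>f. (\<forall>i<N. f i \<in> K) \<and> (\<exists>k<N. f k \<noteq> 0) \<and> (\<forall>i<N. (\<Sum>j<N. X $$ (i, j) * f j) = of_real r * f i)"
  proof (cases "K = UNIV")
    case True thus ?thesis using ev k by auto
  next
    case False
    with K have KR: "K = \<real>" by simp
    have Xr: "X $$ (i, j) = of_real (Re (X $$ (i, j)))" if "i < N" "j < N" for i j
      using XK[OF that] KR by (simp add: complex_is_Real_iff complex_eq_iff)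
    have re: "(\<Sum>j<N. X $$ (i, j) * of_real (Re (f j))) = of_real r * of_real (Re (f i))" if "i < N" for i
    proof -
      have "Re (\<Sum>j<N. X $$ (i, j) * f j) = (\<Sum>j<N. Re (X $$ (i, j)) * Re (f j))"
        using XK KR that by (auto simp: complex_is_Real_iff intro!: sum.cong)
      hence *: "(\<Sum>j<N. Re (X $$ (i, j)) * Re (f j)) = r * Re (f i)" using ev[OF that] by simp
      have "(\<Sum>j<N. X $$ (i, j) * of_real (Re (f j))) = (\<Sum>j<N. of_real (Re (X $$ (i, j)) * Re (f j)))"
        using Xr that by (intro sum.cong) auto
      also have "\<dots> = of_real r * of_real (Re (f i))" using * by (metis of_real_mult of_real_sum)
      finally show ?thesis .
    qed
    have im: "(\<Sum>j<N. X $$ (i, j) * of_real (Im (f j))) = of_real r * of_real (Im (f i))" if "i < N" for i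
    proof -
      have "Im (\<Sum>j<N. X $$ (i, j) * f j) = (\<Sum>j<N. Re (X $$ (i, j)) * Im (f j))"
        using XK KR that by (auto simp: complex_is_Real_iff intro!: sum.cong)
      hence *: "(\<Sum>j<N. Re (X $$ (i, j)) * Im (f j)) = r * Im (f i)" using ev[OF that] by simp
      have "(\<Sum>j<N. X $$ (i, j) * of_real (Im (f j))) = (\<Sum>j<N. of_real (Re (X $$ (i, j)) * Im (f j)))"
        using Xr that by (intro sum.cong) auto
      also have "\<dots> = of_real r * of_real (Im (f i))" using * by (metis of_real_mult of_real_sum)
      finally show ?thesis .
    qed
    show ?thesis
    proof (cases "Re (f k) = 0")
      case True
      hence "Im (f k) \<noteq> 0" using k by (simp add: complex_eq_iff)
      thus ?thesis using im k KR by (intro exI[of _ "\<lambda>i. of_real (Im (f i))"]) auto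
    next
      case False
      thus ?thesis using re k KR by (intro exI[of _ "\<lambda>i. of_real (Re (f i))"]) auto
    qed
  qed
  then obtain f k where fK: "\<And>i. i < N \<Longrightarrow> f i \<in> K" and k: "k < N" "f k \<noteq> 0"
    and ev: "\<And>i. i < N \<Longrightarrow> (\<Sum>j<N. X $$ (i, j) * f j) = of_real r * f i" by blast
  define s where "s = (\<Sum>i<N. (cmod (f i))\<^sup>2)"
  have "0 < (cmod (f k))\<^sup>2" using k by simp
  also have "\<dots> \<le> s" unfolding s_def by (rule member_le_sum) (use k in auto)
  finally have s: "s > 0" .
  define c where "c = complex_of_real (1 / sqrt s)"
  have cc: "c * cnj c * of_real s = 1" using s by (simp add: c_def flip: of_real_mult)
  show ?thesis
  proof (rule that[of "\<lambda>i. c * f i" r])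
    show "c * f i \<in> K" if "i < N" for i using K fK[OF that] by (auto simp: c_def)
    have "(\<Sum>i<N. c * f i * cnj (c * f i)) = c * cnj c * (\<Sum>i<N. of_real ((cmod (f i))\<^sup>2))"
      unfolding sum_distrib_left complex_norm_square by (intro sum.cong) auto
    thus "(\<Sum>i<N. c * f i * cnj (c * f i)) = 1" using cc by (simp add: s_def)
    show "(\<Sum>j<N. X $$ (i, j) * (c * f j)) = of_real r * (c * f i)" if "i < N" for i
    proof -
      have "(\<Sum>j<N. X $$ (i, j) * (c * f j)) = c * (\<Sum>j<N. X $$ (i, j) * f j)"
        unfolding sum_distrib_left by (intro sum.cong) auto
      thus ?thesis using ev[OF that] by simp
    qed
  qed
qed

lemma conj_diag_entry:
  assumes V: "V \<in> carrier_mat N N" and ij: "i < N" "j < N"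
  shows "(V * diag_real N a * mat_adjoint V) $$ (i, j) = (\<Sum>k<N. V $$ (i, k) * of_real (a k) * cnj (V $$ (j, k)))"
proof -
  have VD: "V * diag_real N a \<in> carrier_mat N N" using V by simp
  have 1: "(V * diag_real N a) $$ (i, k) = V $$ (i, k) * of_real (a k)" if "k < N" for k
    using ij(1) that unfolding mult_mat_entry[OF V diag_real_carrier ij(1) that]
    by (simp add: if_distrib[of "\<lambda>x. _ * x"] cong: if_cong)
  show ?thesis
    unfolding mult_mat_entry[OF VD adjoint_carrier[OF V] ij]
    using ij 1 adjoint_entry[OF V] by (intro sum.cong) auto
qed

text \<open>Deflation: a reflection moves an eigenvector to the first coordinate, and being its own
  inverse it turns \<open>X\<close> into a block matrix to whose lower block the induction applies.
  The diagonalising matrix must have entries in \<open>K\<close>, since it is later absorbed by the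
  invariance of the Haar measure on that very group.\<close>

theorem spectral_theorem:
  assumes K: "K = \<real> \<or> K = UNIV" and "X \<in> hermitian_matrices K N"
  shows "\<exists>V\<in>unitary_group K N. \<exists>a. X = V * diag_real N a * mat_adjoint V"
  using assms(2)
proof (induction N arbitrary: X)
  case 0
  have "X = 1\<^sub>m 0 * diag_real 0 (\<lambda>_. 0) * mat_adjoint (1\<^sub>m 0)" "1\<^sub>m 0 \<in> unitary_group K 0"
    using 0 by (auto simp: hermitian_matrices_def unitary_group_def diag_real_def mat_adjoint_def intro!: eq_matI)
  thus ?case by blast
next
  case (Suc n)
  define N where "N = Suc n"
  have N0: "0 < N" by (simp add: N_def)
  note prems = Suc.prems[folded N_def]
  have h: "hermitian N X" and XK: "\<And>i j. i < N \<Longrightarrow> j < N \<Longrightarrow> X $$ (i, j) \<in> K"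
    using prems by (auto simp: hermitian_matrices_def)
  hence Xc: "X \<in> carrier_mat N N" by simp
  obtain v r where vK: "\<And>i. i < N \<Longrightarrow> v i \<in> K" and vn: "(\<Sum>i<N. v i * cnj (v i)) = 1"
    and ev: "\<And>i. i < N \<Longrightarrow> (\<Sum>j<N. X $$ (i, j) * v j) = of_real r * v i"
    using hermitian_eigenvector[OF K prems N0] by blast
  obtain U \<theta> where UU: "U \<in> unitary_group K N" and U0: "\<And>i. i < N \<Longrightarrow> U $$ (i, 0) = \<theta> * v i"
    and Uh: "hermitian N U" using householder[OF K vK N0 vn] by blast
  have U: "U \<in> carrier_mat N N" and U2: "U * U = 1\<^sub>m N" using UU Uh by (auto simp: unitary_group_def)
  define X' where "X' = U * X * U"
  have X'c: "X' \<in> carrier_mat N N" using U Xc by (simp add: X'_def)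
  have X'h: "hermitian N X'" using hermitian_conj[OF h U] Uh by (simp add: X'_def)
  have X'K: "X' $$ (i, j) \<in> K" if "i < N" "j < N" for i j
  proof -
    have UK: "\<And>i j. i < N \<Longrightarrow> j < N \<Longrightarrow> U $$ (i, j) \<in> K" using UU by (auto simp: unitary_group_def)
    have "X' $$ (i, j) = (\<Sum>k<N. (\<Sum>l<N. U $$ (i, l) * X $$ (l, k)) * U $$ (k, j))"
      unfolding X'_def mult_mat_entry[OF mult_carrier_mat[OF U Xc] U that]
      by (intro sum.cong refl) (use mult_mat_entry[OF U Xc] that in simp)
    also have "\<dots> \<in> K" using K UK XK that by (auto intro!: sum_in_Reals Reals_mult)
    finally show ?thesis .
  qed
  have X'0: "X' $$ (i, 0) = (if i = 0 then of_real r else 0)" if i: "i < N" for i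
  proof -
    have "X' = U * (X * U)" using U Xc by (simp add: X'_def assoc_mult_mat[of _ N N _ N _ N])
    hence "X' $$ (i, 0) = (\<Sum>k<N. U $$ (i, k) * (X * U) $$ (k, 0))"
      using mult_mat_entry[OF U mult_carrier_mat[OF Xc U], of i 0] i N0 by simp
    also have "\<dots> = (\<Sum>k<N. U $$ (i, k) * (of_real r * U $$ (k, 0)))"
    proof (intro sum.cong refl arg_cong2[of _ _ _ _ times])
      fix k assume "k \<in> {..<N}"
      hence k: "k < N" by simp
      have "(X * U) $$ (k, 0) = (\<Sum>l<N. X $$ (k, l) * (\<theta> * v l))"
        unfolding mult_mat_entry[OF Xc U k N0] using U0 by (intro sum.cong) auto
      also have "\<dots> = \<theta> * (\<Sum>l<N. X $$ (k, l) * v l)"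
        unfolding sum_distrib_left by (intro sum.cong) auto
      finally show "(X * U) $$ (k, 0) = of_real r * U $$ (k, 0)" using ev[OF k] U0[OF k] by simp
    qed
    also have "\<dots> = of_real r * (U * U) $$ (i, 0)"
      unfolding mult_mat_entry[OF U U i N0] sum_distrib_left by (intro sum.cong) auto
    finally show ?thesis using U2 i by auto
  qed
  have X'0': "X' $$ (0, j) = (if j = 0 then of_real r else 0)" if "j < N" for j
    using hermitian_entry[OF X'h, of 0 j] X'0[OF that] that N0 by (auto split: if_splits)
  define Y where "Y = mat n n (\<lambda>(i, j). X' $$ (Suc i, Suc j))"
  have "Y \<in> hermitian_matrices K n"
  proof -
    have "hermitian n Y" by (rule hermitianI) (simp_all add: Y_def N_def hermitian_entry[OF X'h, symmetric])
    moreover have "Y $$ (i, j) \<in> K" if "i < n" "j < n" for i j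
      using X'K[of "Suc i" "Suc j"] that by (simp add: Y_def N_def)
    ultimately show ?thesis by (simp add: hermitian_matrices_def)
  qed
  from Suc.IH[OF this] obtain V b where V: "V \<in> unitary_group K n" and Y: "Y = V * diag_real n b * mat_adjoint V"
    by blast
  have Vc: "V \<in> carrier_mat n n" using V by (simp add: unitary_group_def)
  \<comment> \<open>\<open>W\<close> has the diagonal blocks 1 and \<open>V\<close>, so that it
    diagonalises the lower block and leaves the split-off eigenvalue \<open>r\<close> in
    place.\<close>
  define W where "W = mat N N (\<lambda>(i, j). if i = 0 \<and> j = 0 then 1 else if i = 0 \<or> j = 0 then 0 else V $$ (i - 1, j - 1))"
  have Wc: "W \<in> carrier_mat N N" by (simp add: W_def)
  define a where "a i = (if i = 0 then r else b (i - 1))" for i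
  have We: "W $$ (0, 0) = 1" "\<And>j. j < n \<Longrightarrow> W $$ (0, Suc j) = 0" "\<And>j. j < n \<Longrightarrow> W $$ (Suc j, 0) = 0"
    "\<And>i j. i < n \<Longrightarrow> j < n \<Longrightarrow> W $$ (Suc i, Suc j) = V $$ (i, j)"
    by (auto simp: W_def N_def)
  have Ws: "(\<Sum>k<N. W $$ (i, k) * f k * cnj (W $$ (j, k))) =
    (if i = 0 \<and> j = 0 then f 0 else if i = 0 \<or> j = 0 then 0
     else (\<Sum>k<n. V $$ (i - 1, k) * f (Suc k) * cnj (V $$ (j - 1, k))))" if "i < N" "j < N" for i j f
    using that unfolding N_def sum.lessThan_Suc_shift
    by (cases i; cases j) (auto simp: We intro!: sum.neutral sum.cong)
  have WU: "W \<in> unitary_group K N"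
  proof (rule unitaryI[OF Wc])
    show "W $$ (i, j) \<in> K" if "i < N" "j < N" for i j
      using that K V by (auto simp: W_def N_def unitary_group_def)
    show "(\<Sum>k<N. W $$ (i, k) * cnj (W $$ (j, k))) = (if i = j then 1 else 0)" if "i < N" "j < N" for i j
      using Ws[OF that, of "\<lambda>_. 1"] that unitary_rows[OF V, of "i - 1" "j - 1"] by (cases i; cases j) (auto simp: N_def)
  qed
  have Ye: "X' $$ (Suc i, Suc j) = (\<Sum>k<n. V $$ (i, k) * of_real (b k) * cnj (V $$ (j, k)))"
    if "i < n" "j < n" for i j
  proof -
    have "X' $$ (Suc i, Suc j) = Y $$ (i, j)" using that by (simp add: Y_def)
    thus ?thesis unfolding Y conj_diag_entry[OF Vc that] .
  qed
  have "X' = W * diag_real N a * mat_adjoint W"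
  proof (rule eq_matI)
    fix i j assume "i < dim_row (W * diag_real N a * mat_adjoint W)" "j < dim_col (W * diag_real N a * mat_adjoint W)"
    hence ij: "i < N" "j < N" using Wc adjoint_carrier[OF Wc] by auto
    show "X' $$ (i, j) = (W * diag_real N a * mat_adjoint W) $$ (i, j)"
      unfolding conj_diag_entry[OF Wc ij] Ws[OF ij]
      using ij X'0[OF ij(1)] X'0'[OF ij(2)] Ye[of "i - 1" "j - 1"]
      by (cases i; cases j) (auto simp: a_def N_def)
  qed (use Wc adjoint_carrier[OF Wc] X'c in auto)
  hence e1: "U * X' * U = (U * W) * diag_real N a * mat_adjoint (U * W)"
    using U Wc Uh by (simp add: adjoint_mult[OF U Wc] square_carrier assoc_mult_mat[of _ N N _ N _ N])
  have e2: "U * X' * U = (U * U) * X * (U * U)"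
    using U Xc by (simp add: X'_def square_carrier assoc_mult_mat[of _ N N _ N _ N])
  have e3: "(U * U) * X * (U * U) = X"
    unfolding U2 using Xc by simp
  have "X = (U * W) * diag_real N a * mat_adjoint (U * W)"
    by (rule trans[OF trans[OF e3[symmetric] e2[symmetric]] e1])
  with unitary_mult[OF K UU WU] show ?case unfolding N_def by blast
qed

section \<open>Resolvents of Hermitian matrices\<close>

text \<open>Cramer's rule instead of a chosen inverse: the entries are rational functions of the
  entries of \<open>X\<close>, which makes them measurable at once.\<close>

definition resolvent :: "complex mat \<Rightarrow> complex \<Rightarrow> complex mat" where
  "resolvent X z = (let Y = X - z \<cdot>\<^sub>m 1\<^sub>m (dim_row X) in inverse (det Y) \<cdot>\<^sub>m adj_mat Y)"

definition tr :: "complex mat \<Rightarrow> complex" where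
  "tr X = (\<Sum>i<dim_row X. X $$ (i, i))"

lemma tr_carrier: "X \<in> carrier_mat N N \<Longrightarrow> tr X = (\<Sum>i<N. X $$ (i, i))"
  by (simp add: tr_def)

lemma tr_comm:
  assumes A: "A \<in> carrier_mat N N" and B: "B \<in> carrier_mat N N"
  shows "tr (A * B) = tr (B * A)"
proof -
  have "tr (A * B) = (\<Sum>i<N. \<Sum>k<N. A $$ (i, k) * B $$ (k, i))"
    unfolding tr_carrier[OF square_carrier(2)[OF A B]]
    by (intro sum.cong refl mult_mat_entry[OF A B]) auto
  also have "\<dots> = (\<Sum>k<N. \<Sum>i<N. A $$ (i, k) * B $$ (k, i))" by (rule sum.swap)
  also have "\<dots> = (\<Sum>k<N. \<Sum>i<N. B $$ (k, i) * A $$ (i, k))" by (simp add: mult.commute)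
  also have "\<dots> = tr (B * A)"
    unfolding tr_carrier[OF square_carrier(2)[OF B A]]
    by (intro sum.cong refl mult_mat_entry[OF B A, symmetric]) auto
  finally show ?thesis .
qed

lemma tr_conj:
  assumes U: "U \<in> unitary_group K N" and A: "A \<in> carrier_mat N N"
  shows "tr (U * A * mat_adjoint U) = tr A"
proof -
  have Uc: "U \<in> carrier_mat N N" and e: "mat_adjoint U * U = 1\<^sub>m N"
    using U by (auto simp: unitary_group_def)
  have "tr (U * A * mat_adjoint U) = tr (mat_adjoint U * (U * A))"
    by (rule tr_comm[of _ N]) (use Uc A in \<open>auto simp: square_carrier\<close>)
  also have "mat_adjoint U * (U * A) = mat_adjoint U * U * A"
    using Uc A by (simp add: assoc_mult_mat[of _ N N _ N _ N] square_carrier)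
  also have "\<dots> = A" unfolding e using A by simp
  finally show ?thesis .
qed

lemma resolvent_carrier: "X \<in> carrier_mat N N \<Longrightarrow> resolvent X z \<in> carrier_mat N N"
  unfolding resolvent_def Let_def
  by (rule square_carrier(5), rule adj_mat(1)) (simp add: square_carrier)

text \<open>A kernel vector of the shifted matrix would be an eigenvector with the nonreal
  eigenvalue \<open>z\<close>.\<close>

lemma det_shift_nonzero:
  assumes X: "hermitian N X" and z: "Im z \<noteq> 0"
  shows "det (X - z \<cdot>\<^sub>m 1\<^sub>m N) \<noteq> 0"
proof
  assume 0: "det (X - z \<cdot>\<^sub>m 1\<^sub>m N) = 0"
  have Xc: "X \<in> carrier_mat N N" using X by blast
  have c: "X - z \<cdot>\<^sub>m 1\<^sub>m N \<in> carrier_mat N N" using Xc by (simp add: square_carrier)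
  obtain v where v: "v \<in> carrier_vec N" "v \<noteq> 0\<^sub>v N" "(X - z \<cdot>\<^sub>m 1\<^sub>m N) *\<^sub>v v = 0\<^sub>v N"
    using 0 unfolding det_0_iff_vec_prod_zero[OF c] by blast
  have "X *\<^sub>v v = z \<cdot>\<^sub>v v"
  proof (rule eq_vecI)
    fix i assume "i < dim_vec (z \<cdot>\<^sub>v v)"
    hence i: "i < N" using v(1) by simp
    have "0 = (\<Sum>k<N. (X - z \<cdot>\<^sub>m 1\<^sub>m N) $$ (i, k) * vec_index v k)"
      using mult_mat_vec_entry[OF c v(1) i] v(3) i by simp
    also have "\<dots> = (\<Sum>k<N. X $$ (i, k) * vec_index v k - (if k = i then z * vec_index v i else 0))"
      by (intro sum.cong refl) (use i Xc in \<open>auto simp: algebra_simps\<close>)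
    also have "\<dots> = (\<Sum>k<N. X $$ (i, k) * vec_index v k) - z * vec_index v i"
      using i by (simp add: sum_subtractf)
    finally show "vec_index (X *\<^sub>v v) i = vec_index (z \<cdot>\<^sub>v v) i"
      unfolding mult_mat_vec_entry[OF Xc v(1) i] using i v(1) by simp
  qed (use Xc v(1) in auto)
  from hermitian_eigenvalue_real[OF X v(1,2) this] z show False by simp
qed

lemma resolvent_inverse:
  assumes X: "hermitian N X" and z: "Im z \<noteq> 0"
  shows "(X - z \<cdot>\<^sub>m 1\<^sub>m N) * resolvent X z = 1\<^sub>m N" "resolvent X z * (X - z \<cdot>\<^sub>m 1\<^sub>m N) = 1\<^sub>m N"
proof -
  have Xc: "X \<in> carrier_mat N N" using X by blast
  define Y where "Y = X - z \<cdot>\<^sub>m 1\<^sub>m N"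
  have Y: "Y \<in> carrier_mat N N" using Xc by (simp add: square_carrier Y_def)
  have d: "det Y \<noteq> 0" unfolding Y_def by (rule det_shift_nonzero[OF X z])
  have G: "resolvent X z = inverse (det Y) \<cdot>\<^sub>m adj_mat Y"
    using Xc by (simp add: resolvent_def Y_def Let_def)
  have 1: "inverse (det Y) \<cdot>\<^sub>m (det Y \<cdot>\<^sub>m 1\<^sub>m N) = 1\<^sub>m N"
    by (rule eq_matI) (use d in auto)
  have "Y * resolvent X z = inverse (det Y) \<cdot>\<^sub>m (det Y \<cdot>\<^sub>m 1\<^sub>m N)"
    unfolding G mult_smult_distrib[OF Y adj_mat(1)[OF Y]] adj_mat(2)[OF Y] ..
  thus "(X - z \<cdot>\<^sub>m 1\<^sub>m N) * resolvent X z = 1\<^sub>m N" unfolding Y_def[symmetric] 1 .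
  have "resolvent X z * Y = inverse (det Y) \<cdot>\<^sub>m (det Y \<cdot>\<^sub>m 1\<^sub>m N)"
    unfolding G mult_smult_assoc_mat[OF adj_mat(1)[OF Y] Y] adj_mat(3)[OF Y] ..
  thus "resolvent X z * (X - z \<cdot>\<^sub>m 1\<^sub>m N) = 1\<^sub>m N" unfolding Y_def[symmetric] 1 .
qed

lemma resolvent_unique:
  assumes X: "hermitian N X" and z: "Im z \<noteq> 0" and G: "G \<in> carrier_mat N N"
    and e: "(X - z \<cdot>\<^sub>m 1\<^sub>m N) * G = 1\<^sub>m N"
  shows "resolvent X z = G"
proof -
  have Xc: "X \<in> carrier_mat N N" using X by blast
  have R: "resolvent X z \<in> carrier_mat N N" by (rule resolvent_carrier[OF Xc])
  have "resolvent X z = resolvent X z * ((X - z \<cdot>\<^sub>m 1\<^sub>m N) * G)" unfolding e using R by simp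
  also have "\<dots> = resolvent X z * (X - z \<cdot>\<^sub>m 1\<^sub>m N) * G"
    by (rule assoc_mult_mat[symmetric]) (use R G Xc in \<open>auto simp: square_carrier\<close>)
  also have "\<dots> = G" unfolding resolvent_inverse(2)[OF X z] using G by simp
  finally show ?thesis .
qed

lemma resolvent_conj:
  assumes K: "U \<in> unitary_group K N" and X: "hermitian N X" and z: "Im z \<noteq> 0"
  shows "resolvent (U * X * mat_adjoint U) z = U * resolvent X z * mat_adjoint U"
proof (rule resolvent_unique[OF _ z])
  note U = unitaryD(1)[OF K] and U1 = unitaryD(2)[OF K] and U2 = unitaryD(3)[OF K]
  have Xc: "X \<in> carrier_mat N N" using X by blast
  note G = resolvent_carrier[OF Xc, of z]
  note aU = square_carrier(1)[OF U]
  show "hermitian N (U * X * mat_adjoint U)" by (rule hermitian_conj[OF X U])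
  show "U * resolvent X z * mat_adjoint U \<in> carrier_mat N N" using U G by (simp add: square_carrier)
  define Y where "Y = X - z \<cdot>\<^sub>m 1\<^sub>m N"
  have Yc: "Y \<in> carrier_mat N N" using Xc by (simp add: Y_def square_carrier)
  have "U * Y * mat_adjoint U = (U * X - z \<cdot>\<^sub>m U) * mat_adjoint U"
    unfolding Y_def mult_minus_distrib_mat[OF U Xc square_carrier(5)[OF one_carrier_mat]]
    using U by (simp add: mult_smult_distrib[OF U one_carrier_mat])
  also have "\<dots> = U * X * mat_adjoint U - (z \<cdot>\<^sub>m U) * mat_adjoint U"
    by (rule minus_mult_distrib_mat) (use U Xc in \<open>auto simp: square_carrier\<close>)
  also have "(z \<cdot>\<^sub>m U) * mat_adjoint U = z \<cdot>\<^sub>m 1\<^sub>m N"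
    unfolding mult_smult_assoc_mat[OF U aU] U1 ..
  finally have "(U * X * mat_adjoint U - z \<cdot>\<^sub>m 1\<^sub>m N) * (U * resolvent X z * mat_adjoint U)
    = (U * Y * mat_adjoint U) * (U * resolvent X z * mat_adjoint U)" by (rule arg_cong[OF sym])
  also have "\<dots> = U * Y * (mat_adjoint U * U) * (resolvent X z * mat_adjoint U)"
    using U aU G Yc by (simp add: assoc_mult_mat[of _ N N _ N _ N] square_carrier)
  also have "\<dots> = U * (Y * resolvent X z) * mat_adjoint U"
    unfolding U2 using U aU G Yc by (simp add: assoc_mult_mat[of _ N N _ N _ N] square_carrier)
  also have "\<dots> = 1\<^sub>m N"
    unfolding Y_def resolvent_inverse(1)[OF X z] using U U1 by simp
  finally show "(U * X * mat_adjoint U - z \<cdot>\<^sub>m 1\<^sub>m N) * (U * resolvent X z * mat_adjoint U) = 1\<^sub>m N" .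
qed

lemma resolvent_entries:
  assumes X: "hermitian N X" and z: "Im z \<noteq> 0" and k: "k < N" and j: "j < N"
  shows "(\<Sum>l<N. X $$ (k, l) * resolvent X z $$ (l, j)) = (if k = j then 1 else 0) + z * resolvent X z $$ (k, j)"
    and "(\<Sum>l<N. resolvent X z $$ (k, l) * X $$ (l, j)) = (if k = j then 1 else 0) + z * resolvent X z $$ (k, j)"
proof -
  have Xc: "X \<in> carrier_mat N N" using X by blast
  define G where "G = resolvent X z"
  have G: "G \<in> carrier_mat N N" unfolding G_def by (rule resolvent_carrier[OF Xc])
  have Y: "X - z \<cdot>\<^sub>m 1\<^sub>m N \<in> carrier_mat N N" using Xc by (simp add: square_carrier)
  have "(if k = j then 1 else 0) = ((X - z \<cdot>\<^sub>m 1\<^sub>m N) * G) $$ (k, j)"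
    unfolding G_def resolvent_inverse(1)[OF X z] using k j by simp
  also have "\<dots> = (\<Sum>l<N. (X - z \<cdot>\<^sub>m 1\<^sub>m N) $$ (k, l) * G $$ (l, j))" by (rule mult_mat_entry[OF Y G k j])
  also have "\<dots> = (\<Sum>l<N. X $$ (k, l) * G $$ (l, j) - (if l = k then z * G $$ (k, j) else 0))"
    by (intro sum.cong refl) (use k Xc in \<open>auto simp: algebra_simps\<close>)
  also have "\<dots> = (\<Sum>l<N. X $$ (k, l) * G $$ (l, j)) - z * G $$ (k, j)" using k by (simp add: sum_subtractf)
  finally show "(\<Sum>l<N. X $$ (k, l) * resolvent X z $$ (l, j)) = (if k = j then 1 else 0) + z * resolvent X z $$ (k, j)"
    unfolding G_def by (simp only: eq_diff_eq)
  have "(if k = j then 1 else 0) = (G * (X - z \<cdot>\<^sub>m 1\<^sub>m N)) $$ (k, j)"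
    unfolding G_def resolvent_inverse(2)[OF X z] using k j by simp
  also have "\<dots> = (\<Sum>l<N. G $$ (k, l) * (X - z \<cdot>\<^sub>m 1\<^sub>m N) $$ (l, j))" by (rule mult_mat_entry[OF G Y k j])
  also have "\<dots> = (\<Sum>l<N. G $$ (k, l) * X $$ (l, j) - (if l = j then z * G $$ (k, j) else 0))"
    by (intro sum.cong refl) (use j Xc in \<open>auto simp: algebra_simps\<close>)
  also have "\<dots> = (\<Sum>l<N. G $$ (k, l) * X $$ (l, j)) - z * G $$ (k, j)" using j by (simp add: sum_subtractf)
  finally show "(\<Sum>l<N. resolvent X z $$ (k, l) * X $$ (l, j)) = (if k = j then 1 else 0) + z * resolvent X z $$ (k, j)"
    unfolding G_def by (simp only: eq_diff_eq)
qed

lemma hermitian_form_real: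
  assumes X: "hermitian N X"
  shows "Im (\<Sum>k<N. \<Sum>l<N. cnj (f k) * X $$ (k, l) * f l) = 0"
proof -
  define q where "q = (\<Sum>k<N. \<Sum>l<N. cnj (f k) * X $$ (k, l) * f l)"
  have "cnj q = (\<Sum>k<N. \<Sum>l<N. cnj (f l) * X $$ (l, k) * f k)"
    unfolding q_def cnj_sum complex_cnj_mult
  proof (intro sum.cong refl)
    fix i j assume "i \<in> {..<N}" "j \<in> {..<N}"
    thus "cnj (cnj (f i)) * cnj (X $$ (i, j)) * cnj (f j) = cnj (f j) * X $$ (j, i) * f i"
      using hermitian_entry[OF X, of j i] by simp
  qed
  also have "\<dots> = q" unfolding q_def by (rule sum.swap)
  finally show ?thesis unfolding q_def[symmetric] by (simp add: complex_eq_iff)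
qed

text \<open>The basic identity \<open>Im \<langle>v, G v\<rangle> = Im z \<parallel>G v\<parallel>\<^sup>2\<close>.\<close>

lemma Im_solution:
  assumes X: "hermitian N X" and p: "\<And>k. k < N \<Longrightarrow> (\<Sum>l<N. X $$ (k, l) * p l) = v k + z * p k"
  shows "Im (\<Sum>k<N. cnj (v k) * p k) = Im z * (\<Sum>k<N. (cmod (p k))\<^sup>2)"
proof -
  have "(\<Sum>k<N. \<Sum>l<N. cnj (p k) * X $$ (k, l) * p l) = (\<Sum>k<N. cnj (p k) * (v k + z * p k))"
    by (intro sum.cong refl) (use p in \<open>simp add: mult.assoc sum_distrib_left[symmetric]\<close>)
  also have "\<dots> = cnj (\<Sum>k<N. cnj (v k) * p k) + z * of_real (\<Sum>k<N. (cmod (p k))\<^sup>2)"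
    unfolding cnj_sum of_real_sum complex_norm_square sum_distrib_left sum.distrib[symmetric]
    by (intro sum.cong refl) (simp add: algebra_simps)
  finally have "Im (cnj (\<Sum>k<N. cnj (v k) * p k) + z * of_real (\<Sum>k<N. (cmod (p k))\<^sup>2)) = 0"
    using hermitian_form_real[OF X, of p] by (simp only:)
  thus ?thesis by (simp only: complex.sel plus_complex.sel cnj.sel times_complex.sel Re_complex_of_real Im_complex_of_real mult_zero_right)
qed

lemma Im_solution_left:
  assumes X: "hermitian N X" and q: "\<And>k. k < N \<Longrightarrow> (\<Sum>l<N. q l * X $$ (l, k)) = cnj (v k) + z * q k"
  shows "Im (\<Sum>k<N. q k * v k) = Im z * (\<Sum>k<N. (cmod (q k))\<^sup>2)"
proof -
  have "(\<Sum>k<N. \<Sum>l<N. cnj (cnj (q k)) * X $$ (k, l) * cnj (q l)) = (\<Sum>l<N. \<Sum>k<N. q k * X $$ (k, l) * cnj (q l))"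
    by (subst sum.swap) simp
  also have "\<dots> = (\<Sum>l<N. (cnj (v l) + z * q l) * cnj (q l))"
    by (intro sum.cong refl) (use q in \<open>simp add: sum_distrib_right[symmetric]\<close>)
  also have "\<dots> = cnj (\<Sum>k<N. q k * v k) + z * of_real (\<Sum>k<N. (cmod (q k))\<^sup>2)"
    unfolding cnj_sum of_real_sum complex_norm_square sum_distrib_left sum.distrib[symmetric]
    by (intro sum.cong refl) (simp add: algebra_simps)
  finally have "Im (cnj (\<Sum>k<N. q k * v k) + z * of_real (\<Sum>k<N. (cmod (q k))\<^sup>2)) = 0"
    using hermitian_form_real[OF X, of "\<lambda>k. cnj (q k)"] by (simp only:)
  thus ?thesis by (simp only: complex.sel plus_complex.sel cnj.sel times_complex.sel Re_complex_of_real Im_complex_of_real mult_zero_right)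
qed

text \<open>Take a unit vector for \<open>v\<close> in the preceding identities. This Ward identity
  is the source of the later gain of a factor 1/N: the N entries of a row or column share a total
  mass that does not grow with N.\<close>

lemma Im_resolvent_diag:
  assumes X: "hermitian N X" and z: "Im z \<noteq> 0" and j: "j < N"
  shows "Im (resolvent X z $$ (j, j)) = Im z * (\<Sum>k<N. (cmod (resolvent X z $$ (k, j)))\<^sup>2)"
    and "Im (resolvent X z $$ (j, j)) = Im z * (\<Sum>k<N. (cmod (resolvent X z $$ (j, k)))\<^sup>2)"
proof -
  have "Im (\<Sum>k<N. cnj (if k = j then 1 else 0) * resolvent X z $$ (k, j))
      = Im z * (\<Sum>k<N. (cmod (resolvent X z $$ (k, j)))\<^sup>2)"
    by (rule Im_solution[OF X]) (rule resolvent_entries(1)[OF X z _ j])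
  also have "(\<Sum>k<N. cnj (if k = j then 1 else 0) * resolvent X z $$ (k, j)) =
      (\<Sum>k<N. if k = j then resolvent X z $$ (j, j) else 0)" by (intro sum.cong) auto
  also have "\<dots> = resolvent X z $$ (j, j)" using j by simp
  finally show "Im (resolvent X z $$ (j, j)) = Im z * (\<Sum>k<N. (cmod (resolvent X z $$ (k, j)))\<^sup>2)" .
  have "Im (\<Sum>k<N. resolvent X z $$ (j, k) * (if k = j then 1 else 0))
      = Im z * (\<Sum>k<N. (cmod (resolvent X z $$ (j, k)))\<^sup>2)"
  proof (rule Im_solution_left[OF X])
    fix k assume "k < N"
    from resolvent_entries(2)[OF X z j this]
    show "(\<Sum>l<N. resolvent X z $$ (j, l) * X $$ (l, k)) =
        cnj (if k = j then 1 else 0) + z * resolvent X z $$ (j, k)" by (auto split: if_splits)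
  qed
  also have "(\<Sum>k<N. resolvent X z $$ (j, k) * (if k = j then 1 else 0)) =
      (\<Sum>k<N. if k = j then resolvent X z $$ (j, j) else 0)" by (intro sum.cong) auto
  also have "\<dots> = resolvent X z $$ (j, j)" using j by simp
  finally show "Im (resolvent X z $$ (j, j)) = Im z * (\<Sum>k<N. (cmod (resolvent X z $$ (j, k)))\<^sup>2)" .
qed

text \<open>The Ward identity keeps only one summand to give Im z |g|^2 <= Im g <= |g| for a
  diagonal entry g, hence |g| <= 1 / Im z; inserting this back bounds the whole row and
  column.\<close>

lemma resolvent_bounds:
  assumes X: "hermitian N X" and z: "Im z > 0" and j: "j < N"
  shows "(\<Sum>k<N. (cmod (resolvent X z $$ (k, j)))\<^sup>2) \<le> 1 / (Im z)\<^sup>2"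
    and "(\<Sum>k<N. (cmod (resolvent X z $$ (j, k)))\<^sup>2) \<le> 1 / (Im z)\<^sup>2"
    and "k < N \<Longrightarrow> cmod (resolvent X z $$ (j, k)) \<le> 1 / Im z"
    and "Im z * (cmod (resolvent X z $$ (j, j)))\<^sup>2 \<le> Im (resolvent X z $$ (j, j))"
proof -
  have z0: "Im z \<noteq> 0" using z by simp
  define g where "g = resolvent X z $$ (j, j)"
  define S where "S = (\<Sum>k<N. (cmod (resolvent X z $$ (j, k)))\<^sup>2)"
  have Sg: "Im g = Im z * S" unfolding g_def S_def by (rule Im_resolvent_diag(2)[OF X z0 j])
  have Sg': "Im g = Im z * (\<Sum>k<N. (cmod (resolvent X z $$ (k, j)))\<^sup>2)"
    unfolding g_def by (rule Im_resolvent_diag(1)[OF X z0 j])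
  have le: "(cmod (resolvent X z $$ (j, k)))\<^sup>2 \<le> S" if "k < N" for k
    unfolding S_def using that by (intro member_le_sum) auto
  have g2: "Im z * (cmod g)\<^sup>2 \<le> Im g" using le[OF j, folded g_def] z unfolding Sg by simp
  also have "\<dots> \<le> cmod g" by (rule order_trans[OF abs_ge_self abs_Im_le_cmod])
  finally have "cmod g * (Im z * cmod g) \<le> cmod g * 1" by (simp add: power2_eq_square mult_ac)
  hence gb: "cmod g \<le> 1 / Im z"
    using z by (cases "cmod g = 0") (auto simp: field_simps)
  have "Im z * S \<le> 1 / Im z"
    using gb Sg order_trans[OF abs_ge_self abs_Im_le_cmod, of g] by simp
  hence Sb: "S \<le> 1 / (Im z)\<^sup>2" using z by (simp add: field_simps power2_eq_square)
  thus "(\<Sum>k<N. (cmod (resolvent X z $$ (j, k)))\<^sup>2) \<le> 1 / (Im z)\<^sup>2" by (simp add: S_def)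
  have "S = (\<Sum>k<N. (cmod (resolvent X z $$ (k, j)))\<^sup>2)" using Sg Sg' z by simp
  thus "(\<Sum>k<N. (cmod (resolvent X z $$ (k, j)))\<^sup>2) \<le> 1 / (Im z)\<^sup>2" using Sb by simp
  show "Im z * (cmod (resolvent X z $$ (j, j)))\<^sup>2 \<le> Im (resolvent X z $$ (j, j))" using g2 by (simp add: g_def)
  show "cmod (resolvent X z $$ (j, k)) \<le> 1 / Im z" if "k < N"
  proof (rule power2_le_imp_le)
    show "(cmod (resolvent X z $$ (j, k)))\<^sup>2 \<le> (1 / Im z)\<^sup>2"
      using le[OF that] Sb by (simp add: power_divide)
  qed (use z in simp)
qed

text \<open>The second resolvent identity: the product G X' G' equals G + z G G', while G X G'
  equals G' + z G G', and the terms with \<open>z\<close> cancel.\<close>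

lemma resolvent_diff:
  assumes X: "hermitian N X" and X': "hermitian N X'" and z: "Im z \<noteq> 0" and kj: "k < N" "j < N"
  shows "resolvent X z $$ (k, j) - resolvent X' z $$ (k, j) =
    (\<Sum>l<N. \<Sum>m<N. resolvent X z $$ (k, l) * (X' $$ (l, m) - X $$ (l, m)) * resolvent X' z $$ (m, j))"
proof -
  define G where "G k l = resolvent X z $$ (k, l)" for k l
  define G' where "G' k l = resolvent X' z $$ (k, l)" for k l
  have GX: "(\<Sum>l<N. G k l * X $$ (l, j)) = (if k = j then 1 else 0) + z * G k j"
    and XG': "(\<Sum>l<N. X' $$ (k, l) * G' l j) = (if k = j then 1 else 0) + z * G' k j" if "k < N" "j < N" for k j
    unfolding G_def G'_def using resolvent_entries[OF X z that] resolvent_entries[OF X' z that] by auto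
  have "(\<Sum>l<N. \<Sum>m<N. G k l * X' $$ (l, m) * G' m j) = (\<Sum>l<N. G k l * ((if l = j then 1 else 0) + z * G' l j))"
    by (intro sum.cong refl) (use XG' kj in \<open>simp add: mult.assoc sum_distrib_left[symmetric]\<close>)
  also have "\<dots> = (\<Sum>l<N. (if l = j then G k j else 0) + z * (G k l * G' l j))"
    by (intro sum.cong refl) (auto simp: algebra_simps)
  also have "\<dots> = G k j + z * (\<Sum>l<N. G k l * G' l j)"
    using kj by (simp add: sum.distrib sum_distrib_left)
  finally have 1: "(\<Sum>l<N. \<Sum>m<N. G k l * X' $$ (l, m) * G' m j) = G k j + z * (\<Sum>l<N. G k l * G' l j)" .
  have "(\<Sum>l<N. \<Sum>m<N. G k l * X $$ (l, m) * G' m j) = (\<Sum>m<N. (\<Sum>l<N. G k l * X $$ (l, m)) * G' m j)"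
    unfolding sum_distrib_right by (rule sum.swap)
  also have "\<dots> = (\<Sum>m<N. ((if k = m then 1 else 0) + z * G k m) * G' m j)"
    by (intro sum.cong refl) (use GX kj in simp)
  also have "\<dots> = (\<Sum>m<N. (if m = k then G' k j else 0) + z * (G k m * G' m j))"
    by (intro sum.cong refl) (auto simp: algebra_simps)
  also have "\<dots> = G' k j + z * (\<Sum>l<N. G k l * G' l j)"
    using kj by (simp add: sum.distrib sum_distrib_left)
  finally have 2: "(\<Sum>l<N. \<Sum>m<N. G k l * X $$ (l, m) * G' m j) = G' k j + z * (\<Sum>l<N. G k l * G' l j)" .
  have "G k j - G' k j = (\<Sum>l<N. \<Sum>m<N. G k l * X' $$ (l, m) * G' m j) - (\<Sum>l<N. \<Sum>m<N. G k l * X $$ (l, m) * G' m j)"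
    unfolding 1 2 by simp
  also have "\<dots> = (\<Sum>l<N. \<Sum>m<N. G k l * (X' $$ (l, m) - X $$ (l, m)) * G' m j)"
    unfolding sum_subtractf[symmetric] by (intro sum.cong refl) (simp add: algebra_simps)
  finally show ?thesis unfolding G_def G'_def .
qed

text \<open>By the Sherman-Morrison formula the difference is \<open>a\<close> times the sum of p q,
  divided by 1 + a s. The numerator is at most |a| Im s / Im z and the denominator at least |a Im
  s|, so the size of the perturbation drops out. This uniformity in \<open>a\<close> matters because
  the eigenvalues removed by truncation may be arbitrarily large.\<close>

lemma tr_resolvent_rank_one:
  assumes X: "hermitian N X" and X': "hermitian N X'" and z: "Im z > 0"
    and r1: "\<And>k l. k < N \<Longrightarrow> l < N \<Longrightarrow> X' $$ (k, l) = X $$ (k, l) + complex_of_real a * v k * cnj (v l)"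
  shows "cmod (tr (resolvent X z) - tr (resolvent X' z)) \<le> 1 / Im z"
proof -
  have Xc: "X \<in> carrier_mat N N" "X' \<in> carrier_mat N N" using X X' by auto
  have z0: "Im z \<noteq> 0" using z by simp
  define G where "G k l = resolvent X z $$ (k, l)" for k l
  define G' where "G' k l = resolvent X' z $$ (k, l)" for k l
  define p where "p k = (\<Sum>l<N. G k l * v l)" for k
  define q where "q j = (\<Sum>l<N. cnj (v l) * G l j)" for j
  define q' where "q' j = (\<Sum>l<N. cnj (v l) * G' l j)" for j
  define s where "s = (\<Sum>k<N. cnj (v k) * p k)"
  have XG: "(\<Sum>l<N. X $$ (k, l) * G l j) = (if k = j then 1 else 0) + z * G k j"
    and GX: "(\<Sum>l<N. G k l * X $$ (l, j)) = (if k = j then 1 else 0) + z * G k j" if "k < N" "j < N" for k j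
    unfolding G_def using resolvent_entries[OF X z0 that] by auto
  have diff: "G k j - G' k j = of_real a * p k * q' j" if kj: "k < N" "j < N" for k j
  proof -
    have "G k j - G' k j = (\<Sum>l<N. \<Sum>m<N. G k l * (X' $$ (l, m) - X $$ (l, m)) * G' m j)"
      unfolding G_def G'_def by (rule resolvent_diff[OF X X' z0 kj])
    also have "\<dots> = (\<Sum>l<N. \<Sum>m<N. of_real a * (G k l * v l) * (cnj (v m) * G' m j))"
      by (intro sum.cong refl) (simp add: r1 algebra_simps)
    also have "\<dots> = of_real a * p k * q' j"
      unfolding p_def q'_def mult.assoc[of "of_real a"] sum_product
      by (simp only: sum_distrib_left mult.assoc)
    finally show ?thesis .
  qed
  have qq': "q j = (1 + of_real a * s) * q' j" if j: "j < N" for j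
  proof -
    have "q j - q' j = (\<Sum>l<N. cnj (v l) * (G l j - G' l j))"
      unfolding q_def q'_def by (simp add: sum_subtractf algebra_simps)
    also have "\<dots> = (\<Sum>l<N. of_real a * q' j * (cnj (v l) * p l))"
      by (intro sum.cong refl) (simp add: diff j)
    also have "\<dots> = of_real a * s * q' j" unfolding s_def by (simp add: sum_distrib_left[symmetric])
    finally show ?thesis by (simp add: algebra_simps)
  qed
  have "Im s = Im z * (\<Sum>k<N. (cmod (p k))\<^sup>2)"
    unfolding s_def
  proof (rule Im_solution[OF X])
    fix k assume k: "k < N"
    have "(\<Sum>l<N. X $$ (k, l) * p l) = (\<Sum>j<N. (\<Sum>l<N. X $$ (k, l) * G l j) * v j)"
      unfolding p_def sum_distrib_left sum_distrib_right by (subst sum.swap) (simp add: mult.assoc)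
    also have "\<dots> = (\<Sum>j<N. (if j = k then v k else 0) + z * (G k j * v j))"
      by (intro sum.cong refl) (use XG k in \<open>auto simp: algebra_simps\<close>)
    also have "\<dots> = v k + z * p k" using k by (simp add: sum.distrib p_def sum_distrib_left)
    finally show "(\<Sum>l<N. X $$ (k, l) * p l) = v k + z * p k" .
  qed
  moreover have "Im (\<Sum>k<N. q k * v k) = Im z * (\<Sum>k<N. (cmod (q k))\<^sup>2)"
  proof (rule Im_solution_left[OF X])
    fix k assume k: "k < N"
    have "(\<Sum>l<N. q l * X $$ (l, k)) = (\<Sum>j<N. cnj (v j) * (\<Sum>l<N. G j l * X $$ (l, k)))"
      unfolding q_def sum_distrib_left sum_distrib_right by (subst sum.swap) (simp add: mult.assoc)
    also have "\<dots> = (\<Sum>j<N. (if j = k then cnj (v k) else 0) + z * (cnj (v j) * G j k))"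
      by (intro sum.cong refl) (use GX k in \<open>auto simp: algebra_simps\<close>)
    also have "\<dots> = cnj (v k) + z * q k" using k by (simp add: sum.distrib q_def sum_distrib_left)
    finally show "(\<Sum>l<N. q l * X $$ (l, k)) = cnj (v k) + z * q k" .
  qed
  moreover have "(\<Sum>k<N. q k * v k) = s"
    unfolding s_def q_def p_def sum_distrib_left sum_distrib_right by (subst sum.swap) (simp add: mult_ac)
  ultimately have pq: "(\<Sum>k<N. (cmod (p k))\<^sup>2) = Im s / Im z" "(\<Sum>k<N. (cmod (q k))\<^sup>2) = Im s / Im z"
    using z by (auto simp: field_simps)
  have "0 \<le> (\<Sum>k<N. (cmod (p k))\<^sup>2)" by (intro sum_nonneg) auto
  hence s0: "Im s \<ge> 0" using z unfolding pq by (simp add: zero_le_divide_iff)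
  have "cmod (\<Sum>k<N. p k * q k) \<le> (\<Sum>k<N. cmod (p k) * cmod (q k))"
    by (rule order_trans[OF norm_sum]) (simp add: norm_mult)
  also have "\<dots> \<le> (\<Sum>k<N. ((cmod (p k))\<^sup>2 + (cmod (q k))\<^sup>2) / 2)"
  proof (intro sum_mono)
    fix k
    have "0 \<le> (cmod (p k) - cmod (q k))\<^sup>2" by simp
    thus "cmod (p k) * cmod (q k) \<le> ((cmod (p k))\<^sup>2 + (cmod (q k))\<^sup>2) / 2"
      by (simp add: power2_eq_square algebra_simps)
  qed
  also have "\<dots> = Im s / Im z"
    unfolding sum_divide_distrib[symmetric] sum.distrib pq by simp
  finally have pqb: "cmod (\<Sum>k<N. p k * q k) \<le> Im s / Im z" .
  have trd: "tr (resolvent X z) - tr (resolvent X' z) = of_real a * (\<Sum>k<N. p k * q' k)"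
    unfolding tr_carrier[OF resolvent_carrier[OF Xc(1)]] tr_carrier[OF resolvent_carrier[OF Xc(2)]]
      sum_subtractf[symmetric] sum_distrib_left
    by (intro sum.cong refl) (use diff in \<open>simp add: G_def G'_def mult.assoc\<close>)
  have "\<bar>a * Im s\<bar> \<le> cmod (1 + of_real a * s)"
    using abs_Im_le_cmod[of "1 + of_real a * s"] by simp
  show ?thesis
  \<comment> \<open>The general argument divides by a quantity bounded below by |a Im s|. If that
    vanishes, then \<open>a\<close> or the vector \<open>p\<close> is zero and the traces
    agree.\<close>
  proof (cases "a * Im s = 0")
    case True
    show ?thesis
    proof (cases "a = 0")
      case True thus ?thesis using z unfolding trd by simp
    next
      case False
      with True have "(\<Sum>k<N. (cmod (p k))\<^sup>2) = 0" unfolding pq by simp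
      hence "\<forall>k<N. p k = 0" by (subst (asm) sum_nonneg_eq_0_iff) auto
      hence "(\<Sum>k<N. p k * q' k) = 0" by (intro sum.neutral) auto
      thus ?thesis using z unfolding trd by simp
    qed
  next
    case False
    define d where "d = 1 + of_real a * s"
    have d: "\<bar>a * Im s\<bar> \<le> cmod d" "cmod d > 0"
      using \<open>\<bar>a * Im s\<bar> \<le> cmod (1 + of_real a * s)\<close> False by (auto simp: d_def)
    have "d * (\<Sum>k<N. p k * q' k) = (\<Sum>k<N. p k * q k)"
      unfolding sum_distrib_left by (intro sum.cong refl) (simp add: qq' d_def[symmetric])
    hence "cmod d * cmod (\<Sum>k<N. p k * q' k) \<le> Im s / Im z" using pqb by (metis norm_mult)
    hence "cmod d * (\<bar>a\<bar> * cmod (\<Sum>k<N. p k * q' k)) \<le> \<bar>a\<bar> * (Im s / Im z)"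
      by (metis abs_ge_zero mult.left_commute mult_left_mono)
    also have "\<dots> = \<bar>a * Im s\<bar> * (1 / Im z)" using s0 by (simp add: abs_mult)
    also have "\<dots> \<le> cmod d * (1 / Im z)" using d z by (intro mult_right_mono) auto
    finally have "\<bar>a\<bar> * cmod (\<Sum>k<N. p k * q' k) \<le> 1 / Im z" by (rule mult_left_le_imp_le[OF _ d(2)])
    thus ?thesis unfolding trd by (simp add: norm_mult)
  qed
qed

section \<open>Sums of a diagonal and a rotated diagonal matrix\<close>

definition rotated_sum :: "nat \<Rightarrow> (nat \<Rightarrow> real) \<Rightarrow> (nat \<Rightarrow> real) \<Rightarrow> complex mat \<Rightarrow> complex mat" where
  "rotated_sum N a b Q = diag_real N a + Q * diag_real N b * mat_adjoint Q"

lemma rotated_sum_hermitian: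
  assumes Q: "Q \<in> carrier_mat N N"
  shows "hermitian N (rotated_sum N a b Q)"
proof -
  have h: "hermitian N (Q * diag_real N b * mat_adjoint Q)" by (rule hermitian_conj[OF diag_real_hermitian Q])
  have "mat_adjoint (rotated_sum N a b Q) = rotated_sum N a b Q"
    unfolding rotated_sum_def
    using adjoint_add[OF diag_real_carrier conjunct1[OF h], of a] h diag_real_hermitian[of N a] by argo
  thus ?thesis using h by (simp add: rotated_sum_def square_carrier)
qed

lemma rotated_sum_carrier: "Q \<in> carrier_mat N N \<Longrightarrow> rotated_sum N a b Q \<in> carrier_mat N N"
  using rotated_sum_hermitian by blast

lemma resolvent_diag:
  assumes z: "Im z \<noteq> 0"
  shows "resolvent (diag_real N a) z = mat N N (\<lambda>(i, j). if i = j then 1 / (of_real (a i) - z) else 0)"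
    (is "_ = ?G")
proof (rule resolvent_unique[OF diag_real_hermitian z])
  have nz: "of_real (a i) - z \<noteq> 0" for i using z by (auto simp: complex_eq_iff)
  have Y: "diag_real N a - z \<cdot>\<^sub>m 1\<^sub>m N \<in> carrier_mat N N" by (simp add: square_carrier)
  have G: "?G \<in> carrier_mat N N" by simp
  show "(diag_real N a - z \<cdot>\<^sub>m 1\<^sub>m N) * ?G = 1\<^sub>m N"
  proof (rule eq_matI)
    fix i j assume "i < dim_row (1\<^sub>m N :: complex mat)" "j < dim_col (1\<^sub>m N :: complex mat)"
    hence ij: "i < N" "j < N" by auto
    have "((diag_real N a - z \<cdot>\<^sub>m 1\<^sub>m N) * ?G) $$ (i, j) = (\<Sum>k<N. if k = i then (if i = j then 1 else 0) else 0)"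
      unfolding mult_mat_entry[OF Y G ij]
      by (intro sum.cong refl) (use ij nz diag_real_carrier[of N a] in auto)
    thus "((diag_real N a - z \<cdot>\<^sub>m 1\<^sub>m N) * ?G) $$ (i, j) = 1\<^sub>m N $$ (i, j)" using ij by simp
  qed (use Y in auto)
qed simp

lemma tr_resolvent_spectral:
  assumes V: "V \<in> unitary_group K N" and z: "Im z \<noteq> 0"
  shows "tr (resolvent (V * diag_real N a * mat_adjoint V) z) = (\<Sum>i<N. 1 / (of_real (a i) - z))"
  unfolding resolvent_conj[OF V diag_real_hermitian z] tr_conj[OF V resolvent_carrier[OF diag_real_carrier]]
  by (simp add: resolvent_diag[OF z] tr_def)

lemma unitary_adjoint_UNIV: "Q \<in> unitary_group K N \<Longrightarrow> mat_adjoint Q \<in> unitary_group UNIV N"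
  by (simp add: unitary_group_def square_carrier)

text \<open>Conjugation by the adjoint of \<open>Q\<close> moves to the eigenbasis of the second
  summand. Every statement about the \<open>a\<close> side thereby yields one about the
  \<open>b\<close> side, with the adjoint of \<open>Q\<close>, which is Haar distributed as
  well.\<close>

lemma rotated_sum_swap:
  assumes Q: "Q \<in> unitary_group K N"
  shows "rotated_sum N b a (mat_adjoint Q) = mat_adjoint Q * rotated_sum N a b Q * Q"
proof -
  note U = unitaryD(1-3)[OF Q] and aU = square_carrier(1)[OF unitaryD(1)[OF Q]]
  define D where "D = diag_real N b"
  have D: "D \<in> carrier_mat N N" by (simp add: D_def)
  define E where "E = diag_real N a"
  have E: "E \<in> carrier_mat N N" by (simp add: E_def)
  have 1: "mat_adjoint Q * (Q * D * mat_adjoint Q) = D * mat_adjoint Q"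
  proof -
    have "mat_adjoint Q * (Q * D * mat_adjoint Q) = (mat_adjoint Q * Q) * (D * mat_adjoint Q)"
      using U(1) aU D by (simp add: assoc_mult_mat[of _ N N _ N _ N] square_carrier)
    thus ?thesis unfolding U(3) using D aU by (simp add: square_carrier)
  qed
  have "mat_adjoint Q * rotated_sum N a b Q * Q = (mat_adjoint Q * E + D * mat_adjoint Q) * Q"
    unfolding rotated_sum_def D_def[symmetric] E_def[symmetric]
    by (subst mult_add_distrib_mat[OF aU E]) (use U aU D 1 in \<open>auto simp: square_carrier\<close>)
  also have "\<dots> = mat_adjoint Q * E * Q + D * mat_adjoint Q * Q"
    by (rule add_mult_distrib_mat) (use U aU D E in \<open>auto simp: square_carrier\<close>)
  also have "D * mat_adjoint Q * Q = D * (mat_adjoint Q * Q)"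
    using U(1) aU D by (simp add: assoc_mult_mat[of _ N N _ N _ N] square_carrier)
  also have "\<dots> = D" unfolding U(3) using D by simp
  finally have "mat_adjoint Q * rotated_sum N a b Q * Q = mat_adjoint Q * E * Q + D" .
  also have "\<dots> = D + mat_adjoint Q * E * Q"
    by (rule comm_add_mat) (use U aU D E in \<open>auto simp: square_carrier\<close>)
  finally show ?thesis by (simp add: rotated_sum_def D_def E_def)
qed

lemma resolvent_rotated_sum_swap:
  assumes Q: "Q \<in> unitary_group K N" and z: "Im z \<noteq> 0"
  shows "resolvent (rotated_sum N b a (mat_adjoint Q)) z = mat_adjoint Q * resolvent (rotated_sum N a b Q) z * Q"
  using resolvent_conj[OF unitary_adjoint_UNIV[OF Q] rotated_sum_hermitian[OF unitaryD(1)[OF Q]] z, of a b]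
  unfolding rotated_sum_swap[OF Q] by simp

lemma tr_resolvent_rotated_sum_swap:
  assumes Q: "Q \<in> unitary_group K N" and z: "Im z \<noteq> 0"
  shows "tr (resolvent (rotated_sum N b a (mat_adjoint Q)) z) = tr (resolvent (rotated_sum N a b Q) z)"
  using tr_conj[OF unitary_adjoint_UNIV[OF Q] resolvent_carrier[OF rotated_sum_carrier[OF unitaryD(1)[OF Q]]], of a b z]
  unfolding resolvent_rotated_sum_swap[OF Q z] by simp

lemma tr_diag_mult:
  assumes M: "M \<in> carrier_mat N N"
  shows "tr (diag_real N a * M) = (\<Sum>k<N. of_real (a k) * M $$ (k, k))"
  unfolding tr_carrier[OF square_carrier(2)[OF diag_real_carrier M]]
proof (intro sum.cong refl)
  fix k assume "k \<in> {..<N}"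
  hence k: "k < N" by simp
  have "(diag_real N a * M) $$ (k, k) = (\<Sum>l<N. if l = k then of_real (a k) * M $$ (k, k) else 0)"
    unfolding mult_mat_entry[OF diag_real_carrier M k k] by (intro sum.cong refl) (use k in auto)
  thus "(diag_real N a * M) $$ (k, k) = of_real (a k) * M $$ (k, k)" using k by simp
qed

text \<open>Take the trace of X G = 1 + z G and split \<open>X\<close>; cyclicity brings the rotated
  summand to diagonal form. Divided by N, and then by the normalised trace, this is what makes the
  sum of the two subordination points exact rather than approximate.\<close>

lemma trace_identity:
  assumes Q: "Q \<in> unitary_group K N" and z: "Im z \<noteq> 0"
  shows "(\<Sum>k<N. of_real (a k) * resolvent (rotated_sum N a b Q) z $$ (k, k))
    + (\<Sum>k<N. of_real (b k) * resolvent (rotated_sum N b a (mat_adjoint Q)) z $$ (k, k))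
    = of_nat N + z * tr (resolvent (rotated_sum N a b Q) z)"
proof -
  note U = unitaryD(1-3)[OF Q] and aU = square_carrier(1)[OF unitaryD(1)[OF Q]]
  define X where "X = rotated_sum N a b Q"
  have X: "hermitian N X" unfolding X_def by (rule rotated_sum_hermitian[OF U(1)])
  hence Xc: "X \<in> carrier_mat N N" by blast
  define G where "G = resolvent X z"
  have G: "G \<in> carrier_mat N N" unfolding G_def by (rule resolvent_carrier[OF Xc])
  define D where "D = diag_real N b"
  have D: "D \<in> carrier_mat N N" by (simp add: D_def)
  define B where "B = Q * D * mat_adjoint Q"
  have B: "B \<in> carrier_mat N N" using U aU D by (simp add: B_def square_carrier)
  have "tr (X * G) = (\<Sum>k<N. (if k = k then 1 else 0) + z * G $$ (k, k))"
    unfolding tr_carrier[OF square_carrier(2)[OF Xc G]]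
  proof (intro sum.cong refl)
    fix k assume "k \<in> {..<N}"
    hence k: "k < N" by simp
    show "(X * G) $$ (k, k) = (if k = k then 1 else 0) + z * G $$ (k, k)"
      unfolding mult_mat_entry[OF Xc G k k] unfolding G_def by (rule resolvent_entries(1)[OF X z k k])
  qed
  also have "\<dots> = of_nat N + z * tr G"
    unfolding tr_carrier[OF G] by (simp add: sum.distrib sum_distrib_left)
  finally have 1: "tr (X * G) = of_nat N + z * tr G" .
  have "X * G = diag_real N a * G + B * G"
    unfolding X_def rotated_sum_def B_def[symmetric] D_def[symmetric]
    by (rule add_mult_distrib_mat[OF diag_real_carrier B G])
  hence 2: "tr (X * G) = tr (diag_real N a * G) + tr (B * G)"
    using G B by (simp add: tr_def sum.distrib square_carrier)
  have c: "D * mat_adjoint Q * G \<in> carrier_mat N N" using aU D G by (simp add: square_carrier)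
  have "B * G = Q * (D * mat_adjoint Q * G)"
    using U aU D G by (simp add: B_def assoc_mult_mat[of _ N N _ N _ N] square_carrier)
  hence "tr (B * G) = tr (D * mat_adjoint Q * G * Q)" by (simp only: tr_comm[OF U(1) c])
  also have "D * mat_adjoint Q * G * Q = D * (mat_adjoint Q * G * Q)"
    using U aU D G by (simp add: assoc_mult_mat[of _ N N _ N _ N] square_carrier)
  also have "mat_adjoint Q * G * Q = resolvent (rotated_sum N b a (mat_adjoint Q)) z"
    unfolding G_def X_def resolvent_rotated_sum_swap[OF Q z] ..
  finally have 3: "tr (B * G) = tr (D * resolvent (rotated_sum N b a (mat_adjoint Q)) z)" .
  show ?thesis
    using 1 unfolding 2 3 unfolding D_def G_def X_def tr_diag_mult[OF resolvent_carrier[OF rotated_sum_carrier[OF aU]]]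
      tr_diag_mult[OF resolvent_carrier[OF rotated_sum_carrier[OF U(1)]]] .
qed

section \<open>Truncation of the eigenvalues\<close>

text \<open>Entries are changed one at a time, each change being a rank one perturbation that costs
  at most 1 / Im z however large it is.\<close>

lemma tr_resolvent_change_diag:
  assumes Y: "Y \<in> carrier_mat N N" and h: "\<And>a. hermitian N (diag_real N a + Y)" and z: "Im z > 0"
  shows "cmod (tr (resolvent (diag_real N a + Y) z) - tr (resolvent (diag_real N a' + Y) z))
    \<le> card {i. i < N \<and> a i \<noteq> a' i} / Im z"
proof -
  have "finite S \<Longrightarrow> S \<subseteq> {..<N} \<Longrightarrow> cmod (tr (resolvent (diag_real N a + Y) z)
      - tr (resolvent (diag_real N (\<lambda>i. if i \<in> S then a' i else a i) + Y) z)) \<le> card S / Im z" for S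
  proof (induction S rule: finite_induct)
    case empty thus ?case by simp
  next
    case (insert m S)
    define c where "c = (\<lambda>i. if i \<in> S then a' i else a i)"
    define d where "d = (\<lambda>i. if i \<in> insert m S then a' i else a i)"
    have 1: "cmod (tr (resolvent (diag_real N a + Y) z) - tr (resolvent (diag_real N c + Y) z)) \<le> card S / Im z"
      unfolding c_def using insert.IH insert.prems by simp
    have "cmod (tr (resolvent (diag_real N c + Y) z) - tr (resolvent (diag_real N d + Y) z)) \<le> 1 / Im z"
    proof (rule tr_resolvent_rank_one[OF h h z])
      fix k l assume "k < N" "l < N"
      thus "(diag_real N d + Y) $$ (k, l) = (diag_real N c + Y) $$ (k, l)
        + complex_of_real (a' m - a m) * (if k = m then 1 else 0) * cnj (if l = m then 1 else 0)"
        using Y insert.hyps by (auto simp: c_def d_def)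
    qed
    hence "cmod (tr (resolvent (diag_real N a + Y) z) - tr (resolvent (diag_real N d + Y) z)) \<le> card S / Im z + 1 / Im z"
      using 1 norm_triangle_mono[of _ "card S / Im z" _ "1 / Im z"] by (smt (verit) norm_diff_triangle_ineq norm_diff_triangle_le)
    thus ?case using insert.hyps by (simp add: d_def add_divide_distrib add.commute)
  qed
  from this[of "{i. i < N \<and> a i \<noteq> a' i}"]
  have "cmod (tr (resolvent (diag_real N a + Y) z)
      - tr (resolvent (diag_real N (\<lambda>i. if i < N \<and> a i \<noteq> a' i then a' i else a i) + Y) z))
      \<le> card {i. i < N \<and> a i \<noteq> a' i} / Im z" by auto
  also have "diag_real N (\<lambda>i. if i < N \<and> a i \<noteq> a' i then a' i else a i) = diag_real N a'"
    by (rule eq_matI) (auto simp: diag_real_def)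
  finally show ?thesis .
qed

text \<open>First \<open>a\<close> is replaced; the change of \<open>b\<close> reduces to the same
  case after exchanging the roles of the summands, which preserves the trace.\<close>

lemma tr_resolvent_truncate:
  assumes Q: "Q \<in> unitary_group K N" and z: "Im z > 0"
  shows "cmod (tr (resolvent (rotated_sum N a b Q) z) - tr (resolvent (rotated_sum N a' b' Q) z))
    \<le> (card {i. i < N \<and> a i \<noteq> a' i} + card {i. i < N \<and> b i \<noteq> b' i}) / Im z"
proof -
  note U = unitaryD(1)[OF Q] and aU = square_carrier(1)[OF unitaryD(1)[OF Q]]
  have z0: "Im z \<noteq> 0" using z by simp
  have 1: "cmod (tr (resolvent (rotated_sum N a b Q) z) - tr (resolvent (rotated_sum N a' b Q) z))
    \<le> card {i. i < N \<and> a i \<noteq> a' i} / Im z"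
    unfolding rotated_sum_def
    by (rule tr_resolvent_change_diag[OF _ rotated_sum_hermitian[OF U, unfolded rotated_sum_def] z])
      (use U aU in \<open>simp add: square_carrier\<close>)
  have "cmod (tr (resolvent (rotated_sum N b a' (mat_adjoint Q)) z) - tr (resolvent (rotated_sum N b' a' (mat_adjoint Q)) z))
    \<le> card {i. i < N \<and> b i \<noteq> b' i} / Im z"
    unfolding rotated_sum_def
    by (rule tr_resolvent_change_diag[OF _ rotated_sum_hermitian[OF aU, unfolded rotated_sum_def] z])
      (use U aU in \<open>simp add: square_carrier\<close>)
  hence 2: "cmod (tr (resolvent (rotated_sum N a' b Q) z) - tr (resolvent (rotated_sum N a' b' Q) z))
    \<le> card {i. i < N \<and> b i \<noteq> b' i} / Im z"
    unfolding tr_resolvent_rotated_sum_swap[OF Q z0] .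
  from norm_triangle_mono[OF 1 2] show ?thesis by (simp add: add_divide_distrib)
qed

section \<open>Measurability of matrix-valued maps\<close>

text \<open>The entrywise form is equivalent to measurability into \<open>mat_borel\<close> by
  \<open>measurable_mat_borel_iff\<close> and is the one that passes through products, determinants
  and cofactors.\<close>

definition measurable_mat :: "'a measure \<Rightarrow> nat \<Rightarrow> ('a \<Rightarrow> complex mat) \<Rightarrow> bool" where
  "measurable_mat M N F \<longleftrightarrow> (\<forall>x\<in>space M. F x \<in> carrier_mat N N) \<and>
     (\<forall>i<N. \<forall>j<N. (\<lambda>x. F x $$ (i, j)) \<in> borel_measurable M)"

lemma measurable_matI:
  "(\<And>x. x \<in> space M \<Longrightarrow> F x \<in> carrier_mat N N) \<Longrightarrow>
   (\<And>i j. i < N \<Longrightarrow> j < N \<Longrightarrow> (\<lambda>x. F x $$ (i, j)) \<in> borel_measurable M) \<Longrightarrow> measurable_mat M N F"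
  by (simp add: measurable_mat_def)

lemma measurable_matD:
  "measurable_mat M N F \<Longrightarrow> x \<in> space M \<Longrightarrow> F x \<in> carrier_mat N N"
  "measurable_mat M N F \<Longrightarrow> i < N \<Longrightarrow> j < N \<Longrightarrow> (\<lambda>x. F x $$ (i, j)) \<in> borel_measurable M"
  by (simp_all add: measurable_mat_def)

lemma measurable_mat_entry_cong:
  assumes "\<And>x. x \<in> space M \<Longrightarrow> F x $$ (i, j) = f x" "f \<in> borel_measurable M"
  shows "(\<lambda>x. F x $$ (i, j)) \<in> borel_measurable M"
  using assms by (subst measurable_cong[of M _ f]) auto

lemma measurable_mat_const: "A \<in> carrier_mat N N \<Longrightarrow> measurable_mat M N (\<lambda>_. A)"
  by (rule measurable_matI) auto

lemma measurable_mat_add: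
  assumes F: "measurable_mat M N F" and G: "measurable_mat M N G"
  shows "measurable_mat M N (\<lambda>x. F x + G x)"
proof (rule measurable_matI)
  show "F x + G x \<in> carrier_mat N N" if "x \<in> space M" for x
    using measurable_matD(1)[OF F that] measurable_matD(1)[OF G that] by (simp add: square_carrier)
  show "(\<lambda>x. (F x + G x) $$ (i, j)) \<in> borel_measurable M" if ij: "i < N" "j < N" for i j
  proof (rule measurable_mat_entry_cong)
    show "(F x + G x) $$ (i, j) = F x $$ (i, j) + G x $$ (i, j)" if "x \<in> space M" for x
      using measurable_matD(1)[OF F that] measurable_matD(1)[OF G that] ij by simp
    show "(\<lambda>x. F x $$ (i, j) + G x $$ (i, j)) \<in> borel_measurable M"
      using measurable_matD(2)[OF F ij] measurable_matD(2)[OF G ij] by simp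
  qed
qed

lemma measurable_mat_diff:
  assumes F: "measurable_mat M N F" and G: "measurable_mat M N G"
  shows "measurable_mat M N (\<lambda>x. F x - G x)"
proof (rule measurable_matI)
  show "F x - G x \<in> carrier_mat N N" if "x \<in> space M" for x
    using measurable_matD(1)[OF F that] measurable_matD(1)[OF G that] by (simp add: square_carrier)
  show "(\<lambda>x. (F x - G x) $$ (i, j)) \<in> borel_measurable M" if ij: "i < N" "j < N" for i j
  proof (rule measurable_mat_entry_cong)
    show "(F x - G x) $$ (i, j) = F x $$ (i, j) - G x $$ (i, j)" if "x \<in> space M" for x
      using measurable_matD(1)[OF F that] measurable_matD(1)[OF G that] ij by simp
    show "(\<lambda>x. F x $$ (i, j) - G x $$ (i, j)) \<in> borel_measurable M"
      using measurable_matD(2)[OF F ij] measurable_matD(2)[OF G ij] by simp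
  qed
qed

lemma measurable_mat_mult:
  assumes F: "measurable_mat M N F" and G: "measurable_mat M N G"
  shows "measurable_mat M N (\<lambda>x. F x * G x)"
proof (rule measurable_matI)
  show "F x * G x \<in> carrier_mat N N" if "x \<in> space M" for x
    using measurable_matD(1)[OF F that] measurable_matD(1)[OF G that] by (simp add: square_carrier)
  show "(\<lambda>x. (F x * G x) $$ (i, j)) \<in> borel_measurable M" if ij: "i < N" "j < N" for i j
  proof (rule measurable_mat_entry_cong)
    show "(F x * G x) $$ (i, j) = (\<Sum>k<N. F x $$ (i, k) * G x $$ (k, j))" if "x \<in> space M" for x
      by (rule mult_mat_entry[OF measurable_matD(1)[OF F that] measurable_matD(1)[OF G that] ij])
    show "(\<lambda>x. \<Sum>k<N. F x $$ (i, k) * G x $$ (k, j)) \<in> borel_measurable M"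
      by (intro borel_measurable_sum borel_measurable_times measurable_matD(2)[OF F] measurable_matD(2)[OF G])
        (use ij in auto)
  qed
qed

lemma measurable_mat_adjoint:
  assumes F: "measurable_mat M N F"
  shows "measurable_mat M N (\<lambda>x. mat_adjoint (F x))"
proof (rule measurable_matI)
  show "mat_adjoint (F x) \<in> carrier_mat N N" if "x \<in> space M" for x
    using measurable_matD(1)[OF F that] by (simp add: square_carrier)
  show "(\<lambda>x. mat_adjoint (F x) $$ (i, j)) \<in> borel_measurable M" if ij: "i < N" "j < N" for i j
  proof (rule measurable_mat_entry_cong)
    show "mat_adjoint (F x) $$ (i, j) = cnj (F x $$ (j, i))" if "x \<in> space M" for x
      by (rule adjoint_entry[OF measurable_matD(1)[OF F that] ij])
    show "(\<lambda>x. cnj (F x $$ (j, i))) \<in> borel_measurable M"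
      by (intro borel_measurable_continuous_on[of cnj] continuous_intros measurable_matD(2)[OF F] ij)
  qed
qed

lemma measurable_det:
  assumes F: "measurable_mat M N F"
  shows "(\<lambda>x. Determinant.det (F x)) \<in> borel_measurable M"
proof -
  have "(\<lambda>x. \<Sum>p\<in>{p. p permutes {0..<N}}. signof p * (\<Prod>i = 0..<N. F x $$ (i, p i))) \<in> borel_measurable M"
    by (intro borel_measurable_sum borel_measurable_times borel_measurable_const borel_measurable_prod measurable_matD(2)[OF F])
      (auto simp: permutes_in_image[of _ "{0..<N}", simplified atLeast0LessThan] dest: permutes_in_image)
  thus ?thesis
    by (subst measurable_cong) (use det_def'[OF measurable_matD(1)[OF F]] in auto)
qed

lemma measurable_mat_delete:
  assumes F: "measurable_mat M N F" and ij: "i < N" "j < N"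
  shows "measurable_mat M (N - 1) (\<lambda>x. mat_delete (F x) i j)"
proof (rule measurable_matI)
  show "mat_delete (F x) i j \<in> carrier_mat (N - 1) (N - 1)" if "x \<in> space M" for x
    using measurable_matD(1)[OF F that] by (simp add: mat_delete_def)
  show "(\<lambda>x. mat_delete (F x) i j $$ (k, l)) \<in> borel_measurable M" if kl: "k < N - 1" "l < N - 1" for k l
  proof (rule measurable_mat_entry_cong)
    show "mat_delete (F x) i j $$ (k, l) = F x $$ (if k < i then k else Suc k, if l < j then l else Suc l)"
      if "x \<in> space M" for x
      using measurable_matD(1)[OF F that] kl by (simp add: mat_delete_def)
    show "(\<lambda>x. F x $$ (if k < i then k else Suc k, if l < j then l else Suc l)) \<in> borel_measurable M"
      by (rule measurable_matD(2)[OF F]) (use kl in auto)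
  qed
qed

lemma measurable_mat_resolvent:
  assumes F: "measurable_mat M N F"
  shows "measurable_mat M N (\<lambda>x. resolvent (F x) z)"
proof (rule measurable_matI)
  define Y where "Y x = F x - z \<cdot>\<^sub>m 1\<^sub>m N" for x
  have Y: "measurable_mat M N Y"
    unfolding Y_def by (intro measurable_mat_diff F measurable_mat_const) (simp add: square_carrier)
  show "resolvent (F x) z \<in> carrier_mat N N" if "x \<in> space M" for x
    by (rule resolvent_carrier[OF measurable_matD(1)[OF F that]])
  show "(\<lambda>x. resolvent (F x) z $$ (i, j)) \<in> borel_measurable M" if ij: "i < N" "j < N" for i j
  proof (rule measurable_mat_entry_cong)
    show "resolvent (F x) z $$ (i, j) = inverse (Determinant.det (Y x)) * ((-1) ^ (j + i) * Determinant.det (mat_delete (Y x) j i))"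
      if x: "x \<in> space M" for x
      using measurable_matD(1)[OF F x] measurable_matD(1)[OF Y x] ij
      by (simp add: resolvent_def Let_def adj_mat_def cofactor_def Y_def)
    show "(\<lambda>x. inverse (Determinant.det (Y x)) * ((-1) ^ (j + i) * Determinant.det (mat_delete (Y x) j i))) \<in> borel_measurable M"
      by (intro borel_measurable_times borel_measurable_const borel_measurable_inverse measurable_det[OF Y]
        measurable_det[OF measurable_mat_delete[OF Y ij(2,1)]])
  qed
qed

lemma measurable_tr:
  assumes F: "measurable_mat M N F"
  shows "(\<lambda>x. tr (F x)) \<in> borel_measurable M"
proof -
  have "(\<lambda>x. \<Sum>i<N. F x $$ (i, i)) \<in> borel_measurable M"
    by (intro borel_measurable_sum measurable_matD(2)[OF F]) auto
  thus ?thesis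
    by (subst measurable_cong) (use tr_carrier[OF measurable_matD(1)[OF F]] in auto)
qed

lemma space_mat_borel: "space (mat_borel N) = carrier_mat N N"
  by (simp add: mat_borel_def)

lemma measurable_mat_borel_iff: "F \<in> M \<rightarrow>\<^sub>M mat_borel N \<longleftrightarrow> measurable_mat M N F"
proof
  assume F: "F \<in> M \<rightarrow>\<^sub>M mat_borel N"
  show "measurable_mat M N F"
  proof (rule measurable_matI)
    show "F x \<in> carrier_mat N N" if "x \<in> space M" for x
      using measurable_space[OF F that] by (simp add: space_mat_borel)
    show "(\<lambda>x. F x $$ (i, j)) \<in> borel_measurable M" if ij: "i < N" "j < N" for i j
    proof -
      have 1: "(\<lambda>X. \<lambda>ij\<in>{..<N} \<times> {..<N}. X $$ ij) \<in> mat_borel N \<rightarrow>\<^sub>M Pi\<^sub>M ({..<N} \<times> {..<N}) (\<lambda>_. borel :: complex measure)"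
        unfolding mat_borel_def by (rule measurable_vimage_algebra1) (auto simp: space_PiM)
      have "(\<lambda>f. f (i, j)) \<in> Pi\<^sub>M ({..<N} \<times> {..<N}) (\<lambda>_. borel :: complex measure) \<rightarrow>\<^sub>M borel"
        by (rule measurable_component_singleton) (use ij in auto)
      from measurable_compose[OF measurable_compose[OF F 1] this] ij
      show ?thesis by simp
    qed
  qed
next
  assume F: "measurable_mat M N F"
  show "F \<in> M \<rightarrow>\<^sub>M mat_borel N"
    unfolding mat_borel_def
  proof (rule measurable_vimage_algebra2)
    show "F \<in> space M \<rightarrow> carrier_mat N N" using measurable_matD(1)[OF F] by auto
    show "(\<lambda>x. \<lambda>ij\<in>{..<N} \<times> {..<N}. F x $$ ij) \<in> M \<rightarrow>\<^sub>M Pi\<^sub>M ({..<N} \<times> {..<N}) (\<lambda>_. borel)"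
      by (rule measurable_restrict) (use measurable_matD(2)[OF F] in auto)
  qed
qed

lemma measurable_unitary_borel_iff:
  "F \<in> M \<rightarrow>\<^sub>M unitary_borel K N \<longleftrightarrow> measurable_mat M N F \<and> F \<in> space M \<rightarrow> unitary_group K N"
  unfolding unitary_borel_def measurable_restrict_space2_iff measurable_mat_borel_iff by blast

lemma measurable_hermitian_borel_iff:
  "F \<in> M \<rightarrow>\<^sub>M hermitian_borel K N \<longleftrightarrow> measurable_mat M N F \<and> F \<in> space M \<rightarrow> hermitian_matrices K N"
  unfolding hermitian_borel_def measurable_restrict_space2_iff measurable_mat_borel_iff by blast

lemma space_unitary_borel: "space (unitary_borel K N) = unitary_group K N"
  by (auto simp: unitary_borel_def space_restrict_space space_mat_borel unitary_group_def)

lemma space_hermitian_borel: "space (hermitian_borel K N) = hermitian_matrices K N"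
  by (auto simp: hermitian_borel_def space_restrict_space space_mat_borel hermitian_matrices_def)

section \<open>Haar measure\<close>

context
  fixes K N H
  assumes K: "K = \<real> \<or> K = UNIV" and haar: "is_haar_probability K N H"
begin

interpretation H: prob_space H using haar by (simp add: is_haar_probability_def)

lemma haar_sets: "sets H = sets (unitary_borel K N)"
  using haar by (simp add: is_haar_probability_def)

lemma haar_space: "space H = unitary_group K N"
  using sets_eq_imp_space_eq[OF haar_sets] by (simp add: space_unitary_borel)

lemma measurable_mat_haar: "measurable_mat H N (\<lambda>Q. Q)"
  using measurable_unitary_borel_iff[of "\<lambda>Q. Q" H K N] measurable_ident_sets[OF haar_sets] by simp

lemma measurable_haar_iff: "F \<in> M \<rightarrow>\<^sub>M H \<longleftrightarrow> measurable_mat M N F \<and> F \<in> space M \<rightarrow> unitary_group K N"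
  using measurable_unitary_borel_iff measurable_cong_sets[OF refl haar_sets] by blast

lemma haar_left: "U \<in> unitary_group K N \<Longrightarrow> distr H H (\<lambda>V. U * V) = H"
  using haar by (simp add: is_haar_probability_def)

lemma measurable_haar_adjoint: "mat_adjoint \<in> H \<rightarrow>\<^sub>M H"
  unfolding measurable_haar_iff using measurable_mat_adjoint[OF measurable_mat_haar] unitary_adjoint[OF K]
  by (auto simp: haar_space)

lemma measurable_haar_left: "U \<in> unitary_group K N \<Longrightarrow> (\<lambda>V. U * V) \<in> H \<rightarrow>\<^sub>M H"
  unfolding measurable_haar_iff
  using measurable_mat_mult[OF measurable_mat_const measurable_mat_haar, of U] unitary_mult[OF K]
  by (auto simp: haar_space unitaryD(1))

text \<open>Inversion invariance: integrate the indicator of \<open>U\<^sup>-\<^sup>1 V \<in> S\<close> in both orders.\<close>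

lemma haar_adjoint: "distr H H mat_adjoint = H"
proof (rule measure_eqI)
  fix S assume "S \<in> sets (distr H H mat_adjoint)"
  hence S: "S \<in> sets H" by simp
  define S' where "S' = mat_adjoint -` S \<inter> space H"
  have S': "S' \<in> sets H" unfolding S'_def by (rule measurable_sets[OF measurable_haar_adjoint S])
  interpret HH: pair_prob_space H H ..
  have F: "(\<lambda>(U, V). mat_adjoint U * V) \<in> H \<Otimes>\<^sub>M H \<rightarrow>\<^sub>M H"
    unfolding measurable_haar_iff
  proof
    have 1: "measurable_mat (H \<Otimes>\<^sub>M H) N fst" "measurable_mat (H \<Otimes>\<^sub>M H) N snd"
      using measurable_haar_iff measurable_fst[of H H] measurable_snd[of H H] by blast+
    show "measurable_mat (H \<Otimes>\<^sub>M H) N (\<lambda>(U, V). mat_adjoint U * V)"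
      using measurable_mat_mult[OF measurable_mat_adjoint[OF 1(1)] 1(2)] by (simp add: case_prod_unfold)
    show "(\<lambda>(U, V). mat_adjoint U * V) \<in> space (H \<Otimes>\<^sub>M H) \<rightarrow> unitary_group K N"
      using unitary_mult[OF K unitary_adjoint[OF K]] by (auto simp: space_pair_measure haar_space)
  qed
  have ind: "(\<lambda>(U, V). indicator S (mat_adjoint U * V) :: ennreal) \<in> borel_measurable (H \<Otimes>\<^sub>M H)"
    using measurable_compose[OF F borel_measurable_indicator[OF S]] by (simp add: case_prod_unfold)
  have left: "(\<integral>\<^sup>+V. indicator T (W * V) \<partial>H) = emeasure H T" if "W \<in> unitary_group K N" "T \<in> sets H" for W T
  proof -
    have "(\<integral>\<^sup>+V. indicator T (W * V) \<partial>H) = (\<integral>\<^sup>+V. indicator T V \<partial>distr H H (\<lambda>V. W * V))"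
      by (rule nn_integral_distr[symmetric]) (use that measurable_haar_left in auto)
    thus ?thesis using that haar_left by simp
  qed
  have "emeasure H S = (\<integral>\<^sup>+U. (\<integral>\<^sup>+V. indicator S (mat_adjoint U * V) \<partial>H) \<partial>H)"
  proof -
    have "(\<integral>\<^sup>+U. (\<integral>\<^sup>+V. indicator S (mat_adjoint U * V) \<partial>H) \<partial>H) = (\<integral>\<^sup>+U. emeasure H S \<partial>H)"
      by (intro nn_integral_cong left S) (simp add: haar_space unitary_adjoint[OF K])
    thus ?thesis by (simp add: H.emeasure_space_1)
  qed
  also have "\<dots> = (\<integral>\<^sup>+V. (\<integral>\<^sup>+U. indicator S (mat_adjoint U * V) \<partial>H) \<partial>H)"
    by (rule HH.Fubini'[OF ind, symmetric])
  also have "\<dots> = (\<integral>\<^sup>+V. (\<integral>\<^sup>+U. indicator S' (mat_adjoint V * U) \<partial>H) \<partial>H)"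
  proof (intro nn_integral_cong)
    fix U V assume UV: "U \<in> space H" "V \<in> space H"
    hence c: "U \<in> carrier_mat N N" "V \<in> carrier_mat N N" by (auto simp: haar_space unitaryD(1))
    have "mat_adjoint (mat_adjoint V * U) = mat_adjoint U * V"
      using adjoint_mult[OF square_carrier(1)[OF c(2)] c(1)] by simp
    moreover have "mat_adjoint V * U \<in> space H"
      using UV unitary_mult[OF K unitary_adjoint[OF K]] by (simp add: haar_space)
    ultimately show "indicator S (mat_adjoint U * V) = (indicator S' (mat_adjoint V * U) :: ennreal)"
      by (simp add: S'_def indicator_def)
  qed
  also have "\<dots> = (\<integral>\<^sup>+V. emeasure H S' \<partial>H)"
    by (intro nn_integral_cong left S') (simp add: haar_space unitary_adjoint[OF K])
  also have "\<dots> = emeasure H S'" by (simp add: H.emeasure_space_1)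
  also have "\<dots> = emeasure (distr H H mat_adjoint) S"
    unfolding S'_def by (rule emeasure_distr[OF measurable_haar_adjoint S, symmetric])
  finally show "emeasure (distr H H mat_adjoint) S = emeasure H S" by (rule sym)
qed simp

lemma measurable_haar_conj:
  assumes U: "U \<in> unitary_group K N" and W: "W \<in> unitary_group K N"
  shows "(\<lambda>V. U * V * W) \<in> H \<rightarrow>\<^sub>M H"
  unfolding measurable_haar_iff
  using measurable_mat_mult[OF measurable_mat_mult[OF measurable_mat_const measurable_mat_haar] measurable_mat_const,
      OF unitaryD(1)[OF U] unitaryD(1)[OF W]] unitary_mult[OF K] U W
  by (auto simp: haar_space)

text \<open>Right translation is inversion, left translation by the adjoint and inversion again.
  Both sides are needed: the eigenbasis of one matrix multiplies the Haar matrix from the left, that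
  of the other from the right.\<close>

lemma haar_left_right:
  assumes U: "U \<in> unitary_group K N" and W: "W \<in> unitary_group K N"
  shows "distr H H (\<lambda>V. U * V * W) = H"
proof -
  define W' where "W' = mat_adjoint W"
  have W': "W' \<in> unitary_group K N" unfolding W'_def by (rule unitary_adjoint[OF K W])
  have "H = distr (distr (distr (distr H H mat_adjoint) H (\<lambda>V. W' * V)) H mat_adjoint) H (\<lambda>V. U * V)"
    by (simp only: haar_adjoint haar_left[OF W'] haar_left[OF U])
  also have "\<dots> = distr H H ((\<lambda>V. U * V) \<circ> (mat_adjoint \<circ> ((\<lambda>V. W' * V) \<circ> mat_adjoint)))"
    by (simp add: distr_distr measurable_haar_adjoint measurable_haar_left[OF W'] measurable_haar_left[OF U]
      measurable_comp[of _ H H _ H])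
  also have "\<dots> = distr H H (\<lambda>V. U * V * W)"
  proof (rule distr_cong[OF refl refl])
    fix V assume "V \<in> space H"
    hence V: "V \<in> carrier_mat N N" by (simp add: haar_space unitaryD(1))
    have "mat_adjoint (W' * mat_adjoint V) = V * W"
      using adjoint_mult[OF unitaryD(1)[OF W'] square_carrier(1)[OF V]] by (simp add: W'_def)
    thus "((\<lambda>V. U * V) \<circ> (mat_adjoint \<circ> ((\<lambda>V. W' * V) \<circ> mat_adjoint))) V = U * V * W"
      using unitaryD(1)[OF U] unitaryD(1)[OF W] V by (simp add: assoc_mult_mat[of _ N N _ N _ N])
  qed
  finally show ?thesis by (rule sym)
qed

end

section \<open>Differentiation along plane rotations\<close>

text \<open>A real rotation of one coordinate plane lies in the orthogonal and in the unitary group,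
  so the same one-parameter family serves both cases.\<close>

definition plane_rotation :: "nat \<Rightarrow> nat \<Rightarrow> nat \<Rightarrow> real \<Rightarrow> complex mat" where
  "plane_rotation N i j t = mat N N (\<lambda>(k, l).
     if k = i then (if l = i then of_real (cos t) else if l = j then of_real (sin t) else 0)
     else if k = j then (if l = i then of_real (- sin t) else if l = j then of_real (cos t) else 0)
     else (if l = k then 1 else 0))"

lemma sum_two:
  fixes f :: "nat \<Rightarrow> complex"
  assumes "i < N" "j < N" "i \<noteq> j"
  shows "(\<Sum>m<N. (if m = i then \<alpha> else if m = j then \<beta> else 0) * f m) = \<alpha> * f i + \<beta> * f j"
proof -
  have "(\<Sum>m<N. (if m = i then \<alpha> else if m = j then \<beta> else 0) * f m)
      = (\<Sum>m<N. (if m = i then \<alpha> * f i else 0) + (if m = j then \<beta> * f j else 0))"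
    by (intro sum.cong refl) (use assms in auto)
  also have "\<dots> = \<alpha> * f i + \<beta> * f j" using assms by (simp add: sum.distrib)
  finally show ?thesis .
qed

locale haar_rotation =
  fixes K :: "complex set" and N :: nat and H :: "complex mat measure" and i j :: nat
  assumes K: "K = \<real> \<or> K = UNIV" and haar: "is_haar_probability K N H"
    and ij: "i < N" "j < N" "i \<noteq> j"
begin

sublocale H: prob_space H using haar by (simp add: is_haar_probability_def)

abbreviation "R \<equiv> plane_rotation N i j"

lemma R_carrier: "R t \<in> carrier_mat N N"
  by (simp add: plane_rotation_def)

lemma R_sum:
  assumes "k < N"
  shows "(\<Sum>m<N. R t $$ (k, m) * f m) =
    (if k = i then of_real (cos t) * f i + of_real (sin t) * f j
     else if k = j then of_real (- sin t) * f i + of_real (cos t) * f j else f k)"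
proof -
  have "(\<Sum>m<N. R t $$ (k, m) * f m) = (\<Sum>m<N. (if k = i then (if m = i then of_real (cos t) else if m = j then of_real (sin t) else 0)
     else if k = j then (if m = i then of_real (- sin t) else if m = j then of_real (cos t) else 0)
     else (if m = k then 1 else 0)) * f m)"
    by (intro sum.cong refl) (use assms in \<open>simp add: plane_rotation_def\<close>)
  also have "\<dots> = (if k = i then of_real (cos t) * f i + of_real (sin t) * f j
     else if k = j then of_real (- sin t) * f i + of_real (cos t) * f j else f k)"
    using sum_two[OF ij, of "of_real (cos t)" "of_real (sin t)" f]
      sum_two[OF ij, of "of_real (- sin t)" "of_real (cos t)" f] assms ij
    by (auto simp: if_distrib[of "\<lambda>x. x * _"] cong: if_cong)
  finally show ?thesis .
qed

lemma R_unitary: "R t \<in> unitary_group K N"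
proof (rule unitaryI[OF R_carrier])
  show "R t $$ (k, l) \<in> K" if "k < N" "l < N" for k l
    using K that by (auto simp: plane_rotation_def)
  have e: "R t $$ (k, m) = (if k = i then (if m = i then of_real (cos t) else if m = j then of_real (sin t) else 0)
     else if k = j then (if m = i then of_real (- sin t) else if m = j then of_real (cos t) else 0)
     else (if m = k then 1 else 0))" if "k < N" "m < N" for k m
    using that by (simp add: plane_rotation_def)
  have cs: "complex_of_real (cos t) * of_real (cos t) + of_real (sin t) * of_real (sin t) = 1"
    using sin_cos_squared_add3[of t] by (metis of_real_1 of_real_add of_real_mult)
  show "(\<Sum>m<N. R t $$ (k, m) * cnj (R t $$ (l, m))) = (if k = l then 1 else 0)" if kl: "k < N" "l < N" for k l
    unfolding R_sum[OF kl(1)] using kl ij cs by (auto simp: e algebra_simps)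
qed

text \<open>The remainder is uniform on the group, so that the derivative may be taken under the Haar integral.\<close>

definition expands :: "(complex mat \<Rightarrow> complex) \<Rightarrow> (complex mat \<Rightarrow> complex) \<Rightarrow> bool" where
  "expands f f' \<longleftrightarrow> f \<in> borel_measurable H \<and> f' \<in> borel_measurable H \<and>
     (\<exists>B. \<forall>Q\<in>unitary_group K N. cmod (f Q) \<le> B \<and> cmod (f' Q) \<le> B \<and>
        (\<forall>t. \<bar>t\<bar> \<le> 1 \<longrightarrow> cmod (f (R t * Q) - f Q - of_real t * f' Q) \<le> B * t\<^sup>2))"

lemma expandsI:
  assumes "f \<in> borel_measurable H" "f' \<in> borel_measurable H"
    and "\<And>Q. Q \<in> unitary_group K N \<Longrightarrow> cmod (f Q) \<le> B1" "\<And>Q. Q \<in> unitary_group K N \<Longrightarrow> cmod (f' Q) \<le> B2"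
    and "\<And>Q t. Q \<in> unitary_group K N \<Longrightarrow> \<bar>t\<bar> \<le> 1 \<Longrightarrow> cmod (f (R t * Q) - f Q - of_real t * f' Q) \<le> B3 * t\<^sup>2"
  shows "expands f f'"
proof -
  define B where "B = max B1 (max B2 B3)"
  have "B3 * t\<^sup>2 \<le> B * t\<^sup>2" for t by (intro mult_right_mono) (auto simp: B_def)
  moreover have "B1 \<le> B" "B2 \<le> B" by (auto simp: B_def)
  ultimately have "cmod (f Q) \<le> B \<and> cmod (f' Q) \<le> B \<and>
        (\<forall>t. \<bar>t\<bar> \<le> 1 \<longrightarrow> cmod (f (R t * Q) - f Q - of_real t * f' Q) \<le> B * t\<^sup>2)"
    if "Q \<in> unitary_group K N" for Q
    using assms(3-5)[OF that] order_trans by blast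
  thus ?thesis unfolding expands_def using assms(1,2) by blast
qed

definition expansion_bound :: "real \<Rightarrow> (complex mat \<Rightarrow> complex) \<Rightarrow> (complex mat \<Rightarrow> complex) \<Rightarrow> bool" where
  "expansion_bound B f f' \<longleftrightarrow> B \<ge> 0 \<and> (\<forall>Q\<in>unitary_group K N. cmod (f Q) \<le> B \<and> cmod (f' Q) \<le> B \<and>
        (\<forall>t. \<bar>t\<bar> \<le> 1 \<longrightarrow> cmod (f (R t * Q) - f Q - of_real t * f' Q) \<le> B * t\<^sup>2))"

lemma expansion_boundD:
  assumes "expansion_bound B f f'"
  shows "B \<ge> 0" "\<And>Q. Q \<in> unitary_group K N \<Longrightarrow> cmod (f Q) \<le> B" "\<And>Q. Q \<in> unitary_group K N \<Longrightarrow> cmod (f' Q) \<le> B"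
    "\<And>Q t. Q \<in> unitary_group K N \<Longrightarrow> \<bar>t\<bar> \<le> 1 \<Longrightarrow> cmod (f (R t * Q) - f Q - of_real t * f' Q) \<le> B * t\<^sup>2"
  using assms unfolding expansion_bound_def by blast+

lemma expandsE:
  assumes "expands f f'"
  obtains B where "expansion_bound B f f'"
proof -
  obtain B where B: "\<forall>Q\<in>unitary_group K N. cmod (f Q) \<le> B \<and> cmod (f' Q) \<le> B \<and>
        (\<forall>t. \<bar>t\<bar> \<le> 1 \<longrightarrow> cmod (f (R t * Q) - f Q - of_real t * f' Q) \<le> B * t\<^sup>2)"
    using assms unfolding expands_def by blast
  \<comment> \<open>The group contains \<open>R 0\<close>, which forces the bound to be
    nonnegative.\<close>
  have "cmod (f (R 0)) \<le> B" using B R_unitary[of 0] by blast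
  hence "0 \<le> B" using norm_ge_zero[of "f (R 0)"] by linarith
  with B have "expansion_bound B f f'" unfolding expansion_bound_def by blast
  thus ?thesis by (rule that)
qed

lemma expands_measurable: "expands f f' \<Longrightarrow> f \<in> borel_measurable H" "expands f f' \<Longrightarrow> f' \<in> borel_measurable H"
  by (simp_all add: expands_def)

lemma expands_const: "expands (\<lambda>_. c) (\<lambda>_. 0)"
  by (rule expandsI[where ?B1.0 = "cmod c" and ?B2.0 = 0 and ?B3.0 = 0]) auto

lemma expands_add:
  assumes f: "expands f f'" and g: "expands g g'"
  shows "expands (\<lambda>Q. f Q + g Q) (\<lambda>Q. f' Q + g' Q)"
proof -
  obtain B where "expansion_bound B f f'" using expandsE[OF f] .
  note B = expansion_boundD[OF this]
  obtain C where "expansion_bound C g g'" using expandsE[OF g] .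
  note C = expansion_boundD[OF this]
  show ?thesis
  proof (rule expandsI[where ?B1.0 = "B + C" and ?B2.0 = "B + C" and ?B3.0 = "B + C"])
    fix Q assume Q: "Q \<in> unitary_group K N"
    show "cmod (f Q + g Q) \<le> B + C" by (rule norm_triangle_mono[OF B(2)[OF Q] C(2)[OF Q]])
    show "cmod (f' Q + g' Q) \<le> B + C" by (rule norm_triangle_mono[OF B(3)[OF Q] C(3)[OF Q]])
    fix t assume t: "\<bar>t\<bar> \<le> (1::real)"
    have "f (R t * Q) + g (R t * Q) - (f Q + g Q) - of_real t * (f' Q + g' Q) =
      (f (R t * Q) - f Q - of_real t * f' Q) + (g (R t * Q) - g Q - of_real t * g' Q)"
      by (simp add: algebra_simps)
    thus "cmod (f (R t * Q) + g (R t * Q) - (f Q + g Q) - of_real t * (f' Q + g' Q)) \<le> (B + C) * t\<^sup>2"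
      using norm_triangle_mono[OF B(4)[OF Q t] C(4)[OF Q t]] by (simp add: algebra_simps)
  qed (use expands_measurable[OF f] expands_measurable[OF g] in auto)
qed

lemma expands_sum:
  assumes "finite I" "\<And>m. m \<in> I \<Longrightarrow> expands (f m) (f' m)"
  shows "expands (\<lambda>Q. \<Sum>m\<in>I. f m Q) (\<lambda>Q. \<Sum>m\<in>I. f' m Q)"
  using assms
proof (induction I rule: finite_induct)
  case empty show ?case using expands_const[of 0] by simp
next
  case (insert m I)
  have "expands (\<lambda>Q. f m Q + (\<Sum>m\<in>I. f m Q)) (\<lambda>Q. f' m Q + (\<Sum>m\<in>I. f' m Q))"
    by (rule expands_add) (use insert in auto)
  thus ?case using insert.hyps by simp
qed

lemma expands_mult:
  assumes f: "expands f f'" and g: "expands g g'"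
  shows "expands (\<lambda>Q. f Q * g Q) (\<lambda>Q. f' Q * g Q + f Q * g' Q)"
proof -
  obtain B where "expansion_bound B f f'" using expandsE[OF f] .
  note B = expansion_boundD[OF this]
  obtain C where "expansion_bound C g g'" using expandsE[OF g] .
  note C = expansion_boundD[OF this]
  have m: "cmod (x * y) \<le> b * c" if "cmod x \<le> b" "cmod y \<le> c" for x y b c
    unfolding norm_mult by (rule mult_mono') (use that in auto)
  show ?thesis
  proof (rule expandsI[where ?B1.0 = "B * C" and ?B2.0 = "B * C + B * C" and ?B3.0 = "B * C + B * C + 2 * (B * C)"])
    fix Q assume Q: "Q \<in> unitary_group K N"
    show "cmod (f Q * g Q) \<le> B * C" by (rule m[OF B(2)[OF Q] C(2)[OF Q]])
    show "cmod (f' Q * g Q + f Q * g' Q) \<le> B * C + B * C"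
      by (rule norm_triangle_mono[OF m[OF B(3)[OF Q] C(2)[OF Q]] m[OF B(2)[OF Q] C(3)[OF Q]]])
    fix t assume t: "\<bar>t\<bar> \<le> (1::real)"
    have RQ: "R t * Q \<in> unitary_group K N" by (rule unitary_mult[OF K R_unitary Q])
    have "t\<^sup>2 \<le> \<bar>t\<bar>" using t by (metis abs_ge_zero mult_left_le power2_abs power2_eq_square)
    hence t2: "C * t\<^sup>2 \<le> C * \<bar>t\<bar>" using C(1) by (rule mult_left_mono)
    have tg: "cmod (of_real t * g' Q) \<le> C * \<bar>t\<bar>" and tf: "cmod (of_real t * f' Q) \<le> B * \<bar>t\<bar>"
      using m[of "of_real t" "\<bar>t\<bar>", OF _ C(3)[OF Q]] m[of "of_real t" "\<bar>t\<bar>", OF _ B(3)[OF Q]] by (simp_all add: mult.commute)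
    have "cmod ((g (R t * Q) - g Q - of_real t * g' Q) + of_real t * g' Q) \<le> C * \<bar>t\<bar> + C * \<bar>t\<bar>"
      by (rule norm_triangle_mono[OF order_trans[OF C(4)[OF Q t] t2] tg])
    hence gd: "cmod (g (R t * Q) - g Q) \<le> 2 * C * \<bar>t\<bar>" by simp
    \<comment> \<open>The remainder of the product splits into remainder times \<open>g\<close>,
      \<open>f\<close> times remainder, and a mixed term; the latter is quadratic in
      \<open>t\<close> because \<open>g\<close> moves by at most 2 \<open>C\<close> |t|.\<close>
    have "cmod ((f (R t * Q) - f Q - of_real t * f' Q) * g (R t * Q) + f Q * (g (R t * Q) - g Q - of_real t * g' Q)
        + of_real t * f' Q * (g (R t * Q) - g Q)) \<le> B * t\<^sup>2 * C + B * (C * t\<^sup>2) + (B * \<bar>t\<bar>) * (2 * C * \<bar>t\<bar>)"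
      by (rule norm_triangle_mono[OF norm_triangle_mono[OF m[OF B(4)[OF Q t] C(2)[OF RQ]] m[OF B(2)[OF Q] C(4)[OF Q t]]]
        m[OF tf gd]])
    also have "\<dots> = (B * C + B * C + 2 * (B * C)) * t\<^sup>2"
      by (simp add: algebra_simps power2_eq_square flip: abs_mult)
    also have "(f (R t * Q) - f Q - of_real t * f' Q) * g (R t * Q) + f Q * (g (R t * Q) - g Q - of_real t * g' Q)
        + of_real t * f' Q * (g (R t * Q) - g Q) =
      f (R t * Q) * g (R t * Q) - f Q * g Q - of_real t * (f' Q * g Q + f Q * g' Q)"
      by (simp add: algebra_simps)
    finally show "cmod (f (R t * Q) * g (R t * Q) - f Q * g Q - of_real t * (f' Q * g Q + f Q * g' Q))
      \<le> (B * C + B * C + 2 * (B * C)) * t\<^sup>2" .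
  qed (use expands_measurable[OF f] expands_measurable[OF g] in auto)
qed

lemma expands_cnj:
  assumes f: "expands f f'"
  shows "expands (\<lambda>Q. cnj (f Q)) (\<lambda>Q. cnj (f' Q))"
proof -
  obtain B where "expansion_bound B f f'" using expandsE[OF f] .
  note B = expansion_boundD[OF this]
  have "cnj \<in> borel_measurable borel"
    by (intro borel_measurable_continuous_onI continuous_intros)
  note meas = measurable_compose[OF _ this]
  show ?thesis
  proof (rule expandsI[where ?B1.0 = B and ?B2.0 = B and ?B3.0 = B])
    fix Q assume Q: "Q \<in> unitary_group K N"
    show "cmod (cnj (f Q)) \<le> B" "cmod (cnj (f' Q)) \<le> B" using B(2,3)[OF Q] by simp_all
    fix t assume t: "\<bar>t\<bar> \<le> (1::real)"
    have "cnj (f (R t * Q)) - cnj (f Q) - of_real t * cnj (f' Q) = cnj (f (R t * Q) - f Q - of_real t * f' Q)" by simp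
    thus "cmod (cnj (f (R t * Q)) - cnj (f Q) - of_real t * cnj (f' Q)) \<le> B * t\<^sup>2"
      using B(4)[OF Q t] by (simp only: complex_mod_cnj)
  qed (use meas expands_measurable[OF f] in auto)
qed

lemma expands_cmult: "expands f f' \<Longrightarrow> expands (\<lambda>Q. c * f Q) (\<lambda>Q. c * f' Q)"
  using expands_mult[OF expands_const[of c]] by simp

lemma expands_diff: "expands f f' \<Longrightarrow> expands g g' \<Longrightarrow> expands (\<lambda>Q. f Q - g Q) (\<lambda>Q. f' Q - g' Q)"
  using expands_add[of f f' "\<lambda>Q. (- 1) * g Q" "\<lambda>Q. (- 1) * g' Q"] expands_cmult[of g g' "- 1"] by simp

lemma expands_cong:
  assumes f: "expands f f'" and e: "\<And>Q. Q \<in> unitary_group K N \<Longrightarrow> g Q = f Q"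
    "\<And>Q. Q \<in> unitary_group K N \<Longrightarrow> g' Q = f' Q"
  shows "expands g g'"
proof -
  have "g \<in> borel_measurable H \<longleftrightarrow> f \<in> borel_measurable H"
    by (rule measurable_cong) (use e(1) in \<open>simp add: haar_space[OF K haar]\<close>)
  moreover have "g' \<in> borel_measurable H \<longleftrightarrow> f' \<in> borel_measurable H"
    by (rule measurable_cong) (use e(2) in \<open>simp add: haar_space[OF K haar]\<close>)
  ultimately have m: "g \<in> borel_measurable H" "g' \<in> borel_measurable H"
    using expands_measurable[OF f] by auto
  obtain B where "expansion_bound B f f'" using expandsE[OF f] .
  note B = expansion_boundD[OF this]
  show ?thesis
  proof (rule expandsI[OF m])
    fix Q assume Q: "Q \<in> unitary_group K N"
    show "cmod (g Q) \<le> B" "cmod (g' Q) \<le> B" using B(2,3)[OF Q] e Q by simp_all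
    show "cmod (g (R t * Q) - g Q - of_real t * g' Q) \<le> B * t\<^sup>2" if "\<bar>t\<bar> \<le> 1" for t
      using B(4)[OF Q that] e Q unitary_mult[OF K R_unitary Q] by simp
  qed
qed

lemma integrable_bounded:
  assumes "f \<in> borel_measurable H" "\<And>Q. Q \<in> unitary_group K N \<Longrightarrow> cmod (f Q) \<le> B"
  shows "integrable H f"
  by (rule H.integrable_const_bound[of _ B]) (use assms in \<open>auto simp: haar_space[OF K haar]\<close>)

lemma expands_integrable:
  assumes "expands f f'" shows "integrable H f" "integrable H f'"
proof -
  obtain B where "expansion_bound B f f'" using expandsE[OF assms] .
  note B = expansion_boundD[OF this]
  show "integrable H f" by (rule integrable_bounded[OF expands_measurable(1)[OF assms] B(2)])
  show "integrable H f'" by (rule integrable_bounded[OF expands_measurable(2)[OF assms] B(3)])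
qed

text \<open>By left invariance the integral of \<open>f\<close> along the rotation does not depend
  on \<open>t\<close>, so the uniform expansion leaves t |I| <= B t^2 for the integral I of the
  derivative; then \<open>t\<close> tends to 0. Applied to a product, this is integration by parts
  on the group.\<close>

lemma integral_derivative_eq_0:
  assumes f: "expands f f'"
  shows "(\<integral>Q. f' Q \<partial>H) = 0"
proof -
  obtain B where "expansion_bound B f f'" using expandsE[OF f] .
  note B = expansion_boundD[OF this]
  note sp = haar_space[OF K haar]
  note int = expands_integrable[OF f]
  have bound: "t * cmod (\<integral>Q. f' Q \<partial>H) \<le> B * t\<^sup>2" if t: "0 < t" "t \<le> 1" for t
  proof -
    have mR: "(\<lambda>Q. R t * Q) \<in> H \<rightarrow>\<^sub>M H" by (rule measurable_haar_left[OF K haar R_unitary])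
    have intR: "integrable H (\<lambda>Q. f (R t * Q))"
      by (rule integrable_bounded[where B = B, OF measurable_compose[OF mR expands_measurable(1)[OF f]]])
        (rule B(2)[OF unitary_mult[OF K R_unitary]])
    have "(\<integral>Q. f (R t * Q) \<partial>H) = (\<integral>Q. f Q \<partial>distr H H (\<lambda>Q. R t * Q))"
      by (rule integral_distr[OF mR expands_measurable(1)[OF f], symmetric])
    also have "\<dots> = (\<integral>Q. f Q \<partial>H)" unfolding haar_left[OF K haar R_unitary] ..
    finally have e: "(\<integral>Q. f (R t * Q) \<partial>H) = (\<integral>Q. f Q \<partial>H)" .
    have "(\<integral>Q. f (R t * Q) - f Q - of_real t * f' Q \<partial>H) = - (of_real t * (\<integral>Q. f' Q \<partial>H))"
      using int intR e by simp
    hence "t * cmod (\<integral>Q. f' Q \<partial>H) = cmod (\<integral>Q. f (R t * Q) - f Q - of_real t * f' Q \<partial>H)"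
      using t by (simp add: norm_mult)
    also have "\<dots> \<le> (\<integral>Q. cmod (f (R t * Q) - f Q - of_real t * f' Q) \<partial>H)" by (rule integral_norm_bound)
    also have "\<dots> \<le> (\<integral>Q. B * t\<^sup>2 \<partial>H)"
      by (intro integral_mono integrable_norm Bochner_Integration.integrable_diff intR int integrable_mult_right)
        (use B(4) t in \<open>auto simp: sp\<close>)
    also have "\<dots> = B * t\<^sup>2" by (simp add: H.prob_space)
    finally show ?thesis .
  qed
  have "cmod (\<integral>Q. f' Q \<partial>H) \<le> 0"
  proof (rule field_le_epsilon)
    fix e :: real assume e: "0 < e"
    define t where "t = min 1 (e / (B + 1))"
    have t: "0 < t" "t \<le> 1" using e B(1) by (auto simp: t_def)
    have "t * cmod (\<integral>Q. f' Q \<partial>H) \<le> t * (B * t)" using bound[OF t] by (simp add: power2_eq_square mult_ac)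
    hence "cmod (\<integral>Q. f' Q \<partial>H) \<le> B * t" using t by simp
    also have "\<dots> \<le> (B + 1) * t" using t by simp
    also have "\<dots> \<le> (B + 1) * (e / (B + 1))" using B(1) by (intro mult_left_mono) (auto simp: t_def)
    also have "\<dots> = e" using B(1) by simp
    finally show "cmod (\<integral>Q. f' Q \<partial>H) \<le> 0 + e" by simp
  qed
  thus ?thesis by simp
qed

end

lemma sin_minus_self_le: "\<bar>sin t - t\<bar> \<le> t\<^sup>2" if "\<bar>t\<bar> \<le> (1::real)"
proof -
  have "\<bar>sin t - (\<Sum>m<2. sin_coeff m * t ^ m)\<bar> \<le> inverse (fact 2) * \<bar>t\<bar> ^ 2"
    by (rule Maclaurin_sin_bound)
  also have "(\<Sum>m<2. sin_coeff m * t ^ m) = t" by (simp add: sin_coeff_def numeral_2_eq_2)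
  also have "inverse (fact 2) * \<bar>t\<bar> ^ 2 \<le> t\<^sup>2" by simp
  finally show ?thesis .
qed

lemma cos_minus_one_le: "\<bar>cos t - 1\<bar> \<le> t\<^sup>2" for t :: real
proof -
  have "cos t = 1 - 2 * (sin (t / 2))\<^sup>2" using cos_double_sin[of "t / 2"] by simp
  moreover have "(sin (t / 2))\<^sup>2 \<le> (t / 2)\<^sup>2"
    using abs_sin_x_le_abs_x[of "t / 2"] by (simp only: abs_le_square_iff)
  hence "(sin (t / 2))\<^sup>2 \<le> t\<^sup>2 / 4" by (simp add: power_divide)
  moreover have "0 \<le> (sin (t / 2))\<^sup>2" by simp
  ultimately show ?thesis by linarith
qed

lemma unitary_entry_le:
  assumes "Q \<in> unitary_group K N" "k < N" "l < N"
  shows "cmod (Q $$ (k, l)) \<le> 1"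
proof -
  have "complex_of_real (\<Sum>m<N. (cmod (Q $$ (k, m)))\<^sup>2) = 1"
    using unitary_rows[OF assms(1,2,2)] by (simp only: of_real_sum complex_norm_square if_True simp_thms)
  hence "(\<Sum>m<N. (cmod (Q $$ (k, m)))\<^sup>2) = 1" by (simp only: of_real_eq_1_iff)
  moreover have "(cmod (Q $$ (k, l)))\<^sup>2 \<le> (\<Sum>m<N. (cmod (Q $$ (k, m)))\<^sup>2)"
    by (rule member_le_sum) (use assms in auto)
  ultimately show ?thesis by (simp add: power_le_one_iff)
qed

lemma rotated_sum_entry:
  assumes Q: "Q \<in> carrier_mat N N" and kl: "k < N" "l < N"
  shows "rotated_sum N a b Q $$ (k, l) = (if k = l then of_real (a k) else 0)
    + (\<Sum>m<N. Q $$ (k, m) * of_real (b m) * cnj (Q $$ (l, m)))"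
  unfolding rotated_sum_def conj_diag_entry[OF Q kl, symmetric]
  using Q kl square_carrier(1)[OF Q] by (subst index_add_mat) auto

context haar_rotation
begin

lemma rotation_entry:
  assumes "Q \<in> carrier_mat N N" "k < N" "l < N"
  shows "(R t * Q) $$ (k, l) = (if k = i then of_real (cos t) * Q $$ (i, l) + of_real (sin t) * Q $$ (j, l)
     else if k = j then of_real (- sin t) * Q $$ (i, l) + of_real (cos t) * Q $$ (j, l) else Q $$ (k, l))"
  unfolding mult_mat_entry[OF R_carrier assms] R_sum[OF assms(2)] ..

text \<open>Only the rows \<open>i\<close> and \<open>j\<close> move, and the generator of the
  rotation sends row \<open>i\<close> to row \<open>j\<close> and row \<open>j\<close> to minus row
  \<open>i\<close>.\<close>

lemma expands_entry:
  assumes kl: "k < N" "l < N"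
  shows "expands (\<lambda>Q. Q $$ (k, l)) (\<lambda>Q. (if k = i then Q $$ (j, l) else 0) - (if k = j then Q $$ (i, l) else 0))"
proof (rule expandsI[where ?B1.0 = 1 and ?B2.0 = 1 and ?B3.0 = 2])
  note m = measurable_matD(2)[OF measurable_mat_haar[OF K haar]]
  show "(\<lambda>Q. Q $$ (k, l)) \<in> borel_measurable H" by (rule m[OF kl])
  show "(\<lambda>Q. (if k = i then Q $$ (j, l) else 0) - (if k = j then Q $$ (i, l) else 0)) \<in> borel_measurable H"
    using m[OF ij(1) kl(2)] m[OF ij(2) kl(2)] by auto
  fix Q assume Q: "Q \<in> unitary_group K N"
  note u = unitary_entry_le[OF Q]
  show "cmod (Q $$ (k, l)) \<le> 1" by (rule u[OF kl])
  show "cmod ((if k = i then Q $$ (j, l) else 0) - (if k = j then Q $$ (i, l) else 0)) \<le> 1"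
    using u[OF ij(1) kl(2)] u[OF ij(2) kl(2)] ij by auto
  fix t assume t: "\<bar>t\<bar> \<le> (1::real)"
  have b: "cmod (of_real x * p + of_real y * q) \<le> 2 * t\<^sup>2" if "\<bar>x\<bar> \<le> t\<^sup>2" "\<bar>y\<bar> \<le> t\<^sup>2" "cmod p \<le> 1" "cmod q \<le> 1" for x y p q
  proof -
    have "cmod (of_real x * p) \<le> t\<^sup>2 * 1" "cmod (of_real y * q) \<le> t\<^sup>2 * 1"
      unfolding norm_mult norm_of_real by (intro mult_mono that; simp)+
    from norm_triangle_mono[OF this] show ?thesis by simp
  qed
  have cs: "\<bar>cos t - 1\<bar> \<le> t\<^sup>2" "\<bar>sin t - t\<bar> \<le> t\<^sup>2" "\<bar>- (sin t - t)\<bar> \<le> t\<^sup>2"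
    using cos_minus_one_le[of t] sin_minus_self_le[OF t] by (auto simp: abs_minus_commute)
  note uij = u[OF ij(1) kl(2)] u[OF ij(2) kl(2)]
  note e = rotation_entry[OF unitaryD(1)[OF Q] kl, of t]
  show "cmod ((R t * Q) $$ (k, l) - Q $$ (k, l) - of_real t * ((if k = i then Q $$ (j, l) else 0) - (if k = j then Q $$ (i, l) else 0))) \<le> 2 * t\<^sup>2"
  proof (cases "k = i")
    case True
    have "(R t * Q) $$ (k, l) - Q $$ (k, l) - of_real t * ((if k = i then Q $$ (j, l) else 0) - (if k = j then Q $$ (i, l) else 0))
      = of_real (cos t - 1) * Q $$ (i, l) + of_real (sin t - t) * Q $$ (j, l)"
      unfolding e using True ij by (simp add: algebra_simps)
    thus ?thesis using b[OF cs(1,2) uij] by simp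
  next
    case False
    show ?thesis
    proof (cases "k = j")
      case True
      have "(R t * Q) $$ (k, l) - Q $$ (k, l) - of_real t * ((if k = i then Q $$ (j, l) else 0) - (if k = j then Q $$ (i, l) else 0))
        = of_real (- (sin t - t)) * Q $$ (i, l) + of_real (cos t - 1) * Q $$ (j, l)"
        unfolding e using True ij by (simp add: algebra_simps)
      thus ?thesis using b[OF cs(3,1) uij] by simp
    next
      case False
      with \<open>k \<noteq> i\<close> show ?thesis unfolding e by simp
    qed
  qed
qed

end

section \<open>Derivative of the resolvent along a plane rotation\<close>

locale haar_resolvent = haar_rotation +
  fixes a b :: "nat \<Rightarrow> real" and z :: complex
  assumes z: "Im z > 0"
begin

definition "X Q = rotated_sum N a b Q"
definition "G Q k l = resolvent (X Q) z $$ (k, l)"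
definition "W Q k l = (\<Sum>m<N. Q $$ (k, m) * of_real (b m) * cnj (Q $$ (l, m)))" for Q :: "complex mat"
text \<open>The commutator of the generator of the rotation with \<open>W\<close>, that is, the
  derivative at 0 of \<open>W\<close> conjugated by the rotation.\<close>

definition "W' Q k l = (if k = i then W Q j l else 0) - (if k = j then W Q i l else 0)
    + (if l = i then W Q k j else 0) - (if l = j then W Q k i else 0)" for Q :: "complex mat"

lemma X_hermitian: "Q \<in> unitary_group K N \<Longrightarrow> hermitian N (X Q)"
  unfolding X_def by (rule rotated_sum_hermitian[OF unitaryD(1)])

lemma X_entry: "Q \<in> unitary_group K N \<Longrightarrow> k < N \<Longrightarrow> l < N \<Longrightarrow>
    X Q $$ (k, l) = (if k = l then of_real (a k) else 0) + W Q k l"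
  unfolding X_def W_def by (rule rotated_sum_entry[OF unitaryD(1)])

lemma expands_W:
  assumes kl: "k < N" "l < N"
  shows "expands (\<lambda>Q. W Q k l) (\<lambda>Q. W' Q k l)"
proof -
  have "expands (\<lambda>Q. \<Sum>m<N. of_real (b m) * (Q $$ (k, m) * cnj (Q $$ (l, m))))
    (\<lambda>Q. \<Sum>m<N. of_real (b m) * (((if k = i then Q $$ (j, m) else 0) - (if k = j then Q $$ (i, m) else 0)) * cnj (Q $$ (l, m))
      + Q $$ (k, m) * cnj ((if l = i then Q $$ (j, m) else 0) - (if l = j then Q $$ (i, m) else 0))))"
    by (intro expands_sum expands_cmult expands_mult expands_cnj expands_entry) (use kl in auto)
  thus ?thesis
  proof (rule expands_cong)
    fix Q
    show "W Q k l = (\<Sum>m<N. of_real (b m) * (Q $$ (k, m) * cnj (Q $$ (l, m))))"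
      by (simp add: W_def mult_ac)
    show "W' Q k l = (\<Sum>m<N. of_real (b m) * (((if k = i then Q $$ (j, m) else 0) - (if k = j then Q $$ (i, m) else 0)) * cnj (Q $$ (l, m))
      + Q $$ (k, m) * cnj ((if l = i then Q $$ (j, m) else 0) - (if l = j then Q $$ (i, m) else 0))))"
    proof -
      have "(if P then sum f {..<N} else 0) = (\<Sum>m<N. if P then f m else 0)" for P and f :: "nat \<Rightarrow> complex" by simp
      note * = this
      show ?thesis
        unfolding W'_def W_def * sum_subtractf[symmetric] sum.distrib[symmetric]
        by (rule sum.cong[OF refl]) (auto simp: algebra_simps)
    qed
  qed
qed

lemma expands_X:
  assumes kl: "k < N" "l < N"
  shows "expands (\<lambda>Q. X Q $$ (k, l)) (\<lambda>Q. W' Q k l)"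
proof -
  have "expands (\<lambda>Q. (if k = l then of_real (a k) else 0) + W Q k l) (\<lambda>Q. 0 + W' Q k l)"
    by (intro expands_add expands_const expands_W kl)
  thus ?thesis by (rule expands_cong) (use X_entry kl in auto)
qed

lemma G_measurable: "k < N \<Longrightarrow> l < N \<Longrightarrow> (\<lambda>Q. G Q k l) \<in> borel_measurable H"
  unfolding G_def X_def rotated_sum_def
  by (rule measurable_matD(2)[OF measurable_mat_resolvent[OF measurable_mat_add[OF measurable_mat_const[OF diag_real_carrier]
    measurable_mat_mult[OF measurable_mat_mult[OF measurable_mat_haar[OF K haar] measurable_mat_const[OF diag_real_carrier]]
      measurable_mat_adjoint[OF measurable_mat_haar[OF K haar]]]]]])

lemma G_bound: "Q \<in> unitary_group K N \<Longrightarrow> k < N \<Longrightarrow> l < N \<Longrightarrow> cmod (G Q k l) \<le> 1 / Im z"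
  unfolding G_def by (rule resolvent_bounds(3)[OF X_hermitian z])

text \<open>The derivative of an inverse, -G W' G. Applying the resolvent identity twice makes the
  remainder quadratic in \<open>t\<close>. Its constant may depend on N, since \<open>t\<close>
  tends to 0 while N is fixed.\<close>

lemma expands_G_raw:
  assumes kl: "k < N" "l < N"
  shows "expands (\<lambda>Q. G Q k l) (\<lambda>Q. - (\<Sum>p<N. \<Sum>q<N. G Q k p * W' Q p q * G Q q l))"
proof -
  define B where "B p q = (SOME B. expansion_bound B (\<lambda>Q. X Q $$ (p, q)) (\<lambda>Q. W' Q p q))" for p q
  have B: "expansion_bound (B p q) (\<lambda>Q. X Q $$ (p, q)) (\<lambda>Q. W' Q p q)" if pq: "p < N" "q < N" for p q
  proof -
    obtain B where "expansion_bound B (\<lambda>Q. X Q $$ (p, q)) (\<lambda>Q. W' Q p q)"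
      using expandsE[OF expands_X[OF pq]] .
    thus ?thesis unfolding B_def by (rule someI)
  qed
  \<comment> \<open>Each entry brings its own expansion constant; being nonnegative, all of them are
    dominated by their sum.\<close>
  define C where "C = (\<Sum>p<N. \<Sum>q<N. B p q)"
  define \<eta> where "\<eta> = Im z"
  have \<eta>: "\<eta> > 0" using z by (simp add: \<eta>_def)
  have BC: "B p q \<le> C" if "p < N" "q < N" for p q
  proof -
    have "B p q \<le> (\<Sum>q<N. B p q)" by (rule member_le_sum) (use that expansion_boundD(1)[OF B] in auto)
    also have "\<dots> \<le> C" unfolding C_def
      by (rule member_le_sum) (use that expansion_boundD(1)[OF B] in \<open>auto intro!: sum_nonneg\<close>)
    finally show ?thesis .
  qed
  have C0: "C \<ge> 0" unfolding C_def by (intro sum_nonneg expansion_boundD(1)[OF B]) auto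
  define n where "n = real N"
  have n: "n \<ge> 0" by (simp add: n_def)
  have m3: "cmod (x * y * w) \<le> b * c * d" if "cmod x \<le> b" "cmod y \<le> c" "cmod w \<le> d" for x y w b c d
    unfolding norm_mult by (rule mult_mono'[OF mult_mono'[OF that(1,2)] that(3)]) auto
  have s2: "cmod (\<Sum>p<N. \<Sum>q<N. f p q) \<le> n\<^sup>2 * b" if fb: "\<And>p q. p < N \<Longrightarrow> q < N \<Longrightarrow> cmod (f p q) \<le> b" for f :: "nat \<Rightarrow> nat \<Rightarrow> complex" and b
  proof -
    have 1: "cmod (\<Sum>q<N. f p q) \<le> n * b" if p: "p < N" for p
    proof -
      have "cmod (\<Sum>q<N. f p q) \<le> (\<Sum>q<N. cmod (f p q))" by (rule norm_sum)
      also have "\<dots> \<le> (\<Sum>q<N. b)" by (rule sum_mono, rule fb[OF p]) simp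
      finally show ?thesis by (simp add: n_def)
    qed
    have "cmod (\<Sum>p<N. \<Sum>q<N. f p q) \<le> (\<Sum>p<N. cmod (\<Sum>q<N. f p q))" by (rule norm_sum)
    also have "\<dots> \<le> (\<Sum>p<N. n * b)" by (rule sum_mono, rule 1) simp
    finally show ?thesis by (simp add: n_def power2_eq_square)
  qed
  have W'b: "cmod (W' Q p q) \<le> C" if "Q \<in> unitary_group K N" "p < N" "q < N" for Q p q
    using expansion_boundD(3)[OF B[OF that(2,3)] that(1)] BC[OF that(2,3)] by linarith
  have Xe: "cmod (X (R t * Q) $$ (p, q) - X Q $$ (p, q) - of_real t * W' Q p q) \<le> C * t\<^sup>2"
    if "Q \<in> unitary_group K N" "\<bar>t\<bar> \<le> 1" "p < N" "q < N" for Q p q t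
  proof -
    have "B p q * t\<^sup>2 \<le> C * t\<^sup>2" by (rule mult_right_mono[OF BC[OF that(3,4)]]) simp
    with expansion_boundD(4)[OF B[OF that(3,4)] that(1,2)] show ?thesis by linarith
  qed
  have Xd: "cmod (X (R t * Q) $$ (p, q) - X Q $$ (p, q)) \<le> 2 * C * \<bar>t\<bar>"
    if Q: "Q \<in> unitary_group K N" "\<bar>t\<bar> \<le> 1" "p < N" "q < N" for Q p q t
  proof -
    have t2: "C * t\<^sup>2 \<le> C * \<bar>t\<bar>"
    proof (rule mult_left_mono[OF _ C0])
      show "t\<^sup>2 \<le> \<bar>t\<bar>" using Q(2) by (metis abs_ge_zero mult_left_le power2_abs power2_eq_square)
    qed
    have "cmod ((X (R t * Q) $$ (p, q) - X Q $$ (p, q) - of_real t * W' Q p q) + of_real t * W' Q p q) \<le> C * \<bar>t\<bar> + \<bar>t\<bar> * C"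
      by (rule norm_triangle_mono[OF order_trans[OF Xe[OF Q] t2]])
        (use W'b[OF Q(1,3,4)] in \<open>simp add: norm_mult mult_left_mono\<close>)
    thus ?thesis by simp
  qed
  have Gd: "cmod (G (R t * Q) k l - G Q k l) \<le> n\<^sup>2 * (1 / \<eta> * (2 * C * \<bar>t\<bar>) * (1 / \<eta>))"
    if Q: "Q \<in> unitary_group K N" "\<bar>t\<bar> \<le> 1" and kl: "k < N" "l < N" for Q t k l
  proof -
    have RQ: "R t * Q \<in> unitary_group K N" by (rule unitary_mult[OF K R_unitary Q(1)])
    have "G Q k l - G (R t * Q) k l = (\<Sum>p<N. \<Sum>q<N. G Q k p * (X (R t * Q) $$ (p, q) - X Q $$ (p, q)) * G (R t * Q) q l)"
      unfolding G_def by (rule resolvent_diff) (use X_hermitian Q RQ z kl in auto)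
    also have "cmod \<dots> \<le> n\<^sup>2 * (1 / \<eta> * (2 * C * \<bar>t\<bar>) * (1 / \<eta>))"
      by (intro s2 m3 Xd Q G_bound[folded \<eta>_def] RQ kl)
    finally show ?thesis by (simp add: norm_minus_commute)
  qed
  show ?thesis
  proof (rule expandsI[where ?B1.0 = "1 / \<eta>" and ?B2.0 = "n\<^sup>2 * (1 / \<eta> * C * (1 / \<eta>))"
      and ?B3.0 = "n\<^sup>2 * (1 / \<eta> * (2 * C) * (n\<^sup>2 * (1 / \<eta> * (2 * C) * (1 / \<eta>)))) + n\<^sup>2 * (1 / \<eta> * C * (1 / \<eta>))"])
    show "(\<lambda>Q. G Q k l) \<in> borel_measurable H" by (rule G_measurable[OF kl])
    show "(\<lambda>Q. - (\<Sum>p<N. \<Sum>q<N. G Q k p * W' Q p q * G Q q l)) \<in> borel_measurable H"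
      by (intro borel_measurable_uminus borel_measurable_sum borel_measurable_times G_measurable expands_measurable(2)[OF expands_X])
        (use kl in auto)
    fix Q assume Q: "Q \<in> unitary_group K N"
    show "cmod (G Q k l) \<le> 1 / \<eta>" by (rule G_bound[OF Q kl, folded \<eta>_def])
    show "cmod (- (\<Sum>p<N. \<Sum>q<N. G Q k p * W' Q p q * G Q q l)) \<le> n\<^sup>2 * (1 / \<eta> * C * (1 / \<eta>))"
      unfolding norm_minus_cancel by (intro s2 m3 W'b G_bound[folded \<eta>_def] Q kl)
    fix t assume t: "\<bar>t\<bar> \<le> (1::real)"
    have RQ: "R t * Q \<in> unitary_group K N" by (rule unitary_mult[OF K R_unitary Q])
    define D where "D p q = X (R t * Q) $$ (p, q) - X Q $$ (p, q)" for p q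
    have 1: "G Q k l - G (R t * Q) k l = (\<Sum>p<N. \<Sum>q<N. G Q k p * D p q * G (R t * Q) q l)"
      unfolding G_def D_def by (rule resolvent_diff) (use X_hermitian Q RQ z kl in auto)
    have "G (R t * Q) k l - G Q k l - of_real t * - (\<Sum>p<N. \<Sum>q<N. G Q k p * W' Q p q * G Q q l)
      = - (\<Sum>p<N. \<Sum>q<N. G Q k p * D p q * G (R t * Q) q l) + (\<Sum>p<N. \<Sum>q<N. G Q k p * (of_real t * W' Q p q) * G Q q l)"
      unfolding 1[symmetric] by (simp add: sum_distrib_left mult_ac)
    also have "\<dots> = - ((\<Sum>p<N. \<Sum>q<N. G Q k p * D p q * (G (R t * Q) q l - G Q q l))
        + (\<Sum>p<N. \<Sum>q<N. G Q k p * (D p q - of_real t * W' Q p q) * G Q q l))"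
      by (simp add: algebra_simps sum.distrib sum_subtractf)
    also have "cmod \<dots> \<le> n\<^sup>2 * (1 / \<eta> * (2 * C * \<bar>t\<bar>) * (n\<^sup>2 * (1 / \<eta> * (2 * C * \<bar>t\<bar>) * (1 / \<eta>))))
        + n\<^sup>2 * (1 / \<eta> * (C * t\<^sup>2) * (1 / \<eta>))"
      unfolding norm_minus_cancel D_def
      by (intro norm_triangle_mono s2 m3 Xd Xe Gd G_bound[folded \<eta>_def] Q t kl)
    also have "\<dots> = (n\<^sup>2 * (1 / \<eta> * (2 * C) * (n\<^sup>2 * (1 / \<eta> * (2 * C) * (1 / \<eta>)))) + n\<^sup>2 * (1 / \<eta> * C * (1 / \<eta>))) * t\<^sup>2"
      by (simp add: algebra_simps power2_eq_square flip: abs_mult)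
    finally show "cmod (G (R t * Q) k l - G Q k l - of_real t * - (\<Sum>p<N. \<Sum>q<N. G Q k p * W' Q p q * G Q q l))
      \<le> (n\<^sup>2 * (1 / \<eta> * (2 * C) * (n\<^sup>2 * (1 / \<eta> * (2 * C) * (1 / \<eta>)))) + n\<^sup>2 * (1 / \<eta> * C * (1 / \<eta>))) * t\<^sup>2" .
  qed
qed

end

text \<open>The resolvent equation with the diagonal part moved to the right. It removes
  \<open>W\<close>, and with it the eigenvalues \<open>b\<close>, from the derivative of the
  resolvent.\<close>

lemma (in haar_resolvent) W_G_sum:
  assumes Q: "Q \<in> unitary_group K N" and kl: "k < N" "l < N"
  shows "(\<Sum>q<N. W Q k q * G Q q l) = (if k = l then 1 else 0) + (z - of_real (a k)) * G Q k l"
    and "(\<Sum>p<N. G Q k p * W Q p l) = (if k = l then 1 else 0) + (z - of_real (a l)) * G Q k l"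
proof -
  have z0: "Im z \<noteq> 0" using z by simp
  have "(\<Sum>q<N. X Q $$ (k, q) * G Q q l) = (\<Sum>q<N. (if q = k then of_real (a k) * G Q k l else 0) + W Q k q * G Q q l)"
    by (rule sum.cong[OF refl]) (use X_entry[OF Q kl(1)] in \<open>auto simp: algebra_simps\<close>)
  also have "\<dots> = of_real (a k) * G Q k l + (\<Sum>q<N. W Q k q * G Q q l)"
    using kl by (simp add: sum.distrib)
  finally show "(\<Sum>q<N. W Q k q * G Q q l) = (if k = l then 1 else 0) + (z - of_real (a k)) * G Q k l"
    using resolvent_entries(1)[OF X_hermitian[OF Q] z0 kl] by (simp add: G_def algebra_simps)
  have "(\<Sum>p<N. G Q k p * X Q $$ (p, l)) = (\<Sum>p<N. (if p = l then of_real (a l) * G Q k l else 0) + G Q k p * W Q p l)"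
    by (rule sum.cong[OF refl]) (use X_entry[OF Q _ kl(2)] in \<open>auto simp: algebra_simps\<close>)
  also have "\<dots> = of_real (a l) * G Q k l + (\<Sum>p<N. G Q k p * W Q p l)"
    using kl by (simp add: sum.distrib)
  finally show "(\<Sum>p<N. G Q k p * W Q p l) = (if k = l then 1 else 0) + (z - of_real (a l)) * G Q k l"
    using resolvent_entries(2)[OF X_hermitian[OF Q] z0 kl] by (simp add: G_def algebra_simps)
qed

context haar_resolvent
begin

text \<open>The derivative of \<open>G\<close> after elimination of \<open>W\<close>. The
  contributions with \<open>z\<close> cancel, so that only entries of \<open>G\<close> and the
  difference of two eigenvalues remain.\<close>

definition "DG Q k l = (if k = i then G Q j l else 0) - (if k = j then G Q i l else 0)
    + (if l = i then G Q k j else 0) - (if l = j then G Q k i else 0)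
    + of_real (a j - a i) * (G Q k i * G Q j l + G Q k j * G Q i l)"

lemma expands_G:
  assumes kl: "k < N" "l < N"
  shows "expands (\<lambda>Q. G Q k l) (\<lambda>Q. DG Q k l)"
proof (rule expands_cong[OF expands_G_raw[OF kl]])
  fix Q assume Q: "Q \<in> unitary_group K N"
  have 1: "(\<Sum>p<N. \<Sum>q<N. G Q k p * (if p = m then W Q n q else 0) * G Q q l) = G Q k m * (\<Sum>q<N. W Q n q * G Q q l)"
    if "m < N" for m n
  proof -
    have "(\<Sum>p<N. \<Sum>q<N. G Q k p * (if p = m then W Q n q else 0) * G Q q l)
      = (\<Sum>p<N. if p = m then G Q k m * (\<Sum>q<N. W Q n q * G Q q l) else 0)"
      by (rule sum.cong[OF refl]) (auto simp: sum_distrib_left mult_ac)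
    thus ?thesis using that by simp
  qed
  have 2: "(\<Sum>p<N. \<Sum>q<N. G Q k p * (if q = m then W Q p n else 0) * G Q q l) = (\<Sum>p<N. G Q k p * W Q p n) * G Q m l"
    if "m < N" for m n
  proof -
    have "(\<Sum>q<N. G Q k p * (if q = m then W Q p n else 0) * G Q q l) = G Q k p * W Q p n * G Q m l" for p
    proof -
      have "(\<Sum>q<N. G Q k p * (if q = m then W Q p n else 0) * G Q q l)
        = (\<Sum>q<N. if q = m then G Q k p * W Q p n * G Q m l else 0)"
        by (rule sum.cong[OF refl]) auto
      thus ?thesis using that by simp
    qed
    thus ?thesis by (simp add: sum_distrib_right)
  qed
  have "(\<Sum>p<N. \<Sum>q<N. G Q k p * W' Q p q * G Q q l) =
    (\<Sum>p<N. \<Sum>q<N. G Q k p * (if p = i then W Q j q else 0) * G Q q l)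
    - (\<Sum>p<N. \<Sum>q<N. G Q k p * (if p = j then W Q i q else 0) * G Q q l)
    + (\<Sum>p<N. \<Sum>q<N. G Q k p * (if q = i then W Q p j else 0) * G Q q l)
    - (\<Sum>p<N. \<Sum>q<N. G Q k p * (if q = j then W Q p i else 0) * G Q q l)"
    unfolding sum.distrib[symmetric] sum_subtractf[symmetric] W'_def
    by (intro sum.cong refl) (simp only: ring_distribs)
  also have "\<dots> = G Q k i * (\<Sum>q<N. W Q j q * G Q q l) - G Q k j * (\<Sum>q<N. W Q i q * G Q q l)
    + (\<Sum>p<N. G Q k p * W Q p j) * G Q i l - (\<Sum>p<N. G Q k p * W Q p i) * G Q j l"
    by (simp only: 1[OF ij(1)] 1[OF ij(2)] 2[OF ij(1)] 2[OF ij(2)])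
  also have "\<dots> = - DG Q k l"
    unfolding W_G_sum(1)[OF Q ij(2) kl(2)] W_G_sum(1)[OF Q ij(1) kl(2)] W_G_sum(2)[OF Q kl(1) ij(2)]
      W_G_sum(2)[OF Q kl(1) ij(1)] DG_def
    by (auto simp: algebra_simps)
  finally show "DG Q k l = - (\<Sum>p<N. \<Sum>q<N. G Q k p * W' Q p q * G Q q l)" by simp
qed simp

definition "gbar Q = (\<Sum>k<N. G Q k k) / of_nat N"
definition "tbar Q = (\<Sum>k<N. of_real (a k) * G Q k k) / of_nat N"
text \<open>If this vanished, then \<open>G Q j j\<close> would be 1 / (a j - \<omega>) with
  \<omega> = (tbar - 1) / gbar: this is subordination with denominators cleared.\<close>

definition "Y Q = gbar Q - G Q j j - of_real (a j) * gbar Q * G Q j j + tbar Q * G Q j j"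
definition "Dg Q = (\<Sum>k<N. DG Q k k) / of_nat N"
definition "Dt Q = (\<Sum>k<N. of_real (a k) * DG Q k k) / of_nat N"
definition "DY Q = Dg Q - DG Q j j - of_real (a j) * (Dg Q * G Q j j + gbar Q * DG Q j j)
    + (Dt Q * G Q j j + tbar Q * DG Q j j)"

lemma expands_gbar: "expands gbar Dg"
proof -
  have "expands (\<lambda>Q. inverse (of_nat N) * (\<Sum>k<N. G Q k k)) (\<lambda>Q. inverse (of_nat N) * (\<Sum>k<N. DG Q k k))"
    by (intro expands_cmult expands_sum expands_G) auto
  thus ?thesis by (rule expands_cong) (simp_all add: gbar_def Dg_def divide_inverse mult.commute)
qed

lemma expands_tbar: "expands tbar Dt"
proof -
  have "expands (\<lambda>Q. inverse (of_nat N) * (\<Sum>k<N. of_real (a k) * G Q k k)) (\<lambda>Q. inverse (of_nat N) * (\<Sum>k<N. of_real (a k) * DG Q k k))"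
    by (intro expands_cmult expands_sum expands_G) auto
  thus ?thesis by (rule expands_cong) (simp_all add: tbar_def Dt_def divide_inverse mult.commute)
qed

lemma expands_Y: "expands Y DY"
proof -
  have "expands (\<lambda>Q. gbar Q - G Q j j - of_real (a j) * (gbar Q * G Q j j) + tbar Q * G Q j j) DY"
    unfolding DY_def
    by (intro expands_add expands_diff expands_cmult expands_mult expands_gbar expands_tbar expands_G ij)
  thus ?thesis by (rule expands_cong) (simp_all add: Y_def mult.assoc)
qed

text \<open>Summed over \<open>i\<close>, these terms give N times \<open>Y\<close>. The test
  function producing them is the off-diagonal entry \<open>G Q i j\<close>, as \<open>P_eq\<close>
  shows.\<close>

definition "P Q = G Q i i - G Q j j - of_real (a j - a i) * (G Q i i * G Q j j)"

lemma P_eq: "P Q = - DG Q i j + of_real (a j - a i) * (G Q i j)\<^sup>2"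
  using ij by (simp add: P_def DG_def algebra_simps power2_eq_square)

text \<open>The derivative of \<open>G Q i j\<close> times the conjugate of \<open>Y\<close>
  integrates to 0. Adding it to the left side replaces \<open>P\<close> by terms that all carry a
  factor \<open>G Q i j\<close>, and these are square summable over \<open>i\<close>.\<close>

lemma integral_P_Y:
  "(\<integral>Q. P Q * cnj (Y Q) \<partial>H) = (\<integral>Q. G Q i j * cnj (DY Q) + of_real (a j - a i) * (G Q i j)\<^sup>2 * cnj (Y Q) \<partial>H)"
proof -
  have 1: "expands (\<lambda>Q. G Q i j * cnj (Y Q)) (\<lambda>Q. DG Q i j * cnj (Y Q) + G Q i j * cnj (DY Q))"
    by (intro expands_mult expands_cnj expands_G expands_Y ij)
  have 2: "expands (\<lambda>Q. of_real (a j - a i) * (G Q i j * G Q i j) * cnj (Y Q))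
     (\<lambda>Q. of_real (a j - a i) * (DG Q i j * G Q i j + G Q i j * DG Q i j) * cnj (Y Q) + of_real (a j - a i) * (G Q i j * G Q i j) * cnj (DY Q))"
    by (intro expands_mult expands_cmult expands_cnj expands_G expands_Y ij)
  have 3: "expands (\<lambda>Q. (G Q i i - G Q j j - of_real (a j - a i) * (G Q i i * G Q j j)) * cnj (Y Q))
     (\<lambda>Q. (DG Q i i - DG Q j j - of_real (a j - a i) * (DG Q i i * G Q j j + G Q i i * DG Q j j)) * cnj (Y Q)
        + (G Q i i - G Q j j - of_real (a j - a i) * (G Q i i * G Q j j)) * cnj (DY Q))"
    by (intro expands_mult expands_cmult expands_diff expands_cnj expands_G expands_Y ij)
  have int: "integrable H (\<lambda>Q. P Q * cnj (Y Q))" using expands_integrable(1)[OF 3] by (simp add: P_def)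
  have "(\<integral>Q. P Q * cnj (Y Q) \<partial>H) = (\<integral>Q. P Q * cnj (Y Q) \<partial>H) + (\<integral>Q. DG Q i j * cnj (Y Q) + G Q i j * cnj (DY Q) \<partial>H)"
    unfolding integral_derivative_eq_0[OF 1] by simp
  also have "\<dots> = (\<integral>Q. P Q * cnj (Y Q) + (DG Q i j * cnj (Y Q) + G Q i j * cnj (DY Q)) \<partial>H)"
    by (rule Bochner_Integration.integral_add[OF int expands_integrable(2)[OF 1], symmetric])
  also have "\<dots> = (\<integral>Q. G Q i j * cnj (DY Q) + of_real (a j - a i) * (G Q i j)\<^sup>2 * cnj (Y Q) \<partial>H)"
    by (rule arg_cong[where f = "integral\<^sup>L H"]) (simp add: P_eq fun_eq_iff algebra_simps)
  finally show ?thesis .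
qed

end

text \<open>Collects the constants of \<open>DY_le\<close>: the first two summands come from the
  derivatives of the two averages, the last from the derivative of the diagonal entry. What matters
  is that N does not occur.\<close>

definition ibp_aux :: "real \<Rightarrow> real \<Rightarrow> real" where
  "ibp_aux T s = 4 * T * s\<^sup>2 * (1 + T * s) + (4 * T * s + 4 * T\<^sup>2 * s\<^sup>2) * s + (1 + 2 * T * s)\<^sup>2"

section \<open>Bounds uniform in N for bounded eigenvalues\<close>

locale haar_resolvent_bounded = haar_resolvent +
  fixes T :: real
  assumes T: "\<And>k. k < N \<Longrightarrow> \<bar>a k\<bar> \<le> T"
begin

definition "s = 1 / Im z"

lemma s_pos: "s > 0" using z by (simp add: s_def)

lemma T_nonneg: "T \<ge> 0" using T[OF ij(1)] by linarith

lemma N_pos: "N > 0" using ij by simp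

lemma adiff: "cmod (of_real (a j - a i)) \<le> 2 * T"
  using T[OF ij(1)] T[OF ij(2)] unfolding norm_of_real by linarith

lemma G_le: "Q \<in> unitary_group K N \<Longrightarrow> k < N \<Longrightarrow> l < N \<Longrightarrow> cmod (G Q k l) \<le> s"
  using G_bound by (simp add: s_def)

lemma G_col: "Q \<in> unitary_group K N \<Longrightarrow> l < N \<Longrightarrow> (\<Sum>k<N. (cmod (G Q k l))\<^sup>2) \<le> s\<^sup>2"
  using resolvent_bounds(1)[OF X_hermitian z] by (simp add: G_def s_def power_divide)

lemma G_row: "Q \<in> unitary_group K N \<Longrightarrow> l < N \<Longrightarrow> (\<Sum>k<N. (cmod (G Q l k))\<^sup>2) \<le> s\<^sup>2"
  using resolvent_bounds(2)[OF X_hermitian z] by (simp add: G_def s_def power_divide)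

lemma avg_le:
  assumes "\<And>k. k < N \<Longrightarrow> cmod (f k) \<le> c"
  shows "cmod ((\<Sum>k<N. f k) / of_nat N) \<le> c"
proof -
  have "cmod (\<Sum>k<N. f k) \<le> (\<Sum>k<N. c)"
    by (rule order_trans[OF norm_sum sum_mono]) (use assms in auto)
  thus ?thesis using N_pos by (simp add: norm_divide field_simps)
qed

lemma gbar_le: "Q \<in> unitary_group K N \<Longrightarrow> cmod (gbar Q) \<le> s"
  unfolding gbar_def by (rule avg_le[OF G_le])

lemma tbar_le: assumes "Q \<in> unitary_group K N" shows "cmod (tbar Q) \<le> T * s"
  unfolding tbar_def
proof (rule avg_le)
  fix k assume "k < N"
  thus "cmod (of_real (a k) * G Q k k) \<le> T * s"
    unfolding norm_mult norm_of_real using T G_le[OF assms] T_nonneg by (intro mult_mono) auto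
qed

text \<open>Column \<open>m\<close> and row \<open>n\<close> both have squared length at most the
  square of \<open>s\<close>, so the N summands add up to a bound without N.\<close>

lemma cauchy_sum:
  assumes Q: "Q \<in> unitary_group K N" and m: "m < N" "n < N" and c: "\<And>k. k < N \<Longrightarrow> cmod (c k) \<le> d" and d: "d \<ge> 0"
  shows "cmod (\<Sum>k<N. c k * (G Q k m * G Q n k)) \<le> d * s\<^sup>2"
proof -
  have "cmod (c k * (G Q k m * G Q n k)) \<le> d * (((cmod (G Q k m))\<^sup>2 + (cmod (G Q n k))\<^sup>2) / 2)" if "k < N" for k
  proof -
    have "0 \<le> (cmod (G Q k m) - cmod (G Q n k))\<^sup>2" by simp
    hence "cmod (G Q k m) * cmod (G Q n k) \<le> ((cmod (G Q k m))\<^sup>2 + (cmod (G Q n k))\<^sup>2) / 2"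
      by (simp add: power2_eq_square algebra_simps)
    thus ?thesis unfolding norm_mult using c[OF that] d by (intro mult_mono) auto
  qed
  hence "cmod (\<Sum>k<N. c k * (G Q k m * G Q n k)) \<le> (\<Sum>k<N. d * (((cmod (G Q k m))\<^sup>2 + (cmod (G Q n k))\<^sup>2) / 2))"
    by (intro order_trans[OF norm_sum sum_mono]) auto
  also have "\<dots> = d * (((\<Sum>k<N. (cmod (G Q k m))\<^sup>2) + (\<Sum>k<N. (cmod (G Q n k))\<^sup>2)) / 2)"
    by (simp add: sum_distrib_left[symmetric] sum.distrib sum_divide_distrib[symmetric])
  also have "\<dots> \<le> d * ((s\<^sup>2 + s\<^sup>2) / 2)"
    using G_col[OF Q m(1)] G_row[OF Q m(2)] d by (intro mult_left_mono) auto
  finally show ?thesis by simp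
qed

text \<open>Along the diagonal the Kronecker terms survive only at \<open>i\<close> and
  \<open>j\<close>. With constant weights or weights \<open>a\<close>, this is N times the
  derivative of \<open>gbar\<close> or \<open>tbar\<close>; it stays bounded by
  \<open>cauchy_sum\<close>, so the averages have derivatives of order 1/N.\<close>

lemma sum_weighted_DG:
  "(\<Sum>k<N. c k * DG Q k k) = (c i - c j) * (G Q j i + G Q i j)
    + of_real (a j - a i) * ((\<Sum>k<N. c k * (G Q k i * G Q j k)) + (\<Sum>k<N. c k * (G Q k j * G Q i k)))"
proof -
  have "(\<Sum>k<N. c k * DG Q k k) = (\<Sum>k<N. (if k = i then c i * (G Q j i + G Q i j) else 0)
      - (if k = j then c j * (G Q i j + G Q j i) else 0)
      + of_real (a j - a i) * (c k * (G Q k i * G Q j k) + c k * (G Q k j * G Q i k)))"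
    by (rule sum.cong[OF refl]) (use ij in \<open>auto simp: DG_def algebra_simps\<close>)
  also have "\<dots> = c i * (G Q j i + G Q i j) - c j * (G Q i j + G Q j i)
    + of_real (a j - a i) * ((\<Sum>k<N. c k * (G Q k i * G Q j k)) + (\<Sum>k<N. c k * (G Q k j * G Q i k)))"
    using ij by (simp add: sum.distrib sum_subtractf sum_distrib_left[symmetric])
  finally show ?thesis by (simp add: algebra_simps)
qed

lemma mult_le: "cmod x \<le> p \<Longrightarrow> cmod y \<le> q \<Longrightarrow> cmod (x * y) \<le> p * q"
  unfolding norm_mult by (rule mult_mono') auto

lemma Dg_le: assumes Q: "Q \<in> unitary_group K N" shows "cmod (Dg Q) \<le> 4 * T * s\<^sup>2 / N"
proof -
  have "(\<Sum>k<N. DG Q k k) = of_real (a j - a i) * ((\<Sum>k<N. 1 * (G Q k i * G Q j k)) + (\<Sum>k<N. 1 * (G Q k j * G Q i k)))"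
    using sum_weighted_DG[of "\<lambda>_. 1" Q] by simp
  also have "cmod \<dots> \<le> 2 * T * (1 * s\<^sup>2 + 1 * s\<^sup>2)"
    by (intro mult_le adiff norm_triangle_mono cauchy_sum Q ij) auto
  finally show ?thesis unfolding Dg_def using N_pos by (simp add: norm_divide divide_right_mono)
qed

lemma Dt_le: assumes Q: "Q \<in> unitary_group K N" shows "cmod (Dt Q) \<le> (4 * T * s + 4 * T\<^sup>2 * s\<^sup>2) / N"
proof -
  have "cmod (of_real (a i) - of_real (a j)) \<le> 2 * T" using adiff by (simp add: norm_minus_commute)
  hence "cmod (\<Sum>k<N. of_real (a k) * DG Q k k) \<le> 2 * T * (s + s) + 2 * T * (T * s\<^sup>2 + T * s\<^sup>2)"
    unfolding sum_weighted_DG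
    by (intro mult_le adiff norm_triangle_mono cauchy_sum Q ij G_le T_nonneg) (use T in auto)
  thus ?thesis unfolding Dt_def using N_pos by (simp add: norm_divide divide_right_mono power2_eq_square algebra_simps)
qed

lemma DGjj_le: assumes Q: "Q \<in> unitary_group K N"
  shows "cmod (DG Q j j) \<le> (1 + 2 * T * s) * (cmod (G Q i j) + cmod (G Q j i))"
proof -
  have "DG Q j j = (- 1 + of_real (a j - a i) * G Q j j) * (G Q i j + G Q j i)"
    using ij by (simp add: DG_def algebra_simps)
  also have "cmod \<dots> \<le> (1 + 2 * T * s) * (cmod (G Q i j) + cmod (G Q j i))"
    by (intro mult_le norm_triangle_mono adiff G_le Q ij norm_triangle_ineq) auto
  finally show ?thesis .
qed

lemma Y_le: assumes Q: "Q \<in> unitary_group K N" shows "cmod (Y Q) \<le> 2 * s + 2 * T * s\<^sup>2"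
proof -
  have "cmod (Y Q) \<le> s + s + T * s * s + T * s * s"
    unfolding Y_def
    by (intro norm_triangle_mono norm_triangle_le_diff[THEN order_trans] mult_le gbar_le tbar_le G_le Q ij order_trans[OF norm_triangle_ineq4] add_mono)
      (use T ij in auto)
  thus ?thesis by (simp add: power2_eq_square)
qed

text \<open>The first term stems from the averages, whose derivatives are of order 1/N, the second
  from \<open>DG Q j j\<close>, which carries the entries \<open>G Q i j\<close> and
  \<open>G Q j i\<close>. Multiplied by \<open>G Q i j\<close> and summed over \<open>i\<close>,
  both stay bounded.\<close>

lemma DY_le: assumes Q: "Q \<in> unitary_group K N"
  shows "cmod (DY Q) \<le> ibp_aux T s / N + ibp_aux T s * (cmod (G Q i j) + cmod (G Q j i))"
proof -
  define u where "u = cmod (G Q i j) + cmod (G Q j i)"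
  have u: "u \<ge> 0" by (simp add: u_def)
  have aj: "cmod (of_real (a j)) \<le> T" using T ij by simp
  define d where "d = (1 + 2 * T * s) * u"
  define g where "g = 4 * T * s\<^sup>2 / N"
  define t where "t = (4 * T * s + 4 * T\<^sup>2 * s\<^sup>2) / N"
  have dj: "cmod (DG Q j j) \<le> d" using DGjj_le[OF Q] by (simp add: d_def u_def)
  have "cmod (DY Q) \<le> g + d + T * (g * s + s * d) + (t * s + T * s * d)"
    unfolding DY_def
    by (intro norm_triangle_mono order_trans[OF norm_triangle_ineq4] add_mono mult_le gbar_le tbar_le aj
      Dg_le[folded g_def] Dt_le[folded t_def] dj G_le Q ij)
  also have "\<dots> = (4 * T * s\<^sup>2 * (1 + T * s) + (4 * T * s + 4 * T\<^sup>2 * s\<^sup>2) * s) / N + (1 + 2 * T * s)\<^sup>2 * u"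
    unfolding g_def t_def d_def using N_pos by (simp add: field_simps power2_eq_square)
  also have "\<dots> \<le> ibp_aux T s / N + ibp_aux T s * u"
    using T_nonneg s_pos u by (intro add_mono divide_right_mono mult_right_mono) (auto simp: ibp_aux_def)
  finally show ?thesis by (simp add: u_def)
qed

definition "c1 = 2 * ibp_aux T s + 2 * T * (2 * s + 2 * T * s\<^sup>2)"

text \<open>A majorant whose sum over \<open>i\<close> is bounded independently of N: the constant
  part contains 1/N, the others are squares of entries of one column and one row.\<close>

definition "u Q = ibp_aux T s * s / N + c1 * (cmod (G Q i j))\<^sup>2 + ibp_aux T s * (cmod (G Q j i))\<^sup>2"

lemma ibp_aux_nonneg: "ibp_aux T s \<ge> 0"
  using T_nonneg s_pos by (simp add: ibp_aux_def)

lemma cmod_integral_P_Y: "cmod (\<integral>Q. P Q * cnj (Y Q) \<partial>H) \<le> (\<integral>Q. u Q \<partial>H)"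
proof -
  note c = ibp_aux_nonneg
  have 1: "cmod (G Q i j * cnj (DY Q) + of_real (a j - a i) * (G Q i j)\<^sup>2 * cnj (Y Q)) \<le> u Q"
    if Q: "Q \<in> unitary_group K N" for Q
  proof -
    define x where "x = cmod (G Q i j)"
    define y where "y = cmod (G Q j i)"
    have x: "0 \<le> x" "x \<le> s" "0 \<le> y" using G_le[OF Q ij(1,2)] by (auto simp: x_def y_def)
    have "cmod (G Q i j * cnj (DY Q) + of_real (a j - a i) * (G Q i j)\<^sup>2 * cnj (Y Q)) \<le>
      x * (ibp_aux T s / N + ibp_aux T s * (x + y)) + 2 * T * x\<^sup>2 * (2 * s + 2 * T * s\<^sup>2)"
      by (intro norm_triangle_mono mult_le adiff)
        (use DY_le[OF Q] Y_le[OF Q] in \<open>auto simp: x_def y_def norm_power\<close>)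
    also have "x * (ibp_aux T s / N + ibp_aux T s * (x + y)) \<le> ibp_aux T s * s / N + 2 * ibp_aux T s * x\<^sup>2 + ibp_aux T s * y\<^sup>2"
    proof -
      have "0 \<le> (x - y)\<^sup>2" "0 \<le> x * x" "0 \<le> y * y" by simp_all
      hence "x * (x + y) \<le> 2 * x\<^sup>2 + y\<^sup>2"
        unfolding power2_eq_square left_diff_distrib right_diff_distrib distrib_left mult.commute[of y x] by linarith
      hence "ibp_aux T s * (x * (x + y)) \<le> ibp_aux T s * (2 * x\<^sup>2 + y\<^sup>2)" using c by (rule mult_left_mono)
      moreover have "x * (ibp_aux T s / N) \<le> s * (ibp_aux T s / N)" using x c by (intro mult_right_mono) auto
      ultimately show ?thesis by (simp add: algebra_simps)
    qed
    finally show ?thesis by (simp add: u_def c1_def x_def y_def algebra_simps)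
  qed
  have m: "u \<in> borel_measurable H"
    unfolding u_def using G_measurable[OF ij(1,2)] G_measurable[OF ij(2,1)] by measurable
  have iu: "integrable H u"
  proof (rule H.integrable_const_bound[OF _ m])
    show "AE Q in H. norm (u Q) \<le> ibp_aux T s * s / N + \<bar>c1\<bar> * s\<^sup>2 + ibp_aux T s * s\<^sup>2"
    proof (rule AE_I2)
      fix Q assume "Q \<in> space H"
      hence Q: "Q \<in> unitary_group K N" by (simp add: haar_space[OF K haar])
      have "(cmod (G Q i j))\<^sup>2 \<le> s\<^sup>2" "(cmod (G Q j i))\<^sup>2 \<le> s\<^sup>2"
        using G_le[OF Q ij(1,2)] G_le[OF Q ij(2,1)] by (auto intro: power_mono)
      hence "\<bar>c1 * (cmod (G Q i j))\<^sup>2\<bar> \<le> \<bar>c1\<bar> * s\<^sup>2" "\<bar>ibp_aux T s * (cmod (G Q j i))\<^sup>2\<bar> \<le> ibp_aux T s * s\<^sup>2"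
        unfolding abs_mult using c by (simp_all add: mult_left_mono)
      moreover have "\<bar>ibp_aux T s * s / N\<bar> \<le> ibp_aux T s * s / N" using c s_pos by simp
      ultimately show "norm (u Q) \<le> ibp_aux T s * s / N + \<bar>c1\<bar> * s\<^sup>2 + ibp_aux T s * s\<^sup>2"
        unfolding u_def real_norm_def by linarith
    qed
  qed
  define f where "f Q = G Q i j * cnj (DY Q) + of_real (a j - a i) * (G Q i j)\<^sup>2 * cnj (Y Q)" for Q
  have mf: "f \<in> borel_measurable H"
    unfolding f_def
    by (intro borel_measurable_add borel_measurable_times borel_measurable_power borel_measurable_const G_measurable
      expands_measurable[OF expands_cnj[OF expands_Y]] ij)
  have fu: "norm (f Q) \<le> u Q" if "Q \<in> space H" for Q
    using 1 that by (simp add: f_def haar_space[OF K haar])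
  have "integrable H f"
  proof (rule Bochner_Integration.integrable_bound[OF iu mf AE_I2])
    fix Q assume "Q \<in> space H"
    from fu[OF this] show "norm (f Q) \<le> norm (u Q)" unfolding real_norm_def by linarith
  qed
  have "cmod (\<integral>Q. f Q \<partial>H) \<le> (\<integral>Q. u Q \<partial>H)"
    by (rule order_trans[OF integral_norm_bound Bochner_Integration.integral_mono])
      (use \<open>integrable H f\<close> iu fu in auto)
  thus ?thesis unfolding integral_P_Y f_def .
qed

end

section \<open>The subordination defect\<close>

text \<open>By \<open>defect_alt\<close> below, the defect is an average over \<open>i\<close> of terms which are, up to \<open>(a j - a i) (G i j)\<^sup>2\<close>,
  the derivatives of \<open>- G i j\<close> along the rotation of \<open>Q\<close> in the plane of \<open>i\<close> and \<open>j\<close>.\<close>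

definition defect :: "nat \<Rightarrow> (nat \<Rightarrow> real) \<Rightarrow> complex mat \<Rightarrow> nat \<Rightarrow> complex" where
  "defect N a M j = tr M / of_nat N - M $$ (j, j) - of_real (a j) * (tr M / of_nat N) * M $$ (j, j)
     + (\<Sum>k<N. of_real (a k) * M $$ (k, k)) / of_nat N * M $$ (j, j)"

text \<open>The bound obtained by summing the majorants \<open>u\<close> of the preceding locale
  over all \<open>i\<close>, with the squared lengths of row and column estimated by the square of
  \<open>s\<close>.\<close>

definition defect_bound :: "real \<Rightarrow> real \<Rightarrow> real" where
  "defect_bound T s = ibp_aux T s * s + (2 * ibp_aux T s + 2 * T * (2 * s + 2 * T * s\<^sup>2)) * s\<^sup>2 + ibp_aux T s * s\<^sup>2"

lemma measurable_defect:
  assumes F: "measurable_mat M N F" and j: "j < N"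
  shows "(\<lambda>x. defect N a (F x) j) \<in> borel_measurable M"
  unfolding defect_def divide_inverse
  by (intro borel_measurable_add borel_measurable_diff borel_measurable_times borel_measurable_const borel_measurable_sum
    measurable_tr[OF F] measurable_matD(2)[OF F] j) auto

lemma defect_alt:
  assumes M: "M \<in> carrier_mat N N" and N: "N > 0"
  shows "of_nat N * defect N a M j =
    (\<Sum>i<N. M $$ (i, i) - M $$ (j, j) - of_real (a j - a i) * (M $$ (i, i) * M $$ (j, j)))"
proof -
  have "(\<Sum>i<N. M $$ (i, i) - M $$ (j, j) - of_real (a j - a i) * (M $$ (i, i) * M $$ (j, j)))
    = (\<Sum>i<N. M $$ (i, i) - M $$ (j, j) - of_real (a j) * M $$ (j, j) * M $$ (i, i)
        + M $$ (j, j) * (of_real (a i) * M $$ (i, i)))"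
    by (intro sum.cong refl) (simp add: algebra_simps)
  also have "\<dots> = tr M - of_nat N * M $$ (j, j) - of_real (a j) * M $$ (j, j) * tr M
        + M $$ (j, j) * (\<Sum>i<N. of_real (a i) * M $$ (i, i))"
    unfolding tr_carrier[OF M] by (simp add: sum.distrib sum_subtractf sum_distrib_left)
  also have "\<dots> = of_nat N * defect N a M j"
    using N by (simp add: defect_def field_simps)
  finally show ?thesis by (rule sym)
qed

lemma measurable_mat_resolvent_rotated_sum:
  assumes "measurable_mat M N F"
  shows "measurable_mat M N (\<lambda>x. resolvent (rotated_sum N a b (F x)) z)"
  unfolding rotated_sum_def
  by (intro measurable_mat_resolvent measurable_mat_add[OF measurable_mat_const[OF diag_real_carrier]]
    measurable_mat_mult[OF measurable_mat_mult[OF _ measurable_mat_const[OF diag_real_carrier]]]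
    measurable_mat_adjoint assms)

text \<open>One factor of N |Y|^2 is written as the sum of the terms \<open>P\<close>. Integration
  by parts bounds each integral by that of its majorant, and the sum of the majorants is bounded
  without N, which leaves a factor 1/N.\<close>

theorem integral_defect:
  assumes K: "K = \<real> \<or> K = UNIV" and haar: "is_haar_probability K N H" and j: "j < N"
    and z: "Im z > 0" and T: "\<And>k. k < N \<Longrightarrow> \<bar>a k\<bar> \<le> T"
  shows "(\<integral>Q. (cmod (defect N a (resolvent (rotated_sum N a b Q) z) j))\<^sup>2 \<partial>H) \<le> defect_bound T (1 / Im z) / N"
    and "integrable H (\<lambda>Q. (cmod (defect N a (resolvent (rotated_sum N a b Q) z) j))\<^sup>2)"
proof -
  interpret H: prob_space H using haar by (simp add: is_haar_probability_def)
  note sp = haar_space[OF K haar]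
  have N: "N > 0" using j by simp
  have T0: "T \<ge> 0" using T[OF j] by linarith
  define s where "s = 1 / Im z"
  have s: "s > 0" using z by (simp add: s_def)
  define G where "G Q k l = resolvent (rotated_sum N a b Q) z $$ (k, l)" for Q k l
  define Y where "Y Q = defect N a (resolvent (rotated_sum N a b Q) z) j" for Q
  define P where "P i Q = G Q i i - G Q j j - of_real (a j - a i) * (G Q i i * G Q j j)" for i Q
  define c where "c = ibp_aux T s"
  define c1 where "c1 = 2 * ibp_aux T s + 2 * T * (2 * s + 2 * T * s\<^sup>2)"
  have c: "c \<ge> 0" using T0 s by (simp add: c_def ibp_aux_def)
  have c10: "c1 \<ge> 0" using T0 s c by (simp add: c1_def c_def)
  define u where "u i Q = c * s / N + c1 * (cmod (G Q i j))\<^sup>2 + c * (cmod (G Q j i))\<^sup>2" for i Q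
  have X: "hermitian N (rotated_sum N a b Q)" if "Q \<in> unitary_group K N" for Q
    by (rule rotated_sum_hermitian[OF unitaryD(1)[OF that]])
  have Gm: "(\<lambda>Q. G Q k l) \<in> borel_measurable H" if "k < N" "l < N" for k l
    unfolding G_def
    by (rule measurable_matD(2)[OF measurable_mat_resolvent_rotated_sum[OF measurable_mat_haar[OF K haar]] that])
  have Gs: "cmod (G Q k l) \<le> s" if "Q \<in> unitary_group K N" "k < N" "l < N" for Q k l
    unfolding G_def s_def by (rule resolvent_bounds(3)[OF X[OF that(1)] z that(2,3)])
  have Ym: "Y \<in> borel_measurable H"
    unfolding Y_def by (rule measurable_defect[OF measurable_mat_resolvent_rotated_sum[OF measurable_mat_haar[OF K haar]] j])
  have sumP: "of_nat N * Y Q = (\<Sum>i<N. P i Q)" if "Q \<in> unitary_group K N" for Q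
    unfolding Y_def P_def G_def
    by (rule defect_alt[OF resolvent_carrier[OF rotated_sum_carrier[OF unitaryD(1)[OF that]]] N])
  have Pb: "cmod (P i Q) \<le> 2 * s + 2 * T * (s * s)" if Q: "Q \<in> unitary_group K N" and i: "i < N" for i Q
  proof -
    have "cmod (of_real (a j - a i)) \<le> 2 * T" using T[OF i] T[OF j] unfolding norm_of_real by linarith
    hence "cmod (of_real (a j - a i) * (G Q i i * G Q j j)) \<le> 2 * T * (s * s)"
      unfolding norm_mult by (intro mult_mono' Gs Q i j) auto
    moreover have "cmod (G Q i i - G Q j j) \<le> s + s"
      by (rule order_trans[OF norm_triangle_ineq4 add_mono]) (use Gs Q i j in auto)
    ultimately show ?thesis unfolding P_def using norm_triangle_ineq4[of "G Q i i - G Q j j" "of_real (a j - a i) * (G Q i i * G Q j j)"] by linarith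
  qed
  have Yb: "cmod (Y Q) \<le> 2 * s + 2 * T * (s * s)" if Q: "Q \<in> unitary_group K N" for Q
  proof -
    have "real N * cmod (Y Q) = cmod (\<Sum>i<N. P i Q)" unfolding sumP[OF Q, symmetric] by (simp add: norm_mult)
    also have "\<dots> \<le> (\<Sum>i<N. 2 * s + 2 * T * (s * s))"
      by (rule order_trans[OF norm_sum sum_mono]) (use Pb[OF Q] in auto)
    finally show ?thesis using N by simp
  qed
  have int: "integrable H (\<lambda>Q. P i Q * cnj (Y Q))" if i: "i < N" for i
  proof (rule H.integrable_const_bound)
    have "cnj \<in> borel_measurable borel" by (intro borel_measurable_continuous_onI continuous_intros)
    from measurable_compose[OF Ym this] show "(\<lambda>Q. P i Q * cnj (Y Q)) \<in> borel_measurable H"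
      unfolding P_def using Gm[OF i i] Gm[OF j j] by measurable
    show "AE Q in H. norm (P i Q * cnj (Y Q)) \<le> (2 * s + 2 * T * (s * s)) * (2 * s + 2 * T * (s * s))"
      by (rule AE_I2) (unfold norm_mult, rule mult_mono', use Pb Yb i sp in auto)
  qed
  have iG: "integrable H (\<lambda>Q. (cmod (G Q k l))\<^sup>2)" if kl: "k < N" "l < N" for k l
  proof (rule H.integrable_const_bound)
    show "(\<lambda>Q. (cmod (G Q k l))\<^sup>2) \<in> borel_measurable H" using Gm[OF kl] by measurable
    show "AE Q in H. norm ((cmod (G Q k l))\<^sup>2) \<le> s\<^sup>2"
      by (rule AE_I2) (use Gs kl sp in \<open>auto intro!: power_mono\<close>)
  qed
  have iu: "integrable H (u i)" if i: "i < N" for i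
    unfolding u_def by (intro Bochner_Integration.integrable_add integrable_mult_right iG i j) simp
  have key: "cmod (\<integral>Q. P i Q * cnj (Y Q) \<partial>H) \<le> (\<integral>Q. u i Q \<partial>H)" if i: "i < N" for i
  proof (cases "i = j")
    \<comment> \<open>There is no rotation plane for equal indices, but then \<open>P\<close>
      vanishes.\<close>
    case True
    have "0 \<le> (\<integral>Q. u i Q \<partial>H)"
      by (rule Bochner_Integration.integral_nonneg) (use c c10 s in \<open>simp add: u_def\<close>)
    thus ?thesis using True by (simp add: P_def)
  next
    case False
    interpret L: haar_resolvent_bounded K N H i j a b z T
      by unfold_locales (use K haar i j z T False in auto)
    have eqs: "L.G = G" "L.s = s" by (simp_all add: fun_eq_iff L.G_def L.X_def G_def L.s_def s_def)
    have "L.c1 = c1" "L.u = u i" by (simp_all add: fun_eq_iff L.c1_def L.u_def u_def c_def c1_def eqs)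
    moreover have "L.P = P i" by (simp add: fun_eq_iff L.P_def P_def eqs)
    moreover have "L.Y Q = Y Q" if "Q \<in> space H" for Q
    proof -
      have "resolvent (rotated_sum N a b Q) z \<in> carrier_mat N N"
        using that unfolding sp by (intro resolvent_carrier rotated_sum_carrier unitaryD(1))
      thus ?thesis unfolding L.Y_def L.gbar_def L.tbar_def Y_def defect_def eqs G_def by (simp add: tr_carrier)
    qed
    hence "(\<integral>Q. P i Q * cnj (L.Y Q) \<partial>H) = (\<integral>Q. P i Q * cnj (Y Q) \<partial>H)"
      by (intro Bochner_Integration.integral_cong refl) simp
    ultimately show ?thesis using L.cmod_integral_P_Y by simp
  qed
  have sumu: "(\<Sum>i<N. u i Q) \<le> c * s + c1 * s\<^sup>2 + c * s\<^sup>2" if Q: "Q \<in> unitary_group K N" for Q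
  proof -
    have "(\<Sum>i<N. u i Q) = c * s + c1 * (\<Sum>i<N. (cmod (G Q i j))\<^sup>2) + c * (\<Sum>i<N. (cmod (G Q j i))\<^sup>2)"
      using N by (simp add: u_def sum.distrib sum_distrib_left)
    also have "\<dots> \<le> c * s + c1 * s\<^sup>2 + c * s\<^sup>2"
    proof (intro add_mono mult_left_mono order_refl c c10)
      show "(\<Sum>i<N. (cmod (G Q i j))\<^sup>2) \<le> s\<^sup>2" "(\<Sum>i<N. (cmod (G Q j i))\<^sup>2) \<le> s\<^sup>2"
        using resolvent_bounds(1,2)[OF X[OF Q] z j] by (auto simp: G_def s_def power_divide)
    qed
    finally show ?thesis .
  qed
  show iY: "integrable H (\<lambda>Q. (cmod (defect N a (resolvent (rotated_sum N a b Q) z) j))\<^sup>2)"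
    unfolding Y_def[symmetric]
  proof (rule H.integrable_const_bound)
    show "(\<lambda>Q. (cmod (Y Q))\<^sup>2) \<in> borel_measurable H" using Ym by measurable
    show "AE Q in H. norm ((cmod (Y Q))\<^sup>2) \<le> (2 * s + 2 * T * (s * s))\<^sup>2"
      by (rule AE_I2) (use Yb sp in \<open>auto intro!: power_mono\<close>)
  qed
  have "complex_of_real (real N * (\<integral>Q. (cmod (Y Q))\<^sup>2 \<partial>H)) = (\<integral>Q. complex_of_real (real N * (cmod (Y Q))\<^sup>2) \<partial>H)"
    by (simp only: integral_complex_of_real integral_mult_right_zero)
  also have "\<dots> = (\<integral>Q. (\<Sum>i<N. P i Q * cnj (Y Q)) \<partial>H)"
  proof (rule Bochner_Integration.integral_cong[OF refl])
    fix Q assume "Q \<in> space H"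
    hence Q: "Q \<in> unitary_group K N" by (simp add: sp)
    show "of_real (real N * (cmod (Y Q))\<^sup>2) = (\<Sum>i<N. P i Q * cnj (Y Q))"
      unfolding sum_distrib_right[symmetric] sumP[OF Q, symmetric] of_real_mult complex_norm_square by simp
  qed
  also have "\<dots> = (\<Sum>i<N. \<integral>Q. P i Q * cnj (Y Q) \<partial>H)"
    by (rule Bochner_Integration.integral_sum) (use int in auto)
  finally have e: "complex_of_real (real N * (\<integral>Q. (cmod (Y Q))\<^sup>2 \<partial>H)) = (\<Sum>i<N. \<integral>Q. P i Q * cnj (Y Q) \<partial>H)" .
  have "real N * (\<integral>Q. (cmod (Y Q))\<^sup>2 \<partial>H) \<le> cmod (complex_of_real (real N * (\<integral>Q. (cmod (Y Q))\<^sup>2 \<partial>H)))"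
    unfolding norm_of_real by simp
  also have "\<dots> \<le> (\<Sum>i<N. \<integral>Q. u i Q \<partial>H)"
    unfolding e by (rule order_trans[OF norm_sum sum_mono]) (use key in auto)
  also have "\<dots> = (\<integral>Q. (\<Sum>i<N. u i Q) \<partial>H)"
    by (rule Bochner_Integration.integral_sum[symmetric]) (use iu in auto)
  also have "\<dots> \<le> (\<integral>Q. c * s + c1 * s\<^sup>2 + c * s\<^sup>2 \<partial>H)"
    by (rule Bochner_Integration.integral_mono) (use iu sumu sp in auto)
  also have "\<dots> = defect_bound T s" by (simp add: H.prob_space defect_bound_def c_def c1_def)
  finally show "(\<integral>Q. (cmod (defect N a (resolvent (rotated_sum N a b Q) z) j))\<^sup>2 \<partial>H) \<le> defect_bound T (1 / Im z) / N"
    using N by (simp add: Y_def s_def field_simps)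
qed

definition avg_defect :: "nat \<Rightarrow> (nat \<Rightarrow> real) \<Rightarrow> complex mat \<Rightarrow> real" where
  "avg_defect N a M = (\<Sum>j<N. (cmod (defect N a M j))\<^sup>2) / N"

lemma avg_defect_nonneg: "avg_defect N a M \<ge> 0"
  by (simp add: avg_defect_def sum_nonneg)

lemma measurable_avg_defect:
  assumes F: "measurable_mat M N F"
  shows "(\<lambda>x. avg_defect N a (F x)) \<in> borel_measurable M"
  unfolding avg_defect_def divide_inverse
  by (intro borel_measurable_times borel_measurable_const borel_measurable_sum borel_measurable_power measurable_compose[OF _ borel_measurable_norm]
    measurable_defect[OF F]) auto

text \<open>Markov's inequality for the average over \<open>j\<close>, since
  \<open>integral_defect\<close> holds uniformly in \<open>j\<close>.\<close>

theorem prob_avg_defect: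
  assumes K: "K = \<real> \<or> K = UNIV" and haar: "is_haar_probability K N H" and N: "N > 0"
    and z: "Im z > 0" and T: "\<And>k. k < N \<Longrightarrow> \<bar>a k\<bar> \<le> T" and \<delta>: "\<delta> > 0"
  shows "measure H {Q \<in> space H. avg_defect N a (resolvent (rotated_sum N a b Q) z) \<ge> \<delta>}
    \<le> defect_bound T (1 / Im z) / (N * \<delta>)"
proof -
  interpret H: prob_space H using haar by (simp add: is_haar_probability_def)
  define f where "f Q = avg_defect N a (resolvent (rotated_sum N a b Q) z)" for Q
  have int: "integrable H f"
    unfolding f_def avg_defect_def
    by (intro Bochner_Integration.integrable_divide Bochner_Integration.integrable_sum integral_defect(2)[OF K haar _ z T]) auto
  have "(\<integral>Q. f Q \<partial>H) = (\<Sum>j<N. \<integral>Q. (cmod (defect N a (resolvent (rotated_sum N a b Q) z) j))\<^sup>2 \<partial>H) / N"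
    unfolding f_def avg_defect_def
    by (subst integral_divide_zero, subst Bochner_Integration.integral_sum) (use integral_defect(2)[OF K haar _ z T] in auto)
  also have "\<dots> \<le> (\<Sum>j<N. defect_bound T (1 / Im z) / N) / N"
    by (intro divide_right_mono sum_mono integral_defect(1)[OF K haar _ z T]) auto
  also have "\<dots> = defect_bound T (1 / Im z) / N" using N by simp
  finally have "(\<integral>Q. f Q \<partial>H) / \<delta> \<le> defect_bound T (1 / Im z) / N / \<delta>" using \<delta> by (intro divide_right_mono) auto
  moreover have "measure H {Q \<in> space H. f Q \<ge> \<delta>} \<le> (\<integral>Q. f Q \<partial>H) / \<delta>"
    by (rule integral_Markov_inequality_measure[OF int sets.empty_sets _ \<delta>]) (simp add: f_def avg_defect_nonneg)
  ultimately show ?thesis unfolding f_def by simp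
qed

section \<open>Approximate subordination\<close>

lemma avg_norm_le:
  fixes f :: "nat \<Rightarrow> complex"
  assumes N: "N > 0" and "(\<Sum>j<N. (cmod (f j))\<^sup>2) / real N \<le> \<delta>\<^sup>2" and d: "\<delta> > 0"
  shows "(\<Sum>j<N. cmod (f j)) / real N \<le> \<delta>"
proof -
  have "cmod (f j) \<le> ((cmod (f j))\<^sup>2 / \<delta> + \<delta>) / 2" for j
  proof -
    have "0 \<le> (cmod (f j) - \<delta>)\<^sup>2" by simp
    hence "2 * (cmod (f j) * \<delta>) \<le> (cmod (f j))\<^sup>2 + \<delta>\<^sup>2" by (simp add: power2_eq_square algebra_simps)
    thus ?thesis using d by (simp add: field_simps power2_eq_square)
  qed
  hence "(\<Sum>j<N. cmod (f j)) \<le> (\<Sum>j<N. ((cmod (f j))\<^sup>2 / \<delta> + \<delta>) / 2)" by (intro sum_mono) auto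
  also have "\<dots> = ((\<Sum>j<N. (cmod (f j))\<^sup>2) / \<delta> + real N * \<delta>) / 2"
    by (simp add: sum.distrib sum_divide_distrib[symmetric])
  finally have "(\<Sum>j<N. cmod (f j)) / real N \<le> ((\<Sum>j<N. (cmod (f j))\<^sup>2) / \<delta> + real N * \<delta>) / 2 / real N"
    by (rule divide_right_mono) simp
  also have "\<dots> = ((\<Sum>j<N. (cmod (f j))\<^sup>2) / real N / \<delta> + \<delta>) / 2" using N by (simp add: field_simps)
  also have "\<dots> \<le> (\<delta>\<^sup>2 / \<delta> + \<delta>) / 2"
    by (intro divide_right_mono add_right_mono assms) (use d in auto)
  also have "\<dots> = \<delta>" using d by (simp add: power2_eq_square)
  finally show ?thesis .
qed

lemma norm_avg_le:
  fixes f :: "nat \<Rightarrow> complex"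
  shows "cmod ((\<Sum>j<N. f j) / of_nat N) \<le> (\<Sum>j<N. cmod (f j)) / real N"
  by (simp add: norm_divide divide_right_mono norm_sum)

lemma norm_avg_square_le:
  fixes f :: "nat \<Rightarrow> complex"
  assumes N: "N > 0"
  shows "(cmod ((\<Sum>j<N. f j) / of_nat N))\<^sup>2 \<le> (\<Sum>j<N. (cmod (f j))\<^sup>2) / real N"
proof -
  define s where "s = (\<Sum>j<N. (cmod (f j))\<^sup>2) / real N"
  have s: "s \<ge> 0" by (simp add: s_def sum_nonneg)
  have "cmod ((\<Sum>j<N. f j) / of_nat N) \<le> sqrt s"
  proof (rule field_le_epsilon)
    fix e :: real assume e: "e > 0"
    have "s \<le> (sqrt s + e)\<^sup>2" using s e by (simp add: power2_sum)
    hence "(\<Sum>j<N. cmod (f j)) / real N \<le> sqrt s + e"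
      unfolding s_def by (intro avg_norm_le[OF N]) (use e s in \<open>auto simp: s_def intro: add_nonneg_pos\<close>)
    thus "cmod ((\<Sum>j<N. f j) / of_nat N) \<le> sqrt s + e" using norm_avg_le[of f N] by linarith
  qed
  hence "(cmod ((\<Sum>j<N. f j) / of_nat N))\<^sup>2 \<le> (sqrt s)\<^sup>2" by (intro power_mono) auto
  thus ?thesis using s by (simp add: s_def)
qed

text \<open>The diagonal entries \<open>\<Gamma> j\<close> nearly satisfy \<open>\<Gamma> j = 1 / (a j - \<omega>)\<close> with the random point \<open>\<omega> = (t - 1) / g\<close>.\<close>

lemma subordination_point:
  fixes \<Gamma> :: "nat \<Rightarrow> complex" and a :: "nat \<Rightarrow> real"
  assumes N: "N > 0" and \<eta>: "\<eta> > 0"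
  defines "g \<equiv> (\<Sum>j<N. \<Gamma> j) / of_nat N"
  defines "t \<equiv> (\<Sum>j<N. of_real (a j) * \<Gamma> j) / of_nat N"
  defines "Y \<equiv> \<lambda>j. g - \<Gamma> j - of_real (a j) * g * \<Gamma> j + t * \<Gamma> j"
  assumes Y: "(\<Sum>j<N. (cmod (Y j))\<^sup>2) / real N \<le> \<delta>\<^sup>2" and \<delta>: "0 < \<delta>" "16 * \<eta> * \<delta> \<le> 1"
    and \<Gamma>: "\<And>j. j < N \<Longrightarrow> cmod (\<Gamma> j) \<le> 1 / \<eta>"
    and Img: "\<eta> * ((\<Sum>j<N. (cmod (\<Gamma> j))\<^sup>2) / real N) \<le> Im g"
    and g: "1 / (2 * \<eta>) \<le> cmod g"
  shows "\<eta> / 2 \<le> Im ((t - 1) / g)"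
    and "cmod ((\<Sum>j<N. 1 / (of_real (a j) - (t - 1) / g)) / of_nat N - g) \<le> 4 * \<delta>"
proof -
  define \<omega> where "\<omega> = (t - 1) / g"
  have "0 < 1 / (2 * \<eta>)" using \<eta> by simp
  hence g0: "g \<noteq> 0" using g by auto
  have Yavg: "(\<Sum>j<N. cmod (Y j)) / real N \<le> \<delta>" by (rule avg_norm_le[OF N Y \<delta>(1)])
  \<comment> \<open>The defect equation in multiplicative form: without \<open>Y j\<close> it would
    say that \<open>\<Gamma> j\<close> is the reciprocal of \<open>a j - \<omega>\<close>.\<close>
  have rel: "\<Gamma> j * g * (of_real (a j) - \<omega>) = g - Y j" for j
    using g0 by (simp add: \<omega>_def Y_def field_simps)
  define P where "P = (\<Sum>j<N. (cmod (\<Gamma> j))\<^sup>2) / real N"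
  define A2 where "A2 = (\<Sum>j<N. a j * (cmod (\<Gamma> j))\<^sup>2) / real N"
  define E where "E = (\<Sum>j<N. Y j * cnj (\<Gamma> j)) / of_nat N"
  have "(cmod g)\<^sup>2 \<le> P" unfolding P_def g_def by (rule norm_avg_square_le[OF N])
  moreover have "(1 / (2 * \<eta>))\<^sup>2 \<le> (cmod g)\<^sup>2" using g \<eta> by (intro power_mono) auto
  ultimately have P: "1 / (4 * \<eta>\<^sup>2) \<le> P" by (simp add: power_divide power2_eq_square)
  have "0 < 1 / (4 * \<eta>\<^sup>2)" using \<eta> by simp
  hence P0: "P > 0" using P by linarith
  have "cmod E \<le> (\<Sum>j<N. cmod (Y j * cnj (\<Gamma> j))) / real N" unfolding E_def by (rule norm_avg_le)
  also have "\<dots> \<le> (\<Sum>j<N. cmod (Y j) * (1 / \<eta>)) / real N"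
  proof (rule divide_right_mono[OF sum_mono])
    fix j assume "j \<in> {..<N}"
    thus "cmod (Y j * cnj (\<Gamma> j)) \<le> cmod (Y j) * (1 / \<eta>)"
      unfolding norm_mult complex_mod_cnj by (intro mult_left_mono \<Gamma>) auto
  qed simp
  also have "\<dots> = (\<Sum>j<N. cmod (Y j)) / real N * (1 / \<eta>)"
    unfolding sum_distrib_right[symmetric] by (rule times_divide_eq_left[symmetric])
  also have "\<dots> \<le> \<delta> * (1 / \<eta>)" using Yavg \<eta> by (intro mult_right_mono) auto
  finally have E: "cmod E \<le> \<delta> / \<eta>" by simp
  \<comment> \<open>Testing \<open>rel\<close> against the conjugate of \<open>\<Gamma> j\<close>
    and averaging brings in the real numbers \<open>A2\<close> and \<open>P\<close>. After division
    by \<open>g\<close> the imaginary part loses \<open>A2\<close> and gives Im \<omega> P = Im g +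
    Im (E / g).\<close>
  have "g * (of_real A2 - \<omega> * of_real P) = (\<Sum>j<N. (\<Gamma> j * g * (of_real (a j) - \<omega>)) * cnj (\<Gamma> j)) / of_nat N"
    unfolding A2_def P_def of_real_divide of_real_sum of_real_mult complex_norm_square of_real_of_nat_eq
    by (simp add: sum_divide_distrib sum_distrib_left sum_subtractf[symmetric] right_diff_distrib left_diff_distrib diff_divide_distrib mult_ac)
  also have "\<dots> = g * cnj g - E"
    unfolding rel E_def by (simp add: g_def sum_distrib_left sum_subtractf left_diff_distrib diff_divide_distrib)
  finally have "of_real A2 - \<omega> * of_real P = cnj g - E / g" using g0 by (simp add: field_simps)
  hence "Im (of_real A2 - \<omega> * of_real P) = Im (cnj g - E / g)" by (rule arg_cong)
  hence "Im \<omega> * P = Im g + Im (E / g)" by simp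
  moreover have "\<bar>Im (E / g)\<bar> \<le> \<delta> / \<eta> * (2 * \<eta>)"
  proof -
    have "cmod (E / g) = cmod E * (1 / cmod g)" by (simp add: norm_divide)
    also have "\<dots> \<le> \<delta> / \<eta> * (2 * \<eta>)"
    proof (rule mult_mono[OF E])
      show "1 / cmod g \<le> 2 * \<eta>" using g \<eta> g0 by (simp add: field_simps)
    qed (use \<delta> \<eta> in auto)
    finally show ?thesis using abs_Im_le_cmod[of "E / g"] by linarith
  qed
  ultimately have 1: "Im \<omega> * P \<ge> \<eta> * P - 2 * \<delta>" using Img \<eta> by (simp add: P_def)
  \<comment> \<open>The error may consume half of \<eta> P; since P >= 1 / (4 \<eta>^2), the
    assumption 16 \<eta> \<delta> <= 1 is exactly what this needs.\<close>
  have "2 * \<delta> \<le> \<eta> / 2 * P"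
  proof -
    have "2 * \<delta> \<le> 1 / (8 * \<eta>)" using \<delta>(2) \<eta> by (simp add: field_simps)
    also have "\<dots> = \<eta> / 2 * (1 / (4 * \<eta>\<^sup>2))" using \<eta> by (simp add: field_simps power2_eq_square)
    also have "\<dots> \<le> \<eta> / 2 * P" using P \<eta> by (intro mult_left_mono) auto
    finally show ?thesis .
  qed
  with 1 have "Im \<omega> * P \<ge> \<eta> / 2 * P" by (simp add: algebra_simps)
  hence Im: "\<eta> / 2 \<le> Im \<omega>" using P0 by simp
  thus "\<eta> / 2 \<le> Im ((t - 1) / g)" by (simp add: \<omega>_def)
  have a\<omega>: "\<eta> / 2 \<le> cmod (of_real (a j) - \<omega>)" for j
    using abs_Im_le_cmod[of "of_real (a j) - \<omega>"] Im by simp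
  hence a0: "of_real (a j) - \<omega> \<noteq> 0" for j using \<eta> by (metis half_gt_zero norm_zero not_le)
  have "(\<Sum>j<N. 1 / (of_real (a j) - \<omega>)) / of_nat N - g = (\<Sum>j<N. Y j / (g * (of_real (a j) - \<omega>))) / of_nat N"
  proof -
    have "1 / (of_real (a j) - \<omega>) - \<Gamma> j = Y j / (g * (of_real (a j) - \<omega>))" for j
    proof -
      have "Y j = g - \<Gamma> j * (g * (of_real (a j) - \<omega>))" using rel[of j] by (simp add: mult.assoc)
      thus ?thesis using a0[of j] g0 by (simp add: diff_divide_distrib)
    qed
    thus ?thesis by (simp add: g_def sum_subtractf[symmetric] diff_divide_distrib[symmetric])
  qed
  also have "cmod \<dots> \<le> (\<Sum>j<N. cmod (Y j / (g * (of_real (a j) - \<omega>)))) / real N" by (rule norm_avg_le)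
  also have "\<dots> \<le> (\<Sum>j<N. cmod (Y j) * 4) / real N"
  proof (intro divide_right_mono sum_mono)
    fix j
    have "1 / (2 * \<eta>) * (\<eta> / 2) \<le> cmod g * cmod (of_real (a j) - \<omega>)"
      by (intro mult_mono g a\<omega>) (use \<eta> in auto)
    hence 4: "1 / 4 \<le> cmod (g * (of_real (a j) - \<omega>))" using \<eta> by (simp add: norm_mult)
    have "cmod (Y j) * 1 \<le> cmod (Y j) * (4 * cmod (g * (of_real (a j) - \<omega>)))"
      by (rule mult_left_mono) (use 4 in auto)
    thus "cmod (Y j / (g * (of_real (a j) - \<omega>))) \<le> cmod (Y j) * 4"
      using 4 by (simp add: norm_divide divide_le_eq mult.assoc)
  qed simp
  also have "\<dots> = (\<Sum>j<N. cmod (Y j)) / real N * 4" by (simp add: sum_distrib_right[symmetric])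
  also have "\<dots> \<le> 4 * \<delta>"
    using mult_right_mono[OF Yavg, of 4] unfolding mult.commute[of \<delta> 4] by simp
  finally show "cmod ((\<Sum>j<N. 1 / (of_real (a j) - (t - 1) / g)) / of_nat N - g) \<le> 4 * \<delta>"
    by (simp add: \<omega>_def)
qed

section \<open>Elementary bounds for Stieltjes transforms\<close>

lemma of_real_minus_nonzero: "Im z \<noteq> 0 \<Longrightarrow> complex_of_real x - z \<noteq> 0"
  by (auto simp: complex_eq_iff)

lemma norm_of_real_minus_ge: "\<bar>Im z\<bar> \<le> cmod (complex_of_real x - z)"
  using abs_Im_le_cmod[of "complex_of_real x - z"] by simp

lemma norm_resolvent_le: "0 < \<eta> \<Longrightarrow> \<eta> \<le> Im z \<Longrightarrow> cmod (1 / (complex_of_real x - z)) \<le> 1 / \<eta>"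
  using norm_of_real_minus_ge[of z x] by (simp add: norm_divide frac_le)

context real_distribution
begin

lemma integrable_bounded_complex:
  fixes f :: "real \<Rightarrow> complex"
  assumes "f \<in> borel_measurable borel" "\<And>x. cmod (f x) \<le> B"
  shows "integrable M f"
  by (rule integrable_const_bound[of _ B]) (use assms in auto)

lemma integrable_resolvent: "0 < Im z \<Longrightarrow> integrable M (\<lambda>x. 1 / (complex_of_real x - z))"
  by (rule integrable_bounded_complex[OF _ norm_resolvent_le[of "Im z"]]) auto

lemma norm_integral_le:
  fixes f :: "real \<Rightarrow> complex"
  assumes "\<And>x. cmod (f x) \<le> B" "f \<in> borel_measurable borel"
  shows "cmod (\<integral>x. f x \<partial>M) \<le> B"
proof -
  have "cmod (\<integral>x. f x \<partial>M) \<le> (\<integral>x. cmod (f x) \<partial>M)" by (rule integral_norm_bound)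
  also have "\<dots> \<le> (\<integral>x. B \<partial>M)"
    by (rule integral_mono) (use integrable_bounded_complex[OF assms(2,1)] assms(1) in auto)
  finally show ?thesis using prob_space by simp
qed

lemma stieltjes_diff:
  assumes "0 < Im z" "0 < Im w"
  shows "stieltjes M z - stieltjes M w = (z - w) * (\<integral>x. 1 / ((complex_of_real x - z) * (complex_of_real x - w)) \<partial>M)"
proof -
  have "stieltjes M z - stieltjes M w = (\<integral>x. 1 / (complex_of_real x - z) - 1 / (complex_of_real x - w) \<partial>M)"
    unfolding stieltjes_def by (rule Bochner_Integration.integral_diff[symmetric]) (use assms integrable_resolvent in auto)
  also have "\<dots> = (\<integral>x. (z - w) * (1 / ((complex_of_real x - z) * (complex_of_real x - w))) \<partial>M)"
    by (intro Bochner_Integration.integral_cong refl)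
      (use of_real_minus_nonzero[of z] of_real_minus_nonzero[of w] assms in \<open>simp add: field_simps\<close>)
  also have "\<dots> = (z - w) * (\<integral>x. 1 / ((complex_of_real x - z) * (complex_of_real x - w)) \<partial>M)"
    by (rule integral_mult_right_zero)
  finally show ?thesis .
qed

lemma stieltjes_lipschitz:
  assumes "0 < \<eta>" "\<eta> \<le> Im z" "\<eta> \<le> Im w"
  shows "cmod (stieltjes M z - stieltjes M w) \<le> cmod (z - w) / \<eta>\<^sup>2"
proof -
  have "cmod (1 / ((complex_of_real x - z) * (complex_of_real x - w))) \<le> 1 / \<eta> * (1 / \<eta>)" for x
    using mult_mono'[OF norm_resolvent_le[OF assms(1,2), of x] norm_resolvent_le[OF assms(1,3), of x]]
    by (simp add: norm_mult norm_divide)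
  hence "cmod (\<integral>x. 1 / ((complex_of_real x - z) * (complex_of_real x - w)) \<partial>M) \<le> 1 / \<eta> * (1 / \<eta>)"
    by (rule norm_integral_le) auto
  from mult_left_mono[OF this norm_ge_zero[of "z - w"]] show ?thesis
    using assms by (simp add: stieltjes_diff norm_mult power2_eq_square)
qed

end

section \<open>Stability of the subordination equations high up in the half plane\<close>

text \<open>The distance of \<open>w\<close> to the real line is at least y / 2 and |w| is at most 2
  y. The constant 5 serves in the tail, the bound 2 |x| / y in the bulk.\<close>

lemma norm_u_le:
  assumes y: "y > 0" and w: "y / 2 \<le> Im w" "cmod w \<le> 2 * y"
  shows "cmod (w / (complex_of_real x - w)) \<le> 4" "cmod (of_real x / (complex_of_real x - w)) \<le> 5"
    "cmod (of_real x / (complex_of_real x - w)) \<le> 2 * \<bar>x\<bar> / y"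
proof -
  have d: "y / 2 \<le> cmod (complex_of_real x - w)" using norm_of_real_minus_ge[of w x] w(1) by linarith
  hence d0: "complex_of_real x - w \<noteq> 0" using y by auto
  have "cmod w \<le> 4 * cmod (complex_of_real x - w)" using w(2) d by linarith
  thus 4: "cmod (w / (complex_of_real x - w)) \<le> 4" using d0 by (simp add: norm_divide divide_le_eq)
  have "of_real x / (complex_of_real x - w) = 1 + w / (complex_of_real x - w)" using d0 by (simp add: field_simps)
  thus "cmod (of_real x / (complex_of_real x - w)) \<le> 5" using norm_triangle_mono[of "1::complex" 1 "w / (complex_of_real x - w)" 4] 4 by simp
  have "\<bar>x\<bar> / cmod (complex_of_real x - w) \<le> \<bar>x\<bar> / (y / 2)" by (rule divide_left_mono[OF d]) (use d y d0 in auto)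
  thus "cmod (of_real x / (complex_of_real x - w)) \<le> 2 * \<bar>x\<bar> / y" by (simp add: norm_divide mult.commute)
qed

context real_distribution
begin

text \<open>Integrates x / (x - w) = 1 + w / (x - w). The left side compares the transform with
  -1/w, that of a point mass at 0; the integrand is small unless |x| is comparable with the height
  of \<open>w\<close>.\<close>

lemma w_stieltjes:
  assumes w: "0 < Im w"
  shows "1 + w * stieltjes M w = (\<integral>x. of_real x / (complex_of_real x - w) \<partial>M)"
proof -
  have "1 + w * stieltjes M w = (\<integral>x. 1 \<partial>M) + (\<integral>x. w * (1 / (complex_of_real x - w)) \<partial>M)"
    using prob_space unfolding stieltjes_def integral_mult_right_zero by simp
  also have "\<dots> = (\<integral>x. 1 + w * (1 / (complex_of_real x - w)) \<partial>M)"
    by (rule Bochner_Integration.integral_add[symmetric]) (use integrable_mult_right[OF integrable_resolvent[OF w], of w] in auto)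
  also have "\<dots> = (\<integral>x. of_real x / (complex_of_real x - w) \<partial>M)"
    by (intro Bochner_Integration.integral_cong refl) (use of_real_minus_nonzero[of w] w in \<open>simp add: field_simps\<close>)
  finally show ?thesis .
qed

lemma integral_x_le:
  assumes y: "y > 0" and w: "y / 2 \<le> Im w" "cmod w \<le> 2 * y" and T: "0 \<le> T"
  shows "(\<integral>x. cmod (of_real x / (complex_of_real x - w)) \<partial>M) \<le> 5 * prob {x. \<bar>x\<bar> > T} + 2 * T / y"
proof -
  have "(\<integral>x. cmod (of_real x / (complex_of_real x - w)) \<partial>M) \<le> (\<integral>x. 2 * T / y + 5 * indicator {x. \<bar>x\<bar> > T} x \<partial>M)"
  proof (rule integral_mono)
    show "integrable M (\<lambda>x. cmod (complex_of_real x / (complex_of_real x - w)))"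
      by (rule integrable_norm, rule integrable_bounded_complex[of _ 5]) (use norm_u_le(2)[OF y w] in auto)
    show "integrable M (\<lambda>x. 2 * T / y + 5 * indicator {x. T < \<bar>x\<bar>} x :: real)"
      by (rule integrable_const_bound[of _ "2 * T / y + 5"]) (use T y in \<open>auto simp: indicator_def\<close>)
    fix x
    show "cmod (complex_of_real x / (complex_of_real x - w)) \<le> 2 * T / y + 5 * indicator {x. T < \<bar>x\<bar>} x"
    proof (cases "\<bar>x\<bar> > T")
      case True
      have "0 \<le> 2 * T / y" using T y by simp
      thus ?thesis using norm_u_le(2)[OF y w, of x] True by simp
    next
      case False
      have "2 * \<bar>x\<bar> / y \<le> 2 * T / y" using False y by (intro divide_right_mono) auto
      thus ?thesis using norm_u_le(3)[OF y w, of x] False by simp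
    qed
  qed
  also have "\<dots> = 5 * prob {x. T < \<bar>x\<bar>} + 2 * T / y"
  proof -
    have "integrable M (indicator {x. T < \<bar>x\<bar>} :: real \<Rightarrow> real)"
      by (rule integrable_const_bound[of _ 1]) (auto simp: indicator_def)
    thus ?thesis using prob_space by (subst Bochner_Integration.integral_add) auto
  qed
  finally show ?thesis .
qed

lemma norm_one_plus_w_stieltjes:
  assumes y: "y > 0" and w: "y / 2 \<le> Im w" "cmod w \<le> 2 * y" and T: "0 \<le> T"
  shows "cmod (1 + w * stieltjes M w) \<le> 5 * prob {x. \<bar>x\<bar> > T} + 2 * T / y"
proof -
  have "0 < Im w" using y w by linarith
  from w_stieltjes[OF this] show ?thesis
    by (metis order_trans[OF integral_norm_bound integral_x_le[OF y w T]])
qed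

end

text \<open>The constants make the two parts of \<open>integral_x_le\<close> equal: 5 times 1/400
  for the tail and 2 L / y <= 1/80 for the bulk, together 1/40, which leaves ample room in
  \<open>F_contraction\<close>.\<close>

locale light_tail = real_distribution +
  fixes y L :: real
  assumes tail: "prob {x. \<bar>x\<bar> > L} \<le> 1 / 400" and L: "0 < L" "160 * L \<le> y"
begin

lemma y_pos: "y > 0" using L by linarith

definition "region w \<longleftrightarrow> y / 2 \<le> Im w \<and> cmod w \<le> 2 * y"

lemma region_Im: "region w \<Longrightarrow> 0 < Im w" using y_pos by (simp add: region_def)

lemma integral_x_le_region:
  assumes w: "region w"
  shows "(\<integral>x. cmod (of_real x / (complex_of_real x - w)) \<partial>M) \<le> 1 / 40"
proof -
  have "2 * L / y \<le> 1 / 80" using L y_pos by (simp add: field_simps)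
  moreover have "(\<integral>x. cmod (of_real x / (complex_of_real x - w)) \<partial>M) \<le> 5 * prob {x. \<bar>x\<bar> > L} + 2 * L / y"
    by (rule integral_x_le[OF y_pos]) (use w L in \<open>auto simp: region_def\<close>)
  ultimately show ?thesis using tail by linarith
qed

lemma norm_one_plus_w_stieltjes_region:
  assumes w: "region w"
  shows "cmod (1 + w * stieltjes M w) \<le> 1 / 40"
  unfolding w_stieltjes[OF region_Im[OF w]]
  by (rule order_trans[OF integral_norm_bound integral_x_le_region[OF w]])

lemma stieltjes_ge:
  assumes w: "region w"
  shows "1 / (4 * y) \<le> cmod (stieltjes M w)"
proof -
  have "cmod (1 + w * stieltjes M w - w * stieltjes M w) \<le> 1 / 40 + cmod w * cmod (stieltjes M w)"
    by (rule order_trans[OF norm_triangle_ineq4 add_mono]) (use norm_one_plus_w_stieltjes_region[OF w] in \<open>auto simp: norm_mult\<close>)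
  hence "1 \<le> 1 / 40 + cmod w * cmod (stieltjes M w)" by simp
  also have "\<dots> \<le> 1 / 40 + 2 * y * cmod (stieltjes M w)"
    using w by (intro add_left_mono mult_right_mono) (auto simp: region_def)
  finally show ?thesis using y_pos by (simp add: field_simps)
qed

text \<open>The reciprocal transform -1/m differs from the identity by a map with Lipschitz constant
  1/2. With p = w m(w), and \<open>p'\<close> likewise, the difference quotient minus 1 is (w w' I -
  p p') / (p p'), and both w w' I and p p' are close to 1.\<close>

lemma F_contraction:
  assumes w: "region w" and w': "region w'"
  shows "cmod ((- 1 / stieltjes M w) - (- 1 / stieltjes M w') - (w - w')) \<le> cmod (w - w') / 2"
proof -
  note Im = region_Im[OF w] region_Im[OF w']
  have nz: "complex_of_real x - w \<noteq> 0" "complex_of_real x - w' \<noteq> 0" for x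
    using of_real_minus_nonzero Im by auto
  define m where "m = stieltjes M w"
  define m' where "m' = stieltjes M w'"
  define I where "I = (\<integral>x. 1 / ((complex_of_real x - w) * (complex_of_real x - w')) \<partial>M)"
  define e where "e x = of_real x / (complex_of_real x - w)" for x
  define e' where "e' x = of_real x / (complex_of_real x - w')" for x
  have eb: "cmod (e x) \<le> 5" "cmod (e' x) \<le> 5" "cmod (w' / (complex_of_real x - w')) \<le> 4" for x
    using norm_u_le[OF y_pos] w w' by (auto simp: e_def e'_def region_def)
  have ie: "integrable M e" "integrable M e'"
    by (rule integrable_bounded_complex[OF _ eb(1)] integrable_bounded_complex[OF _ eb(2)], simp add: e_def e'_def)+
  have ie3: "integrable M (\<lambda>x. e x * (w' / (complex_of_real x - w')))"
  proof (rule integrable_bounded_complex)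
    show "(\<lambda>x. e x * (w' / (complex_of_real x - w'))) \<in> borel_measurable borel" by (simp add: e_def)
    show "cmod (e x * (w' / (complex_of_real x - w'))) \<le> 5 * 4" for x
      unfolding norm_mult by (rule mult_mono'[OF eb(1,3)]) auto
  qed
  have "w * w' * I = (\<integral>x. w * w' * (1 / ((complex_of_real x - w) * (complex_of_real x - w'))) \<partial>M)"
    unfolding I_def by (rule integral_mult_right_zero[symmetric])
  \<comment> \<open>The product of w / (x - w) and w' / (x - w') is rearranged so that every
    deviation from 1 carries a factor \<open>e\<close> or \<open>e'\<close>, whose integrals are at
    most 1/40.\<close>
  also have "\<dots> = (\<integral>x. 1 - e' x + e x * (w' / (complex_of_real x - w')) \<partial>M)"
  proof (intro Bochner_Integration.integral_cong refl)
    fix x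
    have "e x = 1 + w / (complex_of_real x - w)" "e' x = 1 + w' / (complex_of_real x - w')"
      using nz[of x] by (simp_all add: e_def e'_def field_simps)
    moreover have "p * q = 1 - (1 + q) + (1 + p) * q" for p q :: complex by (simp add: algebra_simps)
    ultimately show "w * w' * (1 / ((complex_of_real x - w) * (complex_of_real x - w'))) = 1 - e' x + e x * (w' / (complex_of_real x - w'))"
      by (metis times_divide_times_eq times_divide_eq_right mult.right_neutral)
  qed
  also have "\<dots> = 1 - (\<integral>x. e' x \<partial>M) + (\<integral>x. e x * (w' / (complex_of_real x - w')) \<partial>M)"
    using ie ie3 prob_space by simp
  finally have S: "w * w' * I - 1 = (\<integral>x. e x * (w' / (complex_of_real x - w')) \<partial>M) - (\<integral>x. e' x \<partial>M)" by simp
  have "cmod (\<integral>x. e x * (w' / (complex_of_real x - w')) \<partial>M) \<le> (\<integral>x. cmod (e x * (w' / (complex_of_real x - w'))) \<partial>M)"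
    by (rule integral_norm_bound)
  also have "\<dots> \<le> (\<integral>x. cmod (e x) * 4 \<partial>M)"
  proof (rule integral_mono)
    show "integrable M (\<lambda>x. cmod (e x * (w' / (complex_of_real x - w'))))" by (rule integrable_norm[OF ie3])
    show "integrable M (\<lambda>x. cmod (e x) * 4)" using integrable_norm[OF ie(1)] by simp
    show "cmod (e x * (w' / (complex_of_real x - w'))) \<le> cmod (e x) * 4" for x
      unfolding norm_mult by (rule mult_left_mono[OF eb(3)]) auto
  qed
  also have "\<dots> \<le> 1 / 40 * 4" using integral_x_le_region[OF w] by (simp add: e_def)
  finally have "cmod (\<integral>x. e x * (w' / (complex_of_real x - w')) \<partial>M) \<le> 1 / 10" by simp
  moreover have "cmod (\<integral>x. e' x \<partial>M) \<le> 1 / 40"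
    unfolding e'_def by (rule order_trans[OF integral_norm_bound integral_x_le_region[OF w']])
  ultimately have S8: "cmod (w * w' * I - 1) \<le> 1 / 8"
    unfolding S using norm_triangle_ineq4[of "\<integral>x. e x * (w' / (complex_of_real x - w')) \<partial>M" "\<integral>x. e' x \<partial>M"] by linarith
  define p where "p = w * m"
  define p' where "p' = w' * m'"
  have p: "cmod (1 + p) \<le> 1 / 40" "cmod (1 + p') \<le> 1 / 40"
    using norm_one_plus_w_stieltjes_region[OF w] norm_one_plus_w_stieltjes_region[OF w'] by (simp_all add: p_def p'_def m_def m'_def)
  have "cmod (1 + p - 1) \<le> 1 / 40 + 1" "cmod (1 + p' - 1) \<le> 1 / 40 + 1"
    by (rule order_trans[OF norm_triangle_ineq4 add_mono]; use p in simp)+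
  hence p2: "cmod p \<le> 41 / 40" "cmod p' \<le> 41 / 40" by simp_all
  have "cmod ((1 + p) - p) \<le> 1 / 40 + cmod p" "cmod ((1 + p') - p') \<le> 1 / 40 + cmod p'"
    by (rule order_trans[OF norm_triangle_ineq4 add_mono]; use p in simp)+
  hence p3: "39 / 40 \<le> cmod p" "39 / 40 \<le> cmod p'" by simp_all
  have pp: "39 / 40 * (39 / 40) \<le> cmod (p * p')" unfolding norm_mult by (intro mult_mono p3) auto
  hence pp0: "p * p' \<noteq> 0" by auto
  have "p * p' - 1 = (1 + p) * p' - (1 + p')" by (simp add: algebra_simps)
  also have "cmod \<dots> \<le> 1 / 40 * (41 / 40) + 1 / 40"
    by (rule order_trans[OF norm_triangle_ineq4 add_mono]) (use p p2 in \<open>auto simp only: norm_mult intro!: mult_mono' norm_ge_zero\<close>)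
  finally have pp1: "cmod (p * p' - 1) \<le> 1 / 40 * (41 / 40) + 1 / 40" .
  \<comment> \<open>The right side is below 0.18, whereas |p p'| is above 0.95.\<close>
  have "cmod (w * w' * I - p * p') \<le> 1 / 8 + (1 / 40 * (41 / 40) + 1 / 40)"
    using norm_triangle_ineq4[of "w * w' * I - 1" "p * p' - 1"] S8 pp1 by simp
  hence "cmod (w * w' * I - p * p') \<le> cmod (p * p') / 2" using pp by linarith
  hence q: "cmod ((w * w' * I - p * p') / (p * p')) \<le> 1 / 2"
    using pp0 by (simp only: norm_divide) (simp add: divide_le_eq)
  have nzs: "m \<noteq> 0" "m' \<noteq> 0" "w \<noteq> 0" "w' \<noteq> 0" using pp0 by (auto simp: p_def p'_def)
  have "(- 1 / m) - (- 1 / m') - (w - w') = (m - m') / (m * m') - (w - w')" using nzs by (simp add: field_simps)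
  also have "m - m' = (w - w') * I" unfolding m_def m'_def I_def by (rule stieltjes_diff[OF Im])
  also have "(w - w') * I / (m * m') - (w - w') = (w - w') * ((w * w' * I - p * p') / (p * p'))"
    using nzs by (simp add: p_def p'_def field_simps)
  finally have "cmod ((- 1 / m) - (- 1 / m') - (w - w')) = cmod (w - w') * cmod ((w * w' * I - p * p') / (p * p'))"
    by (simp only: norm_mult)
  also have "\<dots> \<le> cmod (w - w') * (1 / 2)" by (rule mult_left_mono[OF q]) simp
  finally show ?thesis by (simp add: m_def m'_def)
qed

end

text \<open>Only the two transform equations carry an error; the relation for the sum is exact. The
  bounds confine the points to the region where \<open>F_contraction\<close> applies, and all
  conditions are closed, so that they survive limits.\<close>

definition approx_subord ::
  "real measure \<Rightarrow> real measure \<Rightarrow> real \<Rightarrow> real \<Rightarrow> complex \<Rightarrow> complex \<Rightarrow> complex \<Rightarrow> bool" where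
  "approx_subord \<mu> \<nu> y \<epsilon> g w1 w2 \<longleftrightarrow>
     cmod (stieltjes \<mu> w1 - g) \<le> \<epsilon> \<and> cmod (stieltjes \<nu> w2 - g) \<le> \<epsilon> \<and> w1 + w2 = \<i> * of_real y - 1 / g \<and>
     y / 2 \<le> Im w1 \<and> cmod w1 \<le> 2 * y \<and> y / 2 \<le> Im w2 \<and> cmod w2 \<le> 2 * y \<and> 1 / (2 * y) \<le> cmod g \<and> cmod g \<le> 1 / y"

lemma approx_subord_mono: "approx_subord \<mu> \<nu> y \<epsilon> g w1 w2 \<Longrightarrow> \<epsilon> \<le> \<epsilon>' \<Longrightarrow> approx_subord \<mu> \<nu> y \<epsilon>' g w1 w2"
  unfolding approx_subord_def by force

lemma approx_subord_commute: "approx_subord \<mu> \<nu> y \<epsilon> g w1 w2 \<Longrightarrow> approx_subord \<nu> \<mu> y \<epsilon> g w2 w1"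
  unfolding approx_subord_def by (simp add: add.commute)

text \<open>Up to errors, w2 = z + F(w1) - w1 with F = -1/m, and F minus the identity contracts by
  1/2. Replacing 1/g by the reciprocal transform costs 8 y^2 \<epsilon> for each solution, because
  |m| >= 1 / (4 y) and |g| >= 1 / (2 y).\<close>

lemma approx_subord_half:
  assumes \<mu>: "light_tail \<mu> y L" and s: "approx_subord \<mu> \<nu> y \<epsilon> g w1 w2" and s': "approx_subord \<mu> \<nu> y \<epsilon> g' w1' w2'"
  shows "cmod (w2 - w2') \<le> cmod (w1 - w1') / 2 + 16 * y\<^sup>2 * \<epsilon>"
proof -
  interpret M: light_tail \<mu> y L by fact
  have y: "y > 0" by (rule M.y_pos)
  have reg: "M.region w1" "M.region w1'" using s s' by (auto simp: approx_subord_def M.region_def)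
  have err: "cmod (1 / stieltjes \<mu> w - 1 / h) \<le> 8 * y\<^sup>2 * \<epsilon>"
    if w: "M.region w" and h: "cmod (stieltjes \<mu> w - h) \<le> \<epsilon>" "1 / (2 * y) \<le> cmod h" for w h
  proof -
    define m where "m = stieltjes \<mu> w"
    have "0 < 1 / (4 * y)" "0 < 1 / (2 * y)" using y by auto
    hence nz: "m \<noteq> 0" "h \<noteq> 0" using M.stieltjes_ge[OF w] h(2) by (auto simp: m_def)
    have "1 / (4 * y) * (1 / (2 * y)) \<le> cmod m * cmod h"
      by (intro mult_mono h(2) M.stieltjes_ge[OF w, folded m_def]) (use y in auto)
    hence "1 / (cmod m * cmod h) \<le> 8 * y\<^sup>2" using nz y by (simp add: field_simps power2_eq_square)
    have "1 / m - 1 / h = - (m - h) * (1 / (m * h))" using nz by (simp add: field_simps)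
    hence "cmod (1 / m - 1 / h) = cmod (m - h) * (1 / (cmod m * cmod h))" by (simp add: norm_mult norm_divide norm_minus_commute)
    also have "\<dots> \<le> \<epsilon> * (8 * y\<^sup>2)"
      using h(1) \<open>1 / (cmod m * cmod h) \<le> 8 * y\<^sup>2\<close> by (intro mult_mono') (auto simp: m_def)
    finally show ?thesis by (simp add: m_def mult.commute)
  qed
  define e where "e = 1 / stieltjes \<mu> w1 - 1 / g"
  define e' where "e' = 1 / stieltjes \<mu> w1' - 1 / g'"
  have e: "cmod e \<le> 8 * y\<^sup>2 * \<epsilon>" "cmod e' \<le> 8 * y\<^sup>2 * \<epsilon>"
    unfolding e_def e'_def using s s' reg by (auto simp: approx_subord_def intro!: err)
  define c where "c = (- 1 / stieltjes \<mu> w1) - (- 1 / stieltjes \<mu> w1') - (w1 - w1')"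
  have c: "cmod c \<le> cmod (w1 - w1') / 2" unfolding c_def by (rule M.F_contraction[OF reg])
  have "w2 = \<i> * of_real y - 1 / g - w1" "w2' = \<i> * of_real y - 1 / g' - w1'"
    using s s' unfolding approx_subord_def by (metis add_diff_cancel_left')+
  hence "w2 - w2' = c + (e - e')" by (simp add: c_def e_def e'_def)
  hence "cmod (w2 - w2') \<le> cmod c + cmod (e - e')" by (simp only: norm_triangle_ineq)
  also have "cmod (e - e') \<le> cmod e + cmod e'" by (rule norm_triangle_ineq4)
  finally show ?thesis using c e by linarith
qed

text \<open>The half estimate is used in both directions: distances d1 and d2 satisfy d1 + d2 <= (d1
  + d2) / 2 + 32 y^2 \<epsilon>. The bound for \<open>g\<close> follows since 1/g is determined by
  the sum of the points and |g g'| <= 1 / y^2.\<close>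

lemma approx_subord_stable:
  assumes \<mu>: "light_tail \<mu> y L" and \<nu>: "light_tail \<nu> y L"
    and s: "approx_subord \<mu> \<nu> y \<epsilon> g w1 w2" and s': "approx_subord \<mu> \<nu> y \<epsilon> g' w1' w2'"
  shows "cmod (w1 - w1') + cmod (w2 - w2') \<le> 64 * y\<^sup>2 * \<epsilon>" and "cmod (g - g') \<le> 64 * \<epsilon>"
proof -
  have y: "y > 0" by (rule light_tail.y_pos[OF \<mu>])
  show w: "cmod (w1 - w1') + cmod (w2 - w2') \<le> 64 * y\<^sup>2 * \<epsilon>"
    using approx_subord_half[OF \<mu> s s'] approx_subord_half[OF \<nu> approx_subord_commute[OF s] approx_subord_commute[OF s']]
    by linarith
  have g: "1 / (2 * y) \<le> cmod g" "cmod g \<le> 1 / y" "1 / (2 * y) \<le> cmod g'" "cmod g' \<le> 1 / y"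
    using s s' by (auto simp: approx_subord_def)
  have "0 < 1 / (2 * y)" using y by simp
  hence nz: "g \<noteq> 0" "g' \<noteq> 0" using g by auto
  have "1 / g' - 1 / g = (w1 - w1') + (w2 - w2')"
  proof -
    have "w1 + w2 = \<i> * of_real y - 1 / g" "w1' + w2' = \<i> * of_real y - 1 / g'"
      using s s' by (auto simp: approx_subord_def)
    hence "(w1 + w2) - (w1' + w2') = 1 / g' - 1 / g" by simp
    thus ?thesis by (simp add: algebra_simps)
  qed
  hence "cmod (1 / g' - 1 / g) \<le> 64 * y\<^sup>2 * \<epsilon>" using w norm_triangle_ineq[of "w1 - w1'" "w2 - w2'"] by simp
  moreover have "g - g' = g * g' * (1 / g' - 1 / g)" using nz by (simp add: field_simps)
  hence "cmod (g - g') = cmod g * cmod g' * cmod (1 / g' - 1 / g)" by (metis norm_mult)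
  moreover have "cmod g * cmod g' \<le> 1 / y * (1 / y)" by (intro mult_mono g) (use y in auto)
  ultimately have "cmod (g - g') \<le> 1 / y * (1 / y) * (64 * y\<^sup>2 * \<epsilon>)" by (simp only:) (rule mult_mono', auto)
  thus "cmod (g - g') \<le> 64 * \<epsilon>" using y by (simp add: power2_eq_square)
qed

text \<open>Stability replaces a fixed point theorem: solutions with error 1 / (n + 1) form Cauchy
  sequences, and the transforms are Lipschitz in the region, so the limit solves the equations
  exactly.\<close>

theorem exact_subordination:
  assumes \<mu>: "light_tail \<mu> y L" and \<nu>: "light_tail \<nu> y L"
    and ex: "\<And>\<epsilon>. \<epsilon> > 0 \<Longrightarrow> \<exists>g w1 w2. approx_subord \<mu> \<nu> y \<epsilon> g w1 w2"
  obtains g w1 w2 where "approx_subord \<mu> \<nu> y 0 g w1 w2"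
proof -
  interpret M: light_tail \<mu> y L by fact
  interpret V: light_tail \<nu> y L by fact
  have y: "y > 0" by (rule M.y_pos)
  have "\<forall>n. \<exists>g w1 w2. approx_subord \<mu> \<nu> y (1 / real (Suc n)) g w1 w2" using ex by simp
  then obtain g w1 w2 where s: "\<And>n. approx_subord \<mu> \<nu> y (1 / real (Suc n)) (g n) (w1 n) (w2 n)" by metis
  have st: "cmod (w1 n - w1 m) \<le> 64 * y\<^sup>2 * (1 / real (Suc k))" "cmod (w2 n - w2 m) \<le> 64 * y\<^sup>2 * (1 / real (Suc k))"
    "cmod (g n - g m) \<le> 64 * (1 / real (Suc k))" if "n \<ge> k" "m \<ge> k" for n m k
  proof -
    have "1 / real (Suc n) \<le> 1 / real (Suc k)" "1 / real (Suc m) \<le> 1 / real (Suc k)"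
      using that by (auto simp: field_simps)
    note S = approx_subord_stable[OF \<mu> \<nu> approx_subord_mono[OF s this(1)] approx_subord_mono[OF s this(2)]]
    show "cmod (w1 n - w1 m) \<le> 64 * y\<^sup>2 * (1 / real (Suc k))" by (rule order_trans[OF _ S(1)]) simp
    show "cmod (w2 n - w2 m) \<le> 64 * y\<^sup>2 * (1 / real (Suc k))" by (rule order_trans[OF _ S(1)]) simp
    show "cmod (g n - g m) \<le> 64 * (1 / real (Suc k))" by (rule S(2))
  qed
  have conv: "convergent f" if f: "\<And>n m k. n \<ge> k \<Longrightarrow> m \<ge> k \<Longrightarrow> cmod (f n - f m) \<le> C * (1 / real (Suc k))" and C: "C > 0" for f :: "nat \<Rightarrow> complex" and C
  proof -
    have "Cauchy f"
    proof (rule metric_CauchyI)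
      fix e :: real assume e: "e > 0"
      obtain k where k: "C / e < real k" using reals_Archimedean2 by blast
      have "C < e * real k" using k e by (simp add: field_simps)
      also have "\<dots> \<le> e * real (Suc k)" using e by simp
      finally have "C * (1 / real (Suc k)) < e" by (simp add: field_simps)
      thus "\<exists>M. \<forall>m\<ge>M. \<forall>n\<ge>M. dist (f m) (f n) < e"
        using f by (intro exI[of _ k]) (auto simp: dist_norm intro: le_less_trans)
    qed
    thus ?thesis by (simp add: Cauchy_convergent_iff)
  qed
  obtain W1 W2 g' where W1: "w1 \<longlonglongrightarrow> W1" and W2: "w2 \<longlonglongrightarrow> W2" and g': "g \<longlonglongrightarrow> g'"
  proof -
    have "64 * y\<^sup>2 > 0" using y by simp
    have "convergent w1" by (rule conv[of w1, OF st(1) \<open>64 * y\<^sup>2 > 0\<close>])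
    moreover have "convergent w2" by (rule conv[of w2, OF st(2) \<open>64 * y\<^sup>2 > 0\<close>])
    moreover have "convergent g" by (rule conv[of g, OF st(3)]) simp_all
    ultimately show ?thesis using that unfolding convergent_def by blast
  qed
  have lim0: "(\<lambda>n. 1 / real (Suc n)) \<longlonglongrightarrow> 0" by (rule LIMSEQ_Suc[OF lim_1_over_n])
  have le: "1 / (2 * y) \<le> cmod g'" "cmod g' \<le> 1 / y"
    by (rule LIMSEQ_le_const[OF tendsto_norm[OF g']] LIMSEQ_le_const2[OF tendsto_norm[OF g']],
      use s in \<open>auto simp: approx_subord_def\<close>)+
  have "0 < 1 / (2 * y)" using y by simp
  hence nz: "g' \<noteq> 0" using le by auto
  have reg: "y / 2 \<le> Im W1" "cmod W1 \<le> 2 * y" "y / 2 \<le> Im W2" "cmod W2 \<le> 2 * y"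
  proof -
    have b: "y / 2 \<le> Im (w1 n)" "cmod (w1 n) \<le> 2 * y" "y / 2 \<le> Im (w2 n)" "cmod (w2 n) \<le> 2 * y" for n
      using s[of n] by (auto simp: approx_subord_def)
    show "y / 2 \<le> Im W1" by (rule LIMSEQ_le_const[OF tendsto_Im[OF W1]]) (use b(1) in blast)
    show "cmod W1 \<le> 2 * y" by (rule LIMSEQ_le_const2[OF tendsto_norm[OF W1]]) (use b(2) in blast)
    show "y / 2 \<le> Im W2" by (rule LIMSEQ_le_const[OF tendsto_Im[OF W2]]) (use b(3) in blast)
    show "cmod W2 \<le> 2 * y" by (rule LIMSEQ_le_const2[OF tendsto_norm[OF W2]]) (use b(4) in blast)
  qed
  have eq: "W1 + W2 = \<i> * of_real y - 1 / g'"
  proof (rule LIMSEQ_unique)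
    show "(\<lambda>n. w1 n + w2 n) \<longlonglongrightarrow> W1 + W2" by (intro tendsto_add W1 W2)
    have "(\<lambda>n. w1 n + w2 n) = (\<lambda>n. \<i> * of_real y - 1 / g n)" using s by (auto simp: approx_subord_def)
    moreover have "(\<lambda>n. \<i> * of_real y - 1 / g n) \<longlonglongrightarrow> \<i> * of_real y - 1 / g'"
      by (intro tendsto_intros g' nz)
    ultimately show "(\<lambda>n. w1 n + w2 n) \<longlonglongrightarrow> \<i> * of_real y - 1 / g'" by simp
  qed
  have lim: "cmod (stieltjes \<rho> W - g') \<le> 0"
    if \<rho>: "real_distribution \<rho>" and w: "w \<longlonglongrightarrow> W" and wI: "\<And>n. y / 2 \<le> Im (w n)" and WI: "y / 2 \<le> Im W"
      and b: "\<And>n. cmod (stieltjes \<rho> (w n) - g n) \<le> 1 / real (Suc n)" for \<rho> w W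
  proof (rule LIMSEQ_le)
    have "(\<lambda>n. stieltjes \<rho> (w n) - stieltjes \<rho> W) \<longlonglongrightarrow> 0"
    proof (rule Lim_null_comparison)
      show "\<forall>\<^sub>F n in sequentially. norm (stieltjes \<rho> (w n) - stieltjes \<rho> W) \<le> cmod (w n - W) / (y / 2)\<^sup>2"
        using real_distribution.stieltjes_lipschitz[OF \<rho> _ wI WI] y by (intro always_eventually) auto
      have "(\<lambda>n. cmod (w n - W) / (y / 2)\<^sup>2) \<longlonglongrightarrow> cmod (W - W) / (y / 2)\<^sup>2"
        by (intro tendsto_intros w) (use y in auto)
      thus "(\<lambda>n. cmod (w n - W) / (y / 2)\<^sup>2) \<longlonglongrightarrow> 0" by simp
    qed
    hence "(\<lambda>n. stieltjes \<rho> (w n)) \<longlonglongrightarrow> stieltjes \<rho> W" by (simp add: LIM_zero_iff)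
    thus "(\<lambda>n. cmod (stieltjes \<rho> (w n) - g n)) \<longlonglongrightarrow> cmod (stieltjes \<rho> W - g')"
      by (intro tendsto_norm tendsto_diff g')
    show "\<exists>n0. \<forall>n\<ge>n0. cmod (stieltjes \<rho> (w n) - g n) \<le> 1 / real (Suc n)" using b by blast
  qed (rule lim0)
  have "approx_subord \<mu> \<nu> y 0 g' W1 W2"
    unfolding approx_subord_def
    using lim[OF M.real_distribution_axioms W1 _ reg(1)] lim[OF V.real_distribution_axioms W2 _ reg(3)] s eq reg le
    by (simp add: approx_subord_def)
  thus ?thesis by (rule that)
qed

section \<open>Stieltjes transforms and weak convergence\<close>

lemma upper_half_plane: "open {z. 0 < Im z}" "connected {z. 0 < Im z}"
  by (auto intro: open_halfspace_Im_gt convex_connected convex_halfspace_Im_gt)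

context real_distribution
begin

text \<open>The difference quotient equals the integral \<open>I z\<close>, so only the continuity
  of \<open>I\<close> at \<open>w\<close> remains, which an elementary Lipschitz bound
  supplies.\<close>

lemma stieltjes_has_derivative:
  assumes w: "0 < Im w"
  shows "(stieltjes M has_field_derivative (\<integral>x. 1 / ((complex_of_real x - w) * (complex_of_real x - w)) \<partial>M)) (at w)"
proof -
  define I where "I z = (\<integral>x. 1 / ((complex_of_real x - z) * (complex_of_real x - w)) \<partial>M)" for z
  define \<eta> where "\<eta> = Im w / 2"
  have \<eta>: "\<eta> > 0" "\<eta> \<le> Im w" using w by (auto simp: \<eta>_def)
  have near: "\<forall>\<^sub>F z in at w. \<eta> \<le> Im z"
  proof -
    have "\<forall>\<^sub>F z in nhds w. z \<in> {z. \<eta> < Im z}"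
      by (rule eventually_nhds_in_open) (use open_halfspace_Im_gt[of \<eta>] w in \<open>simp_all add: \<eta>_def\<close>)
    thus ?thesis unfolding eventually_at_filter by eventually_elim auto
  qed
  have Id: "cmod (I z - I w) \<le> cmod (z - w) * (1 / \<eta> * (1 / \<eta> * (1 / \<eta>)))" if z: "\<eta> \<le> Im z" for z
  proof -
    have z0: "0 < Im z" using z \<eta> by linarith
    have nz: "complex_of_real x - z \<noteq> 0" "complex_of_real x - w \<noteq> 0" for x
      using of_real_minus_nonzero z0 w by auto
    have r: "cmod (1 / (complex_of_real x - z)) \<le> 1 / \<eta>" "cmod (1 / (complex_of_real x - w)) \<le> 1 / \<eta>" for x
      using norm_resolvent_le[OF \<eta>(1)] z \<eta>(2) by auto
    have b2: "cmod (1 / ((complex_of_real x - u) * (complex_of_real x - w))) \<le> 1 / \<eta> * (1 / \<eta>)"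
      if "cmod (1 / (complex_of_real x - u)) \<le> 1 / \<eta>" for x u
      using mult_mono'[OF that r(2)[of x]] by (simp add: norm_mult norm_divide)
    have int: "integrable M (\<lambda>x. 1 / ((complex_of_real x - u) * (complex_of_real x - w)))"
      if "\<And>x. cmod (1 / (complex_of_real x - u)) \<le> 1 / \<eta>" for u
      by (rule integrable_bounded_complex[OF _ b2[OF that]]) auto
    have "I z - I w = (\<integral>x. 1 / ((complex_of_real x - z) * (complex_of_real x - w)) - 1 / ((complex_of_real x - w) * (complex_of_real x - w)) \<partial>M)"
      unfolding I_def by (rule Bochner_Integration.integral_diff[symmetric, OF int[OF r(1)] int[OF r(2)]])
    also have "\<dots> = (\<integral>x. (z - w) * (1 / (complex_of_real x - z) * (1 / (complex_of_real x - w) * (1 / (complex_of_real x - w)))) \<partial>M)"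
    proof (intro Bochner_Integration.integral_cong refl)
      fix x
      have "1 / (A * B) - 1 / (B * B) = (B - A) * (1 / A * (1 / B * (1 / B)))" if "A \<noteq> 0" "B \<noteq> 0" for A B :: complex
        using that by (simp add: field_simps)
      note e = this[OF nz(1)[of x] nz(2)[of x]]
      have d: "(complex_of_real x - w) - (complex_of_real x - z) = z - w" by simp
      show "1 / ((complex_of_real x - z) * (complex_of_real x - w)) - 1 / ((complex_of_real x - w) * (complex_of_real x - w)) =
        (z - w) * (1 / (complex_of_real x - z) * (1 / (complex_of_real x - w) * (1 / (complex_of_real x - w))))"
        unfolding e d ..
    qed
    also have "\<dots> = (z - w) * (\<integral>x. 1 / (complex_of_real x - z) * (1 / (complex_of_real x - w) * (1 / (complex_of_real x - w))) \<partial>M)"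
      by (rule integral_mult_right_zero)
    finally have "cmod (I z - I w) = cmod (z - w) * cmod (\<integral>x. 1 / (complex_of_real x - z) * (1 / (complex_of_real x - w) * (1 / (complex_of_real x - w))) \<partial>M)"
      by (simp only: norm_mult)
    also have "cmod (\<integral>x. 1 / (complex_of_real x - z) * (1 / (complex_of_real x - w) * (1 / (complex_of_real x - w))) \<partial>M) \<le> 1 / \<eta> * (1 / \<eta> * (1 / \<eta>))"
    proof (rule norm_integral_le)
      fix x
      have "cmod (1 / (complex_of_real x - w) * (1 / (complex_of_real x - w))) \<le> 1 / \<eta> * (1 / \<eta>)"
        unfolding norm_mult by (rule mult_mono'[OF r(2) r(2)]) auto
      from mult_mono'[OF r(1) this]
      show "cmod (1 / (complex_of_real x - z) * (1 / (complex_of_real x - w) * (1 / (complex_of_real x - w)))) \<le> 1 / \<eta> * (1 / \<eta> * (1 / \<eta>))"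
        unfolding norm_mult by simp
    qed measurable
    finally show ?thesis by (simp add: mult_left_mono)
  qed
  have "(I \<longlongrightarrow> I w) (at w)"
  proof (rule LIM_zero_cancel, rule Lim_null_comparison)
    show "\<forall>\<^sub>F z in at w. norm (I z - I w) \<le> cmod (z - w) * (1 / \<eta> * (1 / \<eta> * (1 / \<eta>)))"
      using near by eventually_elim (rule Id)
    have "((\<lambda>z. cmod (z - w) * (1 / \<eta> * (1 / \<eta> * (1 / \<eta>)))) \<longlongrightarrow> cmod (w - w) * (1 / \<eta> * (1 / \<eta> * (1 / \<eta>)))) (at w)"
      by (intro tendsto_intros)
    thus "((\<lambda>z. cmod (z - w) * (1 / \<eta> * (1 / \<eta> * (1 / \<eta>)))) \<longlongrightarrow> 0) (at w)" by simp
  qed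
  moreover have "\<forall>\<^sub>F z in at w. I z = (stieltjes M z - stieltjes M w) / (z - w)"
    using near eventually_neq_at_within[of w w UNIV]
  proof eventually_elim
    case (elim z)
    hence "0 < Im z" using \<eta> by linarith
    from stieltjes_diff[OF this w] elim show ?case by (simp add: I_def)
  qed
  ultimately have "((\<lambda>z. (stieltjes M z - stieltjes M w) / (z - w)) \<longlongrightarrow> I w) (at w)"
    by (rule Lim_transform_eventually)
  thus ?thesis unfolding has_field_derivative_iff I_def .
qed

lemma stieltjes_holomorphic: "stieltjes M holomorphic_on {z. 0 < Im z}"
  by (intro holomorphic_onI) (use stieltjes_has_derivative field_differentiable_at_within field_differentiable_def in blast)

text \<open>The real part of x / (x - i y) is x^2 / (x^2 + y^2), nonnegative everywhere and at least
  1/2 where |x| > y. The transform at one point thus controls a tail, which is how both tightness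
  and the bounds on outliers are obtained.\<close>

lemma tail_le_stieltjes:
  assumes y: "y > 0"
  shows "prob {x. \<bar>x\<bar> > y} \<le> 2 * cmod (1 + \<i> * of_real y * stieltjes M (\<i> * of_real y))"
proof -
  define z where "z = \<i> * complex_of_real y"
  have Im: "Im z = y" by (simp add: z_def)
  define f where "f x = of_real x / (complex_of_real x - z)" for x
  have "1 + z * stieltjes M z = (\<integral>x. 1 \<partial>M) + (\<integral>x. z * (1 / (complex_of_real x - z)) \<partial>M)"
    using prob_space unfolding stieltjes_def integral_mult_right_zero by simp
  also have "\<dots> = (\<integral>x. 1 + z * (1 / (complex_of_real x - z)) \<partial>M)"
    by (rule Bochner_Integration.integral_add[symmetric])
      (use integrable_mult_right[OF integrable_resolvent, of z z] y Im in auto)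
  also have "\<dots> = (\<integral>x. f x \<partial>M)"
    unfolding f_def
    by (intro Bochner_Integration.integral_cong refl) (use of_real_minus_nonzero[of z] Im y in \<open>simp add: field_simps\<close>)
  finally have e: "1 + z * stieltjes M z = (\<integral>x. f x \<partial>M)" .
  have Ref: "Re (f x) = x\<^sup>2 / (x\<^sup>2 + y\<^sup>2)" for x
    by (simp add: f_def z_def Re_divide power2_eq_square)
  have fb: "cmod (f x) \<le> 1" for x
  proof -
    have "\<bar>x\<bar> \<le> cmod (complex_of_real x - z)" using abs_Re_le_cmod[of "complex_of_real x - z"] by (simp add: z_def)
    thus ?thesis by (cases "complex_of_real x - z = 0") (auto simp: f_def norm_divide divide_le_eq)
  qed
  have int: "integrable M f" by (rule integrable_bounded_complex[OF _ fb]) (simp add: f_def)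
  have "prob {x. \<bar>x\<bar> > y} = (\<integral>x. indicator {x. \<bar>x\<bar> > y} x \<partial>M)" by simp
  also have "\<dots> \<le> (\<integral>x. 2 * Re (f x) \<partial>M)"
  proof (rule integral_mono)
    show "integrable M (indicat_real {x. y < \<bar>x\<bar>})"
      by (rule integrable_const_bound[of _ 1]) (auto simp: indicator_def)
    show "integrable M (\<lambda>x. 2 * Re (f x))" using int by simp
    show "indicat_real {x. y < \<bar>x\<bar>} x \<le> 2 * Re (f x)" for x
    proof (cases "\<bar>x\<bar> > y")
      case True
      hence "y\<^sup>2 \<le> x\<^sup>2" unfolding abs_le_square_iff[symmetric] using y by linarith
      moreover have "0 < y\<^sup>2" using y by simp
      moreover have "1 \<le> 2 * (p / (p + q))" if "q \<le> p" "0 < q" for p q :: real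
        using that by (simp add: field_simps)
      ultimately have "1 \<le> 2 * (x\<^sup>2 / (x\<^sup>2 + y\<^sup>2))" by blast
      thus ?thesis using True by (simp add: Ref)
    qed (simp add: Ref)
  qed
  also have "\<dots> = 2 * Re (\<integral>x. f x \<partial>M)" using int by simp
  also have "\<dots> \<le> 2 * cmod (\<integral>x. f x \<partial>M)" using complex_Re_le_cmod by simp
  finally show ?thesis unfolding e[symmetric] z_def .
qed

end

lemma weak_conv_stieltjes:
  assumes "\<And>n. real_distribution (\<rho> n)" "real_distribution \<mu>" "weak_conv_m \<rho> \<mu>" and z: "0 < Im z"
  shows "(\<lambda>n. stieltjes (\<rho> n) z) \<longlonglongrightarrow> stieltjes \<mu> z"
  unfolding stieltjes_def
proof (rule weak_conv_imp_integral_bdd_continuous_conv[OF assms(1-3)])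
  show "isCont (\<lambda>x. 1 / (complex_of_real x - z)) x" for x
    using of_real_minus_nonzero[of z] z by (intro continuous_intros) auto
  show "norm (1 / (complex_of_real x - z)) \<le> 1 / Im z" for x
    by (rule norm_resolvent_le[OF z order_refl])
qed

text \<open>Stieltjes inversion: integrate \<open>Im m\<close> along a horizontal segment and let its height tend to 0.\<close>

lemma stieltjes_segment:
  assumes \<mu>: "real_distribution \<mu>" and \<eta>: "\<eta> > 0" and ab: "a \<le> b"
  shows "(LINT E:{a..b}|lborel. Im (stieltjes \<mu> (Complex E \<eta>))) =
    (\<integral>x. arctan ((b - x) / \<eta>) - arctan ((a - x) / \<eta>) \<partial>\<mu>)"
proof -
  interpret real_distribution \<mu> by fact
  define f where "f x E = Im (1 / (complex_of_real x - Complex E \<eta>))" for x E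
  have f_eq: "f x E = \<eta> / ((x - E)\<^sup>2 + \<eta>\<^sup>2)" for x E
    by (simp add: f_def Im_divide power2_eq_square)
  have fb: "\<bar>f x E\<bar> \<le> 1 / \<eta>" for x E
    unfolding f_def by (rule order_trans[OF abs_Im_le_cmod norm_resolvent_le]) (use \<eta> in auto)
  have inner: "(LINT E:{a..b}|lborel. f x E) = arctan ((b - x) / \<eta>) - arctan ((a - x) / \<eta>)" for x
    unfolding set_lebesgue_integral_def
  proof (rule integral_FTC_atLeastAtMost[OF ab])
    show "((\<lambda>E. arctan ((E - x) / \<eta>)) has_vector_derivative f x E) (at E within {a..b})" for E
    proof -
      have "((\<lambda>E. arctan ((E - x) / \<eta>)) has_real_derivative f x E) (at E within {a..b})"
        using \<eta> by (auto intro!: derivative_eq_intros simp: f_eq field_simps power2_eq_square add_nonneg_eq_0_iff)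
      thus ?thesis by (simp add: has_real_derivative_iff_has_vector_derivative)
    qed
    show "continuous_on {a..b} (f x)"
      unfolding f_eq[abs_def] using \<eta> by (intro continuous_intros) (auto simp: sum_power2_eq_zero_iff)
  qed
  interpret P: pair_sigma_finite \<mu> lborel ..
  have "(LINT E:{a..b}|lborel. Im (stieltjes \<mu> (Complex E \<eta>))) = (LINT E|lborel. (\<integral>x. indicator {a..b} E * f x E \<partial>\<mu>))"
    unfolding set_lebesgue_integral_def
  proof (intro Bochner_Integration.integral_cong refl)
    fix E
    have "Im (stieltjes \<mu> (Complex E \<eta>)) = (\<integral>x. f x E \<partial>\<mu>)"
      unfolding stieltjes_def f_def by (rule integral_Im[symmetric, OF integrable_resolvent]) (use \<eta> in simp)
    thus "indicator {a..b} E *\<^sub>R Im (stieltjes \<mu> (Complex E \<eta>)) = (\<integral>x. indicator {a..b} E * f x E \<partial>\<mu>)" by simp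
  qed
  also have "\<dots> = (\<integral>x. (LINT E|lborel. indicator {a..b} E * f x E) \<partial>\<mu>)"
  proof (rule P.Fubini_integral)
    show "integrable (\<mu> \<Otimes>\<^sub>M lborel) (\<lambda>(x, E). indicator {a..b} E * f x E)"
    proof (rule Bochner_Integration.integrable_bound)
      show "integrable (\<mu> \<Otimes>\<^sub>M lborel) (\<lambda>p. indicator (UNIV \<times> {a..b}) p * (1 / \<eta>))"
      proof (rule integrable_mult_left, rule integrable_real_indicator)
        show "UNIV \<times> {a..b} \<in> sets (\<mu> \<Otimes>\<^sub>M lborel)" by simp
        have "emeasure (\<mu> \<Otimes>\<^sub>M lborel) (UNIV \<times> {a..b}) = emeasure \<mu> UNIV * emeasure lborel {a..b}"
          by (rule lborel.emeasure_pair_measure_Times) auto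
        thus "emeasure (\<mu> \<Otimes>\<^sub>M lborel) (UNIV \<times> {a..b}) < \<infinity>"
          using ab emeasure_space_1 by (simp add: ennreal_mult_less_top)
      qed
      show "(\<lambda>(x, E). indicator {a..b} E * f x E) \<in> borel_measurable (\<mu> \<Otimes>\<^sub>M lborel)"
        unfolding f_eq by measurable
      show "AE p in \<mu> \<Otimes>\<^sub>M lborel. norm (case p of (x, E) \<Rightarrow> indicator {a..b} E * f x E)
          \<le> norm (indicator (UNIV \<times> {a..b}) p * (1 / \<eta>))"
        using fb \<eta> by (intro AE_I2) (auto simp: indicator_def abs_mult)
    qed
  qed
  also have "\<dots> = (\<integral>x. arctan ((b - x) / \<eta>) - arctan ((a - x) / \<eta>) \<partial>\<mu>)"
    using inner unfolding set_lebesgue_integral_def by simp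
  finally show ?thesis .
qed

lemma stieltjes_inj:
  assumes \<mu>: "real_distribution \<mu>" and \<nu>: "real_distribution \<nu>"
    and eq: "\<And>z. 0 < Im z \<Longrightarrow> stieltjes \<mu> z = stieltjes \<nu> z"
  shows "\<mu> = \<nu>"
proof (rule cdf_unique[OF \<mu> \<nu>], rule ext)
  fix x :: real
  \<comment> \<open>The height 1/n^2 tends to 0 faster than the offset 1/n of the right endpoint, so
    an atom at \<open>x\<close> receives full weight. The limit is therefore the distribution
    function at every \<open>x\<close>, not only at continuity points.\<close>
  define h where "h n t = arctan ((x + 1 / real n - t) / (1 / (real n)\<^sup>2)) - arctan ((- real n - t) / (1 / (real n)\<^sup>2))" for n t
  have lim: "(\<lambda>n. \<integral>t. h n t \<partial>\<rho>) \<longlonglongrightarrow> (\<integral>t. pi * indicator {..x} t \<partial>\<rho>)" if \<rho>: "real_distribution \<rho>" for \<rho>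
  proof -
    interpret real_distribution \<rho> by fact
    show ?thesis
    proof (rule integral_dominated_convergence[where w = "\<lambda>_. 2 * pi"])
      show "AE t in \<rho>. (\<lambda>n. h n t) \<longlonglongrightarrow> pi * indicator {..x} t"
      proof (rule AE_I2)
        fix t
        have "filterlim (\<lambda>n. (- real n - t) / (1 / (real n)\<^sup>2)) at_bot sequentially" by real_asymp
        hence 1: "(\<lambda>n. arctan ((- real n - t) / (1 / (real n)\<^sup>2))) \<longlonglongrightarrow> - (pi / 2)"
          by (rule filterlim_compose[OF tendsto_arctan_at_bot])
        have 2: "(\<lambda>n. arctan ((x + 1 / real n - t) / (1 / (real n)\<^sup>2))) \<longlonglongrightarrow> (if t \<le> x then pi / 2 else - (pi / 2))"
        proof (cases "t = x")
          case True
          have "filterlim (\<lambda>n. (x + 1 / real n - x) / (1 / (real n)\<^sup>2)) at_top sequentially" by real_asymp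
          from filterlim_compose[OF tendsto_arctan_at_top this] True show ?thesis by simp
        next
          case False
          show ?thesis
          proof (cases "t < x")
            case True
            hence "filterlim (\<lambda>n. (x + 1 / real n - t) / (1 / (real n)\<^sup>2)) at_top sequentially" by real_asymp
            from filterlim_compose[OF tendsto_arctan_at_top this] True show ?thesis by simp
          next
            case F: False
            with False have "x < t" by simp
            hence "filterlim (\<lambda>n. (x + 1 / real n - t) / (1 / (real n)\<^sup>2)) at_bot sequentially" by real_asymp
            from filterlim_compose[OF tendsto_arctan_at_bot this] \<open>x < t\<close> show ?thesis by simp
          qed
        qed
        show "(\<lambda>n. h n t) \<longlonglongrightarrow> pi * indicator {..x} t"
          unfolding h_def using tendsto_diff[OF 2 1] by (auto simp: indicator_def split: if_splits)
      qed
      show "AE t in \<rho>. norm (h n t) \<le> 2 * pi" for n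
      proof (rule AE_I2)
        fix t
        have "\<bar>arctan u - arctan v\<bar> \<le> 2 * pi" for u v
          using arctan_bounded[of u] arctan_bounded[of v] pi_gt_zero by linarith
        thus "norm (h n t) \<le> 2 * pi" by (simp add: h_def)
      qed
      show "(\<lambda>t. pi * indicator {..x} t) \<in> borel_measurable \<rho>" by simp
      show "h n \<in> borel_measurable \<rho>" for n
      proof -
        have "(\<lambda>t. arctan ((c - t) / d)) \<in> borel_measurable borel" for c d :: real
          by (cases "d = 0") (auto intro!: borel_measurable_continuous_onI continuous_intros)
        thus ?thesis unfolding h_def by (intro borel_measurable_diff) simp_all
      qed
    qed simp
  qed
  have val: "(\<integral>t. pi * indicator {..x} t \<partial>\<rho>) = pi * cdf \<rho> x" if \<rho>: "real_distribution \<rho>" for \<rho>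
  proof -
    interpret real_distribution \<rho> by fact
    show ?thesis by (simp add: cdf_def)
  qed
  have "\<forall>\<^sub>F n in sequentially. (\<integral>t. h n t \<partial>\<mu>) = (\<integral>t. h n t \<partial>\<nu>)"
  proof -
    \<comment> \<open>For such \<open>n\<close> the height is positive and the segment from -n to x
      + 1/n is not empty.\<close>
    have "\<forall>\<^sub>F n in sequentially. n \<ge> nat \<lceil>\<bar>x\<bar>\<rceil> + 1" by (rule eventually_ge_at_top)
    thus ?thesis
    proof eventually_elim
      case (elim n)
      hence "\<bar>x\<bar> \<le> real n" "0 < real n" by linarith+
      moreover have "0 \<le> 1 / real n" by simp
      ultimately have n: "1 / (real n)\<^sup>2 > 0" "- real n \<le> x + 1 / real n" by (simp, linarith)
      have "(LINT E:{- real n..x + 1 / real n}|lborel. Im (stieltjes \<mu> (Complex E (1 / (real n)\<^sup>2)))) =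
        (LINT E:{- real n..x + 1 / real n}|lborel. Im (stieltjes \<nu> (Complex E (1 / (real n)\<^sup>2))))"
        using n(1) by (simp add: eq)
      thus ?case unfolding stieltjes_segment[OF \<mu> n] stieltjes_segment[OF \<nu> n] h_def .
    qed
  qed
  hence "(\<lambda>n. \<integral>t. h n t \<partial>\<mu>) \<longlonglongrightarrow> (\<integral>t. pi * indicator {..x} t \<partial>\<nu>)"
    using lim[OF \<nu>] by (simp add: filterlim_cong)
  from LIMSEQ_unique[OF lim[OF \<mu>] this] show "cdf \<mu> x = cdf \<nu> x" unfolding val[OF \<mu>] val[OF \<nu>] by simp
qed

text \<open>The heights accumulate at \<open>y0\<close> (for the identity theorem) and are unbounded (for tightness).\<close>

definition height :: "real \<Rightarrow> nat \<Rightarrow> real" where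
  "height y0 n = (if even n then y0 + 1 / (real n + 1) else y0 + real n)"

lemma height_gt: "y0 < height y0 n"
  by (cases n) (auto simp: height_def)

lemma zero_on_heights_imp_zero:
  assumes f: "f holomorphic_on {z. 0 < Im z}" and y0: "y0 > 0"
    and zero: "\<And>n. f (\<i> * of_real (height y0 n)) = 0" and z: "0 < Im z"
  shows "f z = 0"
proof (rule analytic_continuation[OF f upper_half_plane(1,2)])
  define U where "U = range (\<lambda>n. \<i> * complex_of_real (height y0 n))"
  have pos: "0 < height y0 n" for n using height_gt[of y0 n] y0 by linarith
  show "U \<subseteq> {z. 0 < Im z}" using pos by (auto simp: U_def)
  show "\<i> * of_real y0 \<in> {z. 0 < Im z}" using y0 by simp
  show "z \<in> {z. 0 < Im z}" using z by simp
  show "f u = 0" if "u \<in> U" for u using that zero by (auto simp: U_def)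
  show "(\<i> * of_real y0) islimpt U"
    unfolding islimpt_sequential
  proof (intro exI conjI allI)
    fix n
    show "\<i> * complex_of_real (height y0 (2 * n)) \<in> U - {\<i> * of_real y0}"
      using height_gt[of y0 "2 * n"] by (auto simp: U_def)
  next
    have "(\<lambda>n. y0 + 1 / (real (2 * n) + 1)) \<longlonglongrightarrow> y0" by real_asymp
    hence "(\<lambda>n. height y0 (2 * n)) \<longlonglongrightarrow> y0" by (simp add: height_def)
    thus "(\<lambda>n. \<i> * complex_of_real (height y0 (2 * n))) \<longlonglongrightarrow> \<i> * of_real y0" by (intro tendsto_intros)
  qed
qed

lemma stieltjes_inj_heights:
  assumes \<mu>: "real_distribution \<mu>" and \<nu>: "real_distribution \<nu>" and y0: "y0 > 0"
    and eq: "\<And>n. stieltjes \<mu> (\<i> * of_real (height y0 n)) = stieltjes \<nu> (\<i> * of_real (height y0 n))"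
  shows "\<mu> = \<nu>"
proof (rule stieltjes_inj[OF \<mu> \<nu>])
  fix z assume z: "0 < Im z"
  have "stieltjes \<mu> z - stieltjes \<nu> z = 0"
    by (rule zero_on_heights_imp_zero[where f = "\<lambda>z. stieltjes \<mu> z - stieltjes \<nu> z", OF _ y0 _ z])
      (use eq in \<open>auto intro!: holomorphic_on_diff real_distribution.stieltjes_holomorphic \<mu> \<nu>\<close>)
  thus "stieltjes \<mu> z = stieltjes \<nu> z" by simp
qed

lemma (in real_distribution) tail_small:
  assumes "\<epsilon> > 0"
  shows "\<exists>T>0. prob {x. \<bar>x\<bar> > T} < \<epsilon>"
proof -
  have "(\<lambda>n. prob {x. \<bar>x\<bar> > real n}) \<longlonglongrightarrow> prob (\<Inter>n. {x. \<bar>x\<bar> > real n})"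
    by (rule finite_Lim_measure_decseq) (auto simp: decseq_def)
  also have "(\<Inter>n. {x::real. \<bar>x\<bar> > real n}) = {}"
  proof -
    have "\<exists>n. \<not> \<bar>x\<bar> > real n" for x :: real using real_nat_ceiling_ge[of "\<bar>x\<bar>"] not_less by blast
    thus ?thesis by auto
  qed
  finally have "\<forall>\<^sub>F n in sequentially. prob {x. \<bar>x\<bar> > real n} < \<epsilon>"
    using assms by (intro order_tendstoD(2)[of _ 0]) auto
  hence "\<forall>\<^sub>F n in sequentially. prob {x. \<bar>x\<bar> > real n} < \<epsilon> \<and> n > 0"
    using eventually_gt_at_top[of 0] by eventually_elim auto
  then obtain n where "prob {x. \<bar>x\<bar> > real n} < \<epsilon> \<and> n > 0" by (rule eventually_happens'[OF sequentially_bot, THEN exE])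
  thus ?thesis by (intro exI[of _ "real n"]) auto
qed

text \<open>At a height where the limit value is good, \<open>tail_le_stieltjes\<close> bounds the
  tails of all but finitely many members of the sequence; the others are tight individually.\<close>

lemma stieltjes_tight:
  assumes \<rho>: "\<And>n. real_distribution (\<rho> n)" and y0: "y0 > 0"
    and lim: "\<And>k. (\<lambda>n. stieltjes (\<rho> n) (\<i> * of_real (height y0 k))) \<longlonglongrightarrow> g k"
    and small: "\<And>\<epsilon>. \<epsilon> > 0 \<Longrightarrow> \<exists>k. cmod (1 + \<i> * of_real (height y0 k) * g k) < \<epsilon>"
  shows "tight \<rho>"
  unfolding tight_def
proof (intro conjI allI impI \<rho>)
  fix \<epsilon> :: real assume \<epsilon>: "\<epsilon> > 0"
  interpret real_distribution "\<rho> n" for n by (rule \<rho>)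
  obtain k where k: "cmod (1 + \<i> * of_real (height y0 k) * g k) < \<epsilon> / 2" using small[of "\<epsilon> / 2"] \<epsilon> by auto
  define y where "y = height y0 k"
  have y: "y > 0" using height_gt[of y0 k] y0 by (simp add: y_def)
  have "(\<lambda>n. cmod (1 + \<i> * of_real y * stieltjes (\<rho> n) (\<i> * of_real y))) \<longlonglongrightarrow> cmod (1 + \<i> * of_real y * g k)"
    unfolding y_def by (intro tendsto_intros lim)
  hence "\<forall>\<^sub>F n in sequentially. cmod (1 + \<i> * of_real y * stieltjes (\<rho> n) (\<i> * of_real y)) < \<epsilon> / 2"
    by (rule order_tendstoD(2)) (use k in \<open>simp add: y_def\<close>)
  then obtain n0 where n0: "\<And>n. n \<ge> n0 \<Longrightarrow> cmod (1 + \<i> * of_real y * stieltjes (\<rho> n) (\<i> * of_real y)) < \<epsilon> / 2"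
    unfolding eventually_sequentially by blast
  have "\<forall>n. \<exists>T>0. measure (\<rho> n) {x. \<bar>x\<bar> > T} < \<epsilon>" using tail_small[OF \<epsilon>] by blast
  then obtain T where T: "\<And>n. T n > 0 \<and> measure (\<rho> n) {x. \<bar>x\<bar> > T n} < \<epsilon>" by metis
  \<comment> \<open>The sum of positive terms dominates each of the finitely many individual tail
    levels.\<close>
  define S where "S = y + (\<Sum>n<n0. T n)"
  have Ssum: "0 \<le> (\<Sum>n<n0. T n)" using T by (intro sum_nonneg) (auto simp: less_imp_le)
  have S: "y \<le> S" "0 < S" using Ssum y by (auto simp: S_def)
  have b: "measure (\<rho> n) {x. \<bar>x\<bar> > S} < \<epsilon>" for n
  proof (cases "n < n0")
    case True
    have "T n \<le> (\<Sum>n<n0. T n)" by (rule member_le_sum) (use True T in \<open>auto simp: less_imp_le\<close>)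
    hence "T n \<le> S" using y by (simp add: S_def)
    hence "measure (\<rho> n) {x. \<bar>x\<bar> > S} \<le> measure (\<rho> n) {x. \<bar>x\<bar> > T n}" by (intro finite_measure_mono) auto
    thus ?thesis using T[of n] by linarith
  next
    case False
    have "measure (\<rho> n) {x. \<bar>x\<bar> > S} \<le> measure (\<rho> n) {x. \<bar>x\<bar> > y}" using S by (intro finite_measure_mono) auto
    also have "\<dots> \<le> 2 * cmod (1 + \<i> * of_real y * stieltjes (\<rho> n) (\<i> * of_real y))" by (rule tail_le_stieltjes[OF y])
    finally show ?thesis using n0[of n] False by simp
  qed
  show "\<exists>a b. a < b \<and> (\<forall>n. 1 - \<epsilon> < measure (\<rho> n) {a<..b})"
  proof (intro exI conjI allI)
    show "- (S + 1) < S + 1" using S by simp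
    fix n
    have "1 - measure (\<rho> n) {x. \<bar>x\<bar> > S} = measure (\<rho> n) (UNIV - {x. \<bar>x\<bar> > S})"
      using prob_compl[of "{x. \<bar>x\<bar> > S}" n] by simp
    also have "\<dots> \<le> measure (\<rho> n) {- (S + 1)<..S + 1}" by (intro finite_measure_mono) auto
    finally show "1 - \<epsilon> < measure (\<rho> n) {- (S + 1)<..S + 1}" using b[of n] by linarith
  qed
qed

text \<open>The values \<open>g\<close> are not known in advance to come from a measure; tightness
  provides one. All subsequential limits share the values at the heights, hence coincide, so the
  entire sequence converges.\<close>

lemma stieltjes_limit_exists:
  assumes \<rho>: "\<And>n. real_distribution (\<rho> n)" and y0: "y0 > 0"
    and lim: "\<And>k. (\<lambda>n. stieltjes (\<rho> n) (\<i> * of_real (height y0 k))) \<longlonglongrightarrow> g k"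
    and small: "\<And>\<epsilon>. \<epsilon> > 0 \<Longrightarrow> \<exists>k. cmod (1 + \<i> * of_real (height y0 k) * g k) < \<epsilon>"
  obtains \<mu> where "real_distribution \<mu>" "\<And>k. stieltjes \<mu> (\<i> * of_real (height y0 k)) = g k" "weak_conv_m \<rho> \<mu>"
proof -
  have pos: "0 < Im (\<i> * complex_of_real (height y0 k))" for k using height_gt[of y0 k] y0 by simp
  note t = stieltjes_tight[OF assms]
  have sub: "stieltjes \<nu> (\<i> * of_real (height y0 k)) = g k"
    if "strict_mono s" "real_distribution \<nu>" "weak_conv_m (\<rho> \<circ> s) \<nu>" for s \<nu> k
  proof -
    have "(\<lambda>n. stieltjes ((\<rho> \<circ> s) n) (\<i> * of_real (height y0 k))) \<longlonglongrightarrow> stieltjes \<nu> (\<i> * of_real (height y0 k))"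
      by (rule weak_conv_stieltjes[OF _ that(2,3) pos]) (simp add: \<rho>)
    moreover have "(\<lambda>n. stieltjes ((\<rho> \<circ> s) n) (\<i> * of_real (height y0 k))) \<longlonglongrightarrow> g k"
      using LIMSEQ_subseq_LIMSEQ[OF lim[of k] that(1)] by (simp add: comp_def)
    ultimately show ?thesis by (rule LIMSEQ_unique)
  qed
  obtain r \<mu> where r: "strict_mono (r :: nat \<Rightarrow> nat)" "real_distribution \<mu>" "weak_conv_m (\<rho> \<circ> id \<circ> r) \<mu>"
    using tight_imp_convergent_subsubsequence[OF t, of id] by (auto simp: strict_mono_def)
  have g: "stieltjes \<mu> (\<i> * of_real (height y0 k)) = g k" for k
    using sub[OF r(1,2)] r(3) by simp
  have "weak_conv_m \<rho> \<mu>"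
  proof (rule tight_subseq_weak_converge[OF \<rho> r(2) t])
    fix s \<nu> assume s: "strict_mono s" "real_distribution \<nu>" "weak_conv_m (\<rho> \<circ> s) \<nu>"
    have "\<nu> = \<mu>" by (rule stieltjes_inj_heights[OF s(2) r(2) y0]) (simp add: sub[OF s] g)
    thus "weak_conv_m (\<rho> \<circ> s) \<mu>" using s(3) by simp
  qed
  with r(2) g show ?thesis by (rule that)
qed

lemma (in real_distribution) one_plus_w_stieltjes_small:
  assumes \<epsilon>: "\<epsilon> > 0"
  shows "\<exists>Y>0. \<forall>y\<ge>Y. \<forall>w. y / 2 \<le> Im w \<longrightarrow> cmod w \<le> 2 * y \<longrightarrow> cmod (1 + w * stieltjes M w) < \<epsilon>"
proof -
  have "\<epsilon> / 10 > 0" using \<epsilon> by simp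
  from tail_small[OF this] obtain T where T: "T > 0" "prob {x. \<bar>x\<bar> > T} < \<epsilon> / 10" by blast
  have "cmod (1 + w * stieltjes M w) < \<epsilon>" if y: "4 * T / \<epsilon> \<le> y" and w: "y / 2 \<le> Im w" "cmod w \<le> 2 * y" for y w
  proof -
    have "0 < 4 * T / \<epsilon>" using T \<epsilon> by simp
    hence y0: "y > 0" using y by linarith
    have "2 * T / y \<le> \<epsilon> / 2" using y y0 \<epsilon> by (simp add: field_simps)
    thus ?thesis using norm_one_plus_w_stieltjes[OF y0 w less_imp_le[OF T(1)]] T(2) by linarith
  qed
  thus ?thesis using T \<epsilon> by (intro exI[of _ "4 * T / \<epsilon>"]) auto
qed

lemma height_large: "\<exists>k. Y \<le> height y0 k"
proof -
  obtain n :: nat where "Y - y0 \<le> real n" using real_arch_simple by blast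
  thus ?thesis by (intro exI[of _ "2 * n + 1"]) (simp add: height_def)
qed

lemma (in real_distribution) stieltjes_heights_small:
  assumes y0: "y0 > 0" and \<epsilon>: "\<epsilon> > 0"
  shows "\<exists>k. cmod (1 + \<i> * of_real (height y0 k) * stieltjes M (\<i> * of_real (height y0 k))) < \<epsilon>"
proof -
  from one_plus_w_stieltjes_small[OF \<epsilon>] obtain Y where Y: "Y > 0"
    "\<forall>y\<ge>Y. \<forall>w. y / 2 \<le> Im w \<longrightarrow> cmod w \<le> 2 * y \<longrightarrow> cmod (1 + w * stieltjes M w) < \<epsilon>" by blast
  from height_large[of Y y0] obtain k where k: "Y \<le> height y0 k" ..
  have "cmod (1 + \<i> * of_real (height y0 k) * stieltjes M (\<i> * of_real (height y0 k))) < \<epsilon>"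
    by (rule Y(2)[rule_format, OF k]) (use k Y(1) in \<open>auto simp: norm_mult\<close>)
  thus ?thesis ..
qed

text \<open>A property that holds eventually along every weakly convergent sequence holds on a neighbourhood,
  described by finitely many values of the Stieltjes transform or of the distribution function.\<close>

lemma stieltjes_neighbourhood:
  assumes \<mu>: "real_distribution \<mu>" and y0: "y0 > 0"
    and P: "\<And>\<rho>. (\<And>n. real_distribution (\<rho> n)) \<Longrightarrow> weak_conv_m \<rho> \<mu> \<Longrightarrow> \<exists>n. P (\<rho> n)"
  obtains m \<delta> where "\<delta> > 0" "\<And>\<rho>. real_distribution \<rho> \<Longrightarrow>
    (\<And>k. k < m \<Longrightarrow> cmod (stieltjes \<rho> (\<i> * of_real (height y0 k)) - stieltjes \<mu> (\<i> * of_real (height y0 k))) \<le> \<delta>) \<Longrightarrow> P \<rho>"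
proof -
  interpret real_distribution \<mu> by fact
  define d where "d \<rho> k = cmod (stieltjes \<rho> (\<i> * of_real (height y0 k)) - stieltjes \<mu> (\<i> * of_real (height y0 k)))" for \<rho> k
  have "\<exists>m::nat. \<forall>\<rho>. real_distribution \<rho> \<longrightarrow> (\<forall>k<m. d \<rho> k \<le> 1 / real (Suc m)) \<longrightarrow> P \<rho>"
  \<comment> \<open>Counterexamples for every \<open>m\<close> would form a sequence whose
    transforms converge at each height; it then converges weakly to \<mu>, against the assumption on
    \<open>P\<close>.\<close>
  proof (rule ccontr)
    assume "\<not> ?thesis"
    then obtain \<rho> where \<rho>: "\<And>m. real_distribution (\<rho> m)" "\<And>m k. k < m \<Longrightarrow> d (\<rho> m) k \<le> 1 / real (Suc m)" "\<And>m. \<not> P (\<rho> m)"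
      by metis
    have lim: "(\<lambda>n. stieltjes (\<rho> n) (\<i> * of_real (height y0 k))) \<longlonglongrightarrow> stieltjes \<mu> (\<i> * of_real (height y0 k))" for k
    proof (rule LIM_zero_cancel, rule Lim_null_comparison)
      show "\<forall>\<^sub>F n in sequentially. norm (stieltjes (\<rho> n) (\<i> * of_real (height y0 k)) - stieltjes \<mu> (\<i> * of_real (height y0 k))) \<le> 1 / real (Suc n)"
        using eventually_gt_at_top[of k] by eventually_elim (use \<rho>(2) in \<open>simp add: d_def\<close>)
      show "(\<lambda>n. 1 / real (Suc n)) \<longlonglongrightarrow> 0" by (rule LIMSEQ_Suc[OF lim_1_over_n])
    qed
    obtain \<nu> where \<nu>: "real_distribution \<nu>" "\<And>k. stieltjes \<nu> (\<i> * of_real (height y0 k)) = stieltjes \<mu> (\<i> * of_real (height y0 k))"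
      "weak_conv_m \<rho> \<nu>"
      using stieltjes_limit_exists[OF \<rho>(1) y0 lim stieltjes_heights_small[OF y0]] by blast
    have "\<nu> = \<mu>" by (rule stieltjes_inj_heights[OF \<nu>(1) \<mu> y0 \<nu>(2)])
    with P[of \<rho>, OF \<rho>(1)] \<nu>(3) \<rho>(3) show False by blast
  qed
  then obtain m :: nat where "\<And>\<rho>. real_distribution \<rho> \<Longrightarrow> (\<And>k. k < m \<Longrightarrow> d \<rho> k \<le> 1 / real (Suc m)) \<Longrightarrow> P \<rho>" by blast
  thus ?thesis by (intro that[of "1 / real (Suc m)" m]) (auto simp: d_def)
qed

text \<open>A distribution function has countably many jumps, so each rational interval contains a
  continuity point; one is selected per pair of rationals and the selection is enumerated.\<close>

lemma dense_continuity_points: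
  assumes \<mu>: "real_distribution \<mu>"
  shows "\<exists>D :: nat \<Rightarrow> real. (\<forall>n. isCont (cdf \<mu>) (D n)) \<and> (\<forall>a b. a < b \<longrightarrow> (\<exists>n. a < D n \<and> D n < b))"
proof -
  interpret real_distribution \<mu> by fact
  have "countable {x. \<not> isCont (cdf \<mu>) x}"
    using countable_atoms by (rule countable_subset[rotated]) (auto simp: isCont_cdf zero_less_measure_iff)
  have ex: "\<exists>c. a < c \<and> c < b \<and> isCont (cdf \<mu>) c" if "a < b" for a b :: real
  proof (rule ccontr)
    assume "\<not> ?thesis"
    hence "{a<..<b} \<subseteq> {x. \<not> isCont (cdf \<mu>) x}" by auto
    hence "countable {a<..<b}" using \<open>countable {x. \<not> isCont (cdf \<mu>) x}\<close> by (rule countable_subset)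
    with that uncountable_open_interval[of a b] show False by blast
  qed
  define c where "c p = (SOME c. of_rat (fst p) < c \<and> c < of_rat (snd p) \<and> isCont (cdf \<mu>) c)" for p :: "rat \<times> rat"
  have c: "of_rat p < c (p, q) \<and> c (p, q) < of_rat q \<and> isCont (cdf \<mu>) (c (p, q))" if "p < q" for p q
    unfolding c_def using someI_ex[OF ex[of "of_rat p" "of_rat q"]] that by (simp add: of_rat_less)
  define C where "C = c ` {p. fst p < snd p}"
  have "c (0, 1) \<in> C" unfolding C_def by (rule imageI) simp
  hence C: "countable C" "C \<noteq> {}" unfolding C_def by (blast intro: countableI_type countable_image)+
  show ?thesis
  proof (rule exI[of _ "from_nat_into C"], intro conjI allI impI)
    show "isCont (cdf \<mu>) (from_nat_into C n)" for n
      using from_nat_into[OF C(2), of n] c by (auto simp: C_def)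
    fix a b :: real assume ab: "a < b"
    obtain p where p: "a < of_rat p" "of_rat p < b" using of_rat_dense[OF ab] by blast
    obtain q where q: "of_rat p < (of_rat q :: real)" "of_rat q < b" using of_rat_dense[OF p(2)] by blast
    have pq: "p < q" using q(1) by (simp add: of_rat_less)
    hence "c (p, q) \<in> C" by (auto simp: C_def)
    then obtain n where "from_nat_into C n = c (p, q)" using from_nat_into_surj[OF C(1)] by blast
    thus "\<exists>n. a < from_nat_into C n \<and> from_nat_into C n < b"
      using c[OF pq] p q by (intro exI[of _ n]) auto
  qed
qed

lemma weak_conv_dense:
  assumes \<rho>: "\<And>n. real_distribution (\<rho> n)"
    and D: "\<And>a b. a < b \<Longrightarrow> \<exists>k. a < D k \<and> D k < b" and lim: "\<And>k. (\<lambda>n. cdf (\<rho> n) (D k)) \<longlonglongrightarrow> cdf \<mu> (D k)"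
  shows "weak_conv_m \<rho> \<mu>"
  unfolding weak_conv_m_def weak_conv_def
proof (intro allI impI)
  fix x assume x: "isCont (cdf \<mu>) x"
  interpret real_distribution "\<rho> n" for n by (rule \<rho>)
  show "(\<lambda>n. cdf (\<rho> n) x) \<longlonglongrightarrow> cdf \<mu> x"
  proof (rule tendstoI)
    fix e :: real assume e: "e > 0"
    obtain d where d: "d > 0" "\<And>u. dist u x < d \<Longrightarrow> dist (cdf \<mu> u) (cdf \<mu> x) < e / 2"
      using x e unfolding continuous_at_eps_delta by (metis half_gt_zero)
    obtain k where k: "x - d < D k" "D k < x" using D[of "x - d" x] d by auto
    obtain l where l: "x < D l" "D l < x + d" using D[of x "x + d"] d by auto
    have k': "dist (cdf \<mu> (D k)) (cdf \<mu> x) < e / 2" "dist (cdf \<mu> (D l)) (cdf \<mu> x) < e / 2"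
      using d(2) k l by (auto simp: dist_real_def)
    have "\<forall>\<^sub>F n in sequentially. dist (cdf (\<rho> n) (D k)) (cdf \<mu> (D k)) < e / 2"
      "\<forall>\<^sub>F n in sequentially. dist (cdf (\<rho> n) (D l)) (cdf \<mu> (D l)) < e / 2"
      using e by (intro tendstoD[OF lim] half_gt_zero; assumption)+
    thus "\<forall>\<^sub>F n in sequentially. dist (cdf (\<rho> n) x) (cdf \<mu> x) < e"
    proof eventually_elim
      case (elim n)
      have "cdf (\<rho> n) (D k) \<le> cdf (\<rho> n) x" "cdf (\<rho> n) x \<le> cdf (\<rho> n) (D l)"
        using k l by (auto intro!: cdf_nondecreasing)
      thus ?case using elim k' unfolding dist_real_def by linarith
    qed
  qed
qed

lemma cdf_neighbourhood:
  assumes \<mu>: "real_distribution \<mu>"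
    and P: "\<And>\<rho>. (\<And>n. real_distribution (\<rho> n)) \<Longrightarrow> weak_conv_m \<rho> \<mu> \<Longrightarrow> \<exists>n. P (\<rho> n)"
  obtains S \<delta> where "\<delta> > 0" "finite S" "\<And>x. x \<in> S \<Longrightarrow> isCont (cdf \<mu>) x"
    "\<And>\<rho>. real_distribution \<rho> \<Longrightarrow> (\<And>x. x \<in> S \<Longrightarrow> \<bar>cdf \<rho> x - cdf \<mu> x\<bar> \<le> \<delta>) \<Longrightarrow> P \<rho>"
proof -
  define D where "D = (SOME D :: nat \<Rightarrow> real. (\<forall>n. isCont (cdf \<mu>) (D n)) \<and> (\<forall>a b. a < b \<longrightarrow> (\<exists>n. a < D n \<and> D n < b)))"
  note D = someI_ex[OF dense_continuity_points[OF \<mu>], folded D_def]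
  note D1 = conjunct1[OF D, rule_format] and D2 = conjunct2[OF D, rule_format]
  define d where "d \<rho> k = \<bar>cdf \<rho> (D k) - cdf \<mu> (D k)\<bar>" for \<rho> k
  have "\<exists>m::nat. \<forall>\<rho>. real_distribution \<rho> \<longrightarrow> (\<forall>k<m. d \<rho> k \<le> 1 / real (Suc m)) \<longrightarrow> P \<rho>"
  proof (rule ccontr)
    assume "\<not> ?thesis"
    then obtain \<rho> where \<rho>: "\<And>m. real_distribution (\<rho> m)" "\<And>m k. k < m \<Longrightarrow> d (\<rho> m) k \<le> 1 / real (Suc m)" "\<And>m. \<not> P (\<rho> m)"
      by metis
    have "weak_conv_m \<rho> \<mu>"
    proof (rule weak_conv_dense[OF \<rho>(1) D2])
      fix k
      show "(\<lambda>n. cdf (\<rho> n) (D k)) \<longlonglongrightarrow> cdf \<mu> (D k)"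
      proof (rule LIM_zero_cancel, rule Lim_null_comparison)
        show "\<forall>\<^sub>F n in sequentially. norm (cdf (\<rho> n) (D k) - cdf \<mu> (D k)) \<le> 1 / real (Suc n)"
          using eventually_gt_at_top[of k] by eventually_elim (use \<rho>(2) in \<open>simp add: d_def\<close>)
        show "(\<lambda>n. 1 / real (Suc n)) \<longlonglongrightarrow> 0" by (rule LIMSEQ_Suc[OF lim_1_over_n])
      qed
    qed
    with P[of \<rho>, OF \<rho>(1)] \<rho>(3) show False by blast
  qed
  then obtain m :: nat where "\<And>\<rho>. real_distribution \<rho> \<Longrightarrow> (\<And>k. k < m \<Longrightarrow> d \<rho> k \<le> 1 / real (Suc m)) \<Longrightarrow> P \<rho>" by blast
  thus ?thesis by (intro that[of "1 / real (Suc m)" "D ` {..<m}"]) (auto simp: D1 d_def)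
qed

text \<open>Uniformity in the half plane via Skorohod's representation.\<close>

lemma weak_conv_stieltjes_uniform:
  assumes \<rho>: "\<And>n. real_distribution (\<rho> n)" and \<mu>: "real_distribution \<mu>" and wc: "weak_conv_m \<rho> \<mu>"
    and \<eta>: "\<eta> > 0" and \<epsilon>: "\<epsilon> > 0"
  shows "\<forall>\<^sub>F n in sequentially. \<forall>z. \<eta> \<le> Im z \<longrightarrow> cmod (stieltjes (\<rho> n) z - stieltjes \<mu> z) \<le> \<epsilon>"
proof -
  obtain \<Omega> :: "real measure" and Yn Y where O: "prob_space \<Omega>" and Yn: "\<And>n. Yn n \<in> \<Omega> \<rightarrow>\<^sub>M borel"
    "\<And>n. distr \<Omega> borel (Yn n) = \<rho> n" and Y: "Y \<in> \<Omega> \<rightarrow>\<^sub>M lborel" "distr \<Omega> borel Y = \<mu>"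
    and lim: "\<And>x. x \<in> space \<Omega> \<Longrightarrow> (\<lambda>n. Yn n x) \<longlonglongrightarrow> Y x"
    using Skorohod[OF \<rho> \<mu> wc] by blast
  interpret O: prob_space \<Omega> by fact
  have Yb: "Y \<in> borel_measurable \<Omega>" using Y(1) by simp
  \<comment> \<open>A majorant of the difference of the resolvent functions that does not depend on
    \<open>z\<close>: the trivial bound for far apart values, the Lipschitz bound for close ones.
    Dominated convergence then acts on all \<open>z\<close> at once.\<close>
  define c where "c n x = min (2 / \<eta>) (\<bar>Yn n x - Y x\<bar> / \<eta>\<^sup>2)" for n x
  have cm: "c n \<in> borel_measurable \<Omega>" for n unfolding c_def using Yn(1)[of n] Yb by measurable
  have "(\<lambda>n. \<integral>x. c n x \<partial>\<Omega>) \<longlonglongrightarrow> (\<integral>x. 0 \<partial>\<Omega>)"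
  proof (rule integral_dominated_convergence[where w = "\<lambda>_. 2 / \<eta>"])
    show "AE x in \<Omega>. (\<lambda>n. c n x) \<longlonglongrightarrow> 0"
    proof (rule AE_I2)
      fix x assume "x \<in> space \<Omega>"
      from lim[OF this] have "(\<lambda>n. min (2 / \<eta>) (\<bar>Yn n x - Y x\<bar> / \<eta>\<^sup>2)) \<longlonglongrightarrow> min (2 / \<eta>) (\<bar>Y x - Y x\<bar> / \<eta>\<^sup>2)"
        by (intro tendsto_intros) (use \<eta> in auto)
      thus "(\<lambda>n. c n x) \<longlonglongrightarrow> 0" using \<eta> by (simp add: c_def)
    qed
    show "AE x in \<Omega>. norm (c n x) \<le> 2 / \<eta>" for n using \<eta> by (intro AE_I2) (auto simp: c_def)
  qed (use cm in auto)
  hence "\<forall>\<^sub>F n in sequentially. (\<integral>x. c n x \<partial>\<Omega>) < \<epsilon>" using \<epsilon> by (intro order_tendstoD(2)[of _ 0]) auto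
  thus ?thesis
  proof eventually_elim
    case (elim n)
    show ?case
    proof (intro allI impI)
      fix z assume z: "\<eta> \<le> Im z"
      define f where "f x = 1 / (complex_of_real x - z)" for x
      have fm: "f \<in> borel_measurable borel" unfolding f_def by measurable
      have fb: "cmod (f x) \<le> 1 / \<eta>" for x unfolding f_def by (rule norm_resolvent_le[OF \<eta> z])
      have int: "integrable \<Omega> (\<lambda>x. f (X x))" if "X \<in> borel_measurable \<Omega>" for X
        by (rule O.integrable_const_bound[of _ "1 / \<eta>"]) (use fb measurable_compose[OF that fm] in auto)
      have ci: "integrable \<Omega> (c n)"
        by (rule O.integrable_const_bound[of _ "2 / \<eta>"]) (use cm \<eta> in \<open>auto simp: c_def\<close>)
      have s: "stieltjes (distr \<Omega> borel X) z = (\<integral>x. f (X x) \<partial>\<Omega>)" if "X \<in> borel_measurable \<Omega>" for X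
        unfolding stieltjes_def f_def[symmetric] by (rule integral_distr[OF that fm])
      have "stieltjes (\<rho> n) z - stieltjes \<mu> z = (\<integral>x. f (Yn n x) - f (Y x) \<partial>\<Omega>)"
        unfolding Yn(2)[symmetric] Y(2)[symmetric] s[OF Yn(1)] s[OF Yb]
        by (rule Bochner_Integration.integral_diff[symmetric, OF int[OF Yn(1)] int[OF Yb]])
      also have "cmod \<dots> \<le> (\<integral>x. cmod (f (Yn n x) - f (Y x)) \<partial>\<Omega>)" by (rule integral_norm_bound)
      also have "\<dots> \<le> (\<integral>x. c n x \<partial>\<Omega>)"
      proof (rule integral_mono[OF integrable_norm[OF Bochner_Integration.integrable_diff[OF int[OF Yn(1)] int[OF Yb]]] ci])
        fix x
        have 1: "cmod (f u - f v) \<le> 2 / \<eta>" for u v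
          using norm_triangle_ineq4[of "f u" "f v"] fb[of u] fb[of v] by simp
        have 2: "cmod (f u - f v) \<le> \<bar>u - v\<bar> / \<eta>\<^sup>2" for u v
        proof -
          have nz: "complex_of_real u - z \<noteq> 0" "complex_of_real v - z \<noteq> 0"
            using of_real_minus_nonzero[of z] z \<eta> by auto
          have "f u - f v = of_real (v - u) * (f u * f v)" using nz by (simp add: f_def field_simps)
          hence "cmod (f u - f v) = \<bar>u - v\<bar> * cmod (f u * f v)"
            by (simp only: norm_mult norm_of_real abs_minus_commute)
          also have "\<dots> \<le> \<bar>u - v\<bar> * (1 / \<eta> * (1 / \<eta>))"
            unfolding norm_mult by (intro mult_left_mono mult_mono' fb) auto
          finally show ?thesis by (simp add: power2_eq_square)
        qed
        show "cmod (f (Yn n x) - f (Y x)) \<le> c n x" using 1 2 by (simp add: c_def)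
      qed
      finally show "cmod (stieltjes (\<rho> n) z - stieltjes \<mu> z) \<le> \<epsilon>" using elim by simp
    qed
  qed
qed

section \<open>Elimination\<close>

abbreviation ev :: "real poly \<Rightarrow> complex \<Rightarrow> complex" where
  "ev p g \<equiv> poly (map_poly complex_of_real p) g"

lemma ev_add [simp]: "ev (p + q) g = ev p g + ev q g"
proof -
  have "map_poly complex_of_real (p + q) = map_poly complex_of_real p + map_poly complex_of_real q"
    by (rule poly_eqI) (simp add: coeff_map_poly)
  thus ?thesis by simp
qed

lemma ev_mult [simp]: "ev (p * q) g = ev p g * ev q g"
proof -
  have "map_poly complex_of_real (p * q) = map_poly complex_of_real p * map_poly complex_of_real q"
    by (rule poly_eqI) (simp add: coeff_map_poly coeff_mult)
  thus ?thesis by simp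
qed

lemma ev_0 [simp]: "ev 0 g = 0" and ev_1 [simp]: "ev 1 g = 1"
  by simp_all

lemma ev_uminus [simp]: "ev (- p) g = - ev p g"
  using ev_add[of p "- p" g] by (simp add: eq_neg_iff_add_eq_0 add.commute)

lemma ev_diff [simp]: "ev (p - q) g = ev p g - ev q g"
  using ev_add[of p "- q" g] by simp

lemma sum_rotate:
  fixes f :: "'a \<Rightarrow> 'b \<Rightarrow> 'c \<Rightarrow> 'd :: comm_monoid_add"
  shows "(\<Sum>k\<in>K. \<Sum>i\<in>I. \<Sum>j\<in>J. f k i j) = (\<Sum>i\<in>I. \<Sum>j\<in>J. \<Sum>k\<in>K. f k i j)"
proof -
  have "(\<Sum>k\<in>K. \<Sum>i\<in>I. \<Sum>j\<in>J. f k i j) = (\<Sum>i\<in>I. \<Sum>k\<in>K. \<Sum>j\<in>J. f k i j)" by (rule sum.swap)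
  also have "\<dots> = (\<Sum>i\<in>I. \<Sum>j\<in>J. \<Sum>k\<in>K. f k i j)" by (intro sum.cong refl) (rule sum.swap)
  finally show ?thesis .
qed

lemma ev_sum: "ev (sum f I) g = (\<Sum>i\<in>I. ev (f i) g)"
  by (induction I rule: infinite_finite_induct) auto

lemma ev_power [simp]: "ev (p ^ k) g = ev p g ^ k"
  by (induction k) auto

lemma ev_X [simp]: "ev [:0, 1:] g = g"
  by (simp add: map_poly_pCons)

lemma poly_altdef_le:
  fixes x :: "'a :: comm_semiring_1"
  assumes "degree p \<le> D"
  shows "poly p x = (\<Sum>j\<le>D. coeff p j * x ^ j)"
  unfolding poly_altdef using assms by (intro sum.mono_neutral_left) (auto simp: coeff_eq_0)

lemma ev_altdef:
  assumes "degree p \<le> D"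
  shows "ev p g = (\<Sum>j\<le>D. of_real (coeff p j) * g ^ j)"
  using poly_altdef_le[OF order_trans[OF degree_map_poly_le assms], of complex_of_real g] by (simp add: coeff_map_poly)

lemma eval_bivariate_altdef:
  assumes "degree L \<le> D"
  shows "eval_bivariate L m z = (\<Sum>i\<le>D. ev (coeff L i) z * m ^ i)"
  using poly_altdef_le[OF order_trans[OF degree_map_poly_le assms], of "\<lambda>p. ev p z" m]
  by (simp add: eval_bivariate_def coeff_map_poly)

text \<open>The given relations are polynomials in the value of the transform. Elimination views
  them instead as polynomials in the point, with coefficients depending on the common value
  g.\<close>

definition swap_poly :: "real poly poly \<Rightarrow> real poly poly" where
  "swap_poly L = (\<Sum>i\<le>degree L. \<Sum>j\<le>degree (coeff L i). monom (monom (coeff (coeff L i) j) i) j)"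

lemma coeff_swap_poly: "coeff (coeff (swap_poly L) j) i = coeff (coeff L i) j"
proof -
  have "coeff (coeff (swap_poly L) j) i = (\<Sum>i'\<le>degree L. \<Sum>j'\<le>degree (coeff L i'). if j' = j \<and> i' = i then coeff (coeff L i) j else 0)"
    unfolding swap_poly_def coeff_sum by (intro sum.cong refl) (auto simp: coeff_sum)
  also have "\<dots> = (\<Sum>i'\<le>degree L. if i' = i then coeff (coeff L i) j else 0)"
  proof (intro sum.cong refl)
    fix i'
    show "(\<Sum>j'\<le>degree (coeff L i'). if j' = j \<and> i' = i then coeff (coeff L i) j else 0) = (if i' = i then coeff (coeff L i) j else 0)"
      by (cases "i' = i"; cases "j \<le> degree (coeff L i)") (auto simp: coeff_eq_0)
  qed
  also have "\<dots> = coeff (coeff L i) j" by (cases "i \<le> degree L") (auto simp: coeff_eq_0)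
  finally show ?thesis .
qed

lemma swap_poly_nonzero: "L \<noteq> 0 \<Longrightarrow> swap_poly L \<noteq> 0"
  using coeff_swap_poly by (metis coeff_0 leading_coeff_0_iff)

lemma eval_swap_poly: "eval_bivariate (swap_poly L) m z = eval_bivariate L z m"
proof -
  define D where "D = degree L + degree (swap_poly L) + (\<Sum>i\<le>degree L. degree (coeff L i)) + (\<Sum>i\<le>degree (swap_poly L). degree (coeff (swap_poly L) i))"
  have d: "degree (coeff P i) \<le> (\<Sum>i\<le>degree P. degree (coeff P i))" for P :: "real poly poly" and i
    by (cases "i \<le> degree P") (auto intro: member_le_sum simp: coeff_eq_0)
  have D: "degree L \<le> D" "degree (swap_poly L) \<le> D" "\<And>i. degree (coeff L i) \<le> D" "\<And>i. degree (coeff (swap_poly L) i) \<le> D"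
    using d[of L] d[of "swap_poly L"] by (auto simp: D_def intro: trans_le_add1 trans_le_add2)
  have "eval_bivariate (swap_poly L) m z = (\<Sum>i\<le>D. \<Sum>j\<le>D. of_real (coeff (coeff (swap_poly L) i) j) * z ^ j * m ^ i)"
    unfolding eval_bivariate_altdef[OF D(2)] ev_altdef[OF D(4)] sum_distrib_right ..
  also have "\<dots> = (\<Sum>j\<le>D. \<Sum>i\<le>D. of_real (coeff (coeff L j) i) * m ^ i * z ^ j)"
    unfolding coeff_swap_poly by (subst sum.swap) (simp add: mult_ac)
  also have "\<dots> = eval_bivariate L z m"
    unfolding eval_bivariate_altdef[OF D(1)] ev_altdef[OF D(3)] sum_distrib_right ..
  finally show ?thesis .
qed

text \<open>Polynomials in \<open>s\<close> with coefficients in \<open>m\<close>; the sum \<open>\<alpha> + \<beta>\<close> of two roots is algebraic because its powers lie,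
  up to denominators, in the finitely generated module spanned by the \<open>\<alpha>\<^sup>i \<beta>\<^sup>j\<close>.\<close>

locale two_polys =
  fixes A B :: "real poly poly"
  assumes A: "0 < degree A" and B: "0 < degree B"
begin

definition "d = degree A"
definition "e = degree B"
definition "p = coeff A d"
definition "q = coeff B e"

definition V :: "(complex \<times> complex \<times> complex) set" where
  "V = {(g, \<alpha>, \<beta>). (\<Sum>i\<le>d. ev (coeff A i) g * \<alpha> ^ i) = 0 \<and> (\<Sum>j\<le>e. ev (coeff B j) g * \<beta> ^ j) = 0}"

lemma de: "0 < d" "0 < e" using A B by (auto simp: d_def e_def)

lemma pq: "p \<noteq> 0" "q \<noteq> 0" using A B by (auto simp: p_def q_def d_def e_def)

definition val :: "(nat \<Rightarrow> nat \<Rightarrow> real poly) \<Rightarrow> complex \<Rightarrow> complex \<Rightarrow> complex \<Rightarrow> complex" where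
  "val c g \<alpha> \<beta> = (\<Sum>i<d. \<Sum>j<e. ev (c i j) g * \<alpha> ^ i * \<beta> ^ j)"

text \<open>Coordinates, with respect to the products of powers of \<alpha> below \<open>d\<close>
  and of \<beta> below \<open>e\<close>, of \<open>p\<close> \<alpha> times the given element. The
  factor \<open>p\<close>, the leading coefficient, avoids division when the power \<alpha>^d is
  reduced.\<close>

definition mulA :: "(nat \<Rightarrow> nat \<Rightarrow> real poly) \<Rightarrow> nat \<Rightarrow> nat \<Rightarrow> real poly" where
  "mulA c i j = (if i = 0 then 0 else p * c (i - 1) j) - c (d - 1) j * coeff A i"

definition mulB :: "(nat \<Rightarrow> nat \<Rightarrow> real poly) \<Rightarrow> nat \<Rightarrow> nat \<Rightarrow> real poly" where
  "mulB c i j = (if j = 0 then 0 else q * c i (j - 1)) - c i (e - 1) * coeff B j"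

text \<open>One application of the companion matrix: the coefficients move up, and the overflowing
  top coefficient is reduced by the relation satisfied by \<open>x\<close>.\<close>

lemma shift_sum:
  fixes f :: "nat \<Rightarrow> complex" and h :: "nat \<Rightarrow> complex"
  assumes n: "0 < n" and rel: "(\<Sum>i\<le>n. h i * x ^ i) = 0"
  shows "(\<Sum>i<n. ((if i = 0 then 0 else h n * f (i - 1)) - f (n - 1) * h i) * x ^ i) = h n * x * (\<Sum>i<n. f i * x ^ i)"
proof -
  obtain k where k: "n = Suc k" using n by (cases n) auto
  have r: "(\<Sum>i<n. h i * x ^ i) = - (h n * x ^ n)"
    using rel by (simp add: lessThan_Suc_atMost[symmetric] eq_neg_iff_add_eq_0)
  have "(\<Sum>i<n. ((if i = 0 then 0 else h n * f (i - 1)) - f (n - 1) * h i) * x ^ i)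
    = (\<Sum>i<n. (if i = 0 then 0 else h n * f (i - 1)) * x ^ i) - f (n - 1) * (\<Sum>i<n. h i * x ^ i)"
    by (simp add: left_diff_distrib sum_subtractf sum_distrib_left mult.assoc)
  also have "(\<Sum>i<n. (if i = 0 then 0 else h n * f (i - 1)) * x ^ i) = (\<Sum>i<k. h n * x * (f i * x ^ i))"
    unfolding k sum.lessThan_Suc_shift by (simp add: mult_ac)
  also have "(\<Sum>i<k. h n * x * (f i * x ^ i)) - f (n - 1) * (\<Sum>i<n. h i * x ^ i)
    = h n * x * (\<Sum>i<n. f i * x ^ i)"
    unfolding r by (simp add: k sum_distrib_left algebra_simps)
  finally show ?thesis .
qed

lemma val_mulA:
  assumes "(g, \<alpha>, \<beta>) \<in> V"
  shows "val (mulA c) g \<alpha> \<beta> = ev p g * \<alpha> * val c g \<alpha> \<beta>"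
proof -
  have "val (mulA c) g \<alpha> \<beta> = (\<Sum>j<e. (\<Sum>i<d. ev (mulA c i j) g * \<alpha> ^ i) * \<beta> ^ j)"
    unfolding val_def sum_distrib_right by (rule sum.swap)
  also have "\<dots> = (\<Sum>j<e. (ev p g * \<alpha> * (\<Sum>i<d. ev (c i j) g * \<alpha> ^ i)) * \<beta> ^ j)"
  proof (intro sum.cong refl arg_cong2[of _ _ _ _ times])
    fix j
    have "(\<Sum>i<d. ev (mulA c i j) g * \<alpha> ^ i) =
      (\<Sum>i<d. ((if i = 0 then 0 else ev (coeff A d) g * ev (c (i - 1) j) g) - ev (c (d - 1) j) g * ev (coeff A i) g) * \<alpha> ^ i)"
      by (intro sum.cong refl) (auto simp: mulA_def p_def)
    also have "\<dots> = ev (coeff A d) g * \<alpha> * (\<Sum>i<d. ev (c i j) g * \<alpha> ^ i)"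
      by (rule shift_sum[OF de(1)]) (use assms in \<open>simp add: V_def\<close>)
    finally show "(\<Sum>i<d. ev (mulA c i j) g * \<alpha> ^ i) = ev p g * \<alpha> * (\<Sum>i<d. ev (c i j) g * \<alpha> ^ i)" by (simp add: p_def)
  qed
  also have "\<dots> = ev p g * \<alpha> * (\<Sum>j<e. \<Sum>i<d. ev (c i j) g * \<alpha> ^ i * \<beta> ^ j)"
    by (simp add: sum_distrib_left sum_distrib_right mult_ac)
  also have "(\<Sum>j<e. \<Sum>i<d. ev (c i j) g * \<alpha> ^ i * \<beta> ^ j) = val c g \<alpha> \<beta>" unfolding val_def by (rule sum.swap)
  finally show ?thesis .
qed

lemma val_mulB:
  assumes "(g, \<alpha>, \<beta>) \<in> V"
  shows "val (mulB c) g \<alpha> \<beta> = ev q g * \<beta> * val c g \<alpha> \<beta>"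
proof -
  have "(\<Sum>j<e. ev (mulB c i j) g * \<beta> ^ j) = ev q g * \<beta> * (\<Sum>j<e. ev (c i j) g * \<beta> ^ j)" for i
  proof -
    have "(\<Sum>j<e. ev (mulB c i j) g * \<beta> ^ j) =
      (\<Sum>j<e. ((if j = 0 then 0 else ev (coeff B e) g * ev (c i (j - 1)) g) - ev (c i (e - 1)) g * ev (coeff B j) g) * \<beta> ^ j)"
      by (intro sum.cong refl) (auto simp: mulB_def q_def)
    also have "\<dots> = ev (coeff B e) g * \<beta> * (\<Sum>j<e. ev (c i j) g * \<beta> ^ j)"
      by (rule shift_sum[OF de(2)]) (use assms in \<open>simp add: V_def\<close>)
    finally show ?thesis by (simp add: q_def)
  qed
  hence *: "(\<Sum>j<e. ev (mulB c i j) g * \<beta> ^ j) * \<alpha> ^ i = ev q g * \<beta> * (\<Sum>j<e. ev (c i j) g * \<beta> ^ j) * \<alpha> ^ i" for i by simp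
  have v: "val f g \<alpha> \<beta> = (\<Sum>i<d. (\<Sum>j<e. ev (f i j) g * \<beta> ^ j) * \<alpha> ^ i)" for f
    unfolding val_def sum_distrib_right by (simp add: mult_ac)
  show ?thesis unfolding v * by (simp only: mult.assoc flip: sum_distrib_left)
qed

text \<open>Coordinates of the powers of p q (\<alpha> + \<beta>), where p q (\<alpha> + \<beta>) is
  formed as q (p \<alpha>) + p (q \<beta>) so that all coefficients remain polynomials.\<close>

primrec pow :: "nat \<Rightarrow> nat \<Rightarrow> nat \<Rightarrow> real poly" where
  "pow 0 = (\<lambda>i j. if i = 0 \<and> j = 0 then 1 else 0)"
| "pow (Suc k) = (\<lambda>i j. q * mulA (pow k) i j + p * mulB (pow k) i j)"

lemma val_pow:
  assumes V: "(g, \<alpha>, \<beta>) \<in> V"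
  shows "val (pow k) g \<alpha> \<beta> = (ev (p * q) g * (\<alpha> + \<beta>)) ^ k"
proof (induction k)
  case 0
  have *: "ev (if P then 1 else 0) g = (if P then 1 else 0)" for P by simp
  have "(\<Sum>j<e. (if i = 0 \<and> j = 0 then 1 else 0) * \<alpha> ^ i * \<beta> ^ j) = (if i = 0 then 1 else 0)" for i :: nat
    using de by (cases "i = 0") (simp_all add: if_distrib[of "\<lambda>t. t * _"] cong: if_cong)
  hence "val (pow 0) g \<alpha> \<beta> = (\<Sum>i<d. if i = 0 then 1 else 0)"
    unfolding val_def pow.simps * by simp
  thus ?case using de by simp
next
  case (Suc k)
  have "val (pow (Suc k)) g \<alpha> \<beta> = (\<Sum>i<d. \<Sum>j<e. ev q g * (ev (mulA (pow k) i j) g * \<alpha> ^ i * \<beta> ^ j) + ev p g * (ev (mulB (pow k) i j) g * \<alpha> ^ i * \<beta> ^ j))"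
    unfolding val_def pow.simps ev_add ev_mult by (intro sum.cong refl) (simp only: ring_distribs mult.assoc)
  also have "\<dots> = ev q g * val (mulA (pow k)) g \<alpha> \<beta> + ev p g * val (mulB (pow k)) g \<alpha> \<beta>"
    unfolding val_def sum.distrib sum_distrib_left ..
  also have "\<dots> = ev q g * (ev p g * \<alpha> * (ev (p * q) g * (\<alpha> + \<beta>)) ^ k) + ev p g * (ev q g * \<beta> * (ev (p * q) g * (\<alpha> + \<beta>)) ^ k)"
    unfolding val_mulA[OF V] val_mulB[OF V] Suc.IH ..
  also have "\<dots> = (ev (p * q) g * (\<alpha> + \<beta>)) ^ Suc k"
    unfolding power_Suc ev_mult by (simp only: ring_distribs mult_ac)
  finally show ?case .
qed

text \<open>The d e + 1 lowest powers have coordinate vectors of length d e and are thus dependent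
  over the polynomial ring. The resulting identity is polynomial in g, so it holds also where a
  leading coefficient vanishes.\<close>

lemma sum_algebraic:
  "\<exists>T. T \<noteq> 0 \<and> (\<forall>(g, \<alpha>, \<beta>)\<in>V. (\<Sum>k\<le>degree T. ev (coeff T k) g * (\<alpha> + \<beta>) ^ k) = 0)"
proof -
  define n where "n = d * e"
  define c where "c = pow"
  have c: "val (c k) g \<alpha> \<beta> = (ev (p * q) g * (\<alpha> + \<beta>)) ^ k" if "(g, \<alpha>, \<beta>) \<in> V" for k g \<alpha> \<beta>
    using val_pow[OF that] by (simp add: c_def)
  \<comment> \<open>An extra zero row makes the matrix of coordinates square with determinant 0, and
    a kernel vector over the ring of polynomials is the required dependence.\<close>
  define M where "M = mat (Suc n) (Suc n) (\<lambda>(r, k). if r = n then 0 else c k (r div e) (r mod e))"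
  have M: "M \<in> carrier_mat (Suc n) (Suc n)" by (simp add: M_def)
  have "Determinant.det M = 0"
    by (subst laplace_expansion_row[OF M, of n]) (simp_all add: M_def)
  then obtain v where v: "v \<in> carrier_vec (Suc n)" "v \<noteq> 0\<^sub>v (Suc n)" "M *\<^sub>v v = 0\<^sub>v (Suc n)"
    unfolding det_0_iff_vec_prod_zero[OF M] by blast
  define w where "w k = vec_index v k" for k
  have rel: "(\<Sum>k<Suc n. w k * c k i j) = 0" if "i < d" "j < e" for i j
  proof -
    define r where "r = i * e + j"
    have r: "r < n"
    proof -
      have "r < i * e + e" using that by (simp add: r_def)
      also have "\<dots> = Suc i * e" by simp
      also have "\<dots> \<le> d * e" using that by (intro mult_le_mono1) simp
      finally show ?thesis by (simp add: n_def)
    qed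
    have rd: "r div e = i" "r mod e = j" using that by (simp_all add: r_def)
    have "0 = vec_index (M *\<^sub>v v) r" using v(3) r by simp
    also have "\<dots> = (\<Sum>k<Suc n. M $$ (r, k) * w k)"
      using r M v(1) by (simp add: scalar_prod_def atLeast0LessThan w_def del: sum.lessThan_Suc)
    also have "\<dots> = (\<Sum>k<Suc n. w k * c k i j)"
      using r by (intro sum.cong refl) (simp add: M_def rd mult.commute)
    finally show ?thesis by (rule sym)
  qed
  \<comment> \<open>The powers of p q are absorbed into the coefficients; since \<open>p\<close> and
    \<open>q\<close> are nonzero, \<open>T\<close> inherits nontriviality from the kernel
    vector.\<close>
  define T where "T = (\<Sum>k<Suc n. monom (w k * (p * q) ^ k) k)"
  have T: "coeff T k = (if k < Suc n then w k * (p * q) ^ k else 0)" for k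
    by (simp add: T_def coeff_sum del: sum.lessThan_Suc)
  have "T \<noteq> 0"
  proof
    assume "T = 0"
    hence "w k = 0" if "k < Suc n" for k using T[of k] that pq by simp
    hence "v = 0\<^sub>v (Suc n)" using v(1) by (intro eq_vecI) (auto simp: w_def)
    with v(2) show False by simp
  qed
  moreover have "(\<Sum>k\<le>degree T. ev (coeff T k) g * (\<alpha> + \<beta>) ^ k) = 0" if V: "(g, \<alpha>, \<beta>) \<in> V" for g \<alpha> \<beta>
  proof -
    have "degree T \<le> n" by (rule degree_le) (simp add: T)
    hence "(\<Sum>k\<le>degree T. ev (coeff T k) g * (\<alpha> + \<beta>) ^ k) = (\<Sum>k\<le>n. ev (coeff T k) g * (\<alpha> + \<beta>) ^ k)"
      by (intro sum.mono_neutral_left) (auto simp: coeff_eq_0)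
    also have "\<dots> = (\<Sum>k<Suc n. ev (w k) g * val (c k) g \<alpha> \<beta>)"
      unfolding lessThan_Suc_atMost by (intro sum.cong refl) (auto simp: T c[OF V] power_mult_distrib mult_ac)
    also have "\<dots> = (\<Sum>k<Suc n. \<Sum>i<d. \<Sum>j<e. ev (w k * c k i j) g * (\<alpha> ^ i * \<beta> ^ j))"
      unfolding val_def sum_distrib_left by (intro sum.cong refl) (simp add: mult_ac)
    also have "\<dots> = (\<Sum>i<d. \<Sum>j<e. \<Sum>k<Suc n. ev (w k * c k i j) g * (\<alpha> ^ i * \<beta> ^ j))"
      by (rule sum_rotate)
    also have "\<dots> = (\<Sum>i<d. \<Sum>j<e. ev (\<Sum>k<Suc n. w k * c k i j) g * (\<alpha> ^ i * \<beta> ^ j))"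
      unfolding ev_sum sum_distrib_right ..
    also have "\<dots> = 0" by (intro sum.neutral ballI) (use rel in \<open>simp del: sum.lessThan_Suc\<close>)
    finally show ?thesis .
  qed
  ultimately show ?thesis by blast
qed

end

text \<open>Substitute z - 1/g and clear denominators by g^n; the linear factor \<open>R\<close> is
  g z - 1. The top coefficient in z is that of \<open>T\<close> times a power of g, so the result is
  nonzero.\<close>

lemma shift_inverse:
  assumes T: "T \<noteq> (0 :: real poly poly)"
  shows "\<exists>S. S \<noteq> 0 \<and> (\<forall>g z. g \<noteq> 0 \<longrightarrow> (\<Sum>k\<le>degree T. ev (coeff T k) g * (z - 1 / g) ^ k) = 0 \<longrightarrow> eval_bivariate S z g = 0)"
proof -
  define n where "n = degree T"
  define X where "X = [:0, 1 :: real:]"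
  define R where "R = [:- 1, X:]"
  define S where "S = (\<Sum>k\<le>n. Polynomial.smult (coeff T k * X ^ (n - k)) (R ^ k))"
  have X: "X \<noteq> 0" by (simp add: X_def)
  have dR: "degree (R ^ k) = k" for k using X by (simp add: R_def degree_power_eq)
  have lR: "coeff (R ^ k) k = X ^ k" for k
    using lead_coeff_power[of R k] dR[of k] X by (simp add: R_def)
  have "coeff S n = (\<Sum>k\<le>n. if k = n then coeff T n * X ^ n else 0)"
    unfolding S_def coeff_sum by (intro sum.cong refl) (auto simp: lR dR coeff_eq_0)
  hence "coeff S n = coeff T n * X ^ n" by simp
  hence "S \<noteq> 0" using T X by (auto simp: n_def)
  moreover have "eval_bivariate S z g = 0" if g: "g \<noteq> 0" and 0: "(\<Sum>k\<le>degree T. ev (coeff T k) g * (z - 1 / g) ^ k) = 0" for g z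
  proof -
    have hom: "eval_bivariate (P + Q) z g = eval_bivariate P z g + eval_bivariate Q z g" for P Q
    proof -
      have "map_poly (\<lambda>p. ev p g) (P + Q) = map_poly (\<lambda>p. ev p g) P + map_poly (\<lambda>p. ev p g) Q"
        by (rule poly_eqI) (simp add: coeff_map_poly)
      thus ?thesis by (simp add: eval_bivariate_def)
    qed
    have homm: "eval_bivariate (P * Q) z g = eval_bivariate P z g * eval_bivariate Q z g" for P Q
    proof -
      have "map_poly (\<lambda>p. ev p g) (P * Q) = map_poly (\<lambda>p. ev p g) P * map_poly (\<lambda>p. ev p g) Q"
        by (rule poly_eqI) (simp add: coeff_map_poly coeff_mult ev_sum)
      thus ?thesis by (simp add: eval_bivariate_def)
    qed
    have c: "eval_bivariate [:p:] z g = ev p g" for p 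
    proof -
      have "map_poly (\<lambda>p. ev p g) [:p:] = [:ev p g:]"
        by (rule poly_eqI) (simp add: coeff_map_poly coeff_pCons split: nat.splits)
      thus ?thesis by (simp add: eval_bivariate_def)
    qed
    have one: "eval_bivariate 1 z g = 1" using c[of 1] by (simp add: one_pCons)
    have hs: "eval_bivariate (Polynomial.smult p P) z g = ev p g * eval_bivariate P z g" for p P
      using homm[of "[:p:]" P] c[of p] by simp
    have hp: "eval_bivariate (P ^ k) z g = eval_bivariate P z g ^ k" for P k
      by (induction k) (simp_all add: one homm)
    have hsum: "eval_bivariate (sum f I) z g = (\<Sum>i\<in>I. eval_bivariate (f i) z g)" for f :: "nat \<Rightarrow> real poly poly" and I
    proof -
      have "eval_bivariate 0 z g = 0" by (simp add: eval_bivariate_def)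
      thus ?thesis by (induction I rule: infinite_finite_induct) (simp_all add: hom)
    qed
    have R: "eval_bivariate R z g = g * (z - 1 / g)"
    proof -
      have "ev (- 1) g = - 1" by simp
      moreover have "map_poly (\<lambda>p. ev p g) R = [:ev (- 1) g, ev X g:]" using g
        by (intro poly_eqI) (auto simp: coeff_map_poly R_def coeff_pCons X_def split: nat.splits)
      ultimately show ?thesis using g by (simp add: eval_bivariate_def X_def algebra_simps)
    qed
    have "eval_bivariate S z g = (\<Sum>k\<le>n. ev (coeff T k) g * g ^ (n - k) * (g * (z - 1 / g)) ^ k)"
      unfolding S_def hsum hs hp R by (simp add: X_def)
    also have "\<dots> = (\<Sum>k\<le>n. g ^ n * (ev (coeff T k) g * (z - 1 / g) ^ k))"
    proof (intro sum.cong refl)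
      fix k assume "k \<in> {..n}"
      hence "g ^ n = g ^ (n - k) * g ^ k" by (simp add: power_add[symmetric])
      thus "ev (coeff T k) g * g ^ (n - k) * (g * (z - 1 / g)) ^ k = g ^ n * (ev (coeff T k) g * (z - 1 / g) ^ k)"
        by (simp add: power_mult_distrib)
    qed
    also have "\<dots> = 0" using 0 by (simp add: sum_distrib_left[symmetric] n_def)
    finally show ?thesis .
  qed
  ultimately show ?thesis by blast
qed

definition eliminates :: "real poly poly \<Rightarrow> real poly poly \<Rightarrow> real poly poly \<Rightarrow> bool" where
  "eliminates LA LB S \<longleftrightarrow> (\<forall>g \<alpha> \<beta> z. g \<noteq> 0 \<longrightarrow> eval_bivariate LA g \<alpha> = 0 \<longrightarrow> eval_bivariate LB g \<beta> = 0 \<longrightarrow>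
    \<alpha> + \<beta> = z - 1 / g \<longrightarrow> eval_bivariate S g z = 0)"

lemma eliminatesI:
  assumes "\<And>g \<alpha> \<beta> z. g \<noteq> 0 \<Longrightarrow> eval_bivariate LA g \<alpha> = 0 \<Longrightarrow> eval_bivariate LB g \<beta> = 0 \<Longrightarrow>
    \<alpha> + \<beta> = z - 1 / g \<Longrightarrow> eval_bivariate S g z = 0"
  shows "eliminates LA LB S"
  unfolding eliminates_def by (intro allI impI) (rule assms)

lemma eliminatesD:
  assumes "eliminates LA LB S" "g \<noteq> 0" "eval_bivariate LA g \<alpha> = 0" "eval_bivariate LB g \<beta> = 0" "\<alpha> + \<beta> = z - 1 / g"
  shows "eval_bivariate S g z = 0"
  using assms(1)[unfolded eliminates_def, rule_format, OF assms(2-5)] .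

text \<open>If one relation has degree 0 in the point, it constrains g alone and is itself the
  required polynomial. Otherwise the sum of the two points is algebraic over the polynomials in g,
  and it equals z - 1/g.\<close>

theorem algebraic_elimination:
  assumes LA: "LA \<noteq> 0" and LB: "LB \<noteq> 0"
  shows "\<exists>S. S \<noteq> 0 \<and> eliminates LA LB S"
proof -
  define A where "A = swap_poly LA"
  define B where "B = swap_poly LB"
  have AB: "A \<noteq> 0" "B \<noteq> 0" using LA LB by (auto simp: A_def B_def swap_poly_nonzero)
  have zA: "(\<Sum>i\<le>degree A. ev (coeff A i) g * \<alpha> ^ i) = eval_bivariate LA g \<alpha>" for g \<alpha>
    using eval_bivariate_altdef[of A "degree A" \<alpha> g] eval_swap_poly[of LA \<alpha> g] by (simp add: A_def)
  have zB: "(\<Sum>i\<le>degree B. ev (coeff B i) g * \<alpha> ^ i) = eval_bivariate LB g \<alpha>" for g \<alpha>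
    using eval_bivariate_altdef[of B "degree B" \<alpha> g] eval_swap_poly[of LB \<alpha> g] by (simp add: B_def)
  consider "degree A = 0" | "degree B = 0" | "0 < degree A \<and> 0 < degree B" by blast
  thus ?thesis
  proof cases
    case 1
    have "eval_bivariate A z g = eval_bivariate LA g \<alpha>" for z g \<alpha>
      using zA[of g \<alpha>] eval_bivariate_altdef[of A 0 z g] 1 by simp
    note * = this
    have "eliminates LA LB (swap_poly A)"
    proof (rule eliminatesI)
      fix g \<alpha> \<beta> z
      assume "eval_bivariate LA g \<alpha> = 0" "eval_bivariate LB g \<beta> = 0"
      thus "eval_bivariate (swap_poly A) g z = 0" using *[of z g \<alpha>] by (simp add: eval_swap_poly)
    qed
    thus ?thesis using swap_poly_nonzero[OF AB(1)] by (intro exI[of _ "swap_poly A"] conjI)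
  next
    case 2
    have "eval_bivariate B z g = eval_bivariate LB g \<alpha>" for z g \<alpha>
      using zB[of g \<alpha>] eval_bivariate_altdef[of B 0 z g] 2 by simp
    note * = this
    have "eliminates LA LB (swap_poly B)"
    proof (rule eliminatesI)
      fix g \<alpha> \<beta> z
      assume "eval_bivariate LA g \<alpha> = 0" "eval_bivariate LB g \<beta> = 0"
      thus "eval_bivariate (swap_poly B) g z = 0" using *[of z g \<beta>] by (simp add: eval_swap_poly)
    qed
    thus ?thesis using swap_poly_nonzero[OF AB(2)] by (intro exI[of _ "swap_poly B"] conjI)
  next
    case 3
    then interpret two_polys A B by unfold_locales auto
    from sum_algebraic obtain T where T: "T \<noteq> 0 \<and> (\<forall>(g, \<alpha>, \<beta>)\<in>V. (\<Sum>k\<le>degree T. ev (coeff T k) g * (\<alpha> + \<beta>) ^ k) = 0)" ..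
    from shift_inverse[OF conjunct1[OF T]] obtain S where S: "S \<noteq> 0 \<and> (\<forall>g z. g \<noteq> 0 \<longrightarrow> (\<Sum>k\<le>degree T. ev (coeff T k) g * (z - 1 / g) ^ k) = 0 \<longrightarrow> eval_bivariate S z g = 0)" ..
    have "eliminates LA LB (swap_poly S)"
    proof (rule eliminatesI)
      fix g \<alpha> \<beta> z
      assume g: "g \<noteq> 0" and \<alpha>: "eval_bivariate LA g \<alpha> = 0" and \<beta>: "eval_bivariate LB g \<beta> = 0" and sum: "\<alpha> + \<beta> = z - 1 / g"
      have V: "(g, \<alpha>, \<beta>) \<in> V" using zA[of g \<alpha>] zB[of g \<beta>] \<alpha> \<beta> by (simp add: V_def d_def e_def)
      have "(\<Sum>k\<le>degree T. ev (coeff T k) g * (z - 1 / g) ^ k) = 0"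
        using bspec[OF conjunct2[OF T] V] by (simp add: sum)
      thus "eval_bivariate (swap_poly S) g z = 0"
        using conjunct2[OF S, rule_format, OF g] by (simp add: eval_swap_poly)
    qed
    thus ?thesis using swap_poly_nonzero[OF conjunct1[OF S]] by (intro exI[of _ "swap_poly S"] conjI)
  qed
qed

section \<open>Empirical distributions\<close>

text \<open>The uniform law on the indices pushed forward by \<open>a\<close>, so that lists of
  eigenvalues become real distributions and weak convergence applies to them.\<close>

definition empirical :: "nat \<Rightarrow> (nat \<Rightarrow> real) \<Rightarrow> real measure" where
  "empirical N a = distr (measure_pmf (pmf_of_set {..<N})) borel a"

lemma real_distribution_empirical: "real_distribution (empirical N a)"
  unfolding empirical_def by (rule prob_space.real_distribution_distr[OF prob_space_measure_pmf]) simp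

lemma measure_empirical:
  assumes N: "N > 0" and S: "S \<in> sets borel"
  shows "measure (empirical N a) S = card {i. i < N \<and> a i \<in> S} / N"
proof -
  have "measure (empirical N a) S = measure (measure_pmf (pmf_of_set {..<N})) (a -` S)"
    unfolding empirical_def by (subst measure_distr) (use S in auto)
  also have "\<dots> = card ({..<N} \<inter> a -` S) / card {..<N}"
    by (rule measure_pmf_of_set) (use N in auto)
  also have "{..<N} \<inter> a -` S = {i. i < N \<and> a i \<in> S}" by auto
  finally show ?thesis by simp
qed

lemma cdf_empirical: "N > 0 \<Longrightarrow> cdf (empirical N a) x = card {i. i < N \<and> a i \<le> x} / N"
  unfolding cdf_def by (subst measure_empirical) auto

lemma stieltjes_empirical:
  assumes N: "N > 0"
  shows "stieltjes (empirical N a) z = (\<Sum>i<N. 1 / (of_real (a i) - z)) / of_nat N"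
proof -
  have "stieltjes (empirical N a) z = (\<integral>i. 1 / (complex_of_real (a i) - z) \<partial>measure_pmf (pmf_of_set {..<N}))"
    unfolding stieltjes_def empirical_def by (rule integral_distr) auto
  also have "\<dots> = (\<Sum>i<N. 1 / (of_real (a i) - z)) / of_nat N"
    using N by (subst integral_measure_pmf[of "{..<N}"])
      (auto simp: scaleR_conv_of_real sum_divide_distrib lessThan_empty_iff mult.commute)
  finally show ?thesis .
qed

lemma stieltjes_empirical_change:
  assumes N: "N > 0" and \<eta>: "\<eta> > 0" and z: "\<eta> \<le> Im z"
  shows "cmod (stieltjes (empirical N a) z - stieltjes (empirical N a') z) \<le> 2 / \<eta> * (card {i. i < N \<and> a i \<noteq> a' i} / N)"
proof -
  define r where "r x = 1 / (complex_of_real x - z)" for x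
  have r: "cmod (r x) \<le> 1 / \<eta>" for x unfolding r_def by (rule norm_resolvent_le[OF \<eta> z])
  have "(\<Sum>i<N. r (a i) - r (a' i)) = (\<Sum>i\<in>{i. i < N \<and> a i \<noteq> a' i}. r (a i) - r (a' i))"
    by (rule sum.mono_neutral_right) auto
  also have "cmod \<dots> \<le> of_nat (card {i. i < N \<and> a i \<noteq> a' i}) * (2 / \<eta>)"
  proof (rule sum_norm_bound)
    fix i
    show "cmod (r (a i) - r (a' i)) \<le> 2 / \<eta>"
      using norm_triangle_ineq4[of "r (a i)" "r (a' i)"] r[of "a i"] r[of "a' i"] by simp
  qed
  finally have *: "cmod (\<Sum>i<N. r (a i) - r (a' i)) \<le> of_nat (card {i. i < N \<and> a i \<noteq> a' i}) * (2 / \<eta>)" .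
  have "stieltjes (empirical N a) z - stieltjes (empirical N a') z = (\<Sum>i<N. r (a i) - r (a' i)) / of_nat N"
    unfolding stieltjes_empirical[OF N] r_def[symmetric] sum_subtractf diff_divide_distrib ..
  hence "cmod (stieltjes (empirical N a) z - stieltjes (empirical N a') z) = cmod (\<Sum>i<N. r (a i) - r (a' i)) / N"
    by (simp add: norm_divide)
  also have "\<dots> \<le> of_nat (card {i. i < N \<and> a i \<noteq> a' i}) * (2 / \<eta>) / N"
    using * by (rule divide_right_mono) simp
  finally show ?thesis by (simp add: mult.commute)
qed

section \<open>Approximate subordination for a fixed rotation\<close>

definition truncate :: "real \<Rightarrow> (nat \<Rightarrow> real) \<Rightarrow> nat \<Rightarrow> real" where
  "truncate T a i = (if \<bar>a i\<bar> \<le> T then a i else 0)"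

lemma truncate_le: "0 \<le> T \<Longrightarrow> \<bar>truncate T a i\<bar> \<le> T" by (simp add: truncate_def)

definition outliers :: "nat \<Rightarrow> (nat \<Rightarrow> real) \<Rightarrow> real \<Rightarrow> real" where
  "outliers N a T = card {i. i < N \<and> \<bar>a i\<bar> > T} / N"

lemma outliers_truncate_le: "0 \<le> L \<Longrightarrow> outliers N (truncate T a) L \<le> outliers N a L"
  unfolding outliers_def by (intro divide_right_mono of_nat_mono card_mono) (auto simp: truncate_def)

lemma card_truncate_le: "card {i. i < N \<and> a i \<noteq> truncate T a i} / N \<le> outliers N a T"
  unfolding outliers_def by (intro divide_right_mono of_nat_mono card_mono) (auto simp: truncate_def)

lemma outliers_measure: "N > 0 \<Longrightarrow> outliers N a T = measure (empirical N a) {x. \<bar>x\<bar> > T}"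
  unfolding outliers_def by (subst measure_empirical) auto

lemma norm_tr_resolvent_truncate:
  assumes N: "N > 0" and Q: "Q \<in> unitary_group K N" and y: "Im z > 0"
  shows "cmod (tr (resolvent (rotated_sum N a b Q) z) / of_nat N - tr (resolvent (rotated_sum N (truncate T a) (truncate T b) Q) z) / of_nat N)
    \<le> (outliers N a T + outliers N b T) / Im z"
proof -
  have "cmod (tr (resolvent (rotated_sum N a b Q) z) / of_nat N - tr (resolvent (rotated_sum N (truncate T a) (truncate T b) Q) z) / of_nat N)
    = cmod (tr (resolvent (rotated_sum N a b Q) z) - tr (resolvent (rotated_sum N (truncate T a) (truncate T b) Q) z)) / N"
    unfolding diff_divide_distrib[symmetric] by (simp add: norm_divide)
  also have "\<dots> \<le> (card {i. i < N \<and> a i \<noteq> truncate T a i} + card {i. i < N \<and> b i \<noteq> truncate T b i}) / Im z / N"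
    by (rule divide_right_mono[OF tr_resolvent_truncate[OF Q y]]) simp
  also have "\<dots> = (card {i. i < N \<and> a i \<noteq> truncate T a i} / N + card {i. i < N \<and> b i \<noteq> truncate T b i} / N) / Im z"
    by (simp add: add_divide_distrib mult.commute)
  also have "\<dots> \<le> (outliers N a T + outliers N b T) / Im z"
    by (rule divide_right_mono[OF add_mono[OF card_truncate_le card_truncate_le]]) (use y in simp)
  finally show ?thesis .
qed

text \<open>For eigenvalues bounded by \<open>L\<close>, \<open>trace_identity\<close> writes 1 + z
  g as a sum of two averages of size at most L / y. Truncation changes g by at most the share of
  outliers divided by y, and the factor |z| = y cancels this denominator.\<close>

lemma norm_one_plus_z_tr:
  assumes N: "N > 0" and Q: "Q \<in> unitary_group K N" and y: "y > 0" and L: "0 \<le> L"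
  shows "cmod (1 + \<i> * of_real y * (tr (resolvent (rotated_sum N a b Q) (\<i> * of_real y)) / of_nat N))
    \<le> 2 * L / y + outliers N a L + outliers N b L"
proof -
  define z where "z = \<i> * complex_of_real y"
  have z: "Im z = y" "Im z > 0" "Im z \<noteq> 0" "cmod z = y" using y by (auto simp: z_def norm_mult)
  define a' b' where "a' = truncate L a" and "b' = truncate L b"
  define G where "G = resolvent (rotated_sum N a' b' Q) z"
  define G' where "G' = resolvent (rotated_sum N b' a' (mat_adjoint Q)) z"
  have Qc: "Q \<in> carrier_mat N N" using Q by (simp add: unitary_group_def)
  hence Qc': "mat_adjoint Q \<in> carrier_mat N N" by auto
  have b1: "cmod (\<Sum>k<N. of_real (c k) * M $$ (k, k)) \<le> N * (L / y)"
    if M: "\<And>k. k < N \<Longrightarrow> cmod (M $$ (k, k)) \<le> 1 / y" and c: "\<And>k. \<bar>c k\<bar> \<le> L" for c :: "nat \<Rightarrow> real" and M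
  proof -
    have "cmod (\<Sum>k<N. of_real (c k) * M $$ (k, k)) \<le> of_nat (card {..<N}) * (L * (1 / y))"
      by (rule sum_norm_bound, unfold norm_mult norm_of_real, rule mult_mono[OF c M]) (use L in auto)
    thus ?thesis by simp
  qed
  have G: "cmod (G $$ (k, k)) \<le> 1 / y" if "k < N" for k
    unfolding G_def using resolvent_bounds(3)[OF rotated_sum_hermitian[OF Qc] z(2) that that] z(1) by simp
  have G': "cmod (G' $$ (k, k)) \<le> 1 / y" if "k < N" for k
    unfolding G'_def using resolvent_bounds(3)[OF rotated_sum_hermitian[OF Qc'] z(2) that that] z(1) by simp
  have tI: "of_nat N + z * tr G = (\<Sum>k<N. of_real (a' k) * G $$ (k, k)) + (\<Sum>k<N. of_real (b' k) * G' $$ (k, k))"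
    using trace_identity[OF Q z(3), of a' b', symmetric] by (simp only: G_def G'_def)
  have "cmod (of_nat N + z * tr G) \<le> N * (L / y) + N * (L / y)"
    unfolding tI
    by (rule order_trans[OF norm_triangle_ineq add_mono[OF b1[OF G] b1[OF G']]])
      (simp_all add: a'_def b'_def truncate_le[OF L])
  moreover have "of_nat N + z * tr G = of_nat N * (1 + z * (tr G / of_nat N))" using N by (simp add: field_simps)
  ultimately have "N * cmod (1 + z * (tr G / of_nat N)) \<le> N * (L / y) + N * (L / y)" by (simp only: norm_mult norm_of_nat)
  also have "\<dots> = N * (2 * L / y)" by simp
  finally have 1: "cmod (1 + z * (tr G / of_nat N)) \<le> 2 * L / y" using N by (simp only: mult_le_cancel_left_pos of_nat_0_less_iff)
  define t where "t = tr (resolvent (rotated_sum N a b Q) z) / of_nat N"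
  have "cmod (t - tr G / of_nat N) \<le> (outliers N a L + outliers N b L) / y"
    using norm_tr_resolvent_truncate[OF N Q z(2), of a b L] by (simp add: t_def G_def a'_def b'_def z(1))
  hence "y * cmod (t - tr G / of_nat N) \<le> y * ((outliers N a L + outliers N b L) / y)"
    using y by (intro mult_left_mono) auto
  hence 2: "cmod (z * (t - tr G / of_nat N)) \<le> outliers N a L + outliers N b L"
    using y by (simp add: norm_mult z(4))
  have "1 + z * t = (1 + z * (tr G / of_nat N)) + z * (t - tr G / of_nat N)" by (simp add: algebra_simps)
  with norm_triangle_mono[OF 1 2] have "cmod (1 + z * t) \<le> 2 * L / y + (outliers N a L + outliers N b L)" by (simp only:)
  thus ?thesis by (simp only: t_def z_def add.assoc)
qed

text \<open>The Stieltjes transform of a measure with light tails is small far out, which confines the subordination points.\<close>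

lemma stieltjes_empirical_le:
  assumes N: "N > 0" and y: "y > 0" and w: "y / 2 \<le> Im w" "2 * y \<le> cmod w" and L: "0 \<le> L" "L < 2 * y"
  shows "cmod (stieltjes (empirical N a) w) \<le> 1 / (2 * y - L) + 4 / y * outliers N a L"
proof -
  define a' where "a' = truncate L a"
  have Im: "0 < y / 2" using y by simp
  have "cmod (\<Sum>i<N. 1 / (complex_of_real (a' i) - w)) \<le> of_nat (card {..<N}) * (1 / (2 * y - L))"
  proof (rule sum_norm_bound)
    fix i
    have "2 * y - L \<le> cmod (complex_of_real (a' i) - w)"
      using norm_triangle_ineq2[of w "complex_of_real (a' i)"] truncate_le[OF L(1), of a i] w
      by (simp add: a'_def norm_minus_commute)
    thus "cmod (1 / (complex_of_real (a' i) - w)) \<le> 1 / (2 * y - L)"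
      using L unfolding norm_divide norm_one by (intro divide_left_mono mult_pos_pos) auto
  qed
  hence "cmod (stieltjes (empirical N a') w) \<le> 1 / (2 * y - L)"
    using N by (simp add: stieltjes_empirical[OF N] norm_divide divide_le_eq mult.commute)
  moreover have "cmod (stieltjes (empirical N a) w - stieltjes (empirical N a') w) \<le> 4 / y * (card {i. i < N \<and> a i \<noteq> a' i} / N)"
    using stieltjes_empirical_change[OF N Im w(1), of a a'] by simp
  moreover have "\<dots> \<le> 4 / y * outliers N a L"
    by (rule mult_left_mono) (use card_truncate_le[of N a L] y in \<open>auto simp: a'_def\<close>)
  ultimately show ?thesis
    using norm_triangle_ineq2[of "stieltjes (empirical N a) w" "stieltjes (empirical N a') w"] by linarith
qed

lemma norm_g_ge:
  assumes y: "y > 0" and g: "cmod (1 + \<i> * of_real y * g) \<le> 1 / 50"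
  shows "49 / (50 * y) \<le> cmod g"
proof -
  have "1 - 1 / 50 \<le> cmod (\<i> * of_real y * g)"
    using norm_triangle_ineq4[of "1 + \<i> * of_real y * g" "\<i> * of_real y * g"] g by simp
  hence "49 / 50 \<le> y * cmod g" using y by (simp add: norm_mult)
  thus ?thesis using y by (simp add: divide_le_eq mult.commute mult.left_commute)
qed

text \<open>\<open>subordination_point\<close> with \<eta> = y gives the lower bound on the height
  and the approximate equation. The remaining task is to confine \<open>w\<close> to the disc of
  radius 2 y.\<close>

lemma subordination_one_side:
  assumes N: "N > 0" and y: "y > 0" and X: "hermitian N X" and L: "0 < L" "160 * L \<le> y"
    and \<delta>: "0 < \<delta>" "16 * y * \<delta> \<le> 1" and out: "outliers N a L \<le> 1 / 400"
  defines "G \<equiv> resolvent X (\<i> * of_real y)"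
  defines "g \<equiv> tr G / of_nat N"
  defines "w \<equiv> ((\<Sum>k<N. of_real (a k) * G $$ (k, k)) / of_nat N - 1) / g"
  assumes d: "avg_defect N a G \<le> \<delta>\<^sup>2" and g1: "cmod (1 + \<i> * of_real y * g) \<le> 1 / 50"
  shows "y / 2 \<le> Im w" "cmod w \<le> 2 * y" "cmod (stieltjes (empirical N a) w - g) \<le> 4 * \<delta>" "cmod g \<le> 1 / y"
proof -
  have z: "Im (\<i> * complex_of_real y) = y" "Im (\<i> * complex_of_real y) > 0" using y by auto
  have Gc: "G \<in> carrier_mat N N" unfolding G_def by (rule resolvent_carrier) (use X in simp)
  define \<Gamma> where "\<Gamma> j = G $$ (j, j)" for j
  have g: "g = (\<Sum>j<N. \<Gamma> j) / of_nat N" by (simp add: g_def \<Gamma>_def tr_carrier[OF Gc])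
  have \<Gamma>: "cmod (\<Gamma> j) \<le> 1 / y" if "j < N" for j
    using resolvent_bounds(3)[OF X z(2) that that] unfolding \<Gamma>_def G_def z(1) .
  have "(\<Sum>j<N. y * (cmod (\<Gamma> j))\<^sup>2) \<le> (\<Sum>j<N. Im (\<Gamma> j))"
  proof (rule sum_mono)
    fix j assume "j \<in> {..<N}"
    thus "y * (cmod (\<Gamma> j))\<^sup>2 \<le> Im (\<Gamma> j)"
      using resolvent_bounds(4)[OF X z(2), of j] unfolding \<Gamma>_def G_def z(1) by simp
  qed
  hence "(\<Sum>j<N. y * (cmod (\<Gamma> j))\<^sup>2) / N \<le> (\<Sum>j<N. Im (\<Gamma> j)) / N" by (rule divide_right_mono) simp
  hence Img: "y * ((\<Sum>j<N. (cmod (\<Gamma> j))\<^sup>2) / N) \<le> Im g"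
    by (simp add: g sum_distrib_left[symmetric] Im_divide_of_nat)
  have gg: "49 / (50 * y) \<le> cmod g" by (rule norm_g_ge[OF y g1])
  have "1 / (2 * y) \<le> 49 / (50 * y)" using y by (simp add: field_simps)
  hence g2: "1 / (2 * y) \<le> cmod g" using gg by linarith
  have def: "defect N a G = (\<lambda>j. g - \<Gamma> j - of_real (a j) * g * \<Gamma> j + (\<Sum>k<N. of_real (a k) * \<Gamma> k) / of_nat N * \<Gamma> j)"
    by (rule ext) (simp add: defect_def g_def \<Gamma>_def)
  have Y: "(\<Sum>j<N. (cmod (g - \<Gamma> j - of_real (a j) * g * \<Gamma> j + (\<Sum>k<N. of_real (a k) * \<Gamma> k) / of_nat N * \<Gamma> j))\<^sup>2) / N \<le> \<delta>\<^sup>2"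
    using d unfolding avg_defect_def def .
  have w: "w = ((\<Sum>k<N. of_real (a k) * \<Gamma> k) / of_nat N - 1) / g" by (simp add: w_def \<Gamma>_def)
  note sp = subordination_point[OF N y, of \<Gamma> a \<delta>, folded g, folded w, OF Y \<delta> \<Gamma> Img g2]
  show Im: "y / 2 \<le> Im w" by (rule sp(1))
  show m: "cmod (stieltjes (empirical N a) w - g) \<le> 4 * \<delta>" using sp(2) by (simp add: stieltjes_empirical[OF N])
  show "cmod g \<le> 1 / y"
  proof -
    have "cmod g \<le> (\<Sum>j<N. cmod (\<Gamma> j)) / N" unfolding g by (rule norm_avg_le)
    also have "\<dots> \<le> (\<Sum>j<N. 1 / y) / N" by (rule divide_right_mono[OF sum_mono]) (use \<Gamma> in auto)
    finally show ?thesis using N by simp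
  qed
  show "cmod w \<le> 2 * y"
  proof (rule ccontr)
    \<comment> \<open>Outside the disc the transform is at most 0.7 / y. Adding the error 4 \<delta>
      <= 0.25 / y keeps \<open>g\<close> below 0.95 / y, while it is at least 0.98 / y.\<close>
    assume "\<not> ?thesis"
    hence "2 * y \<le> cmod w" by simp
    from stieltjes_empirical_le[OF N y Im this less_imp_le[OF L(1)], of a] L y
    have "cmod (stieltjes (empirical N a) w) \<le> 1 / (2 * y - L) + 4 / y * outliers N a L" by simp
    also have "4 / y * outliers N a L \<le> 4 / y * (1 / 400)" using out y by (intro mult_left_mono) auto
    also have "1 / (2 * y - L) \<le> 1 / (3 / 2 * y)" using L y by (intro divide_left_mono) auto
    also have "1 / (3 / 2 * y) + 4 / y * (1 / 400) \<le> 7 / 10 / y" using y by (simp add: field_simps)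
    finally have 1: "cmod (stieltjes (empirical N a) w) \<le> 7 / 10 / y" by simp
    have "4 * \<delta> \<le> 1 / 4 / y" using \<delta> y by (simp add: field_simps)
    moreover have "49 / (50 * y) = 98 / 100 / y" "7 / 10 / y + 1 / 4 / y = 95 / 100 / y" using y by (simp_all add: field_simps)
    moreover have "95 / 100 / y < 98 / 100 / y" using y by (intro divide_strict_right_mono) auto
    moreover have "cmod g \<le> cmod (stieltjes (empirical N a) w) + cmod (stieltjes (empirical N a) w - g)"
      using norm_triangle_ineq4[of "stieltjes (empirical N a) w" "stieltjes (empirical N a) w - g"] by simp
    ultimately show False using 1 gg m by linarith
  qed
qed

text \<open>The one-sided result is applied to \<open>a\<close> with \<open>Q\<close> and to
  \<open>b\<close> with the adjoint of \<open>Q\<close>. Both have the same normalised trace, and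
  \<open>trace_identity\<close> turns into the exact relation for the sum of the points.\<close>

theorem subordination_rotated_sum:
  assumes N: "N > 0" and Q: "Q \<in> unitary_group K N" and y: "y > 0" and L: "0 < L" "160 * L \<le> y"
    and \<delta>: "0 < \<delta>" "16 * y * \<delta> \<le> 1" and out: "outliers N a L \<le> 1 / 400" "outliers N b L \<le> 1 / 400"
  defines "G \<equiv> resolvent (rotated_sum N a b Q) (\<i> * of_real y)"
  defines "G' \<equiv> resolvent (rotated_sum N b a (mat_adjoint Q)) (\<i> * of_real y)"
  assumes d: "avg_defect N a G \<le> \<delta>\<^sup>2" "avg_defect N b G' \<le> \<delta>\<^sup>2"
  obtains w1 w2 where "approx_subord (empirical N a) (empirical N b) y (4 * \<delta>) (tr G / of_nat N) w1 w2"
proof -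
  define g where "g = tr G / of_nat N"
  have z: "Im (\<i> * complex_of_real y) \<noteq> 0" using y by auto
  have g': "tr G' / of_nat N = g" unfolding g_def G_def G'_def tr_resolvent_rotated_sum_swap[OF Q z] ..
  have Qc: "Q \<in> carrier_mat N N" using Q by (rule unitaryD)
  hence Qc': "mat_adjoint Q \<in> carrier_mat N N" by auto
  have "2 * L / y \<le> 1 / 80" using L y by (simp add: field_simps)
  hence g1: "cmod (1 + \<i> * of_real y * g) \<le> 1 / 50"
    using norm_one_plus_z_tr[OF N Q y less_imp_le[OF L(1)], of a b] out unfolding g_def G_def by linarith
  define t1 where "t1 = (\<Sum>k<N. of_real (a k) * G $$ (k, k)) / of_nat N"
  define t2 where "t2 = (\<Sum>k<N. of_real (b k) * G' $$ (k, k)) / of_nat N"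
  have "(\<Sum>k<N. of_real (a k) * G $$ (k, k)) + (\<Sum>k<N. of_real (b k) * G' $$ (k, k)) = of_nat N + \<i> * of_real y * tr G"
    unfolding G_def G'_def by (rule trace_identity[OF Q z])
  hence t: "t1 + t2 = 1 + \<i> * of_real y * g" using N unfolding t1_def t2_def g_def
    by (simp add: add_divide_distrib[symmetric]) (simp add: add_divide_distrib)
  have "49 / (50 * y) \<le> cmod g" by (rule norm_g_ge[OF y g1])
  moreover have "0 < 1 / (2 * y)" "1 / (2 * y) \<le> 49 / (50 * y)" using y by (auto simp: field_simps)
  ultimately have g0: "g \<noteq> 0" and g2: "1 / (2 * y) \<le> cmod g" by auto
  have sum: "(t1 - 1) / g + (t2 - 1) / g = \<i> * of_real y - 1 / g"
  proof -
    have "(t1 - 1) / g + (t2 - 1) / g = (t1 + t2 - 2) / g" by (simp add: add_divide_distrib[symmetric])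
    also have "\<dots> = \<i> * of_real y - 1 / g" using g0 unfolding t by (simp add: field_simps)
    finally show ?thesis .
  qed
  note A = subordination_one_side[OF N y rotated_sum_hermitian[OF Qc, of a b] L \<delta> out(1), folded G_def, folded g_def, folded t1_def, OF d(1) g1]
  note B = subordination_one_side[OF N y rotated_sum_hermitian[OF Qc', of b a] L \<delta> out(2), folded G'_def, unfolded g', folded t2_def, OF d(2) g1]
  have "approx_subord (empirical N a) (empirical N b) y (4 * \<delta>) g ((t1 - 1) / g) ((t2 - 1) / g)"
    unfolding approx_subord_def by (intro conjI A B sum g2)
  thus ?thesis unfolding g_def by (rule that)
qed

section \<open>The Haar estimate\<close>

text \<open>Uniform in a half plane, because the transforms will be evaluated at subordination
  points that depend on the random matrix.\<close>

definition stieltjes_close :: "real \<Rightarrow> real \<Rightarrow> real measure \<Rightarrow> real measure \<Rightarrow> bool" where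
  "stieltjes_close L \<epsilon> \<rho> \<mu> \<longleftrightarrow> (\<forall>z. L \<le> Im z \<longrightarrow> cmod (stieltjes \<rho> z - stieltjes \<mu> z) \<le> \<epsilon>)"

lemma stieltjes_closeD: "stieltjes_close L \<epsilon> \<rho> \<mu> \<Longrightarrow> L \<le> Im z \<Longrightarrow> cmod (stieltjes \<rho> z - stieltjes \<mu> z) \<le> \<epsilon>"
  by (simp add: stieltjes_close_def)

lemma outliers_le_stieltjes_close:
  assumes N: "N > 0" and c: "stieltjes_close L \<epsilon> (empirical N a) \<mu>" and T: "0 < T" "L \<le> T"
    and \<mu>: "cmod (1 + \<i> * of_real T * stieltjes \<mu> (\<i> * of_real T)) \<le> \<kappa>"
  shows "outliers N a T \<le> 2 * (\<kappa> + T * \<epsilon>)"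
proof -
  interpret real_distribution "empirical N a" by (rule real_distribution_empirical)
  define z where "z = \<i> * complex_of_real T"
  have "cmod (z * (stieltjes (empirical N a) z - stieltjes \<mu> z)) \<le> T * \<epsilon>"
    unfolding norm_mult using stieltjes_closeD[OF c, of z] T by (intro mult_mono) (auto simp: z_def norm_mult)
  from norm_triangle_mono[OF \<mu> this[unfolded z_def]]
  have "2 * cmod (1 + \<i> * of_real T * stieltjes (empirical N a) (\<i> * of_real T)) \<le> 2 * (\<kappa> + T * \<epsilon>)"
    by (simp add: algebra_simps)
  thus ?thesis unfolding outliers_measure[OF N] by (rule order_trans[OF tail_le_stieltjes[OF T(1)]])
qed

lemma approx_subord_transfer:
  assumes "approx_subord \<mu>' \<nu>' y \<epsilon>' g w1 w2"
    and "\<And>w. y / 2 \<le> Im w \<Longrightarrow> cmod (stieltjes \<mu>' w - stieltjes \<mu> w) \<le> \<epsilon>"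
    and "\<And>w. y / 2 \<le> Im w \<Longrightarrow> cmod (stieltjes \<nu>' w - stieltjes \<nu> w) \<le> \<epsilon>"
  shows "approx_subord \<mu> \<nu> y (\<epsilon>' + \<epsilon>) g w1 w2"
proof -
  have *: "cmod (m - g) \<le> \<epsilon>' + \<epsilon>" if "cmod (m' - g) \<le> \<epsilon>'" "cmod (m' - m) \<le> \<epsilon>" for m m' :: complex
    using norm_triangle_ineq4[of "m' - g" "m' - m"] that by simp
  from assms(1) show ?thesis unfolding approx_subord_def
    using *[of "stieltjes \<mu>' w1" "stieltjes \<mu> w1"] *[of "stieltjes \<nu>' w2" "stieltjes \<nu> w2"] assms(2)[of w1] assms(3)[of w2] by blast
qed

text \<open>Two truncation levels occur. At the fixed level \<open>L\<close> a small share of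
  outliers is enough to confine the points; the larger level \<open>T\<close> makes the eigenvalues
  bounded for the defect estimate, at a cost governed by \<kappa>.\<close>

lemma subordination_close:
  assumes N: "N > 0" and Q: "Q \<in> unitary_group K N" and L: "0 < L" "160 * L \<le> y" and T: "L \<le> T"
    and c: "stieltjes_close L \<epsilon> (empirical N a) \<mu>" "stieltjes_close L \<epsilon> (empirical N b) \<nu>"
    and \<delta>: "0 < \<delta>" "16 * y * \<delta> \<le> 1" and out: "outliers N a L \<le> 1 / 400" "outliers N b L \<le> 1 / 400"
    and out': "outliers N a T \<le> \<kappa>" "outliers N b T \<le> \<kappa>"
  defines "z \<equiv> \<i> * complex_of_real y"
  assumes d: "avg_defect N (truncate T a) (resolvent (rotated_sum N (truncate T a) (truncate T b) Q) z) \<le> \<delta>\<^sup>2"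
    "avg_defect N (truncate T b) (resolvent (rotated_sum N (truncate T b) (truncate T a) (mat_adjoint Q)) z) \<le> \<delta>\<^sup>2"
  shows "\<exists>g w1 w2. approx_subord \<mu> \<nu> y (4 * \<delta> + (4 * \<kappa> / y + \<epsilon>)) g w1 w2 \<and>
    cmod (tr (resolvent (rotated_sum N a b Q) z) / of_nat N - g) \<le> 2 * \<kappa> / y"
proof -
  have y: "y > 0" using L by linarith
  define a' b' where "a' = truncate T a" and "b' = truncate T b"
  define g where "g = tr (resolvent (rotated_sum N a' b' Q) z) / of_nat N"
  have o: "outliers N a' L \<le> 1 / 400" "outliers N b' L \<le> 1 / 400"
    unfolding a'_def b'_def using outliers_truncate_le[of L N T] out less_imp_le[OF L(1)] order_trans by blast+
  from subordination_rotated_sum[OF N Q y L \<delta> o, folded z_def, folded g_def, unfolded a'_def b'_def, OF d, folded a'_def b'_def]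
  obtain w1 w2 where s: "approx_subord (empirical N a') (empirical N b') y (4 * \<delta>) g w1 w2" .
  have tr: "cmod (stieltjes (empirical N (truncate T c)) w - stieltjes \<rho> w) \<le> 4 * \<kappa> / y + \<epsilon>"
    if cc: "stieltjes_close L \<epsilon> (empirical N c) \<rho>" and oc: "outliers N c T \<le> \<kappa>" and w: "y / 2 \<le> Im w" for c \<rho> w
  proof -
    have y2: "0 < y / 2" using y by simp
    have "cmod (stieltjes (empirical N c) w - stieltjes (empirical N (truncate T c)) w) \<le> 4 / y * (card {i. i < N \<and> c i \<noteq> truncate T c i} / N)"
      using stieltjes_empirical_change[OF N y2 w, of c "truncate T c"] by simp
    also have "\<dots> \<le> 4 / y * \<kappa>"
      using order_trans[OF card_truncate_le oc] y by (intro mult_left_mono) auto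
    finally have 1: "cmod (stieltjes (empirical N c) w - stieltjes (empirical N (truncate T c)) w) \<le> 4 * \<kappa> / y" by simp
    have "cmod (stieltjes (empirical N c) w - stieltjes \<rho> w) \<le> \<epsilon>"
      by (rule stieltjes_closeD[OF cc]) (use w L y in linarith)
    with 1 show ?thesis
      using norm_triangle_ineq4[of "stieltjes (empirical N c) w - stieltjes \<rho> w" "stieltjes (empirical N c) w - stieltjes (empirical N (truncate T c)) w"]
      by simp
  qed
  have "approx_subord \<mu> \<nu> y (4 * \<delta> + (4 * \<kappa> / y + \<epsilon>)) g w1 w2"
    by (rule approx_subord_transfer[OF s]) (unfold a'_def b'_def, (rule tr[OF c(1) out'(1)] tr[OF c(2) out'(2)], assumption)+)
  moreover have "cmod (tr (resolvent (rotated_sum N a b Q) z) / of_nat N - g) \<le> 2 * \<kappa> / y"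
  proof -
    have z: "Im z > 0" "Im z = y" using y by (auto simp: z_def)
    have "(outliers N a T + outliers N b T) / y \<le> 2 * \<kappa> / y" using out' y by (intro divide_right_mono) auto
    thus ?thesis using norm_tr_resolvent_truncate[OF N Q z(1), of a b T] unfolding g_def a'_def b'_def z(2) by linarith
  qed
  ultimately show ?thesis by blast
qed

definition haar_good :: "real measure \<Rightarrow> real measure \<Rightarrow> real \<Rightarrow> real \<Rightarrow> complex \<Rightarrow> bool" where
  "haar_good \<mu> \<nu> y \<kappa> m \<longleftrightarrow> (\<exists>g w1 w2. approx_subord \<mu> \<nu> y \<kappa> g w1 w2 \<and> cmod (m - g) \<le> \<kappa>)"

text \<open>The second exceptional set is pulled back under the adjoint and keeps its measure, since
  the Haar measure is invariant under inversion.\<close>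

lemma prob_avg_defect_pair:
  fixes a b :: "nat \<Rightarrow> real" and T \<delta> :: real
  assumes K: "K = \<real> \<or> K = UNIV" and haar: "is_haar_probability K N H" and N: "N > 0"
    and z: "Im z > 0" and T: "\<And>k. \<bar>a k\<bar> \<le> T" "\<And>k. \<bar>b k\<bar> \<le> T" and \<delta>: "\<delta> > 0"
  shows "\<exists>E\<in>sets H. measure H E \<le> 2 * defect_bound T (1 / Im z) / (N * \<delta>) \<and>
    (\<forall>Q\<in>space H - E. avg_defect N a (resolvent (rotated_sum N a b Q) z) \<le> \<delta> \<and>
       avg_defect N b (resolvent (rotated_sum N b a (mat_adjoint Q)) z) \<le> \<delta>)"
proof -
  interpret H: prob_space H using haar by (simp add: is_haar_probability_def)
  define f1 f2 where "f1 Q = avg_defect N a (resolvent (rotated_sum N a b Q) z)"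
    and "f2 Q = avg_defect N b (resolvent (rotated_sum N b a Q) z)" for Q
  have m: "f1 \<in> borel_measurable H" "f2 \<in> borel_measurable H" unfolding f1_def f2_def
    by (rule measurable_avg_defect measurable_mat_resolvent_rotated_sum measurable_mat_haar[OF K haar])+
  note adj = measurable_haar_adjoint[OF K haar]
  define E1 E2 where "E1 = {Q \<in> space H. f1 Q \<ge> \<delta>}" and "E2 = {Q \<in> space H. f2 Q \<ge> \<delta>}"
  define E where "E = E1 \<union> mat_adjoint -` E2 \<inter> space H"
  have E: "E1 \<in> sets H" "E2 \<in> sets H" unfolding E1_def E2_def using m by measurable
  have E': "mat_adjoint -` E2 \<inter> space H \<in> sets H" by (rule measurable_sets[OF adj E(2)])
  have "measure H (mat_adjoint -` E2 \<inter> space H) = measure (distr H H mat_adjoint) E2"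
    by (rule measure_distr[OF adj E(2), symmetric])
  also have "\<dots> = measure H E2" unfolding haar_adjoint[OF K haar] ..
  finally have "measure H E \<le> measure H E1 + measure H E2"
    unfolding E_def using measure_Un_le[OF E(1) E'] by simp
  also have "\<dots> \<le> defect_bound T (1 / Im z) / (N * \<delta>) + defect_bound T (1 / Im z) / (N * \<delta>)"
    unfolding E1_def E2_def f1_def f2_def
    by (intro add_mono; rule prob_avg_defect[OF K haar N z]; (rule T \<delta>)?)
  finally have "measure H E \<le> 2 * defect_bound T (1 / Im z) / (N * \<delta>)" by (simp add: mult.commute)
  moreover have "f1 Q \<le> \<delta> \<and> f2 (mat_adjoint Q) \<le> \<delta>" if Q: "Q \<in> space H - E" for Q
  proof -
    have "mat_adjoint Q \<in> space H" using measurable_space[OF adj] Q by auto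
    thus ?thesis using Q by (auto simp: E_def E1_def E2_def)
  qed
  moreover have "E \<in> sets H" unfolding E_def by (rule sets.Un[OF E(1) E'])
  ultimately show ?thesis unfolding f1_def f2_def by (intro bexI[of _ E]) auto
qed

text \<open>Uniform in \<open>a\<close> and \<open>b\<close>, which later come from realisations of
  the random matrices, so neither N nor \<epsilon> may depend on them.\<close>

definition haar_bound :: "complex set \<Rightarrow> real measure \<Rightarrow> real measure \<Rightarrow> real \<Rightarrow> real \<Rightarrow> real \<Rightarrow> real \<Rightarrow> nat \<Rightarrow> bool" where
  "haar_bound K \<mu> \<nu> L y \<kappa> \<epsilon> N \<longleftrightarrow> (\<forall>a b H. is_haar_probability K N H \<longrightarrow>
    stieltjes_close L \<epsilon> (empirical N a) \<mu> \<longrightarrow> stieltjes_close L \<epsilon> (empirical N b) \<nu> \<longrightarrow>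
    (\<exists>E\<in>sets H. measure H E \<le> \<kappa> \<and>
      (\<forall>Q\<in>space H - E. haar_good \<mu> \<nu> y \<kappa> (tr (resolvent (rotated_sum N a b Q) (\<i> * of_real y)) / of_nat N))))"

lemma haar_boundD:
  assumes "haar_bound K \<mu> \<nu> L y \<kappa> \<epsilon> N" "is_haar_probability K N H"
    "stieltjes_close L \<epsilon> (empirical N a) \<mu>" "stieltjes_close L \<epsilon> (empirical N b) \<nu>"
  obtains E where "E \<in> sets H" "measure H E \<le> \<kappa>"
    "\<forall>Q\<in>space H - E. haar_good \<mu> \<nu> y \<kappa> (tr (resolvent (rotated_sum N a b Q) (\<i> * of_real y)) / of_nat N)"
  using assms(1)[unfolded haar_bound_def, rule_format, OF assms(2-4)] by (elim bexE conjE) (rule that)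

theorem haar_estimate:
  fixes K :: "complex set" and \<mu> \<nu> :: "real measure" and L y \<kappa> :: real
  assumes K: "K = \<real> \<or> K = UNIV" and \<mu>: "real_distribution \<mu>" and \<nu>: "real_distribution \<nu>"
    and L: "0 < L" "160 * L \<le> y" and \<kappa>: "\<kappa> > 0"
    and \<mu>L: "cmod (1 + \<i> * of_real L * stieltjes \<mu> (\<i> * of_real L)) \<le> 1 / 1600"
    and \<nu>L: "cmod (1 + \<i> * of_real L * stieltjes \<nu> (\<i> * of_real L)) \<le> 1 / 1600"
  shows "\<exists>\<epsilon>>0. \<exists>n0. \<forall>N\<ge>n0. N > 0 \<longrightarrow> haar_bound K \<mu> \<nu> L y \<kappa> \<epsilon> N"
proof -
  have y: "y > 0" using L by linarith
  \<comment> \<open>The total error 4 \<delta> + 4 \<kappa>' / y + \<epsilon> is to be at most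
    \<kappa>; each of its three parts is given \<kappa> / 4.\<close>
  define \<kappa>' where "\<kappa>' = \<kappa> * y / 16"
  have \<kappa>': "\<kappa>' > 0" using \<kappa> y by (simp add: \<kappa>'_def)
  hence \<kappa>'4: "\<kappa>' / 4 > 0" by simp
  from real_distribution.one_plus_w_stieltjes_small[OF \<mu> \<kappa>'4] obtain Y1 where Y1: "Y1 > 0"
    "\<forall>y\<ge>Y1. \<forall>w. y / 2 \<le> Im w \<longrightarrow> cmod w \<le> 2 * y \<longrightarrow> cmod (1 + w * stieltjes \<mu> w) < \<kappa>' / 4" by blast
  from real_distribution.one_plus_w_stieltjes_small[OF \<nu> \<kappa>'4] obtain Y2 where Y2: "Y2 > 0"
    "\<forall>y\<ge>Y2. \<forall>w. y / 2 \<le> Im w \<longrightarrow> cmod w \<le> 2 * y \<longrightarrow> cmod (1 + w * stieltjes \<nu> w) < \<kappa>' / 4" by blast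
  define T where "T = max L (max Y1 Y2)"
  have T: "L \<le> T" "Y1 \<le> T" "Y2 \<le> T" "0 < T" using L by (auto simp: T_def)
  have iT: "T / 2 \<le> Im (\<i> * complex_of_real T)" "cmod (\<i> * complex_of_real T) \<le> 2 * T" using T by (auto simp: norm_mult)
  have \<mu>T: "cmod (1 + \<i> * of_real T * stieltjes \<mu> (\<i> * of_real T)) \<le> \<kappa>' / 4"
    by (rule less_imp_le[OF Y1(2)[rule_format, OF T(2) iT]])
  have \<nu>T: "cmod (1 + \<i> * of_real T * stieltjes \<nu> (\<i> * of_real T)) \<le> \<kappa>' / 4"
    by (rule less_imp_le[OF Y2(2)[rule_format, OF T(3) iT]])
  define \<epsilon> where "\<epsilon> = min (\<kappa>' / 4 / T) (min (\<kappa> / 4) (1 / 1600 / L))"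
  have \<epsilon>: "\<epsilon> > 0" "T * \<epsilon> \<le> \<kappa>' / 4" "\<epsilon> \<le> \<kappa> / 4" "L * \<epsilon> \<le> 1 / 1600"
  proof -
    show "\<epsilon> > 0" using \<kappa>' \<kappa> T L by (simp add: \<epsilon>_def)
    have "\<epsilon> \<le> \<kappa>' / 4 / T" by (simp add: \<epsilon>_def)
    thus "T * \<epsilon> \<le> \<kappa>' / 4" using mult_left_mono[of \<epsilon> "\<kappa>' / 4 / T" T] T(4) by simp
    show "\<epsilon> \<le> \<kappa> / 4" by (simp add: \<epsilon>_def)
    have "\<epsilon> \<le> 1 / 1600 / L" by (simp add: \<epsilon>_def)
    thus "L * \<epsilon> \<le> 1 / 1600" using mult_left_mono[of \<epsilon> "1 / 1600 / L" L] L(1) by simp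
  qed
  define \<delta> where "\<delta> = min (\<kappa> / 16) (1 / (16 * y))"
  have \<delta>: "\<delta> > 0" "16 * y * \<delta> \<le> 1" "4 * \<delta> \<le> \<kappa> / 4"
  proof -
    show "\<delta> > 0" using \<kappa> y by (simp add: \<delta>_def)
    have "\<delta> \<le> 1 / (16 * y)" by (simp add: \<delta>_def)
    thus "16 * y * \<delta> \<le> 1" using mult_left_mono[of \<delta> "1 / (16 * y)" "16 * y"] y by simp
    have "\<delta> \<le> \<kappa> / 16" by (simp add: \<delta>_def)
    thus "4 * \<delta> \<le> \<kappa> / 4" by simp
  qed
  hence \<delta>2: "\<delta>\<^sup>2 > 0" by simp
  \<comment> \<open>The threshold for N comes last: \<open>B\<close> depends on \<open>T\<close>,
    and \<open>T\<close> was chosen from \<kappa> alone, besides the fixed laws and scales.\<close>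
  define B where "B = 2 * defect_bound T (1 / y)"
  from real_arch_simple[of "B / (\<delta>\<^sup>2 * \<kappa>)"] obtain n0 :: nat where n0: "B / (\<delta>\<^sup>2 * \<kappa>) \<le> real n0" by blast
  have "\<exists>E\<in>sets H. measure H E \<le> \<kappa> \<and>
      (\<forall>Q\<in>space H - E. haar_good \<mu> \<nu> y \<kappa> (tr (resolvent (rotated_sum N a b Q) (\<i> * of_real y)) / of_nat N))"
    if Nn: "n0 \<le> N" and N: "N > 0" and haar: "is_haar_probability K N H"
      and c: "stieltjes_close L \<epsilon> (empirical N a) \<mu>" "stieltjes_close L \<epsilon> (empirical N b) \<nu>" for N a b H
  proof -
    have out: "outliers N a L \<le> 1 / 400" "outliers N b L \<le> 1 / 400"
      using outliers_le_stieltjes_close[OF N c(1) L(1) order_refl \<mu>L] outliers_le_stieltjes_close[OF N c(2) L(1) order_refl \<nu>L] \<epsilon>(4)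
      by auto
    have out': "outliers N a T \<le> \<kappa>'" "outliers N b T \<le> \<kappa>'"
      using outliers_le_stieltjes_close[OF N c(1) T(4,1) \<mu>T] outliers_le_stieltjes_close[OF N c(2) T(4,1) \<nu>T] \<epsilon>(2)
      by auto
    have z: "Im (\<i> * complex_of_real y) > 0" "Im (\<i> * complex_of_real y) = y" using y by auto
    have tr: "\<bar>truncate T c k\<bar> \<le> T" for c k by (rule truncate_le[OF less_imp_le[OF T(4)]])
    from prob_avg_defect_pair[OF K haar N z(1) tr[of a] tr[of b] \<delta>2, unfolded z(2), folded B_def]
    obtain E where E1: "E \<in> sets H" and E2: "measure H E \<le> B / (N * \<delta>\<^sup>2) \<and>
      (\<forall>Q\<in>space H - E. avg_defect N (truncate T a) (resolvent (rotated_sum N (truncate T a) (truncate T b) Q) (\<i> * of_real y)) \<le> \<delta>\<^sup>2 \<and>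
       avg_defect N (truncate T b) (resolvent (rotated_sum N (truncate T b) (truncate T a) (mat_adjoint Q)) (\<i> * of_real y)) \<le> \<delta>\<^sup>2)"
      by (rule bexE)
    note E = E1 conjunct1[OF E2] and good = conjunct2[OF E2]
    have "B / (\<delta>\<^sup>2 * \<kappa>) \<le> real N" using n0 Nn by linarith
    hence "B / (N * \<delta>\<^sup>2) \<le> \<kappa>" using N \<delta>2 \<kappa> by (simp add: divide_le_eq mult_ac)
    hence "measure H E \<le> \<kappa>" using E(2) by linarith
    moreover have "haar_good \<mu> \<nu> y \<kappa> (tr (resolvent (rotated_sum N a b Q) (\<i> * of_real y)) / of_nat N)" if Q: "Q \<in> space H - E" for Q
    proof -
      have QU: "Q \<in> unitary_group K N" using Q haar_space[OF K haar] by simp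
      from subordination_close[OF N QU L T(1) c \<delta>(1,2) out out' conjunct1[OF good[rule_format, OF Q]] conjunct2[OF good[rule_format, OF Q]]]
      obtain g w1 w2 where s: "approx_subord \<mu> \<nu> y (4 * \<delta> + (4 * \<kappa>' / y + \<epsilon>)) g w1 w2"
        and t: "cmod (tr (resolvent (rotated_sum N a b Q) (\<i> * of_real y)) / of_nat N - g) \<le> 2 * \<kappa>' / y" by blast
      have e: "4 * \<kappa>' / y = \<kappa> / 4" "2 * \<kappa>' / y = \<kappa> / 8" using y by (auto simp: \<kappa>'_def)
      have "approx_subord \<mu> \<nu> y \<kappa> g w1 w2"
        by (rule approx_subord_mono[OF s]) (use \<delta>(3) \<epsilon>(3) e \<kappa> in linarith)
      moreover have "cmod (tr (resolvent (rotated_sum N a b Q) (\<i> * of_real y)) / of_nat N - g) \<le> \<kappa>"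
        using t e \<kappa> by linarith
      ultimately show ?thesis unfolding haar_good_def by blast
    qed
    ultimately show ?thesis using E(1) by blast
  qed
  hence "\<forall>N\<ge>n0. N > 0 \<longrightarrow> haar_bound K \<mu> \<nu> L y \<kappa> \<epsilon> N"
    unfolding haar_bound_def by (intro allI impI)
  thus ?thesis using \<epsilon>(1) by (intro exI[of _ \<epsilon>] conjI exI[of _ n0])
qed

section \<open>Empirical spectral distributions\<close>

lemma diag_real_mult: "diag_real N a * diag_real N b = diag_real N (\<lambda>i. a i * b i)"
proof (rule eq_matI)
  fix i j assume "i < dim_row (diag_real N (\<lambda>i. a i * b i))" "j < dim_col (diag_real N (\<lambda>i. a i * b i))"
  hence ij: "i < N" "j < N" by (simp_all add: diag_real_def)
  have "(diag_real N a * diag_real N b) $$ (i, j) = (\<Sum>k<N. diag_real N a $$ (i, k) * diag_real N b $$ (k, j))"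
    by (rule mult_mat_entry) (use ij in auto)
  also have "\<dots> = (\<Sum>k<N. if k = i then diag_real N (\<lambda>i. a i * b i) $$ (i, j) else 0)"
    by (intro sum.cong refl) (use ij in \<open>auto simp: diag_real_def\<close>)
  finally show "(diag_real N a * diag_real N b) $$ (i, j) = diag_real N (\<lambda>i. a i * b i) $$ (i, j)" using ij by simp
qed (simp_all add: diag_real_def)

lemma char_poly_diag_real: "char_poly (diag_real N a) = (\<Prod>i<N. [:- of_real (a i), 1:])"
proof -
  have "char_poly (diag_real N a) = (\<Prod>x\<leftarrow>diag_mat (diag_real N a). [:- x, 1:])"
    by (rule char_poly_upper_triangular[of _ N]) (auto simp: diag_real_def)
  also have "diag_mat (diag_real N a) = map (\<lambda>i. of_real (a i)) [0..<N]"
    by (simp add: diag_mat_def diag_real_def)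
  also have "(\<Prod>x\<leftarrow>map (\<lambda>i. complex_of_real (a i)) [0..<N]. [:- x, 1:]) = (\<Prod>i<N. [:- of_real (a i), 1:])"
    by (simp add: comp_def prod.distinct_set_conv_list[symmetric] atLeast0LessThan)
  finally show ?thesis .
qed

lemma esd_spectral:
  assumes V: "V \<in> unitary_group K N" and N: "N > 0"
  shows "esd (V * diag_real N a * mat_adjoint V) x = cdf (empirical N a) x"
proof -
  have Vc: "V \<in> carrier_mat N N" using V by (rule unitaryD)
  have "similar_mat (V * diag_real N a * mat_adjoint V) (diag_real N a)"
    by (rule similar_matI[of _ _ V "mat_adjoint V" N]) (use Vc unitaryD(2,3)[OF V] in auto)
  hence "char_poly (V * diag_real N a * mat_adjoint V) = (\<Prod>i<N. [:- of_real (a i), 1:])"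
    using char_poly_diag_real by (simp only: char_poly_similar)
  also have "proots \<dots> = (\<Sum>i<N. {#complex_of_real (a i)#})" by (subst proots_prod) auto
  finally have p: "proots (char_poly (V * diag_real N a * mat_adjoint V)) = (\<Sum>i<N. {#complex_of_real (a i)#})" .
  have "size {#e \<in># (\<Sum>i<n. {#complex_of_real (a i)#}). Re e \<le> x#} = card {i. i < n \<and> a i \<le> x}" for n
  proof (induction n)
    case (Suc n)
    have "{i. i < Suc n \<and> a i \<le> x} = (if a n \<le> x then insert n {i. i < n \<and> a i \<le> x} else {i. i < n \<and> a i \<le> x})"
      by (auto simp: less_Suc_eq)
    thus ?case using Suc by simp
  qed simp
  thus ?thesis using Vc N by (simp add: esd_def p cdf_empirical)
qed

lemma hermitian_empirical:
  assumes K: "K = \<real> \<or> K = UNIV" and X: "X \<in> hermitian_matrices K N" and N: "N > 0"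
  obtains V a where "V \<in> unitary_group K N" "X = V * diag_real N a * mat_adjoint V" "esd X = cdf (empirical N a)"
    "\<And>z. 0 < Im z \<Longrightarrow> stieltjes (empirical N a) z = tr (resolvent X z) / of_nat N"
proof -
  from spectral_theorem[OF K X] obtain V a where V: "V \<in> unitary_group K N" "X = V * diag_real N a * mat_adjoint V" by blast
  show ?thesis
  proof (rule that[OF V])
    show "esd X = cdf (empirical N a)" unfolding V(2) by (rule ext) (rule esd_spectral[OF V(1) N])
    show "stieltjes (empirical N a) z = tr (resolvent X z) / of_nat N" if "0 < Im z" for z
      unfolding V(2) stieltjes_empirical[OF N] by (subst tr_resolvent_spectral[OF V(1)]) (use that in auto)
  qed
qed

lemma pow_mat_spectral:
  assumes V: "V \<in> unitary_group K N"
  shows "(V * diag_real N a * mat_adjoint V) ^\<^sub>m k = V * diag_real N (\<lambda>i. a i ^ k) * mat_adjoint V"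
proof (induction k)
  case 0
  have Vc: "V \<in> carrier_mat N N" using V by (rule unitaryD)
  have "diag_real N (\<lambda>i. 1) = 1\<^sub>m N" by (rule eq_matI) (auto simp: diag_real_def)
  thus ?case using Vc unitaryD(2)[OF V] by simp
next
  case (Suc k)
  have Vc: "V \<in> carrier_mat N N" using V by (rule unitaryD)
  hence Vc': "mat_adjoint V \<in> carrier_mat N N" by auto
  define D where "D = diag_real N (\<lambda>i. a i ^ k)"
  define D' where "D' = diag_real N a"
  have D: "D \<in> carrier_mat N N" "D' \<in> carrier_mat N N" by (simp_all add: D_def D'_def)
  have "(V * D * mat_adjoint V) * (V * D' * mat_adjoint V) = V * D * (mat_adjoint V * V) * D' * mat_adjoint V"
    using Vc Vc' D by (simp add: assoc_mult_mat[of _ N N _ N _ N])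
  also have "\<dots> = V * (D * D') * mat_adjoint V"
    using Vc Vc' D unfolding unitaryD(3)[OF V] by (simp add: assoc_mult_mat[of _ N N _ N _ N])
  also have "D * D' = diag_real N (\<lambda>i. a i ^ Suc k)" unfolding D_def D'_def diag_real_mult by (simp add: mult.commute)
  finally show ?case using Suc by (simp add: D_def D'_def)
qed

lemma tr_diag_real: "tr (diag_real N a) = (\<Sum>i<N. of_real (a i))"
  by (simp add: tr_def diag_real_def)

lemma measurable_mat_pow:
  assumes F: "measurable_mat M N F"
  shows "measurable_mat M N (\<lambda>x. F x ^\<^sub>m k)"
proof (induction k)
  case 0
  show ?case
  proof (rule measurable_matI)
    show "F x ^\<^sub>m 0 \<in> carrier_mat N N" if "x \<in> space M" for x using measurable_matD(1)[OF F that] by simp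
    show "(\<lambda>x. (F x ^\<^sub>m 0) $$ (i, j)) \<in> borel_measurable M" if ij: "i < N" "j < N" for i j
      by (rule measurable_mat_entry_cong[of _ _ _ _ "\<lambda>_. 1\<^sub>m N $$ (i, j)"]) (use measurable_matD(1)[OF F] in auto)
  qed
next
  case (Suc k)
  thus ?case using measurable_mat_mult[OF Suc F] by simp
qed

text \<open>Polynomials converging pointwise to the indicator of a half line express the counting function through
  the traces of powers.\<close>

lemma polynomials_to_indicator:
  "\<exists>p :: nat \<Rightarrow> real \<Rightarrow> real. (\<forall>n. \<exists>c d. p n = (\<lambda>t. \<Sum>i\<le>d. c i * t ^ i)) \<and>
     (\<forall>t. (\<lambda>n. p n t) \<longlonglongrightarrow> (if t \<le> x then 1 else 0))"
proof -
  \<comment> \<open>A ramp equal to 1 up to \<open>x\<close> and falling to 0 at x + 1/n. At each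
    point it agrees with the indicator from some \<open>n\<close> on, and it is approximated by
    polynomials on intervals that exhaust the line.\<close>
  define f where "f n t = max 0 (1 - real n * max 0 (t - x))" for n :: nat and t :: real
  have ex: "\<exists>p. (\<exists>c d. p = (\<lambda>t. \<Sum>i\<le>d. c i * t ^ i)) \<and> (\<forall>t\<in>{-real n..real n}. \<bar>f n t - p t\<bar> < 1 / Suc n)" for n
  proof -
    have "compact {-real n..real n}" "continuous_on {-real n..real n} (f n)" "0 < 1 / real (Suc n)"
      unfolding f_def by (auto intro!: continuous_intros)
    from Stone_Weierstrass_real_polynomial_function[OF this] obtain p where p: "real_polynomial_function p"
      "\<And>t. t \<in> {-real n..real n} \<Longrightarrow> \<bar>f n t - p t\<bar> < 1 / real (Suc n)" by blast
    show ?thesis using p(1)[unfolded real_polynomial_function_iff_sum] p(2) by blast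
  qed
  define p where "p n = (SOME p. (\<exists>c d. p = (\<lambda>t. \<Sum>i\<le>d. c i * t ^ i)) \<and> (\<forall>t\<in>{-real n..real n}. \<bar>f n t - p t\<bar> < 1 / Suc n))" for n
  have p: "(\<exists>c d. p n = (\<lambda>t. \<Sum>i\<le>d. c i * t ^ i)) \<and> (\<forall>t\<in>{-real n..real n}. \<bar>f n t - p n t\<bar> < 1 / Suc n)" for n
    unfolding p_def by (rule someI_ex[OF ex])
  have lim: "(\<lambda>n. p n t) \<longlonglongrightarrow> (if t \<le> x then 1 else 0)" for t
  proof -
    have "\<forall>\<^sub>F n in sequentially. f n t = (if t \<le> x then 1 else 0)"
    proof (cases "t \<le> x")
      case True
      thus ?thesis by (simp add: f_def)
    next
      case False
      obtain n0 :: nat where n0: "1 / (t - x) \<le> real n0" using real_arch_simple by blast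
      show ?thesis using eventually_ge_at_top[of n0]
      proof eventually_elim
        case (elim n)
        hence "1 / (t - x) \<le> real n" using n0 by linarith
        hence "1 \<le> real n * (t - x)" using False by (simp add: divide_le_eq)
        thus ?case using False by (simp add: f_def)
      qed
    qed
    hence "(\<lambda>n. f n t) \<longlonglongrightarrow> (if t \<le> x then 1 else 0)" by (rule tendsto_eventually)
    moreover have "(\<lambda>n. f n t - p n t) \<longlonglongrightarrow> 0"
    proof (rule Lim_null_comparison)
      obtain n0 :: nat where n0: "\<bar>t\<bar> \<le> real n0" using real_arch_simple by blast
      show "\<forall>\<^sub>F n in sequentially. norm (f n t - p n t) \<le> 1 / real (Suc n)" using eventually_ge_at_top[of n0]
      proof eventually_elim
        case (elim n)
        hence "t \<in> {-real n..real n}" using n0 by auto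
        thus ?case using p[of n] by (auto intro: less_imp_le)
      qed
      show "(\<lambda>n. 1 / real (Suc n)) \<longlonglongrightarrow> 0" by (rule LIMSEQ_Suc[OF lim_1_over_n])
    qed
    ultimately have "(\<lambda>n. f n t - (f n t - p n t)) \<longlonglongrightarrow> (if t \<le> x then 1 else 0) - 0" by (rule tendsto_diff)
    thus ?thesis by simp
  qed
  show ?thesis by (rule exI[of _ p]) (use p lim in blast)
qed

lemma measurable_esd:
  assumes K: "K = \<real> \<or> K = UNIV" and F: "F \<in> M \<rightarrow>\<^sub>M hermitian_borel K N" and N: "N > 0"
  shows "(\<lambda>\<omega>. esd (F \<omega>) x) \<in> borel_measurable M"
proof -
  have Fm: "measurable_mat M N F" and Fs: "\<And>\<omega>. \<omega> \<in> space M \<Longrightarrow> F \<omega> \<in> hermitian_matrices K N"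
    using F unfolding measurable_hermitian_borel_iff by auto
  from polynomials_to_indicator[of x] obtain p :: "nat \<Rightarrow> real \<Rightarrow> real" where
    p: "\<forall>n. \<exists>c d. p n = (\<lambda>t. \<Sum>i\<le>d. c i * t ^ i)" "\<forall>t. (\<lambda>n. p n t) \<longlonglongrightarrow> (if t \<le> x then 1 else 0)" by blast
  define c where "c n = (SOME c. \<exists>d. p n = (\<lambda>t. \<Sum>i\<le>d. c i * t ^ i))" for n
  define d where "d n = (SOME d. p n = (\<lambda>t. \<Sum>i\<le>d. c n i * t ^ i))" for n
  have "\<exists>d. p n = (\<lambda>t. \<Sum>i\<le>d. c n i * t ^ i)" for n unfolding c_def by (rule someI_ex[OF p(1)[rule_format]])
  hence pn: "p n = (\<lambda>t. \<Sum>i\<le>d n. c n i * t ^ i)" for n unfolding d_def by (rule someI_ex)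
  show ?thesis
  proof (rule borel_measurable_LIMSEQ_real)
    show "(\<lambda>\<omega>. (\<Sum>i\<le>d n. c n i * Re (tr (F \<omega> ^\<^sub>m i))) / N) \<in> borel_measurable M" for n
      using measurable_tr[OF measurable_mat_pow[OF Fm]] by measurable
    fix \<omega> assume "\<omega> \<in> space M"
    from hermitian_empirical[OF K Fs[OF this] N] obtain V a where V: "V \<in> unitary_group K N"
      "F \<omega> = V * diag_real N a * mat_adjoint V" and e: "esd (F \<omega>) = cdf (empirical N a)" by blast
    have t: "Re (tr (F \<omega> ^\<^sub>m i)) = (\<Sum>j<N. a j ^ i)" for i
      unfolding V(2) pow_mat_spectral[OF V(1)] tr_conj[OF V(1) diag_real_carrier] tr_diag_real by simp
    have "(\<Sum>i\<le>d n. c n i * Re (tr (F \<omega> ^\<^sub>m i))) = (\<Sum>j<N. p n (a j))" for n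
      unfolding t pn sum_distrib_left by (rule sum.swap)
    moreover have "(\<lambda>n. (\<Sum>j<N. p n (a j)) / N) \<longlonglongrightarrow> (\<Sum>j<N. if a j \<le> x then 1 else 0) / N"
      by (intro tendsto_divide tendsto_sum tendsto_const) (use p(2) N in auto)
    moreover have "(\<Sum>j<N. if a j \<le> x then 1 else 0) / N = esd (F \<omega>) x"
    proof -
      have "{..<N} \<inter> {j. a j \<le> x} = {j. j < N \<and> a j \<le> x}" by auto
      thus ?thesis unfolding e cdf_empirical[OF N] by (simp add: sum.If_cases)
    qed
    ultimately show "(\<lambda>n. (\<Sum>i\<le>d n. c n i * Re (tr (F \<omega> ^\<^sub>m i))) / N) \<longlonglongrightarrow> esd (F \<omega>) x" by simp
  qed
qed

section \<open>Random matrices\<close>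

text \<open>Quantifying over all eigenvalue lists with the given distribution function avoids a
  measurable choice of eigenvalues.\<close>

definition matrix_close :: "real \<Rightarrow> real \<Rightarrow> nat \<Rightarrow> complex mat \<Rightarrow> real measure \<Rightarrow> bool" where
  "matrix_close L \<epsilon> N X \<mu> \<longleftrightarrow> (\<forall>a. esd X = cdf (empirical N a) \<longrightarrow> stieltjes_close L \<epsilon> (empirical N a) \<mu>)"

text \<open>Uniform closeness of transforms is reduced to finitely many values of \<open>esd\<close>
  at continuity points, the form in which convergence in probability is available.\<close>

lemma matrix_close_neighbourhood:
  assumes \<mu>: "real_distribution \<mu>" and L: "L > 0" and \<epsilon>: "\<epsilon> > 0"
  obtains S \<delta> where "\<delta> > 0" "finite S" "\<And>x. x \<in> S \<Longrightarrow> isCont (cdf \<mu>) x"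
    "\<And>N X. (\<And>x. x \<in> S \<Longrightarrow> \<bar>esd X x - cdf \<mu> x\<bar> \<le> \<delta>) \<Longrightarrow> matrix_close L \<epsilon> N X \<mu>"
proof -
  have P: "\<exists>n. stieltjes_close L \<epsilon> (\<rho> n) \<mu>"
    if \<rho>: "\<And>n. real_distribution (\<rho> n)" "weak_conv_m \<rho> \<mu>" for \<rho>
    using eventually_happens'[OF sequentially_bot weak_conv_stieltjes_uniform[OF \<rho>(1) \<mu> \<rho>(2) L \<epsilon>]]
    by (simp add: stieltjes_close_def)
  obtain S \<delta> where S: "\<delta> > 0" "finite S" "\<And>x. x \<in> S \<Longrightarrow> isCont (cdf \<mu>) x"
    and close: "\<And>\<rho>. real_distribution \<rho> \<Longrightarrow> (\<And>x. x \<in> S \<Longrightarrow> \<bar>cdf \<rho> x - cdf \<mu> x\<bar> \<le> \<delta>) \<Longrightarrow> stieltjes_close L \<epsilon> \<rho> \<mu>"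
    by (rule cdf_neighbourhood[OF \<mu> P]) (assumption | rule that; blast)+
  show ?thesis
  proof (rule that[OF S])
    fix N X assume X: "\<And>x. x \<in> S \<Longrightarrow> \<bar>esd X x - cdf \<mu> x\<bar> \<le> \<delta>"
    show "matrix_close L \<epsilon> N X \<mu>" unfolding matrix_close_def
    proof (intro allI impI)
      fix a assume a: "esd X = cdf (empirical N a)"
      show "stieltjes_close L \<epsilon> (empirical N a) \<mu>"
        by (rule close[OF real_distribution_empirical]) (use X a in simp)
    qed
  qed
qed

lemma conj_rotated_sum:
  assumes V: "V \<in> unitary_group K N" and W: "W \<in> carrier_mat N N" and Q: "Q \<in> carrier_mat N N"
  shows "V * diag_real N a * mat_adjoint V + Q * (W * diag_real N b * mat_adjoint W) * mat_adjoint Q =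
    V * rotated_sum N a b (mat_adjoint V * Q * W) * mat_adjoint V"
proof -
  have Vc: "V \<in> carrier_mat N N" using V by (rule unitaryD)
  define D D' V' W' Q' where "D = diag_real N a" and "D' = diag_real N b" and "V' = mat_adjoint V" and "W' = mat_adjoint W" and "Q' = mat_adjoint Q"
  have c: "D \<in> carrier_mat N N" "D' \<in> carrier_mat N N" "V' \<in> carrier_mat N N" "W' \<in> carrier_mat N N" "Q' \<in> carrier_mat N N"
    using Vc W Q by (auto simp: D_def D'_def V'_def W'_def Q'_def)
  note m = square_carrier(2) assoc_mult_mat[of _ N N _ N _ N]
  have adj: "mat_adjoint (V' * Q * W) = W' * (Q' * V)"
    using Vc W Q c by (simp add: adjoint_mult[of _ N N _ N] square_carrier V'_def W'_def Q'_def)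
  have VV: "V * (V' * Y) = Y" if Y: "Y \<in> carrier_mat N N" for Y
    using assoc_mult_mat[OF Vc c(3) Y] Y unfolding V'_def unitaryD(2)[OF V] by simp
  have "V * rotated_sum N a b (V' * Q * W) * V' = V * (D + V' * (Q * (W * (D' * (W' * (Q' * V)))))) * V'"
    unfolding rotated_sum_def adj D_def[symmetric] D'_def[symmetric] using Vc W Q c by (simp add: m)
  also have "\<dots> = V * (D * V') + V * (V' * (Q * (W * (D' * (W' * (Q' * (V * V')))))))"
    using Vc W Q c by (simp add: m mult_add_distrib_mat[of _ N N _ N] add_mult_distrib_mat[of _ N N _ _ N])
  also have "V * V' = 1\<^sub>m N" unfolding V'_def by (rule unitaryD(2)[OF V])
  also have "V * (V' * (Q * (W * (D' * (W' * (Q' * 1\<^sub>m N)))))) = Q * (W * (D' * (W' * Q')))"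
    using VV[of "Q * (W * (D' * (W' * Q')))"] W Q c by (simp add: m)
  finally show ?thesis using Vc W Q c unfolding D_def[symmetric] D'_def[symmetric] V'_def[symmetric] W'_def[symmetric] Q'_def[symmetric]
    by (simp add: m)
qed

text \<open>The exact solution is also a \<kappa>-approximate one, so stability puts every
  approximate value within 64 \<kappa> of it; one more \<kappa> is the distance from
  \<open>m\<close> to such a value.\<close>

lemma haar_good_imp_close:
  assumes "light_tail \<mu> y L" "light_tail \<nu> y L" and s: "approx_subord \<mu> \<nu> y 0 g w1 w2" and h: "haar_good \<mu> \<nu> y \<kappa> m"
  shows "cmod (m - g) \<le> 65 * \<kappa>"
proof -
  from h obtain g' w1' w2' where s': "approx_subord \<mu> \<nu> y \<kappa> g' w1' w2'" and m: "cmod (m - g') \<le> \<kappa>"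
    unfolding haar_good_def by blast
  have "0 \<le> \<kappa>" using order_trans[OF norm_ge_zero m] .
  hence "cmod (g' - g) \<le> 64 * \<kappa>"
    using approx_subord_stable(2)[OF assms(1,2) s' approx_subord_mono[OF s]] by simp
  thus ?thesis using m norm_triangle_ineq[of "m - g'" "g' - g"] by simp
qed

lemma light_tailI:
  assumes \<mu>: "real_distribution \<mu>" and L: "0 < L" "160 * L \<le> y"
    and \<mu>L: "cmod (1 + \<i> * of_real L * stieltjes \<mu> (\<i> * of_real L)) \<le> 1 / 1600"
  shows "light_tail \<mu> y L"
proof -
  interpret real_distribution \<mu> by fact
  show ?thesis
  proof
    have "2 * cmod (1 + \<i> * of_real L * stieltjes \<mu> (\<i> * of_real L)) \<le> 1 / 400" using \<mu>L by simp
    with tail_le_stieltjes[OF L(1)] show "prob {x. \<bar>x\<bar> > L} \<le> 1 / 400" by (rule order_trans)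
  qed (use L in auto)
qed

lemma measurable_resolvent_rotation:
  assumes A: "measurable_mat M N A" and B: "measurable_mat M N B" and Q: "measurable_mat M N Q"
  shows "(\<lambda>x. tr (resolvent (A x + Q x * B x * mat_adjoint (Q x)) z)) \<in> borel_measurable M"
  by (rule measurable_tr[OF measurable_mat_resolvent[OF measurable_mat_add[OF A
    measurable_mat_mult[OF measurable_mat_mult[OF Q B] measurable_mat_adjoint[OF Q]]]]])

definition haar_matrix_bound :: "complex set \<Rightarrow> real measure \<Rightarrow> real measure \<Rightarrow> real \<Rightarrow> real \<Rightarrow> complex \<Rightarrow> real \<Rightarrow> real \<Rightarrow> nat \<Rightarrow> bool" where
  "haar_matrix_bound K \<mu> \<nu> L y g \<kappa> \<epsilon> N \<longleftrightarrow> (\<forall>A B H. is_haar_probability K N H \<longrightarrow>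
    A \<in> hermitian_matrices K N \<longrightarrow> B \<in> hermitian_matrices K N \<longrightarrow> matrix_close L \<epsilon> N A \<mu> \<longrightarrow> matrix_close L \<epsilon> N B \<nu> \<longrightarrow>
    measure H {Q \<in> space H. cmod (tr (resolvent (A + Q * B * mat_adjoint Q) (\<i> * of_real y)) / of_nat N - g) > \<kappa>} \<le> \<kappa>)"

theorem haar_matrix_estimate:
  fixes K :: "complex set" and \<mu> \<nu> :: "real measure" and L y \<kappa> :: real
  assumes K: "K = \<real> \<or> K = UNIV" and \<mu>: "real_distribution \<mu>" and \<nu>: "real_distribution \<nu>"
    and L: "0 < L" "160 * L \<le> y" and \<kappa>: "\<kappa> > 0"
    and \<mu>L: "cmod (1 + \<i> * of_real L * stieltjes \<mu> (\<i> * of_real L)) \<le> 1 / 1600"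
    and \<nu>L: "cmod (1 + \<i> * of_real L * stieltjes \<nu> (\<i> * of_real L)) \<le> 1 / 1600"
    and s: "approx_subord \<mu> \<nu> y 0 g w1 w2"
  shows "\<exists>\<epsilon>>0. \<exists>n0. \<forall>N\<ge>n0. N > 0 \<longrightarrow> haar_matrix_bound K \<mu> \<nu> L y g \<kappa> \<epsilon> N"
proof -
  note tails = light_tailI[OF \<mu> L \<mu>L] light_tailI[OF \<nu> L \<nu>L]
  have y: "y > 0" using L by linarith
  define z where "z = \<i> * complex_of_real y"
  have z: "Im z \<noteq> 0" using y by (simp add: z_def)
  have "\<kappa> / 65 > 0" using \<kappa> by simp
  from haar_estimate[OF K \<mu> \<nu> L this \<mu>L \<nu>L] obtain \<epsilon> n0 where \<epsilon>: "\<epsilon> > 0" and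
    n0: "\<forall>N\<ge>n0. N > 0 \<longrightarrow> haar_bound K \<mu> \<nu> L y (\<kappa> / 65) \<epsilon> N" by blast
  have "measure H {Q \<in> space H. cmod (tr (resolvent (A + Q * B * mat_adjoint Q) z) / of_nat N - g) > \<kappa>} \<le> \<kappa>"
    if Nn: "n0 \<le> N" and N: "N > 0" and haar: "is_haar_probability K N H" and A: "A \<in> hermitian_matrices K N" and B: "B \<in> hermitian_matrices K N"
      and cA: "matrix_close L \<epsilon> N A \<mu>" and cB: "matrix_close L \<epsilon> N B \<nu>" for N A B H
  proof -
    interpret H: prob_space H using haar by (simp add: is_haar_probability_def)
    obtain V a where V: "V \<in> unitary_group K N" "A = V * diag_real N a * mat_adjoint V" "esd A = cdf (empirical N a)"
      using hermitian_empirical[OF K A N] .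
    obtain W b where W: "W \<in> unitary_group K N" "B = W * diag_real N b * mat_adjoint W" "esd B = cdf (empirical N b)"
      using hermitian_empirical[OF K B N] .
    have "stieltjes_close L \<epsilon> (empirical N a) \<mu>" "stieltjes_close L \<epsilon> (empirical N b) \<nu>"
      using cA cB V(3) W(3) unfolding matrix_close_def by auto
    from haar_boundD[OF n0[rule_format, OF Nn N] haar this]
    obtain E where E: "E \<in> sets H" "measure H E \<le> \<kappa> / 65"
      and E2: "\<forall>Q\<in>space H - E. haar_good \<mu> \<nu> y (\<kappa> / 65) (tr (resolvent (rotated_sum N a b Q) z) / of_nat N)"
      unfolding z_def .
    define f where "f Q = cmod (tr (resolvent (rotated_sum N a b Q) z) / of_nat N - g)" for Q
    define \<phi> where "\<phi> Q = mat_adjoint V * Q * W" for Q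
    define F where "F = {Q \<in> space H. f Q > \<kappa>}"
    have fm: "f \<in> borel_measurable H" unfolding f_def
      using measurable_tr[OF measurable_mat_resolvent_rotated_sum[OF measurable_mat_haar[OF K haar]]] by measurable
    hence F: "F \<in> sets H" unfolding F_def by measurable
    have V': "mat_adjoint V \<in> unitary_group K N" by (rule unitary_adjoint[OF K V(1)])
    have \<phi>: "\<phi> \<in> H \<rightarrow>\<^sub>M H" unfolding \<phi>_def by (rule measurable_haar_conj[OF K haar V' W(1)])
    have eq: "cmod (tr (resolvent (A + Q * B * mat_adjoint Q) z) / of_nat N - g) = f (\<phi> Q)" if Q: "Q \<in> space H" for Q
    proof -
      have Qc: "Q \<in> carrier_mat N N" using Q unfolding haar_space[OF K haar] by (rule unitaryD)
      have Wc: "W \<in> carrier_mat N N" and Vc: "V \<in> carrier_mat N N" using W V by (auto dest: unitaryD(1))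
      have \<phi>c: "\<phi> Q \<in> carrier_mat N N" unfolding \<phi>_def using Vc Wc Qc by (intro square_carrier)
      have "A + Q * B * mat_adjoint Q = V * rotated_sum N a b (\<phi> Q) * mat_adjoint V"
        unfolding V(2) W(2) \<phi>_def by (rule conj_rotated_sum[OF V(1) Wc Qc])
      hence "tr (resolvent (A + Q * B * mat_adjoint Q) z) = tr (resolvent (rotated_sum N a b (\<phi> Q)) z)"
        by (simp only: resolvent_conj[OF V(1) rotated_sum_hermitian[OF \<phi>c] z]
          tr_conj[OF V(1) resolvent_carrier[OF rotated_sum_carrier[OF \<phi>c]]])
      thus ?thesis by (simp only: f_def)
    qed
    \<comment> \<open>The event for \<open>A\<close> and \<open>B\<close> is the preimage of the
      event for diagonal matrices under the two-sided translation by their eigenbases, which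
      preserves the Haar measure.\<close>
    have "{Q \<in> space H. cmod (tr (resolvent (A + Q * B * mat_adjoint Q) z) / of_nat N - g) > \<kappa>} = \<phi> -` F \<inter> space H"
      unfolding F_def using eq measurable_space[OF \<phi>] by auto
    also have "measure H (\<phi> -` F \<inter> space H) = measure (distr H H \<phi>) F" by (rule measure_distr[OF \<phi> F, symmetric])
    also have "distr H H \<phi> = H" unfolding \<phi>_def by (rule haar_left_right[OF K haar V' W(1)])
    also have "measure H F \<le> measure H E"
    proof (rule H.finite_measure_mono[OF _ E(1)])
      show "F \<subseteq> E"
      proof
        fix Q assume Q: "Q \<in> F"
        show "Q \<in> E"
        proof (rule ccontr)
          assume "Q \<notin> E"
          hence "Q \<in> space H - E" using Q by (simp add: F_def)
          from haar_good_imp_close[OF tails s bspec[OF E2 this]] have "f Q \<le> \<kappa>" by (simp add: f_def)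
          with Q show False by (simp add: F_def)
        qed
      qed
    qed
    finally show ?thesis using E(2) \<kappa> by linarith
  qed
  hence "\<forall>N\<ge>n0. N > 0 \<longrightarrow> haar_matrix_bound K \<mu> \<nu> L y g \<kappa> \<epsilon> N"
    unfolding haar_matrix_bound_def z_def by (intro allI impI)
  thus ?thesis using \<epsilon> by (intro exI[of _ \<epsilon>] conjI exI[of _ n0])
qed

text \<open>Conditioning on \<open>Y\<close>: independence makes the joint law a product, the fibres
  over \<open>G\<close> have measure at most \<kappa>, and the other fibres at most 1.\<close>

lemma independent_rvs_prob_le:
  assumes P: "prob_space P" and ind: "independent_rvs P S X T Y" and W: "W \<in> sets (S \<Otimes>\<^sub>M T)" and G: "G \<in> sets T"
    and \<kappa>: "0 \<le> \<kappa>" and le: "\<And>y. y \<in> G \<Longrightarrow> measure (distr P S X) {x \<in> space S. (x, y) \<in> W} \<le> \<kappa>"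
  shows "measure P {\<omega> \<in> space P. (X \<omega>, Y \<omega>) \<in> W} \<le> \<kappa> + measure P {\<omega> \<in> space P. Y \<omega> \<notin> G}"
proof -
  interpret P: prob_space P by fact
  have X: "X \<in> P \<rightarrow>\<^sub>M S" and Y: "Y \<in> P \<rightarrow>\<^sub>M T"
    and indep: "P.indep_set (sets (vimage_algebra (space P) X S)) (sets (vimage_algebra (space P) Y T))"
    using ind by (auto simp: independent_rvs_def)
  define SX where "SX = distr P S X"
  define TY where "TY = distr P T Y"
  interpret SX: prob_space SX unfolding SX_def by (rule P.prob_space_distr[OF X])
  interpret TY: prob_space TY unfolding TY_def by (rule P.prob_space_distr[OF Y])
  interpret pair_sigma_finite SX TY ..
  have XY: "(\<lambda>\<omega>. (X \<omega>, Y \<omega>)) \<in> P \<rightarrow>\<^sub>M S \<Otimes>\<^sub>M T" using X Y by measurable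
  have joint: "SX \<Otimes>\<^sub>M TY = distr P (S \<Otimes>\<^sub>M T) (\<lambda>\<omega>. (X \<omega>, Y \<omega>))"
  proof (rule pair_measure_eqI)
    show "sigma_finite_measure SX" "sigma_finite_measure TY" by unfold_locales
    show "sets (SX \<Otimes>\<^sub>M TY) = sets (distr P (S \<Otimes>\<^sub>M T) (\<lambda>\<omega>. (X \<omega>, Y \<omega>)))"
      unfolding sets_distr by (rule sets_pair_measure_cong) (simp_all add: SX_def TY_def)
    fix A B assume "A \<in> sets SX" "B \<in> sets TY"
    hence A: "A \<in> sets S" and B: "B \<in> sets T" by (simp_all add: SX_def TY_def)
    have AB: "(\<lambda>\<omega>. (X \<omega>, Y \<omega>)) -` (A \<times> B) \<inter> space P = (X -` A \<inter> space P) \<inter> (Y -` B \<inter> space P)" by auto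
    have "P.prob ((X -` A \<inter> space P) \<inter> (Y -` B \<inter> space P)) = P.prob (X -` A \<inter> space P) * P.prob (Y -` B \<inter> space P)"
      by (rule P.indep_setD[OF indep in_vimage_algebra[OF A] in_vimage_algebra[OF B]])
    thus "emeasure SX A * emeasure TY B = emeasure (distr P (S \<Otimes>\<^sub>M T) (\<lambda>\<omega>. (X \<omega>, Y \<omega>))) (A \<times> B)"
      unfolding SX_def TY_def emeasure_distr[OF X A] emeasure_distr[OF Y B] emeasure_distr[OF XY pair_measureI[OF A B]] AB
      by (simp add: P.emeasure_eq_measure ennreal_mult)
  qed
  have Wm: "W \<in> sets (SX \<Otimes>\<^sub>M TY)" using W unfolding joint by simp
  have "{\<omega> \<in> space P. (X \<omega>, Y \<omega>) \<in> W} = (\<lambda>\<omega>. (X \<omega>, Y \<omega>)) -` W \<inter> space P" by auto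
  hence "emeasure P {\<omega> \<in> space P. (X \<omega>, Y \<omega>) \<in> W} = emeasure (distr P (S \<Otimes>\<^sub>M T) (\<lambda>\<omega>. (X \<omega>, Y \<omega>))) W"
    by (simp add: emeasure_distr[OF XY W])
  also have "\<dots> = (\<integral>\<^sup>+y. emeasure SX ((\<lambda>x. (x, y)) -` W) \<partial>TY)"
    unfolding joint[symmetric] by (rule emeasure_pair_measure_alt2[OF Wm])
  also have "\<dots> \<le> (\<integral>\<^sup>+y. ennreal \<kappa> + indicator (space T - G) y \<partial>TY)"
  proof (rule nn_integral_mono)
    fix y assume "y \<in> space TY"
    hence y: "y \<in> space T" by (simp add: TY_def)
    show "emeasure SX ((\<lambda>x. (x, y)) -` W) \<le> ennreal \<kappa> + indicator (space T - G) y"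
    proof (cases "y \<in> G")
      case True
      have "(\<lambda>x. (x, y)) -` W = {x \<in> space S. (x, y) \<in> W}" using sets.sets_into_space[OF W] by (auto simp: space_pair_measure)
      hence "emeasure SX ((\<lambda>x. (x, y)) -` W) \<le> ennreal \<kappa>"
        using le[OF True] by (simp add: SX.emeasure_eq_measure SX_def[symmetric] ennreal_leI)
      thus ?thesis by (rule order_trans) simp
    next
      case False
      have "emeasure SX ((\<lambda>x. (x, y)) -` W) \<le> 1" by (rule SX.measure_le_1)
      also have "\<dots> \<le> ennreal \<kappa> + indicator (space T - G) y" using False y by simp
      finally show ?thesis .
    qed
  qed
  also have "\<dots> = ennreal \<kappa> + emeasure TY (space T - G)"
  proof -
    have "space T - G \<in> sets TY" using G by (auto simp: TY_def)
    thus ?thesis by (subst nn_integral_add) (auto simp: TY.emeasure_space_1)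
  qed
  also have "emeasure TY (space T - G) = emeasure P {\<omega> \<in> space P. Y \<omega> \<notin> G}"
  proof -
    have "space T - G \<in> sets T" using G by auto
    moreover have "Y -` (space T - G) \<inter> space P = {\<omega> \<in> space P. Y \<omega> \<notin> G}" using measurable_space[OF Y] by auto
    ultimately show ?thesis unfolding TY_def by (simp add: emeasure_distr[OF Y])
  qed
  also have "ennreal \<kappa> + emeasure P {\<omega> \<in> space P. Y \<omega> \<notin> G} = ennreal (\<kappa> + measure P {\<omega> \<in> space P. Y \<omega> \<notin> G})"
    using \<kappa> by (simp add: P.emeasure_eq_measure)
  finally show ?thesis unfolding P.emeasure_eq_measure by (subst (asm) ennreal_le_iff) (use \<kappa> in auto)
qed

lemma prob_bex_tendsto_0:
  assumes S: "finite S" and prob: "\<And>N :: nat. N > 0 \<Longrightarrow> prob_space (M N)"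
    and m: "\<And>N x. N > 0 \<Longrightarrow> x \<in> S \<Longrightarrow> {\<omega> \<in> space (M N). E x N \<omega>} \<in> sets (M N)"
    and lim: "\<And>x. x \<in> S \<Longrightarrow> (\<lambda>N. measure (M N) {\<omega> \<in> space (M N). E x N \<omega>}) \<longlonglongrightarrow> 0"
  shows "(\<lambda>N. measure (M N) {\<omega> \<in> space (M N). \<exists>x\<in>S. E x N \<omega>}) \<longlonglongrightarrow> 0"
proof (rule tendsto_sandwich[of "\<lambda>_. 0" _ _ "\<lambda>N. \<Sum>x\<in>S. measure (M N) {\<omega> \<in> space (M N). E x N \<omega>}"])
  show "(\<lambda>N. \<Sum>x\<in>S. measure (M N) {\<omega> \<in> space (M N). E x N \<omega>}) \<longlonglongrightarrow> 0"
    using tendsto_sum[OF lim] by simp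
  show "\<forall>\<^sub>F N in sequentially. measure (M N) {\<omega> \<in> space (M N). \<exists>x\<in>S. E x N \<omega>} \<le> (\<Sum>x\<in>S. measure (M N) {\<omega> \<in> space (M N). E x N \<omega>})"
    using eventually_gt_at_top[of 0]
  proof eventually_elim
    case (elim N)
    interpret prob_space "M N" using elim by (rule prob)
    have "{\<omega> \<in> space (M N). \<exists>x\<in>S. E x N \<omega>} = (\<Union>x\<in>S. {\<omega> \<in> space (M N). E x N \<omega>})" by auto
    thus ?case using finite_measure_subadditive_finite[OF S, of "\<lambda>x. {\<omega> \<in> space (M N). E x N \<omega>}"] m[OF elim] by auto
  qed
qed auto

section \<open>The random model: concentration, existence and algebraicity of the limit\<close>

locale rotation_model =
  fixes K :: "complex set" and M :: "nat \<Rightarrow> 'w measure" and A B Q :: "nat \<Rightarrow> 'w \<Rightarrow> complex mat"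
    and \<mu> \<nu> :: "real measure" and L :: real
  assumes K: "K = \<real> \<or> K = UNIV"
    and prob: "\<And>N. N > 0 \<Longrightarrow> prob_space (M N)"
    and A: "\<And>N. N > 0 \<Longrightarrow> A N \<in> M N \<rightarrow>\<^sub>M hermitian_borel K N"
    and B: "\<And>N. N > 0 \<Longrightarrow> B N \<in> M N \<rightarrow>\<^sub>M hermitian_borel K N"
    and Q_haar: "\<And>N. N > 0 \<Longrightarrow> haar_distributed K N (M N) (Q N)"
    and Q_indep: "\<And>N. N > 0 \<Longrightarrow> independent_rvs (M N) (unitary_borel K N) (Q N)
        (hermitian_borel K N \<Otimes>\<^sub>M hermitian_borel K N) (\<lambda>\<omega>. (A N \<omega>, B N \<omega>))"
    and \<mu>: "real_distribution \<mu>" and \<nu>: "real_distribution \<nu>"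
    and A_lim: "esd_tendsto_in_prob M A \<mu>" and B_lim: "esd_tendsto_in_prob M B \<nu>"
    and L: "0 < L" and \<mu>L: "cmod (1 + \<i> * of_real L * stieltjes \<mu> (\<i> * of_real L)) \<le> 1 / 1600"
    and \<nu>L: "cmod (1 + \<i> * of_real L * stieltjes \<nu> (\<i> * of_real L)) \<le> 1 / 1600"
begin

definition C :: "nat \<Rightarrow> 'w \<Rightarrow> complex mat" where
  "C N \<omega> = A N \<omega> + Q N \<omega> * B N \<omega> * mat_adjoint (Q N \<omega>)"

definition trC :: "nat \<Rightarrow> real \<Rightarrow> 'w \<Rightarrow> complex" where
  "trC N y \<omega> = tr (resolvent (C N \<omega>) (\<i> * of_real y)) / of_nat N"

abbreviation "pairs N \<equiv> hermitian_borel K N \<Otimes>\<^sub>M hermitian_borel K N"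

lemma close_event:
  assumes X: "\<And>N. N > 0 \<Longrightarrow> X N \<in> M N \<rightarrow>\<^sub>M hermitian_borel K N"
    and \<rho>: "real_distribution \<rho>" and lim: "esd_tendsto_in_prob M X \<rho>" and \<epsilon>: "\<epsilon> > 0"
  obtains S \<delta> where "finite S" "\<And>N Y. (\<And>x. x \<in> S \<Longrightarrow> \<bar>esd Y x - cdf \<rho> x\<bar> \<le> \<delta>) \<Longrightarrow> matrix_close L \<epsilon> N Y \<rho>"
    "(\<lambda>N. measure (M N) {\<omega> \<in> space (M N). \<exists>x\<in>S. \<bar>esd (X N \<omega>) x - cdf \<rho> x\<bar> > \<delta>}) \<longlonglongrightarrow> 0"
proof (rule matrix_close_neighbourhood[OF \<rho> L \<epsilon>])
  fix S and \<delta> :: real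
  assume \<delta>: "\<delta> > 0" and S: "finite S" "\<And>x. x \<in> S \<Longrightarrow> isCont (cdf \<rho>) x"
    and close: "\<And>N Y. (\<And>x. x \<in> S \<Longrightarrow> \<bar>esd Y x - cdf \<rho> x\<bar> \<le> \<delta>) \<Longrightarrow> matrix_close L \<epsilon> N Y \<rho>"
  have "(\<lambda>N. measure (M N) {\<omega> \<in> space (M N). \<exists>x\<in>S. \<bar>esd (X N \<omega>) x - cdf \<rho> x\<bar> > \<delta>}) \<longlonglongrightarrow> 0"
  proof (rule prob_bex_tendsto_0[OF S(1) prob])
    show "{\<omega> \<in> space (M N). \<bar>esd (X N \<omega>) x - cdf \<rho> x\<bar> > \<delta>} \<in> sets (M N)" if "N > 0" for N x
      using measurable_esd[OF K X[OF that] that] by measurable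
    show "(\<lambda>N. measure (M N) {\<omega> \<in> space (M N). \<bar>esd (X N \<omega>) x - cdf \<rho> x\<bar> > \<delta>}) \<longlonglongrightarrow> 0" if "x \<in> S" for x
      using lim[unfolded esd_tendsto_in_prob_def, rule_format, OF S(2)[OF that] \<delta>] .
  qed
  from that[OF S(1) close this] show thesis .
qed

text \<open>Closeness of both matrices becomes membership of the pair in one measurable set, as
  \<open>independent_rvs_prob_le\<close> requires. Measurability holds because only finitely many
  values of \<open>esd\<close> are involved.\<close>

lemma good_event:
  assumes \<epsilon>: "\<epsilon> > 0"
  obtains G where "\<And>N. N > 0 \<Longrightarrow> G N \<in> sets (pairs N)"
    "\<And>N X Y. (X, Y) \<in> G N \<Longrightarrow> X \<in> hermitian_matrices K N \<and> Y \<in> hermitian_matrices K N \<and> matrix_close L \<epsilon> N X \<mu> \<and> matrix_close L \<epsilon> N Y \<nu>"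
    "(\<lambda>N. measure (M N) {\<omega> \<in> space (M N). (A N \<omega>, B N \<omega>) \<notin> G N}) \<longlonglongrightarrow> 0"
proof (rule close_event[OF A \<mu> A_lim \<epsilon>]; rule close_event[OF B \<nu> B_lim \<epsilon>])
  fix S S' :: "real set" and \<delta> \<delta>' :: real
  assume S: "finite S" and close: "\<And>N Y. (\<And>x. x \<in> S \<Longrightarrow> \<bar>esd Y x - cdf \<mu> x\<bar> \<le> \<delta>) \<Longrightarrow> matrix_close L \<epsilon> N Y \<mu>"
    and lim: "(\<lambda>N. measure (M N) {\<omega> \<in> space (M N). \<exists>x\<in>S. \<bar>esd (A N \<omega>) x - cdf \<mu> x\<bar> > \<delta>}) \<longlonglongrightarrow> 0"
    and S': "finite S'" and close': "\<And>N Y. (\<And>x. x \<in> S' \<Longrightarrow> \<bar>esd Y x - cdf \<nu> x\<bar> \<le> \<delta>') \<Longrightarrow> matrix_close L \<epsilon> N Y \<nu>"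
    and lim': "(\<lambda>N. measure (M N) {\<omega> \<in> space (M N). \<exists>x\<in>S'. \<bar>esd (B N \<omega>) x - cdf \<nu> x\<bar> > \<delta>'}) \<longlonglongrightarrow> 0"
  define G where "G N = {p \<in> space (pairs N). (\<forall>x\<in>S. \<bar>esd (fst p) x - cdf \<mu> x\<bar> \<le> \<delta>) \<and> (\<forall>x\<in>S'. \<bar>esd (snd p) x - cdf \<nu> x\<bar> \<le> \<delta>')}" for N
  show thesis
  proof (rule that[of G])
    show "G N \<in> sets (pairs N)" if N: "N > 0" for N
      unfolding G_def using measurable_esd[OF K measurable_fst N] measurable_esd[OF K measurable_snd N] S S' by measurable
    show "X \<in> hermitian_matrices K N \<and> Y \<in> hermitian_matrices K N \<and> matrix_close L \<epsilon> N X \<mu> \<and> matrix_close L \<epsilon> N Y \<nu>"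
      if "(X, Y) \<in> G N" for N X Y
      using that close[of X N] close'[of Y N] by (auto simp: G_def space_pair_measure space_hermitian_borel)
    define E where "E b N \<omega> = (if b then \<exists>x\<in>S. \<bar>esd (A N \<omega>) x - cdf \<mu> x\<bar> > \<delta> else \<exists>x\<in>S'. \<bar>esd (B N \<omega>) x - cdf \<nu> x\<bar> > \<delta>')" for b N \<omega>
    have "(\<lambda>N. measure (M N) {\<omega> \<in> space (M N). \<exists>b\<in>UNIV. E b N \<omega>}) \<longlonglongrightarrow> 0"
    proof (rule prob_bex_tendsto_0[OF finite prob])
      show "{\<omega> \<in> space (M N). E b N \<omega>} \<in> sets (M N)" if N: "N > 0" for N b
        unfolding E_def using measurable_esd[OF K A[OF N] N] measurable_esd[OF K B[OF N] N] S S' by (cases b) simp_all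
      show "(\<lambda>N. measure (M N) {\<omega> \<in> space (M N). E b N \<omega>}) \<longlonglongrightarrow> 0" for b
        unfolding E_def using lim lim' by (cases b) simp_all
    qed
    moreover have "\<forall>\<^sub>F N in sequentially. measure (M N) {\<omega> \<in> space (M N). \<exists>b\<in>UNIV. E b N \<omega>} = measure (M N) {\<omega> \<in> space (M N). (A N \<omega>, B N \<omega>) \<notin> G N}"
      using eventually_gt_at_top[of 0]
    proof eventually_elim
      case (elim N)
      have "(A N \<omega>, B N \<omega>) \<in> space (pairs N)" if "\<omega> \<in> space (M N)" for \<omega>
        using measurable_space[OF A[OF elim] that] measurable_space[OF B[OF elim] that] by (simp add: space_pair_measure)
      hence "{\<omega> \<in> space (M N). \<exists>b\<in>UNIV. E b N \<omega>} = {\<omega> \<in> space (M N). (A N \<omega>, B N \<omega>) \<notin> G N}"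
        unfolding E_def G_def UNIV_bool by (auto simp: not_le)
      thus ?case by simp
    qed
    ultimately show "(\<lambda>N. measure (M N) {\<omega> \<in> space (M N). (A N \<omega>, B N \<omega>) \<notin> G N}) \<longlonglongrightarrow> 0"
      by (rule Lim_transform_eventually)
  qed
qed

lemma haar_law: "N > 0 \<Longrightarrow> is_haar_probability K N (distr (M N) (unitary_borel K N) (Q N))"
  using Q_haar by (simp add: haar_distributed_def)

text \<open>Solvability is read off from the model. For each accuracy one outcome in the good event
  and one group element outside the exceptional set provide an approximate solution, and
  \<open>exact_subordination\<close> does the rest.\<close>

lemma exact_solution:
  assumes y: "160 * L \<le> y"
  shows "\<exists>g w1 w2. approx_subord \<mu> \<nu> y 0 g w1 w2"
proof -
  have ex: "\<exists>g w1 w2. approx_subord \<mu> \<nu> y \<kappa> g w1 w2" if \<kappa>: "\<kappa> > 0" for \<kappa>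
  proof -
    \<comment> \<open>The cap 1/2 keeps the exceptional set smaller than the whole group, so that an
      element outside it exists.\<close>
    have "min \<kappa> (1 / 2) > 0" using \<kappa> by simp
    from haar_estimate[OF K \<mu> \<nu> L y this \<mu>L \<nu>L] obtain \<epsilon> n0 where \<epsilon>: "\<epsilon> > 0"
      and n0: "\<forall>N\<ge>n0. N > 0 \<longrightarrow> haar_bound K \<mu> \<nu> L y (min \<kappa> (1 / 2)) \<epsilon> N" by blast
    show ?thesis
    proof (rule good_event[OF \<epsilon>])
      fix G assume Gs: "\<And>N. N > 0 \<Longrightarrow> G N \<in> sets (pairs N)"
        and G: "\<And>N X Y. (X, Y) \<in> G N \<Longrightarrow> X \<in> hermitian_matrices K N \<and> Y \<in> hermitian_matrices K N \<and> matrix_close L \<epsilon> N X \<mu> \<and> matrix_close L \<epsilon> N Y \<nu>"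
        and lim: "(\<lambda>N. measure (M N) {\<omega> \<in> space (M N). (A N \<omega>, B N \<omega>) \<notin> G N}) \<longlonglongrightarrow> 0"
      have "\<forall>\<^sub>F N in sequentially. measure (M N) {\<omega> \<in> space (M N). (A N \<omega>, B N \<omega>) \<notin> G N} < 1"
        using lim by (rule order_tendstoD(2)) simp
      hence "\<forall>\<^sub>F N in sequentially. measure (M N) {\<omega> \<in> space (M N). (A N \<omega>, B N \<omega>) \<notin> G N} < 1 \<and> n0 \<le> N \<and> 0 < N"
        by (intro eventually_conj eventually_ge_at_top eventually_gt_at_top)
      from eventually_happens'[OF sequentially_bot this] obtain N where
        N1: "measure (M N) {\<omega> \<in> space (M N). (A N \<omega>, B N \<omega>) \<notin> G N} < 1" and N: "n0 \<le> N" "0 < N" by blast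
      interpret MN: prob_space "M N" by (rule prob[OF N(2)])
      have "\<exists>\<omega>\<in>space (M N). (A N \<omega>, B N \<omega>) \<in> G N"
      proof (rule ccontr)
        assume "\<not> ?thesis"
        hence "{\<omega> \<in> space (M N). (A N \<omega>, B N \<omega>) \<notin> G N} = space (M N)" by auto
        with N1 show False by (simp add: MN.prob_space)
      qed
      then obtain \<omega> where "(A N \<omega>, B N \<omega>) \<in> G N" ..
      from G[OF this] have h: "A N \<omega> \<in> hermitian_matrices K N" "B N \<omega> \<in> hermitian_matrices K N"
        "matrix_close L \<epsilon> N (A N \<omega>) \<mu>" "matrix_close L \<epsilon> N (B N \<omega>) \<nu>" by auto
      obtain V a where a: "esd (A N \<omega>) = cdf (empirical N a)" using hermitian_empirical[OF K h(1) N(2)] .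
      obtain W b where b: "esd (B N \<omega>) = cdf (empirical N b)" using hermitian_empirical[OF K h(2) N(2)] .
      define H where "H = distr (M N) (unitary_borel K N) (Q N)"
      have haar: "is_haar_probability K N H" unfolding H_def by (rule haar_law[OF N(2)])
      then interpret H: prob_space H by (simp add: is_haar_probability_def)
      have cl: "stieltjes_close L \<epsilon> (empirical N a) \<mu>" "stieltjes_close L \<epsilon> (empirical N b) \<nu>"
        using h(3,4) a b unfolding matrix_close_def by auto
      show ?thesis
      proof (rule haar_boundD[OF n0[rule_format, OF N] haar cl])
        fix E assume E: "E \<in> sets H" "measure H E \<le> min \<kappa> (1 / 2)"
          and good: "\<forall>Q\<in>space H - E. haar_good \<mu> \<nu> y (min \<kappa> (1 / 2)) (tr (resolvent (rotated_sum N a b Q) (\<i> * of_real y)) / of_nat N)"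
        have "E \<noteq> space H" using E(2) H.prob_space by auto
        then obtain U where "U \<in> space H - E" using sets.sets_into_space[OF E(1)] by auto
        from bspec[OF good this] obtain g w1 w2 where "approx_subord \<mu> \<nu> y (min \<kappa> (1 / 2)) g w1 w2"
          unfolding haar_good_def by blast
        from approx_subord_mono[OF this, of \<kappa>] show ?thesis by auto
      qed
    qed
  qed
  obtain g w1 w2 where "approx_subord \<mu> \<nu> y 0 g w1 w2"
    using exact_subordination[OF light_tailI[OF \<mu> L y \<mu>L] light_tailI[OF \<nu> L y \<nu>L] ex] .
  thus ?thesis by blast
qed

lemma measurable_mats:
  assumes N: "N > 0"
  shows "measurable_mat (M N) N (A N)" "measurable_mat (M N) N (B N)" "measurable_mat (M N) N (Q N)"
  using A[OF N] B[OF N] Q_haar[OF N] by (simp_all add: measurable_hermitian_borel_iff measurable_unitary_borel_iff haar_distributed_def)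

lemma measurable_trC: "N > 0 \<Longrightarrow> trC N y \<in> borel_measurable (M N)"
  unfolding trC_def C_def using measurable_resolvent_rotation[OF measurable_mats] by measurable

lemma trC_concentration:
  assumes y: "160 * L \<le> y" and s: "approx_subord \<mu> \<nu> y 0 g w1 w2" and c: "c > 0"
  shows "(\<lambda>N. measure (M N) {\<omega> \<in> space (M N). cmod (trC N y \<omega> - g) > c}) \<longlonglongrightarrow> 0"
proof (rule LIMSEQ_I)
  fix r :: real assume r: "r > 0"
  \<comment> \<open>The probability is at most \<kappa> plus that of leaving the good event, each at
    most \<open>r\<close> / 3; the bound by \<open>c\<close> makes the event with threshold
    \<open>c\<close> a subset of the one with threshold \<kappa>.\<close>
  define \<kappa> where "\<kappa> = min c (r / 3)"
  have \<kappa>: "\<kappa> > 0" "\<kappa> \<le> c" "\<kappa> \<le> r / 3" using c r by (auto simp: \<kappa>_def)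
  from haar_matrix_estimate[OF K \<mu> \<nu> L y \<kappa>(1) \<mu>L \<nu>L s] obtain \<epsilon> n0 where \<epsilon>: "\<epsilon> > 0"
    and n0: "\<forall>N\<ge>n0. N > 0 \<longrightarrow> haar_matrix_bound K \<mu> \<nu> L y g \<kappa> \<epsilon> N" by blast
  show "\<exists>no. \<forall>N\<ge>no. norm (measure (M N) {\<omega> \<in> space (M N). cmod (trC N y \<omega> - g) > c} - 0) < r"
  proof (rule good_event[OF \<epsilon>])
    fix G assume Gs: "\<And>N. N > 0 \<Longrightarrow> G N \<in> sets (pairs N)"
      and G: "\<And>N X Y. (X, Y) \<in> G N \<Longrightarrow> X \<in> hermitian_matrices K N \<and> Y \<in> hermitian_matrices K N \<and> matrix_close L \<epsilon> N X \<mu> \<and> matrix_close L \<epsilon> N Y \<nu>"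
      and lim: "(\<lambda>N. measure (M N) {\<omega> \<in> space (M N). (A N \<omega>, B N \<omega>) \<notin> G N}) \<longlonglongrightarrow> 0"
    have "\<forall>\<^sub>F N in sequentially. measure (M N) {\<omega> \<in> space (M N). (A N \<omega>, B N \<omega>) \<notin> G N} < r / 3"
      using lim by (rule order_tendstoD(2)) (use r in simp)
    hence "\<forall>\<^sub>F N in sequentially. norm (measure (M N) {\<omega> \<in> space (M N). cmod (trC N y \<omega> - g) > c} - 0) < r"
      using eventually_ge_at_top[of n0] eventually_gt_at_top[of 0]
    proof eventually_elim
      case (elim N)
      interpret MN: prob_space "M N" by (rule prob[OF elim(3)])
      define f where "f p = cmod (tr (resolvent (fst (snd p) + fst p * snd (snd p) * mat_adjoint (fst p)) (\<i> * of_real y)) / of_nat N - g)" for p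
      define W where "W = {p \<in> space (unitary_borel K N \<Otimes>\<^sub>M pairs N). f p > \<kappa>}"
      have "measurable_mat (unitary_borel K N \<Otimes>\<^sub>M pairs N) N fst" "measurable_mat (unitary_borel K N \<Otimes>\<^sub>M pairs N) N (\<lambda>p. fst (snd p))"
        "measurable_mat (unitary_borel K N \<Otimes>\<^sub>M pairs N) N (\<lambda>p. snd (snd p))"
        using measurable_fst[of "unitary_borel K N" "pairs N"] measurable_compose[OF measurable_snd[of "unitary_borel K N" "pairs N"] measurable_fst]
          measurable_compose[OF measurable_snd[of "unitary_borel K N" "pairs N"] measurable_snd]
        by (simp_all add: measurable_hermitian_borel_iff measurable_unitary_borel_iff)
      from measurable_resolvent_rotation[OF this(2,3,1)]
      have fm: "f \<in> borel_measurable (unitary_borel K N \<Otimes>\<^sub>M pairs N)" unfolding f_def by measurable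
      have W: "W \<in> sets (unitary_borel K N \<Otimes>\<^sub>M pairs N)" unfolding W_def using fm by measurable
      have "measure (M N) {\<omega> \<in> space (M N). (Q N \<omega>, (A N \<omega>, B N \<omega>)) \<in> W} \<le> \<kappa> + measure (M N) {\<omega> \<in> space (M N). (A N \<omega>, B N \<omega>) \<notin> G N}"
      proof (rule independent_rvs_prob_le[OF prob[OF elim(3)] Q_indep[OF elim(3)] W Gs[OF elim(3)]])
        show "0 \<le> \<kappa>" using \<kappa> by simp
        fix p assume p: "p \<in> G N"
        obtain X Y where XY: "p = (X, Y)" by (cases p)
        note h = G[OF p[unfolded XY]]
        define H where "H = distr (M N) (unitary_borel K N) (Q N)"
        have haar: "is_haar_probability K N H" unfolding H_def by (rule haar_law[OF elim(3)])
        have "{x \<in> space (unitary_borel K N). (x, p) \<in> W} = {U \<in> space H. cmod (tr (resolvent (X + U * Y * mat_adjoint U) (\<i> * of_real y)) / of_nat N - g) > \<kappa>}"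
          using h by (auto simp: W_def f_def XY H_def space_pair_measure space_hermitian_borel)
        thus "measure (distr (M N) (unitary_borel K N) (Q N)) {x \<in> space (unitary_borel K N). (x, p) \<in> W} \<le> \<kappa>"
          using n0[rule_format, OF elim(2,3), unfolded haar_matrix_bound_def, rule_format, OF haar] h by (simp add: H_def)
      qed
      moreover have "measure (M N) {\<omega> \<in> space (M N). cmod (trC N y \<omega> - g) > c} \<le> measure (M N) {\<omega> \<in> space (M N). (Q N \<omega>, (A N \<omega>, B N \<omega>)) \<in> W}"
      proof (rule MN.finite_measure_mono)
        have Qm: "Q N \<in> M N \<rightarrow>\<^sub>M unitary_borel K N" using Q_haar[OF elim(3)] by (simp add: haar_distributed_def)
        show "{\<omega> \<in> space (M N). cmod (trC N y \<omega> - g) > c} \<subseteq> {\<omega> \<in> space (M N). (Q N \<omega>, (A N \<omega>, B N \<omega>)) \<in> W}"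
          using \<kappa>(2) measurable_space[OF A[OF elim(3)]] measurable_space[OF B[OF elim(3)]] measurable_space[OF Qm]
          by (auto simp: W_def f_def trC_def C_def space_pair_measure)
        have "(\<lambda>\<omega>. (Q N \<omega>, (A N \<omega>, B N \<omega>))) \<in> M N \<rightarrow>\<^sub>M unitary_borel K N \<Otimes>\<^sub>M pairs N"
          using A[OF elim(3)] B[OF elim(3)] Qm by measurable
        from measurable_sets[OF this W]
        show "{\<omega> \<in> space (M N). (Q N \<omega>, (A N \<omega>, B N \<omega>)) \<in> W} \<in> sets (M N)" by (simp add: vimage_def Int_def conj_commute)
      qed
      ultimately have "measure (M N) {\<omega> \<in> space (M N). cmod (trC N y \<omega> - g) > c} < r"
        using elim(1) \<kappa>(3) r by linarith
      thus ?case by simp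
    qed
    thus ?thesis unfolding eventually_sequentially .
  qed
qed

text \<open>Only the spectrum of \<open>C\<close> matters from here on, so complex Hermitian is
  enough in the real case too.\<close>

lemma C_hermitian:
  assumes N: "N > 0" and \<omega>: "\<omega> \<in> space (M N)"
  shows "C N \<omega> \<in> hermitian_matrices UNIV N"
proof -
  have h: "hermitian N (A N \<omega>)" "hermitian N (B N \<omega>)"
    using measurable_space[OF A[OF N] \<omega>] measurable_space[OF B[OF N] \<omega>] by (auto simp: space_hermitian_borel hermitian_matrices_def)
  have Q: "Q N \<omega> \<in> carrier_mat N N" by (rule measurable_matD(1)[OF measurable_mats(3)[OF N] \<omega>])
  note BQ = hermitian_conj[OF h(2) Q]
  have "mat_adjoint (C N \<omega>) = C N \<omega>" unfolding C_def using adjoint_add[of "A N \<omega>" N N] h BQ by simp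
  moreover have "C N \<omega> \<in> carrier_mat N N" unfolding C_def using h BQ by auto
  ultimately show ?thesis by (simp add: hermitian_matrices_def)
qed

lemma C_empirical:
  assumes N: "N > 0" and \<omega>: "\<omega> \<in> space (M N)"
  shows "\<exists>a. esd (C N \<omega>) = cdf (empirical N a) \<and> (\<forall>y>0. stieltjes (empirical N a) (\<i> * of_real y) = trC N y \<omega>)"
proof (rule hermitian_empirical[OF _ C_hermitian[OF N \<omega>] N])
  fix a assume "esd (C N \<omega>) = cdf (empirical N a)"
    "\<And>z. 0 < Im z \<Longrightarrow> stieltjes (empirical N a) z = tr (resolvent (C N \<omega>) z) / of_nat N"
  thus ?thesis by (intro exI[of _ a]) (simp add: trC_def)
qed simp

text \<open>The relation for the sum of the points gives 1 + z g = (1 + w1 m(w1)) + (1 + w2 m(w2))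
  with both terms small at large heights. This provides the tightness of the limit.\<close>

lemma solution_small:
  assumes \<epsilon>: "\<epsilon> > 0"
  shows "\<exists>Y. \<forall>y\<ge>Y. \<forall>g w1 w2. approx_subord \<mu> \<nu> y 0 g w1 w2 \<longrightarrow> cmod (1 + \<i> * of_real y * g) < \<epsilon>"
proof -
  have \<epsilon>2: "\<epsilon> / 2 > 0" using \<epsilon> by simp
  from real_distribution.one_plus_w_stieltjes_small[OF \<mu> \<epsilon>2] obtain Y1 where Y1: "Y1 > 0"
    "\<forall>y\<ge>Y1. \<forall>w. y / 2 \<le> Im w \<longrightarrow> cmod w \<le> 2 * y \<longrightarrow> cmod (1 + w * stieltjes \<mu> w) < \<epsilon> / 2" by blast
  from real_distribution.one_plus_w_stieltjes_small[OF \<nu> \<epsilon>2] obtain Y2 where Y2: "Y2 > 0"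
    "\<forall>y\<ge>Y2. \<forall>w. y / 2 \<le> Im w \<longrightarrow> cmod w \<le> 2 * y \<longrightarrow> cmod (1 + w * stieltjes \<nu> w) < \<epsilon> / 2" by blast
  have "cmod (1 + \<i> * of_real y * g) < \<epsilon>" if y: "max Y1 Y2 \<le> y" and s: "approx_subord \<mu> \<nu> y 0 g w1 w2" for y g w1 w2
  proof -
    have e: "stieltjes \<mu> w1 = g" "stieltjes \<nu> w2 = g" "w1 + w2 = \<i> * of_real y - 1 / g"
      and r: "y / 2 \<le> Im w1" "cmod w1 \<le> 2 * y" "y / 2 \<le> Im w2" "cmod w2 \<le> 2 * y" and g: "1 / (2 * y) \<le> cmod g"
      using s by (auto simp: approx_subord_def)
    have "0 < 1 / (2 * y)" using y Y1(1) by simp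
    hence "g \<noteq> 0" using g by auto
    hence "1 + \<i> * of_real y * g = 2 + (w1 + w2) * g" unfolding e(3) by (simp add: algebra_simps)
    also have "\<dots> = (1 + w1 * stieltjes \<mu> w1) + (1 + w2 * stieltjes \<nu> w2)" unfolding e(1,2) by (simp add: algebra_simps)
    finally have "cmod (1 + \<i> * of_real y * g) \<le> cmod (1 + w1 * stieltjes \<mu> w1) + cmod (1 + w2 * stieltjes \<nu> w2)"
      by (simp only: norm_triangle_ineq)
    moreover have "cmod (1 + w1 * stieltjes \<mu> w1) < \<epsilon> / 2" by (rule Y1(2)[rule_format, OF _ r(1,2)]) (use y in simp)
    moreover have "cmod (1 + w2 * stieltjes \<nu> w2) < \<epsilon> / 2" by (rule Y2(2)[rule_format, OF _ r(3,4)]) (use y in simp)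
    ultimately show ?thesis by linarith
  qed
  thus ?thesis by (intro exI[of _ "max Y1 Y2"]) auto
qed

definition "h k = height (160 * L) k"

lemma h: "160 * L \<le> h k" "0 < h k" using height_gt[of "160 * L" k] L by (simp_all add: h_def)

text \<open>The value is unique by \<open>approx_subord_stable\<close> with error 0, so the choice
  is harmless.\<close>

definition "g k = (SOME g. \<exists>w1 w2. approx_subord \<mu> \<nu> (h k) 0 g w1 w2)"

lemma g: "\<exists>w1 w2. approx_subord \<mu> \<nu> (h k) 0 (g k) w1 w2"
  unfolding g_def by (rule someI_ex[OF exact_solution[OF h(1)]])

lemma trC_tendsto:
  assumes c: "c > 0"
  shows "(\<lambda>N. measure (M N) {\<omega> \<in> space (M N). \<exists>k\<in>{..<m}. cmod (trC N (h k) \<omega> - g k) > c}) \<longlonglongrightarrow> 0"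
proof (rule prob_bex_tendsto_0[OF _ prob])
  show "{\<omega> \<in> space (M N). cmod (trC N (h k) \<omega> - g k) > c} \<in> sets (M N)" if "N > 0" for N k
    using measurable_trC[OF that, of "h k"] by measurable
  fix k
  from g[of k] obtain w1 w2 where "approx_subord \<mu> \<nu> (h k) 0 (g k) w1 w2" by (elim exE)
  from trC_concentration[OF h(1) this c]
  show "(\<lambda>N. measure (M N) {\<omega> \<in> space (M N). cmod (trC N (h k) \<omega> - g k) > c}) \<longlonglongrightarrow> 0" .
qed simp

text \<open>For each \<open>n\<close> concentration provides some N and an outcome whose spectral
  transform is within 1 / (n + 1) of \<open>g\<close> at the first \<open>n\<close> heights. The
  empirical laws of these samples converge weakly to the required measure.\<close>

lemma limit_exists:
  "\<exists>\<rho>. real_distribution \<rho> \<and> (\<forall>k. stieltjes \<rho> (\<i> * of_real (h k)) = g k)"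
proof -
  have ex: "\<exists>\<sigma>. real_distribution \<sigma> \<and> (\<forall>k<n. cmod (stieltjes \<sigma> (\<i> * of_real (h k)) - g k) \<le> 1 / real (Suc n))" for n
  proof -
    have "0 < 1 / real (Suc n)" by simp
    from trC_tendsto[OF this, of n]
    have "\<forall>\<^sub>F N in sequentially. measure (M N) {\<omega> \<in> space (M N). \<exists>k\<in>{..<n}. cmod (trC N (h k) \<omega> - g k) > 1 / real (Suc n)} < 1"
      by (rule order_tendstoD(2)) simp
    hence "\<forall>\<^sub>F N in sequentially. measure (M N) {\<omega> \<in> space (M N). \<exists>k\<in>{..<n}. cmod (trC N (h k) \<omega> - g k) > 1 / real (Suc n)} < 1 \<and> 0 < N"
      by (intro eventually_conj eventually_gt_at_top)
    from eventually_happens'[OF sequentially_bot this] obtain N where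
      N1: "measure (M N) {\<omega> \<in> space (M N). \<exists>k\<in>{..<n}. cmod (trC N (h k) \<omega> - g k) > 1 / real (Suc n)} < 1" and N: "0 < N" by blast
    interpret MN: prob_space "M N" by (rule prob[OF N])
    have "\<exists>\<omega>\<in>space (M N). \<forall>k<n. cmod (trC N (h k) \<omega> - g k) \<le> 1 / real (Suc n)"
    proof (rule ccontr)
      assume "\<not> ?thesis"
      hence "{\<omega> \<in> space (M N). \<exists>k\<in>{..<n}. cmod (trC N (h k) \<omega> - g k) > 1 / real (Suc n)} = space (M N)"
        by (auto simp: not_le)
      with N1 show False by (simp add: MN.prob_space)
    qed
    then obtain \<omega> where \<omega>: "\<omega> \<in> space (M N)" "\<forall>k<n. cmod (trC N (h k) \<omega> - g k) \<le> 1 / real (Suc n)" ..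
    from C_empirical[OF N \<omega>(1)] obtain a where "\<forall>y>0. stieltjes (empirical N a) (\<i> * of_real y) = trC N y \<omega>"
      by (elim exE conjE)
    thus ?thesis using \<omega>(2) h(2) by (intro exI[of _ "empirical N a"]) (auto simp: real_distribution_empirical)
  qed
  define \<sigma> where "\<sigma> n = (SOME \<sigma>. real_distribution \<sigma> \<and> (\<forall>k<n. cmod (stieltjes \<sigma> (\<i> * of_real (h k)) - g k) \<le> 1 / real (Suc n)))" for n
  have \<sigma>: "real_distribution (\<sigma> n) \<and> (\<forall>k<n. cmod (stieltjes (\<sigma> n) (\<i> * of_real (h k)) - g k) \<le> 1 / real (Suc n))" for n
    unfolding \<sigma>_def by (rule someI_ex[OF ex])
  have lim: "(\<lambda>n. stieltjes (\<sigma> n) (\<i> * of_real (height (160 * L) k))) \<longlonglongrightarrow> g k" for k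
  proof (rule LIM_zero_cancel, rule Lim_null_comparison)
    show "\<forall>\<^sub>F n in sequentially. norm (stieltjes (\<sigma> n) (\<i> * of_real (height (160 * L) k)) - g k) \<le> 1 / real (Suc n)"
      using eventually_gt_at_top[of k] by eventually_elim (use \<sigma> in \<open>simp add: h_def\<close>)
    show "(\<lambda>n. 1 / real (Suc n)) \<longlonglongrightarrow> 0" by (rule LIMSEQ_Suc[OF lim_1_over_n])
  qed
  have small: "\<exists>k. cmod (1 + \<i> * of_real (height (160 * L) k) * g k) < \<epsilon>" if \<epsilon>: "\<epsilon> > 0" for \<epsilon>
  proof -
    from solution_small[OF \<epsilon>] obtain Y where Y: "\<forall>y\<ge>Y. \<forall>g w1 w2. approx_subord \<mu> \<nu> y 0 g w1 w2 \<longrightarrow> cmod (1 + \<i> * of_real y * g) < \<epsilon>" ..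
    from height_large[of Y "160 * L"] obtain k where k: "Y \<le> h k" unfolding h_def ..
    from g[of k] obtain w1 w2 where "approx_subord \<mu> \<nu> (h k) 0 (g k) w1 w2" by (elim exE)
    from Y[rule_format, OF k this] show ?thesis unfolding h_def ..
  qed
  have L0: "160 * L > 0" using L by simp
  show ?thesis
    by (rule stieltjes_limit_exists[OF conjunct1[OF \<sigma>] L0 lim small], assumption) (auto simp: h_def)
qed

text \<open>Closeness of the distribution function at a continuity point is enforced by finitely
  many values of the transform, so a failure lies in a finite union of events whose probabilities
  tend to 0.\<close>

lemma C_tendsto:
  assumes \<rho>: "real_distribution \<rho>" and \<rho>g: "\<And>k. stieltjes \<rho> (\<i> * of_real (h k)) = g k"
  shows "esd_tendsto_in_prob M C \<rho>"
  unfolding esd_tendsto_in_prob_def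
proof (intro allI impI)
  fix x \<epsilon> :: real assume x: "isCont (cdf \<rho>) x" and \<epsilon>: "\<epsilon> > 0"
  have P: "\<exists>n. \<bar>cdf (\<sigma> n) x - cdf \<rho> x\<bar> \<le> \<epsilon>" if \<sigma>: "\<And>n. real_distribution (\<sigma> n)" "weak_conv_m \<sigma> \<rho>" for \<sigma>
  proof -
    have "(\<lambda>n. cdf (\<sigma> n) x) \<longlonglongrightarrow> cdf \<rho> x" using \<sigma>(2) x unfolding weak_conv_m_def weak_conv_def by blast
    from tendstoD[OF this \<epsilon>] have "\<forall>\<^sub>F n in sequentially. \<bar>cdf (\<sigma> n) x - cdf \<rho> x\<bar> < \<epsilon>" by (simp add: dist_real_def)
    from eventually_happens'[OF sequentially_bot this] show ?thesis by (auto intro: less_imp_le)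
  qed
  have L0: "160 * L > 0" using L by simp
  show "(\<lambda>N. measure (M N) {\<omega> \<in> space (M N). \<bar>esd (C N \<omega>) x - cdf \<rho> x\<bar> > \<epsilon>}) \<longlonglongrightarrow> 0"
  proof (rule stieltjes_neighbourhood[where P = "\<lambda>\<sigma>. \<bar>cdf \<sigma> x - cdf \<rho> x\<bar> \<le> \<epsilon>", OF \<rho> L0 P])
    fix m :: nat and \<delta> :: real assume \<delta>: "\<delta> > 0" and close: "\<And>\<sigma>. real_distribution \<sigma> \<Longrightarrow>
      (\<And>k. k < m \<Longrightarrow> cmod (stieltjes \<sigma> (\<i> * of_real (height (160 * L) k)) - stieltjes \<rho> (\<i> * of_real (height (160 * L) k))) \<le> \<delta>) \<Longrightarrow>
      \<bar>cdf \<sigma> x - cdf \<rho> x\<bar> \<le> \<epsilon>"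
    show "(\<lambda>N. measure (M N) {\<omega> \<in> space (M N). \<bar>esd (C N \<omega>) x - cdf \<rho> x\<bar> > \<epsilon>}) \<longlonglongrightarrow> 0"
    proof (rule tendsto_sandwich[OF _ _ tendsto_const trC_tendsto[OF \<delta>, of m]])
      show "\<forall>\<^sub>F N in sequentially. measure (M N) {\<omega> \<in> space (M N). \<bar>esd (C N \<omega>) x - cdf \<rho> x\<bar> > \<epsilon>} \<le>
        measure (M N) {\<omega> \<in> space (M N). \<exists>k\<in>{..<m}. cmod (trC N (h k) \<omega> - g k) > \<delta>}"
        using eventually_gt_at_top[of 0]
      proof eventually_elim
        case (elim N)
        interpret MN: prob_space "M N" by (rule prob[OF elim])
        show ?case
        proof (rule MN.finite_measure_mono)
          have "trC N (h k) \<in> borel_measurable (M N)" for k by (rule measurable_trC[OF elim])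
          thus "{\<omega> \<in> space (M N). \<exists>k\<in>{..<m}. cmod (trC N (h k) \<omega> - g k) > \<delta>} \<in> sets (M N)" by measurable
          show "{\<omega> \<in> space (M N). \<bar>esd (C N \<omega>) x - cdf \<rho> x\<bar> > \<epsilon>} \<subseteq> {\<omega> \<in> space (M N). \<exists>k\<in>{..<m}. cmod (trC N (h k) \<omega> - g k) > \<delta>}"
          proof (rule subsetI, rule ccontr)
            fix \<omega> assume \<omega>: "\<omega> \<in> {\<omega> \<in> space (M N). \<bar>esd (C N \<omega>) x - cdf \<rho> x\<bar> > \<epsilon>}"
              and n: "\<omega> \<notin> {\<omega> \<in> space (M N). \<exists>k\<in>{..<m}. cmod (trC N (h k) \<omega> - g k) > \<delta>}"
            hence \<omega>s: "\<omega> \<in> space (M N)" by simp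
            from C_empirical[OF elim \<omega>s] obtain a where a: "esd (C N \<omega>) = cdf (empirical N a)"
              "\<forall>y>0. stieltjes (empirical N a) (\<i> * of_real y) = trC N y \<omega>" by (elim exE conjE)
            have "\<bar>cdf (empirical N a) x - cdf \<rho> x\<bar> \<le> \<epsilon>"
              by (rule close[OF real_distribution_empirical]) (use a(2)[rule_format, OF h(2)] \<rho>g n \<omega>s in \<open>auto simp: h_def not_less\<close>)
            with \<omega> a(1) show False by simp
          qed
        qed
      qed
    qed simp
  qed
qed

text \<open>At each height the relations for \<mu> and \<nu> are used at the two subordination
  points; their common value is also the value of the limit transform at that height, so elimination
  yields a relation there.\<close>

lemma C_algebraic:
  assumes \<rho>: "real_distribution \<rho>" and \<rho>g: "\<And>k. stieltjes \<rho> (\<i> * of_real (h k)) = g k"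
    and alg: "algebraic_distribution \<mu>" "algebraic_distribution \<nu>"
  shows "algebraic_distribution \<rho>"
proof -
  from alg(1) obtain LA where LA: "LA \<noteq> 0" "\<And>z. Im z > 0 \<Longrightarrow> eval_bivariate LA (stieltjes \<mu> z) z = 0"
    unfolding algebraic_distribution_def by blast
  from alg(2) obtain LB where LB: "LB \<noteq> 0" "\<And>z. Im z > 0 \<Longrightarrow> eval_bivariate LB (stieltjes \<nu> z) z = 0"
    unfolding algebraic_distribution_def by blast
  from algebraic_elimination[OF LA(1) LB(1)] obtain S where S: "S \<noteq> 0" and el: "eliminates LA LB S" by blast
  have zero: "eval_bivariate S (stieltjes \<rho> (\<i> * of_real (h k))) (\<i> * of_real (h k)) = 0" for k
  proof -
    from g[of k] obtain w1 w2 where s: "approx_subord \<mu> \<nu> (h k) 0 (g k) w1 w2" by (elim exE)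
    have e: "stieltjes \<mu> w1 = g k" "stieltjes \<nu> w2 = g k" "w1 + w2 = \<i> * of_real (h k) - 1 / g k"
      and r: "h k / 2 \<le> Im w1" "h k / 2 \<le> Im w2" and gk: "1 / (2 * h k) \<le> cmod (g k)"
      using s by (auto simp: approx_subord_def)
    have Im: "0 < Im w1" "0 < Im w2" using r h(2)[of k] by linarith+
    have "0 < 1 / (2 * h k)" using h(2) by simp
    hence "g k \<noteq> 0" using gk by auto
    from eliminatesD[OF el this LA(2)[OF Im(1), unfolded e(1)] LB(2)[OF Im(2), unfolded e(2)] e(3)]
    show ?thesis unfolding \<rho>g .
  qed
  have "eval_bivariate S (stieltjes \<rho> z) z = 0" if z: "0 < Im z" for z
  proof (rule zero_on_heights_imp_zero[where f = "\<lambda>z. eval_bivariate S (stieltjes \<rho> z) z", OF _ _ zero[unfolded h_def] z])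
    note hol = real_distribution.stieltjes_holomorphic[OF \<rho>]
    show "(\<lambda>z. eval_bivariate S (stieltjes \<rho> z) z) holomorphic_on {z. 0 < Im z}"
      unfolding eval_bivariate_altdef[OF order_refl] ev_altdef[OF order_refl]
      by (intro holomorphic_intros hol)
    show "0 < 160 * L" using L by simp
  qed
  thus ?thesis unfolding algebraic_distribution_def using S by blast
qed

end

theorem theorem5p23:
  fixes K :: "complex set"
    and M :: "nat \<Rightarrow> 'w measure"
    and A B Q :: "nat \<Rightarrow> 'w \<Rightarrow> complex mat"
  assumes real_or_complex: "K = \<real> \<or> K = UNIV"
    and prob: "\<And>N. N > 0 \<Longrightarrow> prob_space (M N)"
    and A_hermitian: "\<And>N. N > 0 \<Longrightarrow> A N \<in> M N \<rightarrow>\<^sub>M hermitian_borel K N"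
    and B_hermitian: "\<And>N. N > 0 \<Longrightarrow> B N \<in> M N \<rightarrow>\<^sub>M hermitian_borel K N"
    and Q_haar: "\<And>N. N > 0 \<Longrightarrow> haar_distributed K N (M N) (Q N)"
    and Q_indep: "\<And>N. N > 0 \<Longrightarrow>
      independent_rvs (M N) (unitary_borel K N) (Q N)
        (hermitian_borel K N \<Otimes>\<^sub>M hermitian_borel K N) (\<lambda>\<omega>. (A N \<omega>, B N \<omega>))"
    and A_lim: "tendsto_in_M_alg M A"
    and B_lim: "tendsto_in_M_alg M B"
  shows "tendsto_in_M_alg M (\<lambda>N \<omega>. A N \<omega> + Q N \<omega> * B N \<omega> * mat_adjoint (Q N \<omega>))"
proof -
  from A_lim obtain \<mu> where mu: "real_distribution \<mu>" "esd_tendsto_in_prob M A \<mu>" "algebraic_distribution \<mu>"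
    unfolding tendsto_in_M_alg_def by blast
  from B_lim obtain \<nu> where nu: "real_distribution \<nu>" "esd_tendsto_in_prob M B \<nu>" "algebraic_distribution \<nu>"
    unfolding tendsto_in_M_alg_def by blast
  \<comment> \<open>Tails are bounded by twice this quantity. For empirical laws closeness adds
    another 1/1600, and 2 (1/1600 + 1/1600) is the 1/400 allowed for outliers.\<close>
  have c: "(1 / 1600 :: real) > 0" by simp
  from real_distribution.one_plus_w_stieltjes_small[OF mu(1) c] obtain Y1 where Y1: "Y1 > 0"
    "\<forall>y\<ge>Y1. \<forall>w. y / 2 \<le> Im w \<longrightarrow> cmod w \<le> 2 * y \<longrightarrow> cmod (1 + w * stieltjes \<mu> w) < 1 / 1600" by blast
  from real_distribution.one_plus_w_stieltjes_small[OF nu(1) c] obtain Y2 where Y2: "Y2 > 0"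
    "\<forall>y\<ge>Y2. \<forall>w. y / 2 \<le> Im w \<longrightarrow> cmod w \<le> 2 * y \<longrightarrow> cmod (1 + w * stieltjes \<nu> w) < 1 / 1600" by blast
  define L where "L = max Y1 Y2"
  have L: "0 < L" "Y1 \<le> L" "Y2 \<le> L" using Y1(1) by (auto simp: L_def)
  have iL: "L / 2 \<le> Im (\<i> * complex_of_real L)" "cmod (\<i> * complex_of_real L) \<le> 2 * L" using L by (auto simp: norm_mult)
  interpret rotation_model K M A B Q \<mu> \<nu> L
    by (rule rotation_model.intro[OF real_or_complex prob A_hermitian B_hermitian Q_haar Q_indep mu(1) nu(1) mu(2) nu(2) L(1)
      less_imp_le[OF Y1(2)[rule_format, OF L(2) iL]] less_imp_le[OF Y2(2)[rule_format, OF L(3) iL]]])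
  from limit_exists obtain \<rho> where \<rho>: "real_distribution \<rho>" and \<rho>g: "\<forall>k. stieltjes \<rho> (\<i> * of_real (h k)) = g k"
    by (elim exE conjE)
  note \<rho>g = \<rho>g[rule_format]
  have "tendsto_in_M_alg M C" unfolding tendsto_in_M_alg_def
    using \<rho> C_tendsto[OF \<rho> \<rho>g] C_algebraic[OF \<rho> \<rho>g mu(3) nu(3)] by blast
  thus ?thesis unfolding C_def .
qed

end
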